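(* Let $N\ge1$ be an integer and $0<\sigma\le\frac4N$. Let $u$ be a minimizer for problem $(\mathcal P_m)$. The following properties hold. (i) There exists some $c=c(u)>0$ such that $u$ is a minimum action solution of $$\Delta^2u+2\Delta u+(1+c)u-|u|^{2\sigma}u=0\quad\text{in }\mathbb{R}^N.\qquad(\ast)$$ Furthermore, any minimum action solution of $(\ast)$ with $c=c(u)$ is also a minimizer for $(\mathcal P_m)$. (ii) If $m_1<m_2$, $u_1$ solves $(\mathcal P_{m_1})$ and $u_2$ solves $(\mathcal P_{m_2})$, then $c(u_1)<c(u_2)$. (iii) If $0<\sigma<\frac4N$, then $c(u)\to\infty$ as $m\to\infty$. (iv) If $0<\sigma<\max\left(1,\frac4{N+1}\right)$ and $\sigma\le\frac4N$, then $c(u)\to0$ as $m\to0$. If $u_m$ is any solution of $(\mathcal P_m)$ and $v_m=\frac{u_m}{\sqrt m}=\frac{u_m}{\|u_m\|_{L^2}}$ (so that $\|v_m\|_{L^2}=1$), then $$\|\Delta v_m\|_{L^2}\to1,\qquad\|\nabla v_m\|_{L^2}\to1,\qquad\|(\Delta+1)v_m\|_{L^2}\to0\qquad\text{as }m\to0,$$ and $\|v_m\|_{L^p}\to0$ as $m\to 0$ for any $p\in(2,\infty)$ if $N\le4$, respectively for any $p\in(2,2^{**})$ if $N\ge5$.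
   Context: All functions are complex-valued. For $u\in H^2(\mathbb{R}^N)$, $E(u)=\int_{\mathbb{R}^N}|\Delta u|^2dx-2\int_{\mathbb{R}^N}|\nabla u|^2dx-\frac1{\sigma+1}\int_{\mathbb{R}^N}|u|^{2\sigma+2}dx$. For $m>0$, $S(m)=\{u\in H^2(\mathbb{R}^N):\|u\|_{L^2}^2=m\}$ and $E_{min}(m)=\inf_{S(m)}E$. Problem $(\mathcal P_m)$ is: minimize $E$ on $S(m)$; a solution (minimizer) is $u\in S(m)$ with $E(u)=E_{min}(m)$. Solutions of $(\ast)$ in $H^2(\mathbb{R}^N)$ are critical points of the action $S_c(u)=E(u)+(1+c)\|u\|_{L^2}^2$. A minimum action solution of $(\ast)$ is a nontrivial solution $v\in H^2(\mathbb{R}^N)$ of $(\ast)$ such that $S_c(v)\le S_c(w)$ for every nontrivial solution $w\in H^2(\mathbb{R}^N)$ of $(\ast)$. The number $c(u)$ is uniquely determined by $u$ through equation $(\ast)$. The limits as $m\to0$ or $m\to\infty$ hold for arbitrary choices of minimizers of $(\mathcal P_m)$. $2^{**}=\frac{2N}{N-4}$ for $N\ge5$. *)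

theory Defs
  imports "HOL-Analysis.Analysis"
begin

section \<open>Test functions\<close>

definition partial_deriv :: "'n::finite \<Rightarrow> (real^'n \<Rightarrow> complex) \<Rightarrow> real^'n \<Rightarrow> complex" where
  "partial_deriv i f x = frechet_derivative f (at x) (axis i 1)"

definition laplacian :: "(real^'n::finite \<Rightarrow> complex) \<Rightarrow> real^'n \<Rightarrow> complex" where
  "laplacian f x = (\<Sum>i\<in>UNIV. partial_deriv i (partial_deriv i f) x)"

primrec times_cont_differentiable :: "nat \<Rightarrow> (real^'n::finite \<Rightarrow> complex) \<Rightarrow> bool" where
  "times_cont_differentiable 0 f \<longleftrightarrow> continuous_on UNIV f"
| "times_cont_differentiable (Suc k) f \<longleftrightarrow>
     (\<forall>x. f differentiable (at x)) \<and> (\<forall>i. times_cont_differentiable k (partial_deriv i f))"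

definition test_functions :: "(real^'n::finite \<Rightarrow> complex) set" where
  "test_functions =
     {\<phi>. (\<forall>k. times_cont_differentiable k \<phi>) \<and> compact (closure {x. \<phi> x \<noteq> 0})}"


section \<open>Lebesgue and Sobolev spaces\<close>

text \<open>
  Functions are honest functions rather than classes modulo null sets; all notions below are
  invariant under modification on a null set.
\<close>

definition Lp_space :: "real \<Rightarrow> (real^'n::finite \<Rightarrow> 'b::euclidean_space) set" where
  "Lp_space p =
     {f \<in> borel_measurable lebesgue. integrable lebesgue (\<lambda>x. norm (f x) powr p)}"

text \<open>Meaningful only on \<open>Lp_space p\<close>: outside of it the integral may take the default value 0.\<close>

definition Lp_norm :: "real \<Rightarrow> (real^'n::finite \<Rightarrow> 'b::euclidean_space) \<Rightarrow> real" where
  "Lp_norm p f = (\<integral>x. norm (f x) powr p \<partial>lebesgue) powr (1 / p)"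

definition locally_integrable :: "(real^'n::finite \<Rightarrow> complex) \<Rightarrow> bool" where
  "locally_integrable f \<longleftrightarrow> (\<forall>K. compact K \<longrightarrow> set_integrable lebesgue K f)"

definition has_weak_partial_deriv ::
    "'n::finite \<Rightarrow> (real^'n \<Rightarrow> complex) \<Rightarrow> (real^'n \<Rightarrow> complex) \<Rightarrow> bool" where
  "has_weak_partial_deriv i u g \<longleftrightarrow> locally_integrable u \<and> locally_integrable g \<and>
     (\<forall>\<phi>\<in>test_functions.
        (\<integral>x. u x * partial_deriv i \<phi> x \<partial>lebesgue) = - (\<integral>x. g x * \<phi> x \<partial>lebesgue))"

primrec Sobolev_H :: "nat \<Rightarrow> (real^'n::finite \<Rightarrow> complex) set" where
  "Sobolev_H 0 = Lp_space 2"
| "Sobolev_H (Suc k) =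
     {u \<in> Lp_space 2. \<forall>i. \<exists>g\<in>Sobolev_H k. has_weak_partial_deriv i u g}"

text \<open>
  Weak derivatives are unique up to null sets, so the choice of a representative does not
  affect any of the integrals in which it is used.
\<close>

definition weak_partial_deriv :: "'n::finite \<Rightarrow> (real^'n \<Rightarrow> complex) \<Rightarrow> real^'n \<Rightarrow> complex" where
  "weak_partial_deriv i u = (SOME g. has_weak_partial_deriv i u g)"

definition weak_grad :: "(real^'n::finite \<Rightarrow> complex) \<Rightarrow> real^'n \<Rightarrow> complex^'n" where
  "weak_grad u x = (\<chi> i. weak_partial_deriv i u x)"

definition weak_laplacian :: "(real^'n::finite \<Rightarrow> complex) \<Rightarrow> real^'n \<Rightarrow> complex" where
  "weak_laplacian u x = (\<Sum>i\<in>UNIV. weak_partial_deriv i (weak_partial_deriv i u) x)"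


section \<open>The minimization problem\<close>

definition energy :: "real \<Rightarrow> (real^'n::finite \<Rightarrow> complex) \<Rightarrow> real" where
  "energy \<sigma> u =
     (\<integral>x. (norm (weak_laplacian u x))\<^sup>2 \<partial>lebesgue)
     - 2 * (\<integral>x. (norm (weak_grad u x))\<^sup>2 \<partial>lebesgue)
     - 1 / (\<sigma> + 1) * (\<integral>x. norm (u x) powr (2 * \<sigma> + 2) \<partial>lebesgue)"

definition mass_constraint :: "real \<Rightarrow> (real^'n::finite \<Rightarrow> complex) set" where
  "mass_constraint m = {u \<in> Sobolev_H 2. (Lp_norm 2 u)\<^sup>2 = m}"

text \<open>The infimum is taken in the extended reals because it can be \<open>-\<infinity>\<close>.\<close>

definition min_energy :: "'n::finite itself \<Rightarrow> real \<Rightarrow> real \<Rightarrow> ereal" where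
  "min_energy _ \<sigma> m = (INF u\<in>(mass_constraint m :: (real^'n \<Rightarrow> complex) set). ereal (energy \<sigma> u))"

definition minimizer :: "real \<Rightarrow> real \<Rightarrow> (real^'n::finite \<Rightarrow> complex) \<Rightarrow> bool" where
  "minimizer \<sigma> m u \<longleftrightarrow>
     u \<in> mass_constraint m \<and> ereal (energy \<sigma> u) = min_energy TYPE('n) \<sigma> m"


section \<open>The Euler-Lagrange equation\<close>

text \<open>
  \<open>\<Delta>\<^sup>2 u + 2 \<Delta> u + (1 + c) u - |u|\<^sup>2\<^sup>\<sigma> u = 0\<close> in the sense of distributions.
  For \<open>0 < \<sigma> \<le> 4 / N\<close> the Sobolev embedding makes the nonlinear term locally integrable.
\<close>

definition solution :: "real \<Rightarrow> real \<Rightarrow> (real^'n::finite \<Rightarrow> complex) \<Rightarrow> bool" where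
  "solution \<sigma> c u \<longleftrightarrow> u \<in> Sobolev_H 2 \<and>
     (\<forall>\<phi>\<in>test_functions.
        (\<integral>x. u x * (laplacian (laplacian \<phi>) x + 2 * laplacian \<phi> x + of_real (1 + c) * \<phi> x)
             - of_real (norm (u x) powr (2 * \<sigma>)) * u x * \<phi> x \<partial>lebesgue) = 0)"

definition nontrivial_solution :: "real \<Rightarrow> real \<Rightarrow> (real^'n::finite \<Rightarrow> complex) \<Rightarrow> bool" where
  "nontrivial_solution \<sigma> c u \<longleftrightarrow> solution \<sigma> c u \<and> \<not> (AE x in lebesgue. u x = 0)"

definition action :: "real \<Rightarrow> real \<Rightarrow> (real^'n::finite \<Rightarrow> complex) \<Rightarrow> real" where
  "action \<sigma> c u = energy \<sigma> u + (1 + c) * (Lp_norm 2 u)\<^sup>2"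

definition min_action_solution :: "real \<Rightarrow> real \<Rightarrow> (real^'n::finite \<Rightarrow> complex) \<Rightarrow> bool" where
  "min_action_solution \<sigma> c v \<longleftrightarrow> nontrivial_solution \<sigma> c v \<and>
     (\<forall>w :: real^'n \<Rightarrow> complex. nontrivial_solution \<sigma> c w \<longrightarrow> action \<sigma> c v \<le> action \<sigma> c w)"

text \<open>
  At most one \<open>c\<close> qualifies: subtracting the equations for \<open>c\<close> and \<open>c'\<close> gives \<open>(c - c') u = 0\<close>.
\<close>

definition frequency :: "real \<Rightarrow> (real^'n::finite \<Rightarrow> complex) \<Rightarrow> real" where
  "frequency \<sigma> u = (THE c. nontrivial_solution \<sigma> c u)"

text \<open>
  The filter of pairs \<open>(m, u)\<close>, with \<open>u\<close> an arbitrary minimizer of mass \<open>m\<close>, as \<open>m\<close> runs along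
  \<open>F\<close>.  Limits along it are uniform in the choice of minimizers, and they do not require
  minimizers to exist for every \<open>m\<close>.
\<close>

definition minimizers_along ::
    "real \<Rightarrow> real filter \<Rightarrow> (real \<times> (real^'n::finite \<Rightarrow> complex)) filter" where
  "minimizers_along \<sigma> F = inf (filtercomap fst F) (principal {(m, u). 0 < m \<and> minimizer \<sigma> m u})"

definition normalized :: "real \<times> (real^'n::finite \<Rightarrow> complex) \<Rightarrow> real^'n \<Rightarrow> complex" where
  "normalized = (\<lambda>(m, u) x. u x / of_real (sqrt m))"

text \<open>Unfolded form of limits along this filter.\<close>

lemma eventually_minimizers_along:
  "eventually P (minimizers_along \<sigma> F) \<longleftrightarrow>
     (\<forall>\<^sub>F m in F. \<forall>u. 0 < m \<and> minimizer \<sigma> m u \<longrightarrow> P (m, u))"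
proof
  assume "eventually P (minimizers_along \<sigma> F)"
  then obtain Q where Q: "eventually Q F"
    "\<And>z. Q (fst z) \<Longrightarrow> z \<in> {(m, u). 0 < m \<and> minimizer \<sigma> m u} \<Longrightarrow> P z"
    unfolding minimizers_along_def eventually_inf_principal eventually_filtercomap by blast
  from Q(1) show "\<forall>\<^sub>F m in F. \<forall>u. 0 < m \<and> minimizer \<sigma> m u \<longrightarrow> P (m, u)"
    by (rule eventually_mono) (use Q(2) in auto)
next
  assume "\<forall>\<^sub>F m in F. \<forall>u. 0 < m \<and> minimizer \<sigma> m u \<longrightarrow> P (m, u)"
  then show "eventually P (minimizers_along \<sigma> F)"
    unfolding minimizers_along_def eventually_inf_principal eventually_filtercomap
    by (intro exI[of _ "\<lambda>m. \<forall>u. 0 < m \<and> minimizer \<sigma> m u \<longrightarrow> P (m, u)"]) auto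
qed

end

theory Submission
  imports Defs
begin

text \<open>
  Write \<open>m\<close> for the mass of \<open>u\<close>, \<open>Q\<close> for the squared norm of \<open>(\<Delta> + 1) u\<close> and \<open>P\<close> for the integral of
  \<open>|u|\<^sup>2\<^sup>\<sigma>\<^sup>+\<^sup>2\<close>.  Completing the square in the quadratic part turns the energy into
  \<open>E(u) = Q - m - P / (\<sigma> + 1)\<close>, so everything is a matter of comparing \<open>Q\<close> with \<open>P\<close>.  Two families of
  competitors do all the work: the multiples of a function, for which \<open>Q\<close> scales like \<open>m\<close> and \<open>P\<close> like
  \<open>m\<^sup>\<sigma>\<^sup>+\<^sup>1\<close> (\<open>minimizer_compare\<close>), and plane waves of unit frequency under a wide envelope, for which \<open>Q / m\<close>
  is arbitrarily small (\<open>plane_wave_packets\<close>).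

  \<^emph>\<open>The equation.\<close>  The first variation along normalized perturbations (\<open>first_variation\<close>) gives the
  equation with \<open>c m = P - Q\<close>.  Wave packets show that the minimal energy is at most \<open>- m\<close>, that is,
  \<open>Q \<le> P / (\<sigma> + 1) < P\<close>; hence \<open>c > 0\<close>.  Every solution, minimizer or not, satisfies \<open>Q + c m = P\<close>
  (\<open>solution_Nehari\<close>), so along the ray through a nontrivial solution the action is a positive multiple of
  \<open>a - a\<^sup>\<sigma>\<^sup>+\<^sup>1 / (\<sigma> + 1)\<close>, where \<open>a\<close> is the ratio of the masses.  Its strict maximum is at the solution, and the
  ray contains a competitor of mass \<open>m\<close>; therefore no nontrivial solution has smaller action than the
  minimizer, and one with the same action has mass \<open>m\<close> and minimal energy (\<open>minimizer_action_le\<close>).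

  \<^emph>\<open>Monotonicity.\<close>  Each of two minimizers of different mass is compared with a multiple of the other; the two
  inequalities combine to the strict inequality of the numbers \<open>(P - Q) / m\<close>
  (\<open>minimizer_frequency_strict_mono\<close>).

  \<^emph>\<open>Large mass.\<close>  Multiples of one fixed test function have an energy of order \<open>- m\<^sup>\<sigma>\<^sup>+\<^sup>1\<close>, and \<open>c m\<close> is at least
  \<open>- (E + m)\<close> (\<open>frequency_large_mass\<close>).

  \<^emph>\<open>Small mass.\<close>  For \<open>v = u / \<surd>m\<close> the inequality \<open>Q \<le> P\<close> and the Gagliardo-Nirenberg inequality say that
  \<open>q = Q / m\<close> is bounded by a multiple of \<open>m\<^sup>\<sigma> (1 + q)\<close>.  Absorbing the last term gives \<open>c\<close> and \<open>q\<close> of order \<open>m\<^sup>\<sigma>\<close>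
  (\<open>small_mass_estimate\<close>).  Since \<open>(\<Delta> + 1) v\<close> tends to \<open>0\<close>, the norms of \<open>\<Delta> v\<close> and of the gradient tend to \<open>1\<close>.
  Such functions are almost eigenfunctions of the Laplacian, so that their dilates by different factors are
  almost orthogonal; this forces \<open>v\<close> to vanish in the weak sense, uniformly under translations, and a bound
  in a higher Lebesgue space turns this into convergence to \<open>0\<close> in all intermediate ones (\<open>Lp_vanishing\<close>).

  The embeddings needed for this are obtained from a single estimate, \<open>mollification_error\<close>: averaging \<open>v\<close> at
  scale \<open>r\<close> changes it by at most a constant times \<open>r\<^sup>2\<close> times the norm of the weak Laplacian.  Where \<open>v\<close> is
  large compared with its averages it is dominated by this error; choosing the scale according to the level
  improves integrability of order \<open>q\<close> to every order below \<open>2 + 4 q / N\<close>, and iteration from \<open>q = 2\<close> reaches all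
  subcritical exponents (\<open>Lp_bounded_subcritical\<close>).  Mollified pairings \<open>\<integral>\<integral> f(x) g(y) \<eta>(x - y)\<close> also replace density
  arguments: derivatives are moved onto the kernel \<open>\<eta>\<close>, after which the mollification is removed
  (\<open>mollified_pairing\<close>).
\<close>

section \<open>Calculus of test functions\<close>

lemma partial_deriv_eq:
  "(f has_derivative f') (at x) \<Longrightarrow> partial_deriv i f x = f' (axis i 1)"
  unfolding partial_deriv_def using frechet_derivative_at by metis

lemma times_cont_differentiable_Suc_imp:
  "times_cont_differentiable (Suc k) f \<Longrightarrow> times_cont_differentiable k f"
proof (induction k arbitrary: f)
  case 0
  then show ?case
    by (auto intro!: continuous_at_imp_continuous_on differentiable_imp_continuous_within)
next
  case (Suc k)
  from Suc.prems have "f differentiable (at x)" "times_cont_differentiable (Suc k) (partial_deriv i f)" for x i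
    by simp_all
  then show ?case using Suc.IH by simp
qed

lemma times_cont_differentiable_const: "times_cont_differentiable k (\<lambda>_. c)"
proof (induction k arbitrary: c)
  case (Suc k)
  have "partial_deriv i (\<lambda>_. c) = (\<lambda>_. 0)" for i :: 'a
    by (rule ext, subst partial_deriv_eq[OF has_derivative_const]) simp
  then show ?case using Suc.IH by simp
qed simp

lemma times_cont_differentiable_coord:
  "times_cont_differentiable k (\<lambda>x. complex_of_real (x $ j))"
proof (cases k)
  case (Suc k)
  have d: "((\<lambda>x. complex_of_real (x $ j)) has_derivative (\<lambda>h. complex_of_real (h $ j))) (at x)"
    for x :: "real^'a"
    by (intro bounded_linear_imp_has_derivative bounded_linear_compose[OF bounded_linear_of_real]
        bounded_linear_vec_nth)
  have "partial_deriv i (\<lambda>x. complex_of_real (x $ j)) = (\<lambda>_. of_real (axis i 1 $ j))" for i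
    by (rule ext, subst partial_deriv_eq[OF d]) simp
  then show ?thesis
    using d Suc by (auto simp: times_cont_differentiable_const differentiable_def)
qed (auto intro!: continuous_intros)

lemma partial_deriv_add:
  assumes "f differentiable (at x)" "g differentiable (at x)"
  shows "partial_deriv i (\<lambda>x. f x + g x) x = partial_deriv i f x + partial_deriv i g x"
proof -
  from assms obtain f' g' where *: "(f has_derivative f') (at x)" "(g has_derivative g') (at x)"
    by (auto simp: differentiable_def)
  then show ?thesis
    using partial_deriv_eq[OF has_derivative_add[OF *]] by (simp add: partial_deriv_eq)
qed

lemma partial_deriv_mult:
  assumes "f differentiable (at x)" "g differentiable (at x)"
  shows "partial_deriv i (\<lambda>x. f x * g x) x = f x * partial_deriv i g x + partial_deriv i f x * g x"
proof -
  from assms obtain f' g' where *: "(f has_derivative f') (at x)" "(g has_derivative g') (at x)"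
    by (auto simp: differentiable_def)
  then show ?thesis
    using partial_deriv_eq[OF has_derivative_mult[OF *]] by (simp add: partial_deriv_eq)
qed

lemma partial_deriv_linear:
  assumes L: "bounded_linear L" and "f differentiable (at x)"
  shows "partial_deriv i (\<lambda>x. L (f x)) x = L (partial_deriv i f x)"
proof -
  from assms obtain f' where *: "(f has_derivative f') (at x)"
    by (auto simp: differentiable_def)
  then show ?thesis
    using partial_deriv_eq[OF bounded_linear.has_derivative[OF L *]] by (simp add: partial_deriv_eq)
qed

lemma has_derivative_affine_comp:
  assumes "(f has_derivative f') (at (a *\<^sub>R x + b))"
  shows "((\<lambda>x. f (a *\<^sub>R x + b)) has_derivative (\<lambda>h. f' (a *\<^sub>R h))) (at x)"
proof -
  have "((\<lambda>x. a *\<^sub>R x + b) has_derivative (\<lambda>h. a *\<^sub>R h)) (at x)"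
    by (auto intro!: derivative_eq_intros)
  then show ?thesis
    using has_derivative_compose[of "\<lambda>x. a *\<^sub>R x + b" "\<lambda>h. a *\<^sub>R h" x UNIV f f'] assms by simp
qed

lemma partial_deriv_affine:
  assumes "f differentiable (at (a *\<^sub>R x + b))"
  shows "partial_deriv i (\<lambda>x. f (a *\<^sub>R x + b)) x = of_real a * partial_deriv i f (a *\<^sub>R x + b)"
proof -
  from assms obtain f' where *: "(f has_derivative f') (at (a *\<^sub>R x + b))"
    by (auto simp: differentiable_def)
  then have "f' (a *\<^sub>R axis i 1) = a *\<^sub>R f' (axis i 1)"
    using has_derivative_linear linear_cmul by blast
  then show ?thesis
    using partial_deriv_eq[OF has_derivative_affine_comp[OF *]]
    by (simp add: partial_deriv_eq[OF *] scaleR_conv_of_real[where 'a=complex])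
qed

lemma times_cont_differentiable_add:
  "times_cont_differentiable k f \<Longrightarrow> times_cont_differentiable k g \<Longrightarrow>
   times_cont_differentiable k (\<lambda>x. f x + g x)"
proof (induction k arbitrary: f g)
  case 0 then show ?case by (auto intro: continuous_intros)
next
  case (Suc k)
  then have "partial_deriv i (\<lambda>x. f x + g x) = (\<lambda>x. partial_deriv i f x + partial_deriv i g x)" for i
    by (intro ext partial_deriv_add) auto
  with Suc show ?case by (auto intro: differentiable_add)
qed

lemma times_cont_differentiable_mult:
  "times_cont_differentiable k f \<Longrightarrow> times_cont_differentiable k g \<Longrightarrow>
   times_cont_differentiable k (\<lambda>x. f x * g x)"
proof (induction k arbitrary: f g)
  case 0 then show ?case by (auto intro: continuous_intros)
next
  case (Suc k)
  then have eq: "partial_deriv i (\<lambda>x. f x * g x) =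
      (\<lambda>x. f x * partial_deriv i g x + partial_deriv i f x * g x)" for i
    by (intro ext partial_deriv_mult) auto
  have "times_cont_differentiable k f" "times_cont_differentiable k g"
    using Suc.prems times_cont_differentiable_Suc_imp by blast+
  then have "times_cont_differentiable k (partial_deriv i (\<lambda>x. f x * g x))" for i
    unfolding eq using Suc.prems by (intro times_cont_differentiable_add Suc.IH) auto
  with Suc.prems show ?case by (auto intro: differentiable_mult)
qed

lemma times_cont_differentiable_linear:
  assumes L: "bounded_linear L"
  shows "times_cont_differentiable k f \<Longrightarrow> times_cont_differentiable k (\<lambda>x. L (f x))"
proof (induction k arbitrary: f)
  case 0 then show ?case
    using bounded_linear.continuous_on[OF L] by auto
next
  case (Suc k)
  then have "partial_deriv i (\<lambda>x. L (f x)) = (\<lambda>x. L (partial_deriv i f x))" for i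
    by (intro ext partial_deriv_linear[OF L]) auto
  moreover have "(\<lambda>x. L (f x)) differentiable (at x)" for x
  proof -
    have "f differentiable (at x)" using Suc.prems by simp
    then obtain f' where "(f has_derivative f') (at x)"
      unfolding differentiable_def by auto
    from bounded_linear.has_derivative[OF L this] show ?thesis by (rule differentiableI)
  qed
  ultimately show ?case using Suc by auto
qed

lemma times_cont_differentiable_affine:
  "times_cont_differentiable k f \<Longrightarrow> times_cont_differentiable k (\<lambda>x. f (a *\<^sub>R x + b))"
proof (induction k arbitrary: f)
  case 0 then show ?case
    using continuous_on_compose2[of UNIV f UNIV "\<lambda>x. a *\<^sub>R x + b"] by (simp add: continuous_intros)
next
  case (Suc k)
  then have eq: "partial_deriv i (\<lambda>x. f (a *\<^sub>R x + b)) = (\<lambda>x. of_real a * partial_deriv i f (a *\<^sub>R x + b))" for i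
    by (intro ext partial_deriv_affine) auto
  have "(\<lambda>x. f (a *\<^sub>R x + b)) differentiable (at x)" for x
  proof -
    have "f differentiable (at (a *\<^sub>R x + b))" using Suc.prems by simp
    then obtain f' where "(f has_derivative f') (at (a *\<^sub>R x + b))"
      unfolding differentiable_def by auto
    from has_derivative_affine_comp[OF this] show ?thesis by (rule differentiableI)
  qed
  moreover have "times_cont_differentiable k (\<lambda>x. of_real a * partial_deriv i f (a *\<^sub>R x + b))" for i
    using Suc by (intro times_cont_differentiable_mult times_cont_differentiable_const) auto
  ultimately show ?case using eq by auto
qed

lemma partial_deriv_chain:
  assumes F: "(F has_vector_derivative F') (at (q x))"
    and q: "(\<lambda>x. complex_of_real (q x)) differentiable (at x)"
  shows "(\<lambda>x. F (q x)) differentiable (at x)"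
    and "partial_deriv i (\<lambda>x. F (q x)) x = partial_deriv i (\<lambda>x. complex_of_real (q x)) x * F'"
proof -
  from q obtain d where d: "((\<lambda>x. complex_of_real (q x)) has_derivative d) (at x)"
    by (auto simp: differentiable_def)
  have q': "(q has_derivative (\<lambda>h. Re (d h))) (at x)"
    using bounded_linear.has_derivative[OF bounded_linear_Re d] by simp
  have "((\<lambda>x. complex_of_real (q x)) has_derivative (\<lambda>h. of_real (Re (d h)))) (at x)"
    using bounded_linear.has_derivative[OF bounded_linear_of_real q'] .
  then have d_eq: "d = (\<lambda>h. of_real (Re (d h)))"
    by (rule has_derivative_unique[OF d])
  have D: "((\<lambda>x. F (q x)) has_derivative (\<lambda>h. Re (d h) *\<^sub>R F')) (at x)"
    using has_derivative_compose[OF q' F[unfolded has_vector_derivative_def]] .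
  then show "(\<lambda>x. F (q x)) differentiable (at x)"
    by (rule differentiableI)
  show "partial_deriv i (\<lambda>x. F (q x)) x = partial_deriv i (\<lambda>x. complex_of_real (q x)) x * F'"
    unfolding partial_deriv_eq[OF D] partial_deriv_eq[OF d]
    by (subst (2) d_eq) (simp add: scaleR_conv_of_real)
qed

definition smooth :: "(real^'n::finite \<Rightarrow> complex) \<Rightarrow> bool" where
  "smooth f \<longleftrightarrow> (\<forall>k. times_cont_differentiable k f)"

text \<open>The composition of the \<open>j\<close>-th derivative \<open>F j\<close> with \<open>q\<close> has a partial derivative that involves \<open>F (Suc j)\<close>; the
  induction on the order of differentiability therefore treats all \<open>j\<close> at once.  The real function \<open>q\<close> appears
  in its complex guise because partial derivatives are taken of complex functions.\<close>

lemma smooth_chain: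
  assumes F: "\<And>j t. (F j has_vector_derivative F (Suc j) t) (at t)"
    and q: "smooth (\<lambda>x. complex_of_real (q x))"
  shows "smooth (\<lambda>x. F j (q x))"
proof -
  have q': "times_cont_differentiable k (\<lambda>x. complex_of_real (q x))" for k
    using q by (simp add: smooth_def)
  have qd: "(\<lambda>x. complex_of_real (q x)) differentiable (at x)" for x
    using q'[of "Suc 0"] by simp
  have "times_cont_differentiable k (\<lambda>x. F j (q x))" for k
  proof (induction k arbitrary: j)
    case 0
    show ?case
      using partial_deriv_chain(1)[OF F qd]
      by (auto intro!: continuous_at_imp_continuous_on differentiable_imp_continuous_within)
  next
    case (Suc k)
    have "partial_deriv i (\<lambda>x. F j (q x)) =
        (\<lambda>x. partial_deriv i (\<lambda>x. complex_of_real (q x)) x * F (Suc j) (q x))" for i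
      by (rule ext, rule partial_deriv_chain(2)[OF F qd])
    moreover have "times_cont_differentiable k (partial_deriv i (\<lambda>x. complex_of_real (q x)))" for i
      using q'[of "Suc k"] by simp
    ultimately show ?case
      using partial_deriv_chain(1)[OF F qd] Suc.IH by (auto intro: times_cont_differentiable_mult)
  qed
  then show ?thesis by (simp add: smooth_def)
qed

lemma smooth_differentiable: "smooth f \<Longrightarrow> f differentiable (at x)"
  unfolding smooth_def by (auto dest: spec[of _ "Suc 0"])

lemma smooth_continuous: "smooth f \<Longrightarrow> continuous_on UNIV f"
  unfolding smooth_def by (auto dest: spec[of _ 0])

lemma smooth_partial_deriv: "smooth f \<Longrightarrow> smooth (partial_deriv i f)"
  unfolding smooth_def by (metis times_cont_differentiable.simps(2))

lemma smooth_const: "smooth (\<lambda>_. c)"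
  and smooth_coord: "smooth (\<lambda>x. complex_of_real (x $ j))"
  by (simp_all add: smooth_def times_cont_differentiable_const times_cont_differentiable_coord)

lemma smooth_add: "smooth f \<Longrightarrow> smooth g \<Longrightarrow> smooth (\<lambda>x. f x + g x)"
  and smooth_mult: "smooth f \<Longrightarrow> smooth g \<Longrightarrow> smooth (\<lambda>x. f x * g x)"
  and smooth_linear: "bounded_linear L \<Longrightarrow> smooth f \<Longrightarrow> smooth (\<lambda>x. L (f x))"
  and smooth_affine: "smooth f \<Longrightarrow> smooth (\<lambda>x. f (a *\<^sub>R x + b))"
  by (simp_all add: smooth_def times_cont_differentiable_add times_cont_differentiable_mult
      times_cont_differentiable_linear times_cont_differentiable_affine)

lemma smooth_sum: "(\<And>i. i \<in> A \<Longrightarrow> smooth (f i)) \<Longrightarrow> smooth (\<lambda>x. \<Sum>i\<in>A. f i x)"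
  by (induction A rule: infinite_finite_induct) (auto intro: smooth_const smooth_add)

lemma test_functions_iff:
  "\<phi> \<in> test_functions \<longleftrightarrow> smooth \<phi> \<and> (\<exists>R. \<forall>x. R \<le> norm x \<longrightarrow> \<phi> x = 0)"
proof safe
  assume "\<phi> \<in> test_functions"
  then have "smooth \<phi>" and c: "compact (closure {x. \<phi> x \<noteq> 0})"
    by (auto simp: test_functions_def smooth_def)
  then show "smooth \<phi>" by simp
  from compact_imp_bounded[OF c] obtain R where "\<And>x. x \<in> closure {x. \<phi> x \<noteq> 0} \<Longrightarrow> norm x \<le> R"
    unfolding bounded_iff by blast
  then have "\<phi> x = 0" if "R + 1 \<le> norm x" for x
    using that closure_subset[of "{x. \<phi> x \<noteq> 0}"] by force
  then show "\<exists>R. \<forall>x. R \<le> norm x \<longrightarrow> \<phi> x = 0" by blast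
next
  fix R assume *: "smooth \<phi>" "\<forall>x. R \<le> norm x \<longrightarrow> \<phi> x = 0"
  have "bounded {x. \<phi> x \<noteq> 0}"
    using *(2) unfolding bounded_iff by (metis (mono_tags) linear mem_Collect_eq)
  then show "\<phi> \<in> test_functions"
    using * by (auto simp: test_functions_def smooth_def)
qed

lemma test_functionI: "smooth \<phi> \<Longrightarrow> (\<And>x. R \<le> norm x \<Longrightarrow> \<phi> x = 0) \<Longrightarrow> \<phi> \<in> test_functions"
  by (auto simp: test_functions_iff)

lemma test_function_smooth: "\<phi> \<in> test_functions \<Longrightarrow> smooth \<phi>"
  by (simp add: test_functions_iff)

lemma test_function_partial_deriv:
  assumes "\<phi> \<in> test_functions" shows "partial_deriv i \<phi> \<in> test_functions"
proof -
  from assms obtain R where s: "smooth \<phi>" and R: "\<And>x. R \<le> norm x \<Longrightarrow> \<phi> x = 0"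
    by (auto simp: test_functions_iff)
  have "partial_deriv i \<phi> x = 0" if "R + 1 \<le> norm x" for x
  proof -
    have "(\<phi> has_derivative (\<lambda>_. 0)) (at x)"
    proof (rule has_derivative_transform_within[OF has_derivative_const[of 0]])
      show "(0::real) < 1" by simp
      fix y assume "dist y x < 1"
      then have "norm x - norm y < 1"
        by (metis dist_norm dist_commute norm_triangle_ineq2 order_le_less_trans)
      then show "0 = \<phi> y" using that R[of y] by simp
    qed simp
    then show ?thesis by (simp add: partial_deriv_eq)
  qed
  with smooth_partial_deriv[OF s] show ?thesis by (auto simp: test_functions_iff)
qed

lemma test_function_add:
  assumes "\<phi> \<in> test_functions" "\<psi> \<in> test_functions"
  shows "(\<lambda>x. \<phi> x + \<psi> x) \<in> test_functions"
proof -
  from assms obtain R R' where "\<And>x. R \<le> norm x \<Longrightarrow> \<phi> x = 0" "\<And>x. R' \<le> norm x \<Longrightarrow> \<psi> x = 0"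
    by (auto simp: test_functions_iff)
  then show ?thesis
    by (intro test_functionI[of _ "max R R'"] smooth_add[OF assms[THEN test_function_smooth]]) auto
qed

lemma test_function_mult:
  assumes "smooth f" "\<phi> \<in> test_functions"
  shows "(\<lambda>x. f x * \<phi> x) \<in> test_functions"
proof -
  from assms obtain R where "\<And>x. R \<le> norm x \<Longrightarrow> \<phi> x = 0"
    by (auto simp: test_functions_iff)
  then show ?thesis
    by (intro test_functionI[of _ R] smooth_mult[OF assms(1) test_function_smooth[OF assms(2)]]) auto
qed

lemma test_function_linear:
  assumes "bounded_linear L" "\<phi> \<in> test_functions"
  shows "(\<lambda>x. L (\<phi> x)) \<in> test_functions"
proof -
  from assms obtain R where "\<And>x. R \<le> norm x \<Longrightarrow> \<phi> x = 0"
    by (auto simp: test_functions_iff)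
  then show ?thesis
    by (intro test_functionI[of _ R] smooth_linear[OF assms(1) test_function_smooth[OF assms(2)]])
       (auto simp: linear_0[OF bounded_linear.linear[OF assms(1)]])
qed

lemma test_function_affine:
  assumes "\<phi> \<in> test_functions" "a \<noteq> 0"
  shows "(\<lambda>x. \<phi> (a *\<^sub>R x + b)) \<in> test_functions"
proof -
  from assms obtain R where R: "\<And>x. R \<le> norm x \<Longrightarrow> \<phi> x = 0"
    by (auto simp: test_functions_iff)
  have "\<phi> (a *\<^sub>R x + b) = 0" if "(\<bar>R\<bar> + norm b) / \<bar>a\<bar> \<le> norm x" for x
  proof (rule R)
    have "\<bar>R\<bar> + norm b \<le> norm (a *\<^sub>R x)"
      using that assms(2) by (simp add: field_simps)
    then show "R \<le> norm (a *\<^sub>R x + b)"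
      using norm_triangle_ineq2[of "a *\<^sub>R x" "-b"] by simp
  qed
  then show ?thesis
    by (intro test_functionI[of _ "(\<bar>R\<bar> + norm b) / \<bar>a\<bar>"]
        smooth_affine[OF test_function_smooth[OF assms(1)]])
qed

lemma test_function_zero: "(\<lambda>_. 0) \<in> test_functions"
  by (auto simp: test_functions_iff intro: smooth_const)

lemma test_function_sum:
  "(\<And>i. i \<in> A \<Longrightarrow> f i \<in> test_functions) \<Longrightarrow> (\<lambda>x. \<Sum>i\<in>A. f i x) \<in> test_functions"
  by (induction A rule: infinite_finite_induct) (auto intro: test_function_zero test_function_add)

lemma test_function_laplacian: "\<phi> \<in> test_functions \<Longrightarrow> laplacian \<phi> \<in> test_functions"
  unfolding laplacian_def[abs_def] by (intro test_function_sum test_function_partial_deriv)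

lemma laplacian_affine:
  assumes "smooth f"
  shows "laplacian (\<lambda>x. f (a *\<^sub>R x + b)) x = of_real (a\<^sup>2) * laplacian f (a *\<^sub>R x + b)"
proof -
  have "partial_deriv i (\<lambda>x. f (a *\<^sub>R x + b)) = (\<lambda>x. of_real a * partial_deriv i f (a *\<^sub>R x + b))" for i
    using assms by (intro ext partial_deriv_affine smooth_differentiable)
  moreover have "partial_deriv i (\<lambda>x. of_real a * partial_deriv i f (a *\<^sub>R x + b)) x
      = of_real a * (of_real a * partial_deriv i (partial_deriv i f) (a *\<^sub>R x + b))" for i
    using assms
    by (subst partial_deriv_linear[OF bounded_linear_mult_right])
       (auto intro!: smooth_differentiable smooth_affine smooth_partial_deriv partial_deriv_affine)
  ultimately show ?thesis
    by (simp add: laplacian_def sum_distrib_left power2_eq_square mult_ac)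
qed

lemma laplacian_linear:
  assumes "bounded_linear L" "smooth f"
  shows "laplacian (\<lambda>x. L (f x)) x = L (laplacian f x)"
proof -
  have "partial_deriv i (\<lambda>x. L (f x)) = (\<lambda>x. L (partial_deriv i f x))" for i
    using assms by (intro ext partial_deriv_linear smooth_differentiable)
  then show ?thesis
    using assms by (simp add: laplacian_def partial_deriv_linear smooth_differentiable
        smooth_partial_deriv linear_sum[OF bounded_linear.linear])
qed

section \<open>A smooth bump\<close>

text \<open>The functions \<open>t \<mapsto> p (1 / t) exp (- 1 / t)\<close>, extended by \<open>0\<close>, are closed under
  differentiation; so each of them is smooth although it vanishes on a half-line.  In the variable
  \<open>s = 1 / t\<close> the derivative is \<open>- s\<^sup>2\<close> times the derivative by \<open>s\<close>, which maps \<open>p(s) exp(- s)\<close> to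
  \<open>s\<^sup>2 (p - p')(s) exp(- s)\<close>.\<close>

definition flat :: "real poly \<Rightarrow> real \<Rightarrow> real" where
  "flat p t = (if 0 < t then poly p (1 / t) * exp (- 1 / t) else 0)"

definition flat_deriv :: "real poly \<Rightarrow> real poly" where
  "flat_deriv p = [:0, 0, 1:] * (p - pderiv p)"

lemma poly_times_exp_minus_tendsto: "((\<lambda>s. poly p s * exp (- s)) \<longlongrightarrow> 0) at_top" for p :: "real poly"
proof -
  have "((\<lambda>s. \<Sum>i\<le>degree p. coeff p i * (s ^ i / exp s)) \<longlongrightarrow> (\<Sum>i\<le>degree p. coeff p i * 0)) at_top"
    by (intro tendsto_intros tendsto_power_div_exp_0)
  then show ?thesis
    by (simp add: poly_altdef exp_minus divide_inverse sum_distrib_right mult.assoc)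
qed

lemma flat_has_derivative: "(flat p has_real_derivative flat (flat_deriv p) t) (at t)"
proof -
  consider "t < 0" | "t = 0" | "t > 0" by linarith
  then show ?thesis
  proof cases
    case 1
    have "((\<lambda>_. 0) has_real_derivative flat (flat_deriv p) t) (at t)"
      using 1 by (simp add: flat_def)
    then show ?thesis
      by (rule has_field_derivative_transform_within[where d = "-t"])
         (use 1 in \<open>auto simp: flat_def dist_real_def\<close>)
  next
    case 3
    have "((\<lambda>t. poly p (1 / t) * exp (- 1 / t)) has_real_derivative flat (flat_deriv p) t) (at t)"
      using 3 by (auto intro!: derivative_eq_intros DERIV_chain2[OF poly_DERIV]
          simp: flat_def flat_deriv_def field_simps power2_eq_square)
    then show ?thesis
      by (rule has_field_derivative_transform_within[where d = t])
         (use 3 in \<open>auto simp: flat_def dist_real_def\<close>)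
  next
    case 2
    have "((\<lambda>s. poly ([:0, 1:] * p) s * exp (- s)) \<longlongrightarrow> 0) at_top"
      by (rule poly_times_exp_minus_tendsto)
    then have "((\<lambda>t. poly ([:0, 1:] * p) (inverse t) * exp (- inverse t)) \<longlongrightarrow> 0) (at_right 0)"
      by (rule filterlim_compose[OF _ filterlim_inverse_at_top_right])
    moreover have "eventually (\<lambda>t::real. 0 < t) (at_right 0)"
      by (simp add: eventually_at_right_less)
    ultimately have r: "((\<lambda>t. (flat p t - flat p 0) / (t - 0)) \<longlongrightarrow> 0) (at_right 0)"
      by (elim Lim_transform_eventually eventually_mono) (auto simp: flat_def field_simps)
    have "eventually (\<lambda>t::real. t < 0) (at_left 0)"
      by (simp add: eventually_at_filter)
    then have "eventually (\<lambda>t. 0 = (flat p t - flat p 0) / (t - 0)) (at_left 0)"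
      by (elim eventually_mono) (auto simp: flat_def)
    then have l: "((\<lambda>t. (flat p t - flat p 0) / (t - 0)) \<longlongrightarrow> 0) (at_left 0)"
      by (rule Lim_transform_eventually[OF tendsto_const])
    have "((\<lambda>t. (flat p t - flat p 0) / (t - 0)) \<longlongrightarrow> 0) (at 0)"
      using l r by (rule filterlim_split_at)
    then show ?thesis
      using 2 by (simp add: has_field_derivative_iff flat_def)
  qed
qed

lemma smooth_flat_comp:
  assumes q: "smooth (\<lambda>x. complex_of_real (q x))"
  shows "smooth (\<lambda>x. complex_of_real (flat p (q x)))"
proof -
  have "smooth (\<lambda>x. complex_of_real (flat ((flat_deriv ^^ 0) p) (q x)))"
  proof (rule smooth_chain[OF _ q, of "\<lambda>j t. complex_of_real (flat ((flat_deriv ^^ j) p) t)"])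
    fix j t
    show "((\<lambda>t. complex_of_real (flat ((flat_deriv ^^ j) p) t)) has_vector_derivative
        complex_of_real (flat ((flat_deriv ^^ Suc j) p) t)) (at t)"
      using flat_has_derivative[of "(flat_deriv ^^ j) p" t] has_vector_derivative_of_real by fastforce
  qed
  then show ?thesis by simp
qed

text \<open>The polynomial \<open>[:0, 0, 1:]\<close> is \<open>flat_deriv 1\<close>; so the primitive and the kernel are coupled by \<open>\<nabla> bump_primitive x = x bump x\<close>; this makes
  \<open>laplacian bump_primitive\<close> the generator of the dilations of \<open>bump\<close>.\<close>

definition bump :: "real^'n::finite \<Rightarrow> real" where
  "bump x = flat [:0, 0, 1:] (1 - x \<bullet> x)"

definition bump_primitive :: "real^'n::finite \<Rightarrow> real" where
  "bump_primitive x = - flat 1 (1 - x \<bullet> x) / 2"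

lemma smooth_one_minus_square: "smooth (\<lambda>x. complex_of_real (1 - x \<bullet> x))"
proof -
  have eq: "(\<lambda>x::real^'n. complex_of_real (1 - x \<bullet> x)) =
      (\<lambda>x. 1 + (\<Sum>i\<in>UNIV. (- 1) * (complex_of_real (x $ i) * complex_of_real (x $ i))))"
    by (auto simp: inner_vec_def sum_negf)
  show ?thesis
    unfolding eq by (intro smooth_add smooth_const smooth_sum smooth_mult smooth_coord)
qed

lemma norm_ge_1_imp_inner: "1 \<le> norm x \<Longrightarrow> \<not> 0 < 1 - x \<bullet> x" for x :: "real^'n"
  using power_mono[of 1 "norm x" 2] by (simp add: power2_norm_eq_inner)

lemma test_function_bump: "(\<lambda>x. complex_of_real (bump x)) \<in> test_functions"
  using norm_ge_1_imp_inner unfolding bump_def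
  by (intro test_functionI[of _ 1] smooth_flat_comp[OF smooth_one_minus_square]) (auto simp: flat_def)

lemma test_function_bump_primitive: "(\<lambda>x. complex_of_real (bump_primitive x)) \<in> test_functions"
proof -
  have "(\<lambda>x. complex_of_real (flat 1 (1 - x \<bullet> x))) \<in> test_functions"
    using norm_ge_1_imp_inner
    by (intro test_functionI[of _ 1] smooth_flat_comp[OF smooth_one_minus_square]) (auto simp: flat_def)
  then have "(\<lambda>x. (-1/2) * complex_of_real (flat 1 (1 - x \<bullet> x))) \<in> test_functions"
    by (intro test_function_mult smooth_const)
  then show ?thesis by (simp add: bump_primitive_def[abs_def])
qed

lemma bump_nonneg: "0 \<le> bump x"
  by (simp add: bump_def flat_def)

lemma bump_0_pos: "0 < bump 0"
  by (simp add: bump_def flat_def)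

lemma bump_eq_0: "1 \<le> norm x \<Longrightarrow> bump x = 0"
  using norm_ge_1_imp_inner[of x] by (simp add: bump_def flat_def)

lemma bump_primitive_has_derivative:
  "(bump_primitive has_derivative (\<lambda>h. bump x * (x \<bullet> h))) (at x)"
proof -
  have "((\<lambda>x. flat 1 (1 - x \<bullet> x)) has_derivative (\<lambda>h. flat (flat_deriv 1) (1 - x \<bullet> x) * (- (2 * (x \<bullet> h))))) (at x)"
    by (rule has_derivative_compose[OF _ flat_has_derivative[unfolded has_field_derivative_def]])
       (auto intro!: derivative_eq_intros simp: inner_commute)
  then have "((\<lambda>x. - flat 1 (1 - x \<bullet> x) / 2) has_derivative
      (\<lambda>h. - (flat (flat_deriv 1) (1 - x \<bullet> x) * (- (2 * (x \<bullet> h)))) / 2)) (at x)"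
    by (auto intro!: derivative_eq_intros)
  then show ?thesis
    by (simp add: bump_primitive_def[abs_def] bump_def flat_deriv_def one_pCons pderiv_pCons)
qed

lemma bump_differentiable: "\<exists>d. (bump has_derivative d) (at x)"
proof -
  obtain d where "((\<lambda>x. complex_of_real (bump x)) has_derivative d) (at x)"
    using smooth_differentiable[OF test_function_smooth[OF test_function_bump]]
    by (auto simp: differentiable_def)
  from bounded_linear.has_derivative[OF bounded_linear_Re this] show ?thesis by auto
qed

text \<open>The divergence of the field \<open>x bump x\<close>; its value is minus the derivative at \<open>t = 1\<close> of
  \<open>t\<^sup>-\<^sup>N bump (x / t)\<close>.\<close>

lemma laplacian_bump_primitive:
  fixes x :: "real^'n"
  assumes d: "(bump has_derivative d) (at x)"
  shows "laplacian (\<lambda>x. complex_of_real (bump_primitive x)) x = of_real (real CARD('n) * bump x + d x)"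
proof -
  have 1: "partial_deriv i (\<lambda>x. complex_of_real (bump_primitive x)) = (\<lambda>x. of_real (bump x * (x $ i)))" for i :: 'n
    by (rule ext, subst partial_deriv_eq[OF bounded_linear.has_derivative[OF bounded_linear_of_real
          bump_primitive_has_derivative]]) (simp add: inner_axis)
  have 2: "partial_deriv i (\<lambda>x. complex_of_real (bump x * (x $ i))) x = of_real (bump x + d (axis i 1) * x $ i)"
    for i
  proof -
    have "((\<lambda>x. bump x * (x $ i)) has_derivative (\<lambda>h. bump x * (h $ i) + d h * (x $ i))) (at x)"
      by (intro has_derivative_mult d bounded_linear_imp_has_derivative bounded_linear_vec_nth)
    from partial_deriv_eq[OF bounded_linear.has_derivative[OF bounded_linear_of_real this]]
    show ?thesis by simp
  qed
  have "d x = d (\<Sum>i\<in>UNIV. x $ i *\<^sub>R axis i 1)"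
    by (simp only: basis_expansion[of x, unfolded scalar_mult_eq_scaleR])
  also have "\<dots> = (\<Sum>i\<in>UNIV. x $ i * d (axis i 1))"
    using has_derivative_linear[OF d] by (simp add: linear_sum linear_cmul)
  finally show ?thesis
    unfolding laplacian_def 1 2 by (simp add: sum.distrib mult.commute)
qed

section \<open>Integration tools\<close>

lemma norm_diff_le_of_vector_derivative:
  fixes g :: "real \<Rightarrow> 'b::real_normed_vector"
  assumes g: "\<And>t. t \<in> {a..b} \<Longrightarrow> (g has_vector_derivative g' t) (at t)"
    and B: "\<And>t. t \<in> {a..b} \<Longrightarrow> norm (g' t) \<le> B"
    and st: "s \<in> {a..b}" "t \<in> {a..b}"
  shows "norm (g t - g s) \<le> B * \<bar>t - s\<bar>"
proof -
  have "norm (g t - g s) \<le> B * norm (t - s)"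
  proof (rule differentiable_bound[of "{a..b}" g "\<lambda>t h. h *\<^sub>R g' t"])
    show "(g has_derivative (\<lambda>h. h *\<^sub>R g' t)) (at t within {a..b})" if "t \<in> {a..b}" for t
      using g[OF that] has_derivative_at_withinI unfolding has_vector_derivative_def by blast
    show "onorm (\<lambda>h. h *\<^sub>R g' t) \<le> B" if "t \<in> {a..b}" for t
      using mult_left_mono[OF B[OF that] abs_ge_zero] by (intro onorm_le) (simp add: mult.commute)
  qed (use st in auto)
  then show ?thesis by simp
qed

lemma borel_measurable_cnj [measurable (raw)]:
  assumes "f \<in> borel_measurable M" shows "(\<lambda>x. cnj (f x)) \<in> borel_measurable M"
proof -
  have "cnj \<in> borel_measurable borel"
    by (intro borel_measurable_continuous_onI continuous_intros)
  from measurable_compose[OF assms this] show ?thesis .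
qed

lemma norm_triangle3: "norm (a + b + c) \<le> norm a + norm b + norm c"
  using norm_triangle_ineq[of "a + b" c] norm_triangle_ineq[of a b] by linarith

lemma has_vector_derivative_iff_quotient:
  "(f has_vector_derivative f') (at t0) \<longleftrightarrow> ((\<lambda>t. (f t - f t0) /\<^sub>R (t - t0)) \<longlongrightarrow> f') (at t0)"
proof -
  have eq: "norm ((f t - f t0) - (t - t0) *\<^sub>R f') / norm (t - t0) = norm ((f t - f t0) /\<^sub>R (t - t0) - f')"
    if "t \<noteq> t0" for t
  proof -
    have "(f t - f t0) - (t - t0) *\<^sub>R f' = (t - t0) *\<^sub>R ((f t - f t0) /\<^sub>R (t - t0) - f')"
      using that by (simp add: scaleR_right_diff_distrib)
    then show ?thesis using that by (simp only: norm_scaleR) simp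
  qed
  have "((\<lambda>t. norm ((f t - f t0) - (t - t0) *\<^sub>R f') / norm (t - t0)) \<longlongrightarrow> 0) (at t0) \<longleftrightarrow>
      ((\<lambda>t. norm ((f t - f t0) /\<^sub>R (t - t0) - f')) \<longlongrightarrow> 0) (at t0)"
    by (rule tendsto_cong, unfold eventually_at_filter, rule always_eventually) (metis eq)
  then show ?thesis
    unfolding has_vector_derivative_def has_derivative_iff_norm
    by (simp add: bounded_linear_scaleR_left tendsto_norm_zero_iff LIM_zero_iff)
qed

text \<open>Differentiation under the integral sign: the Lipschitz bound \<open>w\<close> dominates the difference quotients.\<close>

lemma has_vector_derivative_integral:
  fixes f :: "real \<Rightarrow> 'a \<Rightarrow> 'b::{banach,second_countable_topology}"
  assumes d: "0 < d"
    and int: "\<And>t. \<bar>t - t0\<bar> < d \<Longrightarrow> integrable M (f t)"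
    and f': "f' \<in> borel_measurable M"
    and der: "\<And>x. x \<in> space M \<Longrightarrow> ((\<lambda>t. f t x) has_vector_derivative f' x) (at t0)"
    and w: "integrable M w"
    and lip: "\<And>t x. \<bar>t - t0\<bar> < d \<Longrightarrow> x \<in> space M \<Longrightarrow> norm (f t x - f t0 x) \<le> \<bar>t - t0\<bar> * w x"
  shows "((\<lambda>t. \<integral>x. f t x \<partial>M) has_vector_derivative (\<integral>x. f' x \<partial>M)) (at t0)"
proof -
  let ?q = "\<lambda>t x. (f t x - f t0 x) /\<^sub>R (t - t0)"
  have "((\<lambda>t. ((\<integral>x. f t x \<partial>M) - (\<integral>x. f t0 x \<partial>M)) /\<^sub>R (t - t0)) \<longlongrightarrow> (\<integral>x. f' x \<partial>M)) (at t0)"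
    unfolding tendsto_at_iff_sequentially
  proof (intro allI impI)
    fix X :: "nat \<Rightarrow> real" assume X: "\<forall>i. X i \<in> UNIV - {t0}" "X \<longlonglongrightarrow> t0"
    from X(2) d obtain N where N: "\<And>n. n \<ge> N \<Longrightarrow> \<bar>X n - t0\<bar> < d"
      unfolding LIMSEQ_def dist_real_def by blast
    define Y where "Y n = X (n + N)" for n
    have Y: "Y n \<noteq> t0" "\<bar>Y n - t0\<bar> < d" for n
      using X(1) N by (auto simp: Y_def)
    have Ylim: "Y \<longlonglongrightarrow> t0"
      unfolding Y_def using X(2) by (rule LIMSEQ_ignore_initial_segment)
    have "(\<lambda>n. \<integral>x. ?q (Y n) x \<partial>M) \<longlonglongrightarrow> (\<integral>x. f' x \<partial>M)"
    proof (rule integral_dominated_convergence[where w = w])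
      show "?q (Y n) \<in> borel_measurable M" for n
        using int[OF Y(2)[of n]] int[of t0] d by (intro borel_measurable_integrable) auto
      show "AE x in M. (\<lambda>n. ?q (Y n) x) \<longlonglongrightarrow> f' x"
      proof (rule AE_I2)
        fix x assume "x \<in> space M"
        from der[OF this] have "((\<lambda>t. ?q t x) \<longlongrightarrow> f' x) (at t0)"
          by (simp add: has_vector_derivative_iff_quotient)
        then show "(\<lambda>n. ?q (Y n) x) \<longlonglongrightarrow> f' x"
          unfolding tendsto_at_iff_sequentially using Y(1) Ylim by (auto simp: o_def)
      qed
      show "AE x in M. norm (?q (Y n) x) \<le> w x" for n
      proof (rule AE_I2)
        fix x assume "x \<in> space M"
        from lip[OF Y(2) this, of n] show "norm (?q (Y n) x) \<le> w x"
          using Y(1)[of n] by (simp only: norm_scaleR) (simp add: field_simps)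
      qed
    qed (use f' w in auto)
    moreover have "(\<integral>x. ?q (Y n) x \<partial>M) = ((\<integral>x. f (Y n) x \<partial>M) - (\<integral>x. f t0 x \<partial>M)) /\<^sub>R (Y n - t0)" for n
      using int[OF Y(2)[of n]] int[of t0] d by simp
    ultimately show "((\<lambda>t. ((\<integral>x. f t x \<partial>M) - (\<integral>x. f t0 x \<partial>M)) /\<^sub>R (t - t0)) \<circ> X) \<longlonglongrightarrow> (\<integral>x. f' x \<partial>M)"
      by (rule_tac LIMSEQ_offset[where k = N]) (simp only: o_def Y_def)
  qed
  then show ?thesis
    by (simp add: has_vector_derivative_iff_quotient)
qed

lemma lborel_integrable_affine_iff:
  fixes f :: "'a::euclidean_space \<Rightarrow> 'b::{banach, second_countable_topology}"
  assumes c: "c \<noteq> 0"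
  shows "integrable lborel (\<lambda>x. f (t + c *\<^sub>R x)) \<longleftrightarrow> integrable lborel f"
proof -
  have nn: "(\<integral>\<^sup>+x. g x \<partial>lborel) = \<bar>c\<bar> ^ DIM('a) * (\<integral>\<^sup>+x. g (t + c *\<^sub>R x) \<partial>lborel)"
    if "g \<in> borel_measurable borel" "c \<noteq> 0" for g :: "'a \<Rightarrow> ennreal" and t c
    using that by (subst lborel_affine[of c t])
       (simp_all add: nn_integral_density nn_integral_distr nn_integral_cmult ennreal_power)
  have imp: "integrable lborel (\<lambda>x. f (t + c *\<^sub>R x))" if f: "integrable lborel f" and c: "c \<noteq> 0"
    for f :: "'a \<Rightarrow> 'b" and t c
    using f f[THEN borel_measurable_integrable] c unfolding integrable_iff_bounded
    by (subst (asm) nn[where c=c and t=t]) (auto simp: ennreal_mult_less_top)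
  have "integrable lborel f" if "integrable lborel (\<lambda>x. f (t + c *\<^sub>R x))"
    using imp[OF that, of "1/c" "- t /\<^sub>R c"] c by (simp add: algebra_simps)
  then show ?thesis using imp c by blast
qed

lemma lborel_integral_affine:
  fixes f :: "'a::euclidean_space \<Rightarrow> 'b::{banach, second_countable_topology}"
  assumes c: "c \<noteq> 0"
  shows "(\<integral>x. f (t + c *\<^sub>R x) \<partial>lborel) = (\<integral>x. f x \<partial>lborel) /\<^sub>R \<bar>c\<bar> ^ DIM('a)"
proof (cases "integrable lborel f")
  case f[measurable]: True
  have "(\<integral>x. f x \<partial>lborel) = \<bar>c\<bar> ^ DIM('a) *\<^sub>R (\<integral>x. f (t + c *\<^sub>R x) \<partial>lborel)"
    using c f f[THEN borel_measurable_integrable]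
    by (subst lborel_affine[OF c, of t]) (simp add: integral_density integral_distr)
  then show ?thesis using c by simp
next
  case False
  then show ?thesis
    using c by (simp add: lborel_integrable_affine_iff not_integrable_integral_eq)
qed

lemma lborel_integral_shift:
  fixes f :: "'a::euclidean_space \<Rightarrow> 'b::{banach, second_countable_topology}"
  shows "(\<integral>x. f (x + t) \<partial>lborel) = (\<integral>x. f x \<partial>lborel)"
  using lborel_integral_affine[of 1 f t] by (simp add: add.commute)

lemma lborel_integrable_shift:
  fixes f :: "'a::euclidean_space \<Rightarrow> 'b::{banach, second_countable_topology}"
  shows "integrable lborel (\<lambda>x. f (x + t)) \<longleftrightarrow> integrable lborel f"
  using lborel_integrable_affine_iff[of 1 f t] by (simp add: add.commute)

lemma lborel_integral_reflect:
  fixes f :: "'a::euclidean_space \<Rightarrow> 'b::{banach, second_countable_topology}"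
  shows "(\<integral>x. f (t - x) \<partial>lborel) = (\<integral>x. f x \<partial>lborel)"
  using lborel_integral_affine[of "-1" f t] by simp

lemma lborel_integrable_reflect:
  fixes f :: "'a::euclidean_space \<Rightarrow> 'b::{banach, second_countable_topology}"
  shows "integrable lborel (\<lambda>x. f (t - x)) \<longleftrightarrow> integrable lborel f"
  using lborel_integrable_affine_iff[of "-1" f t] by simp

section \<open>Compactly supported kernels and integration by parts\<close>

text \<open>Continuity and compact support are all that kernels need; test functions and all their derivatives
  share these properties.\<close>

definition ccs :: "('a::euclidean_space \<Rightarrow> complex) \<Rightarrow> bool" where
  "ccs k \<longleftrightarrow> continuous_on UNIV k \<and> (\<exists>R. \<forall>x. R \<le> norm x \<longrightarrow> k x = 0)"

lemma test_function_ccs: "\<phi> \<in> test_functions \<Longrightarrow> ccs \<phi>"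
  by (simp add: test_functions_iff ccs_def smooth_continuous)

lemma ccs_measurable [measurable_dest]: "ccs k \<Longrightarrow> k \<in> borel_measurable borel"
  by (auto simp: ccs_def intro: borel_measurable_continuous_onI)

lemma ccs_bounded:
  assumes "ccs k" obtains M where "0 < M" "\<And>x. norm (k x) \<le> M"
proof -
  from assms obtain R where c: "continuous_on UNIV k" and R: "\<And>x. R \<le> norm x \<Longrightarrow> k x = 0"
    by (auto simp: ccs_def)
  have "bounded (k ` cball 0 R)"
    by (intro compact_imp_bounded compact_continuous_image continuous_on_subset[OF c]) auto
  then obtain M where M: "\<And>x. x \<in> cball 0 R \<Longrightarrow> norm (k x) \<le> M"
    unfolding bounded_iff by blast
  have "norm (k x) \<le> max 1 M" for x
    using M[of x] R[of x] by (cases "norm x \<le> R") auto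
  then show ?thesis using that[of "max 1 M"] by auto
qed

lemma integrable_indicator_cball: "integrable lborel (indicator (cball x R) :: 'a::euclidean_space \<Rightarrow> real)"
  using emeasure_lborel_cball_finite[of x R] by (intro integrable_real_indicator) auto

lemma ccs_integrable:
  assumes "ccs k" shows "integrable lborel k"
proof -
  from assms obtain R where R: "\<And>x. R \<le> norm x \<Longrightarrow> k x = 0" by (auto simp: ccs_def)
  obtain M where M: "\<And>x. norm (k x) \<le> M" using ccs_bounded[OF assms] by metis
  have [measurable]: "k \<in> borel_measurable borel" using assms by (rule ccs_measurable)
  have "norm (k x) \<le> norm (M * indicator (cball 0 R) x)" for x
    using M[of x] R[of x] by (auto simp: indicator_def)
  then show ?thesis
    by (intro Bochner_Integration.integrable_bound[OF integrable_mult_right[OF integrable_indicator_cball]] AE_I2)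
       auto
qed

lemma ccs_norm_square_integrable:
  assumes "ccs k" shows "integrable lborel (\<lambda>x. (norm (k x))\<^sup>2)"
proof -
  obtain M where M: "\<And>x. norm (k x) \<le> M" using ccs_bounded[OF assms] by metis
  have [measurable]: "k \<in> borel_measurable borel" using assms by (rule ccs_measurable)
  have "norm ((norm (k x))\<^sup>2) \<le> norm (M * norm (k x))" for x
    using M[of x] order_trans[OF norm_ge_zero M[of x]]
    by (simp add: power2_eq_square mult_right_mono)
  then show ?thesis
    by (intro Bochner_Integration.integrable_bound[OF integrable_mult_right[OF integrable_norm[OF ccs_integrable[OF assms]]]] AE_I2)
       auto
qed

lemma test_function_deriv_line:
  assumes "\<phi> \<in> test_functions"
  shows "((\<lambda>t. \<phi> (x + t *\<^sub>R axis i 1)) has_vector_derivative partial_deriv i \<phi> (x + t *\<^sub>R axis i 1)) (at t)"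
proof -
  obtain D where D: "(\<phi> has_derivative D) (at (x + t *\<^sub>R axis i 1))"
    using smooth_differentiable[OF test_function_smooth[OF assms]] unfolding differentiable_def by blast
  have "((\<lambda>t. x + t *\<^sub>R axis i 1) has_derivative (\<lambda>h. h *\<^sub>R axis i 1)) (at t)"
    by (auto intro!: derivative_eq_intros)
  from has_derivative_compose[OF this D] have
    "((\<lambda>t. \<phi> (x + t *\<^sub>R axis i 1)) has_derivative (\<lambda>h. D (h *\<^sub>R axis i 1))) (at t)" .
  then show ?thesis
    unfolding has_vector_derivative_def partial_deriv_eq[OF D]
    using has_derivative_linear[OF D] by (simp add: linear_cmul)
qed

text \<open>Translating a test function does not change its integral; differentiate in the translation.\<close>

lemma integral_partial_deriv_test_function:
  assumes \<phi>: "\<phi> \<in> test_functions"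
  shows "(\<integral>x. partial_deriv i \<phi> x \<partial>lborel) = 0"
proof -
  note \<phi>' = test_function_ccs[OF test_function_partial_deriv[OF \<phi>, of i]]
  from \<phi> obtain R where R: "\<And>x. R \<le> norm x \<Longrightarrow> \<phi> x = 0" by (auto simp: test_functions_iff)
  obtain M where M: "0 < M" "\<And>x. norm (partial_deriv i \<phi> x) \<le> M" using ccs_bounded[OF \<phi>'] by metis
  have "((\<lambda>t. \<integral>x. \<phi> (x + t *\<^sub>R axis i 1) \<partial>lborel) has_vector_derivative (\<integral>x. partial_deriv i \<phi> x \<partial>lborel)) (at 0)"
  proof (rule has_vector_derivative_integral[where d = 1 and w = "\<lambda>x. M * indicator (cball 0 (R + 1)) x"])
    show "integrable lborel (\<lambda>x. \<phi> (x + t *\<^sub>R axis i 1))" for t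
      by (simp add: lborel_integrable_shift ccs_integrable test_function_ccs \<phi>)
    show "partial_deriv i \<phi> \<in> borel_measurable lborel"
      using ccs_measurable[OF \<phi>'] by simp
    show "((\<lambda>t. \<phi> (x + t *\<^sub>R axis i 1)) has_vector_derivative partial_deriv i \<phi> x) (at 0)" for x
      using test_function_deriv_line[OF \<phi>, of x i 0] by simp
    show "integrable lborel (\<lambda>x. M * indicator (cball 0 (R + 1)) x)"
      by (intro integrable_mult_right integrable_indicator_cball)
    fix t :: real and x assume t: "\<bar>t - 0\<bar> < 1"
    show "norm (\<phi> (x + t *\<^sub>R axis i 1) - \<phi> (x + 0 *\<^sub>R axis i 1)) \<le> \<bar>t - 0\<bar> * (M * indicator (cball 0 (R + 1)) x)"
    proof (cases "x \<in> cball 0 (R + 1)")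
      case True
      have "norm (\<phi> (x + t *\<^sub>R axis i 1) - \<phi> (x + 0 *\<^sub>R axis i 1)) \<le> M * \<bar>t - 0\<bar>"
        by (rule norm_diff_le_of_vector_derivative[of "-1" 1, OF test_function_deriv_line[OF \<phi>] M(2)])
           (use t in auto)
      with True show ?thesis by (simp add: mult.commute)
    next
      case False
      have "norm x - norm (t *\<^sub>R axis i 1 :: real^'a) \<le> norm (x + t *\<^sub>R axis i 1)"
        by (rule norm_diff_ineq)
      then have "R \<le> norm (x + t *\<^sub>R axis i 1)"
        using False t by (simp add: norm_axis_1)
      then show ?thesis using False R[of x] R[of "x + t *\<^sub>R axis i 1"] by simp
    qed
  qed simp
  then have "((\<lambda>t. \<integral>x. \<phi> x \<partial>lborel) has_vector_derivative (\<integral>x. partial_deriv i \<phi> x \<partial>lborel)) (at 0)"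
    by (simp add: lborel_integral_shift)
  then show ?thesis
    by (rule vector_derivative_unique_at[OF _ has_vector_derivative_const])
qed

lemma test_function_integration_by_parts:
  assumes \<phi>: "\<phi> \<in> test_functions" and \<psi>: "\<psi> \<in> test_functions"
  shows "(\<integral>x. \<phi> x * partial_deriv i \<psi> x \<partial>lborel) = - (\<integral>x. partial_deriv i \<phi> x * \<psi> x \<partial>lborel)"
proof -
  have eq: "partial_deriv i (\<lambda>x. \<phi> x * \<psi> x) = (\<lambda>x. \<phi> x * partial_deriv i \<psi> x + partial_deriv i \<phi> x * \<psi> x)"
    by (rule ext, rule partial_deriv_mult)
       (rule smooth_differentiable[OF test_function_smooth[OF \<phi>]],
        rule smooth_differentiable[OF test_function_smooth[OF \<psi>]])
  have "integrable lborel (\<lambda>x. \<phi> x * partial_deriv i \<psi> x)" "integrable lborel (\<lambda>x. partial_deriv i \<phi> x * \<psi> x)"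
    by (rule ccs_integrable[OF test_function_ccs], rule test_function_mult[OF test_function_smooth[OF \<phi>]
          test_function_partial_deriv[OF \<psi>]])
       (rule ccs_integrable[OF test_function_ccs], rule test_function_mult[OF test_function_smooth[OF
          test_function_partial_deriv[OF \<phi>]] \<psi>])
  with integral_partial_deriv_test_function[OF test_function_mult[OF test_function_smooth[OF \<phi>] \<psi>], of i]
  show ?thesis unfolding eq by (simp add: add_eq_0_iff2)
qed

section \<open>Continuity of translations and mollified pairings\<close>

text \<open>An open set \<open>U\<close> slightly larger than \<open>A\<close> is used because points of \<open>U\<close> stay in \<open>U\<close> under small translations; this
  gives pointwise convergence, and dominated convergence applies.\<close>

lemma indicator_translation_L1:
  fixes A :: "'a::euclidean_space set"
  assumes A[measurable]: "A \<in> sets borel" and fin: "emeasure lborel A < \<infinity>" and z: "z \<longlonglongrightarrow> 0"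
  shows "(\<lambda>n. \<integral>x. \<bar>indicator A (x + z n) - indicator A x :: real\<bar> \<partial>lborel) \<longlonglongrightarrow> 0"
proof (rule LIMSEQ_I)
  fix e :: real assume "0 < e"
  then obtain U where U: "open U" "A \<subseteq> U" "emeasure lborel (U - A) < ennreal (e / 4)"
    using outer_regular_lborel[OF A, of "e / 4"] by auto
  have [measurable]: "U \<in> sets borel" using U(1) by simp
  have finD: "emeasure lborel (U - A) < \<infinity>"
    using U(3) by (rule order_less_trans) simp
  have "emeasure lborel U \<le> emeasure lborel A + emeasure lborel (U - A)"
    using U(2) by (subst plus_emeasure) (auto intro!: emeasure_mono)
  then have finU: "emeasure lborel U < \<infinity>"
    using fin finD by (metis ennreal_add_eq_top infinity_ennreal_def not_le_imp_less top.extremum_uniqueI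
        top.not_eq_extremum)
  define D where "D = (indicator (U - A) :: 'a \<Rightarrow> real)"
  have Dint: "integrable lborel D" unfolding D_def using finD by (intro integrable_real_indicator) auto
  have D: "(\<integral>x. D x \<partial>lborel) < e / 4"
    unfolding D_def using U(3) finD by (simp add: measure_def) (metis enn2real_less_iff infinity_ennreal_def less_divide_eq_numeral1(1))
  have lim0: "(\<lambda>n. \<integral>x. indicator U x * (1 - indicator U (x + y n)) \<partial>lborel) \<longlonglongrightarrow> (\<integral>x. (0::real) \<partial>(lborel :: 'a measure))"
    if y: "y \<longlonglongrightarrow> 0" for y :: "nat \<Rightarrow> 'a"
  proof (rule integral_dominated_convergence[where w = "indicator U"])
    show "AE x in lborel. (\<lambda>n. indicator U x * (1 - indicator U (x + y n)) :: real) \<longlonglongrightarrow> 0"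
    proof (rule AE_I2)
      fix x
      show "(\<lambda>n. indicator U x * (1 - indicator U (x + y n)) :: real) \<longlonglongrightarrow> 0"
      proof (cases "x \<in> U")
        case True
        have "(\<lambda>n. x + y n) \<longlonglongrightarrow> x + 0" by (intro tendsto_intros y)
        with True U(1) have "eventually (\<lambda>n. x + y n \<in> U) sequentially"
          by (simp add: topological_tendstoD)
        then have "eventually (\<lambda>n. 0 = (indicator U x * (1 - indicator U (x + y n)) :: real)) sequentially"
          by eventually_elim simp
        then show ?thesis by (rule Lim_transform_eventually[OF tendsto_const])
      qed simp
    qed
    show "integrable lborel (indicator U :: 'a \<Rightarrow> real)"
      using finU by (intro integrable_real_indicator) auto
  qed (auto simp: indicator_def)
  have int1: "integrable lborel (\<lambda>x. indicator U x * (1 - indicator U (x + y)) :: real)" for y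
    by (rule Bochner_Integration.integrable_bound[of lborel "indicator U :: 'a \<Rightarrow> real"])
       (use finU in \<open>auto simp: indicator_def\<close>)
  let ?h = "\<lambda>y x. indicator U x * (1 - indicator U (x + y)) :: real"
  have bound: "(\<integral>x. \<bar>indicator A (x + y) - indicator A x :: real\<bar> \<partial>lborel)
      \<le> (\<integral>x. ?h y x \<partial>lborel) + (\<integral>x. ?h (-y) x \<partial>lborel) + 2 * (\<integral>x. D x \<partial>lborel)" for y
  proof -
    have "(\<integral>x. \<bar>indicator A (x + y) - indicator A x :: real\<bar> \<partial>lborel) \<le> (\<integral>x. ?h y x + ?h (-y) (x + y) + D (x + y) + D x \<partial>lborel)"
    proof (rule integral_mono)
      show "integrable lborel (\<lambda>x. \<bar>indicator A (x + y) - indicator A x :: real\<bar>)"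
        using fin lborel_integrable_shift[of "indicator A :: 'a \<Rightarrow> real" y]
        by (intro integrable_abs Bochner_Integration.integrable_diff) (auto intro!: integrable_real_indicator)
      show "integrable lborel (\<lambda>x. ?h y x + ?h (-y) (x + y) + D (x + y) + D x)"
        using int1[of y] int1[of "-y"] Dint lborel_integrable_shift[of "?h (-y)" y] lborel_integrable_shift[of D y]
        by (intro Bochner_Integration.integrable_add) auto
      fix x show "\<bar>indicator A (x + y) - indicator A x :: real\<bar> \<le> ?h y x + ?h (-y) (x + y) + D (x + y) + D x"
        using U(2) by (auto simp: indicator_def D_def)
    qed
    also have "\<dots> = (\<integral>x. ?h y x \<partial>lborel) + (\<integral>x. ?h (-y) (x + y) \<partial>lborel) + (\<integral>x. D (x + y) \<partial>lborel) + (\<integral>x. D x \<partial>lborel)"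
      using int1[of y] int1[of "-y"] Dint lborel_integrable_shift[of "?h (-y)" y] lborel_integrable_shift[of D y]
      by simp
    also have "\<dots> = (\<integral>x. ?h y x \<partial>lborel) + (\<integral>x. ?h (-y) x \<partial>lborel) + 2 * (\<integral>x. D x \<partial>lborel)"
      using lborel_integral_shift[of "?h (-y)" y] lborel_integral_shift[of D y] by simp
    finally show ?thesis .
  qed
  have "(\<lambda>n. (\<integral>x. ?h (z n) x \<partial>lborel) + (\<integral>x. ?h (- z n) x \<partial>lborel)) \<longlonglongrightarrow> 0"
    using tendsto_add[OF lim0[OF z] lim0[of "\<lambda>n. - z n"]] tendsto_minus[OF z] by simp
  from LIMSEQ_D[OF this, of "e / 2"] \<open>0 < e\<close> obtain N where
    N: "\<And>n. n \<ge> N \<Longrightarrow> norm ((\<integral>x. ?h (z n) x \<partial>lborel) + (\<integral>x. ?h (- z n) x \<partial>lborel) - 0) < e / 2"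
    by auto
  have "norm ((\<integral>x. \<bar>indicator A (x + z n) - indicator A x :: real\<bar> \<partial>lborel) - 0) < e" if "n \<ge> N" for n
  proof -
    have "0 \<le> (\<integral>x. \<bar>indicator A (x + z n) - indicator A x :: real\<bar> \<partial>lborel)" by simp
    moreover have "(\<integral>x. ?h (z n) x \<partial>lborel) + (\<integral>x. ?h (- z n) x \<partial>lborel) < e / 2"
      using N[OF that] by (simp only: real_norm_def diff_zero abs_less_iff)
    ultimately show ?thesis using bound[of "z n"] D by (simp only: real_norm_def diff_zero abs_of_nonneg)
  qed
  then show "\<exists>N. \<forall>n\<ge>N. norm ((\<integral>x. \<bar>indicator A (x + z n) - indicator A x :: real\<bar> \<partial>lborel) - 0) < e"
    by blast
qed

lemma L1_translation_continuous:
  fixes g :: "'a::euclidean_space \<Rightarrow> 'b::{banach,second_countable_topology}"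
  assumes "integrable lborel g" and z: "z \<longlonglongrightarrow> 0"
  shows "(\<lambda>n. \<integral>x. norm (g (x + z n) - g x) \<partial>lborel) \<longlonglongrightarrow> 0"
  using assms(1)
proof (induction rule: integrable_induct)
  case (base A c)
  have "norm (indicator A (x + y) *\<^sub>R c - indicator A x *\<^sub>R c) = norm c * \<bar>indicator A (x + y) - indicator A x :: real\<bar>"
    for x y by (simp add: scaleR_left_diff_distrib[symmetric])
  then show ?case
    using tendsto_mult_right_zero[OF indicator_translation_L1[of A z], of "norm c"] base z by simp
next
  case (add f g)
  show ?case
  proof (rule real_tendsto_sandwich[OF _ _ tendsto_const])
    show "(\<lambda>n. (\<integral>x. norm (f (x + z n) - f x) \<partial>lborel) + (\<integral>x. norm (g (x + z n) - g x) \<partial>lborel)) \<longlonglongrightarrow> 0"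
      using tendsto_add[OF add.IH] by simp
    show "\<forall>\<^sub>F n in sequentially. (\<integral>x. norm (f (x + z n) + g (x + z n) - (f x + g x)) \<partial>lborel)
        \<le> (\<integral>x. norm (f (x + z n) - f x) \<partial>lborel) + (\<integral>x. norm (g (x + z n) - g x) \<partial>lborel)"
    proof (rule always_eventually, rule allI)
      fix n
      have i: "integrable lborel (\<lambda>x. f (x + z n))" "integrable lborel (\<lambda>x. g (x + z n))"
        "integrable lborel f" "integrable lborel g"
        using add.hyps by (simp_all add: lborel_integrable_shift)
      show "(\<integral>x. norm (f (x + z n) + g (x + z n) - (f x + g x)) \<partial>lborel)
        \<le> (\<integral>x. norm (f (x + z n) - f x) \<partial>lborel) + (\<integral>x. norm (g (x + z n) - g x) \<partial>lborel)"
        using i unfolding Bochner_Integration.integral_add[OF integrable_norm integrable_norm,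
            OF Bochner_Integration.integrable_diff Bochner_Integration.integrable_diff, OF i(1,3) i(2,4), symmetric]
        by (intro integral_mono norm_diff_triangle_ineq) auto
    qed
  qed auto
next
  case (lim f s)
  have i: "integrable lborel f" "integrable lborel (s i)" for i using lim by auto
  have d: "(\<lambda>i. \<integral>x. norm (s i x - f x) \<partial>lborel) \<longlonglongrightarrow> (\<integral>x. (0::real) \<partial>(lborel :: 'a measure))"
  proof (rule integral_dominated_convergence[where w = "\<lambda>x. 3 * norm (f x)"])
    show "AE x in lborel. (\<lambda>i. norm (s i x - f x)) \<longlonglongrightarrow> 0"
      using lim by (auto intro!: AE_I2 tendsto_norm_zero LIM_zero)
    show "AE x in lborel. norm (norm (s i x - f x)) \<le> 3 * norm (f x)" for i
    proof (rule AE_I2)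
      fix x :: 'a
      have "norm (s i x - f x) \<le> norm (s i x) + norm (f x)" by (rule norm_triangle_ineq4)
      with lim.hyps(3)[of x i] show "norm (norm (s i x - f x)) \<le> 3 * norm (f x)" by simp
    qed
  qed (use i in auto)
  show ?case
  proof (rule LIMSEQ_I)
    fix e :: real assume "0 < e"
    with LIMSEQ_D[OF d, of "e / 4"] obtain i0 where "\<And>i. i \<ge> i0 \<Longrightarrow> norm ((\<integral>x. norm (s i x - f x) \<partial>lborel) - 0) < e / 4"
      by auto
    then have s: "(\<integral>x. norm (s i0 x - f x) \<partial>lborel) < e / 4" by (metis abs_less_iff diff_zero order_refl real_norm_def)
    from LIMSEQ_D[OF lim.IH[of i0], of "e / 4"] \<open>0 < e\<close> obtain N where
      N: "\<And>n. n \<ge> N \<Longrightarrow> norm ((\<integral>x. norm (s i0 (x + z n) - s i0 x) \<partial>lborel) - 0) < e / 4" by auto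
    have "norm ((\<integral>x. norm (f (x + z n) - f x) \<partial>lborel) - 0) < e" if "n \<ge> N" for n
    proof -
      note ii = i lborel_integrable_shift[of f "z n"] lborel_integrable_shift[of "s i0" "z n"]
      have shift: "(\<integral>x. norm (s i0 (x + z n) - f (x + z n)) \<partial>lborel) = (\<integral>x. norm (s i0 x - f x) \<partial>lborel)"
        by (rule lborel_integral_shift[of "\<lambda>x. norm (s i0 x - f x)"])
      have "(\<integral>x. norm (f (x + z n) - f x) \<partial>lborel) \<le>
          (\<integral>x. norm (s i0 (x + z n) - f (x + z n)) + norm (s i0 (x + z n) - s i0 x) + norm (s i0 x - f x) \<partial>lborel)"
      proof (rule integral_mono)
        fix x
        have "f (x + z n) - f x = - (s i0 (x + z n) - f (x + z n)) + (s i0 (x + z n) - s i0 x) + (s i0 x - f x)"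
          by simp
        then show "norm (f (x + z n) - f x) \<le>
            norm (s i0 (x + z n) - f (x + z n)) + norm (s i0 (x + z n) - s i0 x) + norm (s i0 x - f x)"
          using norm_triangle3[of "- (s i0 (x + z n) - f (x + z n))" "s i0 (x + z n) - s i0 x" "s i0 x - f x"]
          by (simp only: norm_minus_cancel)
      qed (use ii in auto)
      also have "\<dots> = 2 * (\<integral>x. norm (s i0 x - f x) \<partial>lborel) + (\<integral>x. norm (s i0 (x + z n) - s i0 x) \<partial>lborel)"
        using ii shift by simp
      finally have "(\<integral>x. norm (f (x + z n) - f x) \<partial>lborel) < e"
        using s N[OF that] \<open>0 < e\<close> by (simp only: real_norm_def diff_zero abs_less_iff) linarith
      then show ?thesis by (simp add: abs_of_nonneg)
    qed
    then show "\<exists>N. \<forall>n\<ge>N. norm ((\<integral>x. norm (f (x + z n) - f x) \<partial>lborel) - 0) < e" by blast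
  qed
qed

text \<open>The bound \<open>norm (f x) * norm (g y) \<le> H x + H y\<close> with integrable \<open>H\<close> replaces duality of Lebesgue
  spaces: by Young's inequality it covers every pair of conjugate exponents, and it survives
  translations.\<close>

lemma pairing_translation_continuous:
  fixes f g :: "'a::euclidean_space \<Rightarrow> complex" and H :: "'a \<Rightarrow> real"
  assumes f[measurable]: "f \<in> borel_measurable borel" and g[measurable]: "g \<in> borel_measurable borel"
    and H: "integrable lborel H" and fgH: "\<And>x y. norm (f x) * norm (g y) \<le> H x + H y"
    and z: "z \<longlonglongrightarrow> 0"
  shows "(\<lambda>n. \<integral>y. f (y + z n) * g y \<partial>lborel) \<longlonglongrightarrow> (\<integral>y. f y * g y \<partial>lborel)"
proof (rule LIMSEQ_I)
  fix e :: real assume e: "0 < e"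
  have [measurable]: "H \<in> borel_measurable borel" using H by simp
  have H0: "0 \<le> H x" for x
    using fgH[of x x] mult_nonneg_nonneg[OF norm_ge_zero[of "f x"] norm_ge_zero[of "g x"]] by linarith
  \<comment> \<open>On \<open>T k\<close> both functions are bounded, so that translations act continuously on the truncations; off \<open>T k\<close> the
    product is dominated by the tail of \<open>H\<close>.\<close>
  define T where "T k = {y. norm y \<le> real k \<and> norm (f y) \<le> real k \<and> norm (g y) \<le> real k}" for k
  have T[measurable]: "T k \<in> sets borel" for k unfolding T_def by measurable
  define Hc where "Hc k x = H x * indicator (- T k) x" for k x
  have Hc_meas[measurable]: "Hc k \<in> borel_measurable borel" for k unfolding Hc_def[abs_def] by measurable
  have Hc_int: "integrable lborel (Hc k)" for k
    by (rule Bochner_Integration.integrable_bound[OF H]) (auto simp: Hc_def H0 indicator_def)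
  have "(\<lambda>k. \<integral>x. Hc k x \<partial>lborel) \<longlonglongrightarrow> (\<integral>x. 0 \<partial>(lborel :: 'a measure))"
  proof (rule integral_dominated_convergence[where w = H])
    show "AE x in lborel. (\<lambda>k. Hc k x) \<longlonglongrightarrow> 0"
    proof (rule AE_I2)
      fix x :: 'a
      obtain N :: nat where N: "max (norm x) (max (norm (f x)) (norm (g x))) \<le> real N"
        using real_arch_simple by blast
      have "eventually (\<lambda>k. 0 = Hc k x) sequentially"
        using eventually_ge_at_top[of N]
      proof eventually_elim
        case (elim k)
        then have "real N \<le> real k" by simp
        with N show ?case by (auto simp: Hc_def T_def)
      qed
      then show "(\<lambda>k. Hc k x) \<longlonglongrightarrow> 0" by (rule Lim_transform_eventually[OF tendsto_const])
    qed
  qed (use H in \<open>auto simp: Hc_def H0 indicator_def\<close>)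
  from LIMSEQ_D[OF this, of "e / 24"] e obtain k where
    "norm ((\<integral>x. Hc k x \<partial>lborel) - (\<integral>x. 0 \<partial>(lborel :: 'a measure))) < e / 24" by auto
  then have k: "(\<integral>x. Hc k x \<partial>lborel) < e / 24" by simp
  define F where "F x = indicator (T k) x *\<^sub>R f x" for x
  define G where "G x = indicator (T k) x *\<^sub>R g x" for x
  have [measurable]: "F \<in> borel_measurable borel" "G \<in> borel_measurable borel"
    unfolding F_def[abs_def] G_def[abs_def] by measurable
  have F_int: "integrable lborel F"
    by (rule Bochner_Integration.integrable_bound[OF integrable_mult_right[OF integrable_indicator_cball[of 0 "real k"], of "real k"]])
       (auto simp: F_def T_def indicator_def)
  have G_le: "norm (G x) \<le> real k" for x by (auto simp: G_def T_def indicator_def)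
  have F_int': "integrable lborel (\<lambda>x. F (x + w))" and H_int': "integrable lborel (\<lambda>x. H (x + w))"
    and Hc_int': "integrable lborel (\<lambda>x. Hc k (x + w))" for w
    using F_int H Hc_int by (simp_all add: lborel_integrable_shift)
  have fg_int: "integrable lborel (\<lambda>y. f (y + w) * g y)" for w
    by (rule Bochner_Integration.integrable_bound[OF Bochner_Integration.integrable_add[OF H_int'[of w] H]])
       (auto simp: norm_mult H0 intro!: AE_I2 order_trans[OF fgH])
  let ?W = "\<lambda>w y. real k * norm (F (y + w) - F y) + 2 * Hc k (y + w) + 2 * norm (H (y + w) - H y) + 4 * Hc k y"
  have pw: "norm (f (y + w) * g y - f y * g y) \<le> ?W w y" for w y
  proof -
    have FG: "norm (F (y + w) * G y - F y * G y) \<le> real k * norm (F (y + w) - F y)"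
      using mult_right_mono[OF G_le[of y] norm_ge_zero[of "F (y + w) - F y"]]
      by (simp only: norm_mult[symmetric] left_diff_distrib[symmetric] mult.commute[of "G y"])
    have a: "norm (f (y + w) * g y - F (y + w) * G y) \<le> 2 * Hc k (y + w) + 2 * Hc k y + 2 * norm (H (y + w) - H y)"
    proof (cases "y + w \<in> T k \<and> y \<in> T k")
      case True then show ?thesis by (simp add: F_def G_def Hc_def)
    next
      case False
      then have "norm (f (y + w) * g y - F (y + w) * G y) = norm (f (y + w)) * norm (g y)"
        by (auto simp: F_def G_def norm_mult)
      also have "\<dots> \<le> H (y + w) + H y" by (rule fgH)
      also have "\<dots> \<le> 2 * Hc k (y + w) + 2 * Hc k y + 2 * norm (H (y + w) - H y)"
        using False H0[of y] H0[of "y + w"] by (auto simp: Hc_def indicator_def abs_if)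
      finally show ?thesis .
    qed
    have b: "norm (F y * G y - f y * g y) \<le> 2 * Hc k y"
      using fgH[of y y] by (auto simp: F_def G_def Hc_def indicator_def norm_mult)
    have "f (y + w) * g y - f y * g y = (F (y + w) * G y - F y * G y) + (f (y + w) * g y - F (y + w) * G y) + (F y * G y - f y * g y)"
      by simp
    then have "norm (f (y + w) * g y - f y * g y) \<le>
        norm (F (y + w) * G y - F y * G y) + norm (f (y + w) * g y - F (y + w) * G y) + norm (F y * G y - f y * g y)"
      by (metis norm_triangle3)
    with FG a b show ?thesis by linarith
  qed
  have W_int: "integrable lborel (?W w)" for w
    using F_int F_int'[of w] H H_int'[of w] Hc_int[of k] Hc_int'[of w] by simp
  have bound: "norm ((\<integral>y. f (y + w) * g y \<partial>lborel) - (\<integral>y. f y * g y \<partial>lborel))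
      \<le> real k * (\<integral>y. norm (F (y + w) - F y) \<partial>lborel) + 2 * (\<integral>y. norm (H (y + w) - H y) \<partial>lborel) + 6 * (\<integral>x. Hc k x \<partial>lborel)" for w
  proof -
    have "norm ((\<integral>y. f (y + w) * g y \<partial>lborel) - (\<integral>y. f y * g y \<partial>lborel)) = norm (\<integral>y. f (y + w) * g y - f y * g y \<partial>lborel)"
      using fg_int[of w] fg_int[of 0] by simp
    also have "\<dots> \<le> (\<integral>y. ?W w y \<partial>lborel)"
      by (rule Bochner_Integration.integral_norm_bound_integral) (use fg_int[of w] fg_int[of 0] W_int pw in auto)
    also have "\<dots> = real k * (\<integral>y. norm (F (y + w) - F y) \<partial>lborel) + 2 * (\<integral>y. Hc k (y + w) \<partial>lborel)
        + 2 * (\<integral>y. norm (H (y + w) - H y) \<partial>lborel) + 4 * (\<integral>y. Hc k y \<partial>lborel)"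
      using F_int F_int'[of w] H H_int'[of w] Hc_int[of k] Hc_int'[of w] by simp
    finally show ?thesis by (simp add: lborel_integral_shift[of "Hc k"])
  qed
  have "(\<lambda>n. real k * (\<integral>y. norm (F (y + z n) - F y) \<partial>lborel) + 2 * (\<integral>y. norm (H (y + z n) - H y) \<partial>lborel)) \<longlonglongrightarrow> real k * 0 + 2 * 0"
    by (intro tendsto_intros L1_translation_continuous F_int H z)
  from LIMSEQ_D[OF this, of "e / 2"] e obtain N where N: "\<And>n. n \<ge> N \<Longrightarrow>
    norm (real k * (\<integral>y. norm (F (y + z n) - F y) \<partial>lborel) + 2 * (\<integral>y. norm (H (y + z n) - H y) \<partial>lborel)) < e / 2"
    by auto
  have "norm ((\<integral>y. f (y + z n) * g y \<partial>lborel) - (\<integral>y. f y * g y \<partial>lborel)) < e" if "n \<ge> N" for n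
    using bound[of "z n"] N[OF that] k e by (simp add: abs_less_iff)
  then show "\<exists>N. \<forall>n\<ge>N. norm ((\<integral>y. f (y + z n) * g y \<partial>lborel) - (\<integral>y. f y * g y \<partial>lborel)) < e" by blast
qed

lemma kernel_integrable_fst:
  fixes k :: "'a::euclidean_space \<Rightarrow> complex" and G :: "'a \<Rightarrow> real"
  assumes k: "ccs k" and G: "integrable lborel G"
  shows "integrable (lborel \<Otimes>\<^sub>M lborel) (\<lambda>(x, y). G x * norm (k (x - y)))"
proof -
  have [measurable]: "k \<in> borel_measurable borel" "G \<in> borel_measurable borel"
    using ccs_measurable[OF k] G by auto
  have ki: "integrable lborel (\<lambda>y. norm (k y))" by (intro integrable_norm ccs_integrable k)
  show ?thesis
  proof (rule lborel_pair.Fubini_integrable)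
    show "integrable lborel (\<lambda>x. \<integral>y. norm (case (x, y) of (x, y) \<Rightarrow> G x * norm (k (x - y))) \<partial>lborel)"
      using G by (simp add: abs_mult lborel_integral_reflect[of "\<lambda>y. norm (k y)"])
    show "AE x in lborel. integrable lborel (\<lambda>y. case (x, y) of (x, y) \<Rightarrow> G x * norm (k (x - y)))"
      using lborel_integrable_reflect[of "\<lambda>y. norm (k y)"] ki by auto
  qed measurable
qed

lemma ccs_reflect: "ccs k \<Longrightarrow> ccs (\<lambda>x. k (- x))"
  unfolding ccs_def by (auto intro!: continuous_on_compose2[of UNIV k UNIV uminus] continuous_intros) (metis norm_minus_cancel)

lemma kernel_integrable_snd:
  fixes k :: "'a::euclidean_space \<Rightarrow> complex" and G :: "'a \<Rightarrow> real"
  assumes k: "ccs k" and G: "integrable lborel G"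
  shows "integrable (lborel \<Otimes>\<^sub>M lborel) (\<lambda>(x, y). G y * norm (k (x - y)))"
  using lborel_pair.integrable_product_swap[OF kernel_integrable_fst[OF ccs_reflect[OF k] G]]
  by (simp add: case_prod_unfold)

lemma pairing_integrable:
  fixes f g k :: "'a::euclidean_space \<Rightarrow> complex" and H :: "'a \<Rightarrow> real"
  assumes f[measurable]: "f \<in> borel_measurable borel" and g[measurable]: "g \<in> borel_measurable borel"
    and H: "integrable lborel H" and fgH: "\<And>x y. norm (f x) * norm (g y) \<le> H x + H y"
    and k: "ccs k"
  shows "integrable (lborel \<Otimes>\<^sub>M lborel) (\<lambda>(x, y). f x * g y * k (x - y))"
proof -
  have [measurable]: "k \<in> borel_measurable borel" "H \<in> borel_measurable borel"
    using ccs_measurable[OF k] H by auto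
  show ?thesis
  proof (rule Bochner_Integration.integrable_bound[OF Bochner_Integration.integrable_add[OF
          kernel_integrable_fst[OF k H] kernel_integrable_snd[OF k H]]])
    show "AE p in lborel \<Otimes>\<^sub>M lborel. norm (case p of (x, y) \<Rightarrow> f x * g y * k (x - y)) \<le>
        norm ((case p of (x, y) \<Rightarrow> H x * norm (k (x - y))) + (case p of (x, y) \<Rightarrow> H y * norm (k (x - y))))"
    proof (rule AE_I2, clarify)
      fix x y
      have "norm (f x * g y * k (x - y)) \<le> (H x + H y) * norm (k (x - y))"
        using mult_right_mono[OF fgH[of x y] norm_ge_zero[of "k (x - y)"]] by (simp add: norm_mult)
      also have "\<dots> \<le> norm (H x * norm (k (x - y)) + H y * norm (k (x - y)))"
        by (simp add: distrib_right)
      finally show "norm (f x * g y * k (x - y)) \<le> norm (H x * norm (k (x - y)) + H y * norm (k (x - y)))" .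
    qed
  qed measurable
qed

lemma pairing_swap:
  fixes f g k :: "'a::euclidean_space \<Rightarrow> complex" and H :: "'a \<Rightarrow> real"
  assumes "f \<in> borel_measurable borel" "g \<in> borel_measurable borel"
    and "integrable lborel H" and "\<And>x y. norm (f x) * norm (g y) \<le> H x + H y" and "ccs k"
  shows "(\<integral>y. \<integral>x. f x * g y * k (x - y) \<partial>lborel \<partial>lborel) = (\<integral>x. \<integral>y. f x * g y * k (x - y) \<partial>lborel \<partial>lborel)"
  by (rule lborel_pair.Fubini_integral[OF pairing_integrable[OF assms]])

lemma pairing_shift:
  fixes f g k :: "'a::euclidean_space \<Rightarrow> complex" and H :: "'a \<Rightarrow> real"
  assumes f[measurable]: "f \<in> borel_measurable borel" and g[measurable]: "g \<in> borel_measurable borel"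
    and H: "integrable lborel H" and fgH: "\<And>x y. norm (f x) * norm (g y) \<le> H x + H y"
    and k: "ccs k"
  shows "(\<integral>x. \<integral>y. f x * g y * k (x - y) \<partial>lborel \<partial>lborel) = (\<integral>z. k z * (\<integral>y. f (y + z) * g y \<partial>lborel) \<partial>lborel)"
    and "integrable lborel (\<lambda>z. k z * (\<integral>y. f (y + z) * g y \<partial>lborel))"
proof -
  have [measurable]: "k \<in> borel_measurable borel" "H \<in> borel_measurable borel"
    using ccs_measurable[OF k] H by auto
  have H0: "0 \<le> H x" for x
    using fgH[of x x] mult_nonneg_nonneg[OF norm_ge_zero[of "f x"] norm_ge_zero[of "g x"]] by linarith
  have H': "integrable lborel (\<lambda>x. H (x + w))" for w
    using H by (simp add: lborel_integrable_shift)
  have int: "integrable (lborel \<Otimes>\<^sub>M lborel) (\<lambda>(z, y). k z * (f (y + z) * g y))"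
  proof (rule Bochner_Integration.integrable_bound)
    show "integrable (lborel \<Otimes>\<^sub>M lborel) (\<lambda>(z, y). norm (k z) * (H (y + z) + H y))"
    proof (rule lborel_pair.Fubini_integrable)
      have "(\<integral>y. \<bar>H (y + z) + H y\<bar> \<partial>lborel) = 2 * (\<integral>y. H y \<partial>lborel)" for z
        using H0 H H'[of z] lborel_integral_shift[of H z] by (simp add: abs_of_nonneg)
      then show "integrable lborel (\<lambda>z. \<integral>y. norm (case (z, y) of (z, y) \<Rightarrow> norm (k z) * (H (y + z) + H y)) \<partial>lborel)"
        using ccs_integrable[OF k] by (simp add: abs_mult)
      show "AE z in lborel. integrable lborel (\<lambda>y. case (z, y) of (z, y) \<Rightarrow> norm (k z) * (H (y + z) + H y))"
        using H H' by auto
    qed measurable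
    show "AE p in lborel \<Otimes>\<^sub>M lborel. norm (case p of (z, y) \<Rightarrow> k z * (f (y + z) * g y)) \<le>
        norm (case p of (z, y) \<Rightarrow> norm (k z) * (H (y + z) + H y))"
      using fgH H0 by (auto simp: norm_mult abs_mult intro!: AE_I2 mult_left_mono)
  qed measurable
  have "(\<integral>x. \<integral>y. f x * g y * k (x - y) \<partial>lborel \<partial>lborel) = (\<integral>y. \<integral>x. f x * g y * k (x - y) \<partial>lborel \<partial>lborel)"
    by (rule pairing_swap[OF assms, symmetric])
  also have "\<dots> = (\<integral>y. \<integral>z. k z * (f (y + z) * g y) \<partial>lborel \<partial>lborel)"
  proof -
    have "(\<integral>x. f x * g y * k (x - y) \<partial>lborel) = (\<integral>z. k z * (f (y + z) * g y) \<partial>lborel)" for y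
      using lborel_integral_shift[of "\<lambda>x. f x * g y * k (x - y)" y] by (simp add: mult_ac add.commute)
    then show ?thesis by simp
  qed
  also have "\<dots> = (\<integral>z. \<integral>y. k z * (f (y + z) * g y) \<partial>lborel \<partial>lborel)"
    by (rule lborel_pair.Fubini_integral[OF int])
  finally show "(\<integral>x. \<integral>y. f x * g y * k (x - y) \<partial>lborel \<partial>lborel) = (\<integral>z. k z * (\<integral>y. f (y + z) * g y \<partial>lborel) \<partial>lborel)"
    by simp
  show "integrable lborel (\<lambda>z. k z * (\<integral>y. f (y + z) * g y \<partial>lborel))"
    using lborel_pair.integrable_fst[OF int] by simp
qed

definition mollifier :: "real \<Rightarrow> real^'n::finite \<Rightarrow> real" where
  "mollifier t z = bump (z /\<^sub>R t) / (t ^ CARD('n) * (\<integral>x. bump (x :: real^'n) \<partial>lborel))"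

lemma bump_integrable: "integrable lborel bump"
  using ccs_integrable[OF test_function_ccs[OF test_function_bump]] by (simp add: complex_of_real_integrable_eq)

lemma bump_measurable [measurable]: "bump \<in> borel_measurable borel"
  using borel_measurable_integrable[OF bump_integrable] by simp

lemma bump_integral_pos: "0 < (\<integral>x. bump (x :: real^'n::finite) \<partial>lborel)"
proof -
  have "\<not> (AE x in lborel. bump (x :: real^'n) = 0)"
  proof
    assume "AE x in lborel. bump (x :: real^'n) = 0"
    moreover have "continuous_on UNIV (bump :: real^'n \<Rightarrow> real)"
      using bump_differentiable has_derivative_continuous by (intro continuous_at_imp_continuous_on) blast
    then have "open {x :: real^'n. bump x \<in> {0<..}}"
      by (intro open_vimage[unfolded vimage_def]) auto
    then obtain r where r: "0 < r" "ball 0 r \<subseteq> {x :: real^'n. bump x \<in> {0<..}}"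
      using bump_0_pos open_contains_ball[of "{x :: real^'n. bump x \<in> {0<..}}"] by auto
    ultimately have "AE x in lborel. (x :: real^'n) \<notin> ball 0 r" by (auto elim!: eventually_mono)
    then have "ball (0 :: real^'n) r \<in> null_sets lborel"
      by (subst AE_iff_null_sets) auto
    then show False
      using r(1) content_ball_pos[of r "0 :: real^'n"] by (simp add: measure_def null_sets_def)
  qed
  then show ?thesis
    using integral_nonneg_eq_0_iff_AE[OF bump_integrable] bump_nonneg
    by (metis AE_I2 integral_nonneg_AE order_le_less)
qed

lemma mollifier_nonneg: "0 < t \<Longrightarrow> 0 \<le> mollifier t z"
  unfolding mollifier_def
  by (intro divide_nonneg_nonneg mult_nonneg_nonneg bump_nonneg less_imp_le[OF bump_integral_pos]) simp

lemma mollifier_eq_0: "0 < t \<Longrightarrow> t \<le> norm z \<Longrightarrow> mollifier t z = 0"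
  unfolding mollifier_def by (simp add: bump_eq_0 field_simps)

lemma test_function_mollifier:
  assumes "0 < t" shows "(\<lambda>z. complex_of_real (mollifier t z)) \<in> test_functions"
proof -
  let ?c = "1 / (t ^ CARD('a) * (\<integral>x. bump (x :: real^'a) \<partial>lborel))"
  have "(\<lambda>z. complex_of_real ?c * complex_of_real (bump (inverse t *\<^sub>R z + 0))) \<in> test_functions"
    using assms by (intro test_function_mult smooth_const test_function_affine[OF test_function_bump]) auto
  then show ?thesis by (simp add: mollifier_def[abs_def])
qed

lemma mollifier_integral:
  assumes "0 < t" shows "(\<integral>z. mollifier t (z :: real^'n::finite) \<partial>lborel) = 1"
  using assms bump_integral_pos[where 'n='n] lborel_integral_affine[of "inverse t" "bump :: real^'n \<Rightarrow> real" 0]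
  unfolding mollifier_def by (simp add: field_simps)

lemma mollifier_integrable: "0 < t \<Longrightarrow> integrable lborel (mollifier t)"
  using ccs_integrable[OF test_function_ccs[OF test_function_mollifier]] by (simp add: complex_of_real_integrable_eq)

text \<open>Mollifying one factor of a pairing and removing the mollification reproduces the pairing.  Every
  identity for weak derivatives below is proved by moving derivatives onto the mollifier.\<close>

lemma mollified_pairing:
  fixes f g :: "real^'n::finite \<Rightarrow> complex" and H :: "real^'n \<Rightarrow> real"
  assumes f: "f \<in> borel_measurable borel" and g: "g \<in> borel_measurable borel"
    and H: "integrable lborel H" and fgH: "\<And>x y. norm (f x) * norm (g y) \<le> H x + H y"
  shows "((\<lambda>t. \<integral>x. \<integral>y. f x * g y * of_real (mollifier t (x - y)) \<partial>lborel \<partial>lborel) \<longlongrightarrow> (\<integral>x. f x * g x \<partial>lborel)) (at_right 0)"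
proof -
  let ?I = "\<lambda>z. \<integral>y. f (y + z) * g y \<partial>lborel"
  have lim: "(?I \<longlongrightarrow> ?I 0) (at 0)"
    unfolding tendsto_at_iff_sequentially o_def
    using pairing_translation_continuous[OF f g H fgH] by auto
  have I: "\<exists>d>0. \<forall>z. norm z < d \<longrightarrow> norm (I z - I 0) < e" if "(I \<longlongrightarrow> I 0) (at 0)" "0 < e"
    for e and I :: "real^'n \<Rightarrow> complex"
  proof -
    from LIM_D[OF that] obtain d where
      d: "d > 0" "\<And>z. z \<noteq> 0 \<Longrightarrow> norm z < d \<Longrightarrow> norm (I z - I 0) < e" by auto
    have "norm (I z - I 0) < e" if "norm z < d" for z
      using d(2)[of z] that \<open>0 < e\<close> by (cases "z = 0") auto
    with d(1) show ?thesis by blast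
  qed
  show ?thesis
  proof (rule tendstoI)
    fix e :: real assume e: "0 < e"
    then obtain d where d: "0 < d" "\<And>z. norm z < d \<Longrightarrow> norm (?I z - ?I 0) < e / 2"
      using I[OF lim, of "e / 2"] by (auto simp only: half_gt_zero)
    have "dist (\<integral>x. \<integral>y. f x * g y * of_real (mollifier t (x - y)) \<partial>lborel \<partial>lborel) (\<integral>x. f x * g x \<partial>lborel) < e"
      if t: "0 < t" "t < d" for t
    proof -
      let ?m = "\<lambda>z :: real^'n. complex_of_real (mollifier t z)"
      note k = test_function_ccs[OF test_function_mollifier[OF t(1)]]
      note sh = pairing_shift[OF f g H fgH k]
      have mi: "integrable lborel (\<lambda>z. ?m z * ?I 0)"
        by (intro integrable_mult_left ccs_integrable k)
      have "(\<integral>z. ?m z * ?I 0 \<partial>lborel) = ?I 0"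
        using mollifier_integral[OF t(1), where 'n='n] by (simp add: ccs_integrable[OF k])
      then have "(\<integral>x. \<integral>y. f x * g y * ?m (x - y) \<partial>lborel \<partial>lborel) - ?I 0 = (\<integral>z. ?m z * ?I z - ?m z * ?I 0 \<partial>lborel)"
        unfolding sh(1) using sh(2) mi by (subst Bochner_Integration.integral_diff) auto
      also have "norm \<dots> \<le> (\<integral>z. mollifier t z * (e / 2) \<partial>(lborel :: (real^'n) measure))"
      proof (rule Bochner_Integration.integral_norm_bound_integral)
        show "integrable lborel (\<lambda>z. ?m z * ?I z - ?m z * ?I 0)" using sh(2) mi by simp
        show "integrable lborel (\<lambda>z :: real^'n. mollifier t z * (e / 2))"
          by (intro integrable_mult_left mollifier_integrable t)
        fix z :: "real^'n"
        show "norm (?m z * ?I z - ?m z * ?I 0) \<le> mollifier t z * (e / 2)"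
        proof (cases "norm z < t")
          case True
          then have "norm (?I z - ?I 0) \<le> e / 2" using d(2)[of z] t(2) by simp
          from mult_left_mono[OF this mollifier_nonneg[OF t(1), of z]] mollifier_nonneg[OF t(1), of z]
          show ?thesis by (simp add: right_diff_distrib[symmetric] norm_mult)
        qed (simp add: mollifier_eq_0 t(1))
      qed
      also have "\<dots> = e / 2" using mollifier_integral[OF t(1), where 'n='n] mollifier_integrable[OF t(1), where 'a='n] by simp
      finally show ?thesis using e by (simp add: dist_norm)
    qed
    then show "\<forall>\<^sub>F t in at_right 0. dist (\<integral>x. \<integral>y. f x * g y * of_real (mollifier t (x - y)) \<partial>lborel \<partial>lborel) (\<integral>x. f x * g x \<partial>lborel) < e"
      using d(1) by (auto simp: eventually_at_right_field intro!: exI[of _ d])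
  qed
qed

text \<open>The fundamental lemma of the calculus of variations: pair \<open>g\<close> with its own phase on a ball.\<close>

lemma AE_zero_of_test_functions:
  fixes g :: "real^'n::finite \<Rightarrow> complex"
  assumes g[measurable]: "g \<in> borel_measurable borel"
    and loc: "\<And>R. integrable lborel (\<lambda>x. indicator (cball 0 R) x *\<^sub>R g x)"
    and zero: "\<And>\<phi>. \<phi> \<in> test_functions \<Longrightarrow> (\<integral>x. g x * \<phi> x \<partial>lborel) = 0"
  shows "AE x in lborel. g x = 0"
proof -
  have ball: "AE x in lborel. x \<in> cball 0 R \<longrightarrow> g x = 0" for R
  proof -
    \<comment> \<open>The larger ball leaves room for mollifiers of radius at most \<open>1\<close> centred in the smaller one.\<close>
    define G where "G = (\<lambda>x. indicator (cball 0 (R + 1)) x *\<^sub>R g x)"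
    define f where "f = (\<lambda>x. indicator (cball 0 R) x *\<^sub>R cnj (sgn (g x)))"
    have [measurable]: "(\<lambda>x. sgn (g x)) \<in> borel_measurable borel"
      unfolding sgn_div_norm by measurable
    have f[measurable]: "f \<in> borel_measurable borel" and G[measurable]: "G \<in> borel_measurable borel"
      unfolding f_def G_def
      by (auto intro!: borel_measurable_scaleR borel_measurable_indicator borel_measurable_cnj)
    have Gi: "integrable lborel G" unfolding G_def by (rule loc)
    have f1: "norm (f x) \<le> 1" for x by (auto simp: f_def indicator_def norm_sgn)
    have fG: "norm (f x) * norm (G y) \<le> norm (G x) + norm (G y)" for x y
      using mult_right_mono[OF f1[of x] norm_ge_zero[of "G y"]] by (simp add: add_increasing)
    note lim = mollified_pairing[OF f G integrable_norm[OF Gi] fG]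
    have "(\<integral>x. \<integral>y. f x * G y * of_real (mollifier t (x - y)) \<partial>lborel \<partial>lborel) = 0" if t: "0 < t" "t < 1" for t
    proof -
      have "(\<integral>y. f x * G y * of_real (mollifier t (x - y)) \<partial>lborel) = 0" for x
      proof (cases "x \<in> cball 0 R")
        case True
        have eq: "G y * of_real (mollifier t (x - y)) = g y * of_real (mollifier t (x - y))" for y
        proof (cases "norm (x - y) < t")
          case True
          then have "norm y \<le> R + 1"
            using norm_triangle_ineq4[of x "x - y"] \<open>x \<in> cball 0 R\<close> t by simp
          then show ?thesis by (simp add: G_def)
        qed (simp add: mollifier_eq_0 t)
        have "(\<lambda>y. complex_of_real (mollifier t ((-1) *\<^sub>R y + x))) \<in> test_functions"
          by (rule test_function_affine[OF test_function_mollifier[OF t(1)]]) simp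
        from zero[OF this] show ?thesis by (simp add: mult.assoc eq)
      qed (simp add: f_def)
      then show ?thesis by simp
    qed
    then have "eventually (\<lambda>t. 0 = (\<integral>x. \<integral>y. f x * G y * of_real (mollifier t (x - y)) \<partial>lborel \<partial>lborel)) (at_right 0)"
      by (auto simp: eventually_at_right_field intro!: exI[of _ 1])
    then have "(\<integral>x. f x * G x \<partial>lborel) = 0"
      using tendsto_unique[OF trivial_limit_at_right_real lim Lim_transform_eventually[OF tendsto_const]] by blast
    moreover have "f x * G x = of_real (indicator (cball 0 R) x * norm (g x))" for x
      by (cases "g x = 0")
         (auto simp: f_def G_def indicator_def sgn_div_norm complex_norm_square[symmetric] power2_eq_square scaleR_conv_of_real
            field_simps)
    ultimately have "(\<integral>x. complex_of_real (indicator (cball 0 R) x * norm (g x)) \<partial>lborel) = 0"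
      by (simp only:)
    then have z: "(\<integral>x. indicator (cball 0 R) x * norm (g x) \<partial>lborel) = 0"
      by (simp only: integral_complex_of_real of_real_eq_0_iff)
    have "integrable lborel (\<lambda>x. indicator (cball 0 R) x * norm (g x))"
      using integrable_norm[OF loc[of R]] by simp
    then have "AE x in lborel. indicator (cball 0 R) x * norm (g x) = 0"
      using z integral_nonneg_eq_0_iff_AE[of lborel "\<lambda>x. indicator (cball 0 R) x * norm (g x)"] by auto
    then show ?thesis by (auto elim!: eventually_mono)
  qed
  have "AE x in lborel. \<forall>k::nat. x \<in> cball 0 (real k) \<longrightarrow> g x = 0"
    unfolding AE_all_countable using ball by blast
  then show ?thesis
    by (rule eventually_mono) (use real_arch_simple in auto)
qed

section \<open>Square integrable functions\<close>

text \<open>The squared norm of \<open>L\<^sup>2\<close> is a plain real number here, so that no quotient by null functions is formed.\<close>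

definition L2 :: "('a::euclidean_space \<Rightarrow> complex) \<Rightarrow> bool" where
  "L2 f \<longleftrightarrow> f \<in> borel_measurable borel \<and> integrable lborel (\<lambda>x. (norm (f x))\<^sup>2)"

definition nsq :: "('a::euclidean_space \<Rightarrow> complex) \<Rightarrow> real" where
  "nsq f = (\<integral>x. (norm (f x))\<^sup>2 \<partial>lborel)"

lemma L2_measurable [measurable_dest]: "L2 f \<Longrightarrow> f \<in> borel_measurable borel"
  by (simp add: L2_def)

lemma nsq_nonneg: "0 \<le> nsq f"
  by (simp add: nsq_def)

lemma mult_le_add_squares: "a * b \<le> a\<^sup>2 + b\<^sup>2" for a b :: real
proof -
  have "0 \<le> (a - b)\<^sup>2 + a\<^sup>2 + b\<^sup>2" by simp
  then show ?thesis by (simp add: power2_diff)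
qed

lemma L2_majorant:
  assumes "L2 f" "L2 g"
  shows "integrable lborel (\<lambda>x. (norm (f x))\<^sup>2 + (norm (g x))\<^sup>2)"
    and "norm (f x) * norm (g y) \<le> ((norm (f x))\<^sup>2 + (norm (g x))\<^sup>2) + ((norm (f y))\<^sup>2 + (norm (g y))\<^sup>2)"
  using assms mult_le_add_squares[of "norm (f x)" "norm (g y)"] zero_le_power2[of "norm (g x)"] zero_le_power2[of "norm (f y)"]
  by (simp add: L2_def, linarith)

lemma L2_mult_integrable:
  assumes f: "L2 f" and g: "L2 g"
  shows "integrable lborel (\<lambda>x. norm (f x) * norm (g x))" "integrable lborel (\<lambda>x. f x * g x)"
proof -
  have [measurable]: "f \<in> borel_measurable borel" "g \<in> borel_measurable borel"
    using f g by (simp_all add: L2_def)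
  show 1: "integrable lborel (\<lambda>x. norm (f x) * norm (g x))"
    by (rule Bochner_Integration.integrable_bound[OF L2_majorant(1)[OF f g]])
       (auto intro!: AE_I2 mult_le_add_squares)
  show "integrable lborel (\<lambda>x. f x * g x)"
    by (rule Bochner_Integration.integrable_bound[OF 1]) (auto simp: norm_mult)
qed

lemma L2_Cauchy_Schwarz:
  assumes f: "L2 f" and g: "L2 g"
  shows "(\<integral>x. norm (f x) * norm (g x) \<partial>lborel) \<le> sqrt (nsq f) * sqrt (nsq g)"
proof -
  have [measurable]: "f \<in> borel_measurable borel" "g \<in> borel_measurable borel"
    using f g by (simp_all add: L2_def)
  let ?I = "\<integral>x. norm (f x) * norm (g x) \<partial>lborel"
  have I: "(\<integral>\<^sup>+x. ennreal (norm (f x)) * ennreal (norm (g x)) \<partial>lborel) = ennreal ?I"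
    using nn_integral_eq_integral[OF L2_mult_integrable(1)[OF f g]] by (simp add: ennreal_mult')
  have sq: "(\<integral>\<^sup>+x. (ennreal (norm (h x)))\<^sup>2 \<partial>lborel) = ennreal (nsq h)" if "L2 h" for h :: "'a \<Rightarrow> complex"
    using that nn_integral_eq_integral[of lborel "\<lambda>x. (norm (h x))\<^sup>2"]
    by (simp add: L2_def nsq_def ennreal_power)
  have I0: "0 \<le> ?I" by simp
  have "(ennreal ?I)\<^sup>2 \<le> ennreal (nsq f) * ennreal (nsq g)"
    using Cauchy_Schwarz_nn_integral[of "\<lambda>x. ennreal (norm (f x))" lborel "\<lambda>x. ennreal (norm (g x))"]
    unfolding I sq[OF f] sq[OF g] by simp
  then have "?I\<^sup>2 \<le> nsq f * nsq g"
    by (simp only: ennreal_power[OF I0] ennreal_mult[OF nsq_nonneg nsq_nonneg, symmetric])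
       (simp add: nsq_nonneg)
  then show ?thesis
    using real_le_rsqrt by (simp add: real_sqrt_mult[symmetric])
qed

lemma L2_Cauchy_Schwarz_norm:
  assumes f: "L2 f" and g: "L2 g"
  shows "norm (\<integral>x. f x * g x \<partial>lborel) \<le> sqrt (nsq f) * sqrt (nsq g)"
proof -
  have "norm (\<integral>x. f x * g x \<partial>lborel) \<le> (\<integral>x. norm (f x * g x) \<partial>lborel)"
    by (rule integral_norm_bound)
  with L2_Cauchy_Schwarz[OF f g] show ?thesis by (simp add: norm_mult)
qed

lemma norm_add_square_le: "(norm (a + b))\<^sup>2 \<le> 2 * (norm a)\<^sup>2 + 2 * (norm b)\<^sup>2"
proof -
  have "(norm (a + b))\<^sup>2 \<le> (norm a + norm b)\<^sup>2" by (intro power_mono norm_triangle_ineq) simp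
  also have "\<dots> \<le> 2 * (norm a)\<^sup>2 + 2 * (norm b)\<^sup>2"
    using zero_le_power2[of "norm a - norm b"] by (simp add: power2_sum power2_diff)
  finally show ?thesis .
qed

lemma L2_add:
  assumes f: "L2 f" and g: "L2 g" shows "L2 (\<lambda>x. f x + g x)"
proof -
  have [measurable]: "f \<in> borel_measurable borel" "g \<in> borel_measurable borel"
    using f g by (simp_all add: L2_def)
  have "integrable lborel (\<lambda>x. 2 * (norm (f x))\<^sup>2 + 2 * (norm (g x))\<^sup>2)"
    using f g by (simp add: L2_def)
  then have "integrable lborel (\<lambda>x. (norm (f x + g x))\<^sup>2)"
    by (rule Bochner_Integration.integrable_bound) (auto intro!: AE_I2 norm_add_square_le)
  then show ?thesis by (simp add: L2_def)
qed

lemma L2_cmult: "L2 f \<Longrightarrow> L2 (\<lambda>x. c * f x)"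
  by (auto simp: L2_def norm_mult power_mult_distrib)

lemma nsq_cmult: "nsq (\<lambda>x. c * f x) = (norm c)\<^sup>2 * nsq f"
  by (simp add: nsq_def norm_mult power_mult_distrib)

lemma L2_cnj: "L2 f \<Longrightarrow> L2 (\<lambda>x. cnj (f x))"
  by (auto simp: L2_def)

lemma nsq_cnj: "nsq (\<lambda>x. cnj (f x)) = nsq f"
  by (simp add: nsq_def)

lemma L2_affine:
  assumes "c \<noteq> 0" "L2 f" shows "L2 (\<lambda>x. f (t + c *\<^sub>R x))"
  using assms lborel_integrable_affine_iff[OF assms(1), of "\<lambda>x. (norm (f x))\<^sup>2" t] by (auto simp: L2_def)

lemma L2_shift: "L2 f \<Longrightarrow> L2 (\<lambda>x. f (x + t))"
  using L2_affine[of 1 f t] by (simp add: add.commute)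

lemma nsq_shift: "nsq (\<lambda>x. f (x + t)) = nsq f"
  unfolding nsq_def by (rule lborel_integral_shift[of "\<lambda>x. (norm (f x))\<^sup>2"])

lemma L2_ccs: "ccs k \<Longrightarrow> L2 k"
  by (simp add: L2_def ccs_norm_square_integrable ccs_measurable)

lemma L2_sum: "(\<And>i. i \<in> A \<Longrightarrow> L2 (f i)) \<Longrightarrow> L2 (\<lambda>x. \<Sum>i\<in>A. f i x)"
proof (induction A rule: infinite_finite_induct)
  case (insert x F) then show ?case by (auto intro: L2_add)
qed (simp_all add: L2_def)

lemma L2_pairing_norm_le:
  fixes f g k :: "'a::euclidean_space \<Rightarrow> complex"
  assumes f: "L2 f" and g: "L2 g" and k: "ccs k"
  shows "norm (\<integral>x. \<integral>y. f x * g y * k (x - y) \<partial>lborel \<partial>lborel) \<le> sqrt (nsq f) * sqrt (nsq g) * (\<integral>z. norm (k z) \<partial>lborel)"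
proof -
  note fg = L2_measurable[OF f] L2_measurable[OF g] L2_majorant[OF f g]
  note sh = pairing_shift[OF fg k]
  have "norm (\<integral>x. \<integral>y. f x * g y * k (x - y) \<partial>lborel \<partial>lborel) \<le>
      (\<integral>z. sqrt (nsq f) * sqrt (nsq g) * norm (k z) \<partial>lborel)"
    unfolding sh(1)
  proof (rule Bochner_Integration.integral_norm_bound_integral[OF sh(2)])
    show "integrable lborel (\<lambda>z. sqrt (nsq f) * sqrt (nsq g) * norm (k z))"
      by (intro integrable_mult_right integrable_norm ccs_integrable k)
    fix z
    have "norm (\<integral>y. f (y + z) * g y \<partial>lborel) \<le> sqrt (nsq f) * sqrt (nsq g)"
      using L2_Cauchy_Schwarz_norm[OF L2_shift[OF f, of z] g] by (simp add: nsq_shift)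
    then show "norm (k z * (\<integral>y. f (y + z) * g y \<partial>lborel)) \<le> sqrt (nsq f) * sqrt (nsq g) * norm (k z)"
      using mult_right_mono[OF _ norm_ge_zero[of "k z"]] by (simp only: norm_mult mult.commute[of "norm (k z)"])
  qed
  then show ?thesis by simp
qed

section \<open>Weak derivatives of square integrable functions\<close>

text \<open>Both \<open>partial_deriv i\<close> (with sign \<open>s = - 1\<close>) and \<open>laplacian\<close> (with \<open>s = 1\<close>) commute with translations, and
  reflecting the argument produces the sign with which they are moved across an integral.  This is all
  that integration by parts needs, so the two cases share one proof.\<close>

definition translation_op :: "real \<Rightarrow> ((real^'n::finite \<Rightarrow> complex) \<Rightarrow> real^'n \<Rightarrow> complex) \<Rightarrow> bool" where
  "translation_op s T \<longleftrightarrow> s * s = 1 \<and> (\<forall>\<phi>\<in>test_functions. T \<phi> \<in> test_functions \<and>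
     (\<forall>x. T (\<lambda>y. \<phi> (x - y)) = (\<lambda>y. of_real s * T \<phi> (x - y)) \<and> T (\<lambda>y. \<phi> (y - x)) = (\<lambda>y. T \<phi> (y - x))) \<and>
     T (\<lambda>y. cnj (\<phi> y)) = (\<lambda>y. cnj (T \<phi> y)))"

text \<open>For \<open>s = - 1\<close> and a partial derivative, \<open>d\<close> is the weak derivative of \<open>u\<close>; for \<open>s = 1\<close> and the Laplacian, \<open>d\<close> is
  the weak Laplacian.\<close>

definition weak_pair :: "real \<Rightarrow> ((real^'n::finite \<Rightarrow> complex) \<Rightarrow> real^'n \<Rightarrow> complex) \<Rightarrow>
    (real^'n \<Rightarrow> complex) \<Rightarrow> (real^'n \<Rightarrow> complex) \<Rightarrow> bool" where
  "weak_pair s T u d \<longleftrightarrow> L2 u \<and> L2 d \<and>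
     (\<forall>\<phi>\<in>test_functions. (\<integral>x. u x * T \<phi> x \<partial>lborel) = of_real s * (\<integral>x. d x * \<phi> x \<partial>lborel))"

lemma translation_op_partial_deriv: "translation_op (-1) (partial_deriv i)"
proof -
  have "partial_deriv i (\<lambda>y. \<phi> (x - y)) = (\<lambda>y. - partial_deriv i \<phi> (x - y))"
    "partial_deriv i (\<lambda>y. \<phi> (y - x)) = (\<lambda>y. partial_deriv i \<phi> (y - x))"
    "partial_deriv i (\<lambda>y. cnj (\<phi> y)) = (\<lambda>y. cnj (partial_deriv i \<phi> y))"
    if "\<phi> \<in> test_functions" for \<phi> :: "real^'a \<Rightarrow> complex" and x
    using smooth_differentiable[OF test_function_smooth[OF that]]
      partial_deriv_affine[of \<phi> "-1" _ x i] partial_deriv_affine[of \<phi> 1 _ "-x" i]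
      partial_deriv_linear[OF bounded_linear_cnj, of \<phi> _ i]
    by (auto simp: fun_eq_iff)
  then show ?thesis
    by (simp add: translation_op_def test_function_partial_deriv)
qed

lemma translation_op_laplacian: "translation_op 1 laplacian"
proof -
  have "laplacian (\<lambda>y. \<phi> (x - y)) = (\<lambda>y. laplacian \<phi> (x - y))"
    "laplacian (\<lambda>y. \<phi> (y - x)) = (\<lambda>y. laplacian \<phi> (y - x))"
    "laplacian (\<lambda>y. cnj (\<phi> y)) = (\<lambda>y. cnj (laplacian \<phi> y))"
    if "\<phi> \<in> test_functions" for \<phi> :: "real^'a \<Rightarrow> complex" and x
    using laplacian_affine[OF test_function_smooth[OF that], of "-1" x]
      laplacian_affine[OF test_function_smooth[OF that], of 1 "-x"]
      laplacian_linear[OF bounded_linear_cnj test_function_smooth[OF that]]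
    by (auto simp: fun_eq_iff)
  then show ?thesis
    by (simp add: translation_op_def test_function_laplacian)
qed

lemma test_function_reflect: "\<phi> \<in> test_functions \<Longrightarrow> (\<lambda>y. \<phi> (x - y)) \<in> test_functions"
  using test_function_affine[of \<phi> "-1" x] by simp

lemma test_function_shift: "\<phi> \<in> test_functions \<Longrightarrow> (\<lambda>y. \<phi> (y - x)) \<in> test_functions"
  using test_function_affine[of \<phi> 1 "-x"] by simp

lemma weak_pair_L2: "weak_pair s T u d \<Longrightarrow> L2 u" "weak_pair s T u d \<Longrightarrow> L2 d"
  by (simp_all add: weak_pair_def)

lemma weak_pair_cnj:
  assumes T: "translation_op s T" and w: "weak_pair s T u d"
  shows "weak_pair s T (\<lambda>x. cnj (u x)) (\<lambda>x. cnj (d x))"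
proof -
  have "(\<integral>x. cnj (u x) * T \<phi> x \<partial>lborel) = of_real s * (\<integral>x. cnj (d x) * \<phi> x \<partial>lborel)" if \<phi>: "\<phi> \<in> test_functions" for \<phi>
  proof -
    have c: "(\<lambda>x. cnj (\<phi> x)) \<in> test_functions" by (rule test_function_linear[OF bounded_linear_cnj \<phi>])
    have "T (\<lambda>x. cnj (\<phi> x)) = (\<lambda>x. cnj (T \<phi> x))" using T \<phi> by (simp add: translation_op_def)
    then have "(\<integral>x. cnj (cnj (u x) * T \<phi> x) \<partial>lborel) = of_real s * (\<integral>x. cnj (cnj (d x) * \<phi> x) \<partial>lborel)"
      using w c unfolding weak_pair_def by (auto dest!: bspec[of _ _ "\<lambda>x. cnj (\<phi> x)"])
    then have "cnj (\<integral>x. cnj (u x) * T \<phi> x \<partial>lborel) = of_real s * cnj (\<integral>x. cnj (d x) * \<phi> x \<partial>lborel)"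
      by (simp only: Bochner_Integration.integral_cnj)
    then have "cnj (cnj (\<integral>x. cnj (u x) * T \<phi> x \<partial>lborel)) = cnj (of_real s * cnj (\<integral>x. cnj (d x) * \<phi> x \<partial>lborel))"
      by (rule arg_cong)
    then show ?thesis by simp
  qed
  with w show ?thesis by (simp add: weak_pair_def L2_cnj)
qed

lemma weak_pair_add:
  assumes T: "translation_op s T" and "weak_pair s T u d" "weak_pair s T v e"
  shows "weak_pair s T (\<lambda>x. u x + v x) (\<lambda>x. d x + e x)"
proof -
  have "(\<integral>x. (u x + v x) * T \<phi> x \<partial>lborel) = of_real s * (\<integral>x. (d x + e x) * \<phi> x \<partial>lborel)" if \<phi>: "\<phi> \<in> test_functions" for \<phi>
  proof -
    have T\<phi>: "L2 (T \<phi>)" "L2 \<phi>"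
      using T \<phi> by (auto simp: translation_op_def intro: L2_ccs test_function_ccs)
    have "integrable lborel (\<lambda>x. u x * T \<phi> x)" "integrable lborel (\<lambda>x. v x * T \<phi> x)"
      "integrable lborel (\<lambda>x. d x * \<phi> x)" "integrable lborel (\<lambda>x. e x * \<phi> x)"
      using assms T\<phi> by (auto simp: weak_pair_def intro: L2_mult_integrable)
    then show ?thesis using assms \<phi> by (simp add: weak_pair_def distrib_right distrib_left)
  qed
  with assms show ?thesis by (simp add: weak_pair_def L2_add)
qed

lemma weak_pair_cmult:
  assumes "weak_pair s T u d"
  shows "weak_pair s T (\<lambda>x. c * u x) (\<lambda>x. c * d x)"
  using assms by (simp add: weak_pair_def L2_cmult mult.assoc)

text \<open>A derivative on one factor of a mollified pairing may be traded for a derivative of the kernel.\<close>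

lemma weak_pair_move:
  assumes T: "translation_op s T" and w: "weak_pair s T u d" and g: "L2 g" and \<kappa>: "\<kappa> \<in> test_functions"
  shows weak_pair_move_fst: "(\<integral>x. \<integral>y. d x * g y * \<kappa> (x - y) \<partial>lborel \<partial>lborel)
      = of_real s * (\<integral>x. \<integral>y. u x * g y * T \<kappa> (x - y) \<partial>lborel \<partial>lborel)"
    and weak_pair_move_snd: "(\<integral>x. \<integral>y. g x * d y * \<kappa> (x - y) \<partial>lborel \<partial>lborel)
      = (\<integral>x. \<integral>y. g x * u y * T \<kappa> (x - y) \<partial>lborel \<partial>lborel)"
proof -
  have s: "complex_of_real s * of_real s = 1"
    using T unfolding translation_op_def of_real_mult[symmetric] by simp
  have u: "L2 u" and d: "L2 d" using w by (auto simp: weak_pair_def)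
  have T\<kappa>: "T \<kappa> \<in> test_functions" using T \<kappa> by (simp add: translation_op_def)
  have w': "\<forall>\<phi>\<in>test_functions. (\<integral>x. u x * T \<phi> x \<partial>lborel) = of_real s * (\<integral>x. d x * \<phi> x \<partial>lborel)"
    using w by (simp add: weak_pair_def)
  have T_reflect: "T (\<lambda>y. \<kappa> (x - y)) = (\<lambda>y. of_real s * T \<kappa> (x - y))"
    and T_shift: "T (\<lambda>y. \<kappa> (y - x)) = (\<lambda>y. T \<kappa> (y - x))" for x
    using T \<kappa> by (simp_all add: translation_op_def)
  have pull: "(\<integral>x. f x * g y * k (x - y) \<partial>lborel) = g y * (\<integral>x. f x * k (x - y) \<partial>lborel)" for f k y
    by (subst integral_mult_right_zero[symmetric]) (simp add: mult_ac)
  have snd: "(\<integral>y. d y * \<kappa> (x - y) \<partial>lborel) = (\<integral>y. u y * T \<kappa> (x - y) \<partial>lborel)" for x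
  proof -
    have "(\<integral>y. u y * (of_real s * T \<kappa> (x - y)) \<partial>lborel) = of_real s * (\<integral>y. d y * \<kappa> (x - y) \<partial>lborel)"
      using bspec[OF w' test_function_reflect[OF \<kappa>, of x]] by (simp only: T_reflect)
    then have "of_real s * (\<integral>y. u y * T \<kappa> (x - y) \<partial>lborel) = of_real s * (\<integral>y. d y * \<kappa> (x - y) \<partial>lborel)"
      by (simp add: mult.left_commute)
    then have "of_real s * of_real s * (\<integral>y. u y * T \<kappa> (x - y) \<partial>lborel) = of_real s * of_real s * (\<integral>y. d y * \<kappa> (x - y) \<partial>lborel)"
      by (simp add: mult.assoc)
    then show ?thesis by (simp add: s)
  qed
  have fst: "(\<integral>x. d x * \<kappa> (x - y) \<partial>lborel) = of_real s * (\<integral>x. u x * T \<kappa> (x - y) \<partial>lborel)" for y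
  proof -
    have "(\<integral>x. u x * T \<kappa> (x - y) \<partial>lborel) = of_real s * (\<integral>x. d x * \<kappa> (x - y) \<partial>lborel)"
      using bspec[OF w' test_function_shift[OF \<kappa>, of y]] by (simp only: T_shift)
    then show ?thesis using s by (simp add: mult.assoc[symmetric])
  qed
  have "(\<integral>x. g x * (\<integral>y. d y * \<kappa> (x - y) \<partial>lborel) \<partial>lborel) = (\<integral>x. g x * (\<integral>y. u y * T \<kappa> (x - y) \<partial>lborel) \<partial>lborel)"
    by (simp only: snd)
  then show "(\<integral>x. \<integral>y. g x * d y * \<kappa> (x - y) \<partial>lborel \<partial>lborel) = (\<integral>x. \<integral>y. g x * u y * T \<kappa> (x - y) \<partial>lborel \<partial>lborel)"
    by (simp add: mult.assoc)
  have "(\<integral>x. \<integral>y. d x * g y * \<kappa> (x - y) \<partial>lborel \<partial>lborel) = (\<integral>y. \<integral>x. d x * g y * \<kappa> (x - y) \<partial>lborel \<partial>lborel)"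
    by (rule pairing_swap[OF L2_measurable[OF d] L2_measurable[OF g] L2_majorant[OF d g] test_function_ccs[OF \<kappa>], symmetric])
  also have "\<dots> = (\<integral>y. g y * (\<integral>x. d x * \<kappa> (x - y) \<partial>lborel) \<partial>lborel)"
    by (simp only: pull)
  also have "\<dots> = of_real s * (\<integral>y. g y * (\<integral>x. u x * T \<kappa> (x - y) \<partial>lborel) \<partial>lborel)"
    by (simp add: fst mult.left_commute)
  also have "(\<integral>y. g y * (\<integral>x. u x * T \<kappa> (x - y) \<partial>lborel) \<partial>lborel) = (\<integral>y. \<integral>x. u x * g y * T \<kappa> (x - y) \<partial>lborel \<partial>lborel)"
    by (simp only: pull)
  also have "\<dots> = (\<integral>x. \<integral>y. u x * g y * T \<kappa> (x - y) \<partial>lborel \<partial>lborel)"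
    by (rule pairing_swap[OF L2_measurable[OF u] L2_measurable[OF g] L2_majorant[OF u g] test_function_ccs[OF T\<kappa>]])
  finally show "(\<integral>x. \<integral>y. d x * g y * \<kappa> (x - y) \<partial>lborel \<partial>lborel)
      = of_real s * (\<integral>x. \<integral>y. u x * g y * T \<kappa> (x - y) \<partial>lborel \<partial>lborel)" .
qed

text \<open>Neither factor is a test function.  In the mollified pairing the operator can be taken off \<open>u\<close>, passed
  through the kernel, and put on \<open>v\<close>.\<close>

lemma weak_pair_integration_by_parts:
  assumes T: "translation_op s T" and u: "weak_pair s T u d" and v: "weak_pair s T v e"
  shows "(\<integral>x. d x * v x \<partial>lborel) = of_real s * (\<integral>x. u x * e x \<partial>lborel)"
proof -
  note L = weak_pair_L2[OF u] weak_pair_L2[OF v]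
  let ?m = "\<lambda>t x. complex_of_real (mollifier t x)"
  have eq: "(\<integral>x. \<integral>y. d x * v y * ?m t (x - y) \<partial>lborel \<partial>lborel) = of_real s * (\<integral>x. \<integral>y. u x * e y * ?m t (x - y) \<partial>lborel \<partial>lborel)"
    if "0 < t" for t
    using weak_pair_move_fst[OF T u L(3) test_function_mollifier[OF that]]
      weak_pair_move_snd[OF T v L(1) test_function_mollifier[OF that]] by simp
  have "((\<lambda>t. \<integral>x. \<integral>y. d x * v y * ?m t (x - y) \<partial>lborel \<partial>lborel) \<longlongrightarrow> of_real s * (\<integral>x. u x * e x \<partial>lborel)) (at_right 0)"
  proof (rule Lim_transform_eventually)
    show "((\<lambda>t. of_real s * (\<integral>x. \<integral>y. u x * e y * ?m t (x - y) \<partial>lborel \<partial>lborel)) \<longlongrightarrow> of_real s * (\<integral>x. u x * e x \<partial>lborel)) (at_right 0)"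
      by (intro tendsto_mult_left mollified_pairing[OF L2_measurable[OF L(1)] L2_measurable[OF L(4)] L2_majorant[OF L(1,4)]])
    show "\<forall>\<^sub>F t in at_right 0. of_real s * (\<integral>x. \<integral>y. u x * e y * ?m t (x - y) \<partial>lborel \<partial>lborel)
        = (\<integral>x. \<integral>y. d x * v y * ?m t (x - y) \<partial>lborel \<partial>lborel)"
      using eventually_at_right_less[of 0] by eventually_elim (simp only: eq)
  qed
  then show ?thesis
    by (rule tendsto_unique[OF trivial_limit_at_right_real
          mollified_pairing[OF L2_measurable[OF L(2)] L2_measurable[OF L(3)] L2_majorant[OF L(2,3)]]])
qed

abbreviation lap_pair :: "(real^'n::finite \<Rightarrow> complex) \<Rightarrow> (real^'n \<Rightarrow> complex) \<Rightarrow> bool" where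
  "lap_pair \<equiv> weak_pair 1 laplacian"

lemma of_real_square_inverse:
  assumes "c \<noteq> 0" shows "complex_of_real (c\<^sup>2) * (of_real ((inverse c)\<^sup>2) * z) = z"
  using right_inverse[OF assms] by (simp only: mult.assoc[symmetric] of_real_mult[symmetric]
      power_mult_distrib[symmetric] power_one of_real_1 mult_1_left)

lemma lap_pair_affine:
  fixes u L :: "real^'n::finite \<Rightarrow> complex"
  assumes w: "lap_pair u L" and c: "c \<noteq> 0"
  shows "lap_pair (\<lambda>x. u (b + c *\<^sub>R x)) (\<lambda>x. of_real (c\<^sup>2) * L (b + c *\<^sub>R x))"
proof -
  have "(\<integral>x. u (b + c *\<^sub>R x) * laplacian \<phi> x \<partial>lborel) = (\<integral>x. of_real (c\<^sup>2) * L (b + c *\<^sub>R x) * \<phi> x \<partial>lborel)"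
    if \<phi>: "\<phi> \<in> test_functions" for \<phi>
  proof -
    let ?\<psi> = "\<lambda>y. \<phi> (inverse c *\<^sub>R y + (- b /\<^sub>R c))"
    have inv: "inverse c *\<^sub>R (b + c *\<^sub>R x) + (- b /\<^sub>R c) = x" for x
      using c by (simp add: scaleR_right_distrib)
    have \<psi>: "?\<psi> \<in> test_functions" using \<phi> c by (intro test_function_affine) auto
    have lap: "laplacian ?\<psi> (b + c *\<^sub>R x) = of_real ((inverse c)\<^sup>2) * laplacian \<phi> x" for x
      using laplacian_affine[OF test_function_smooth[OF \<phi>], of "inverse c" "- b /\<^sub>R c" "b + c *\<^sub>R x"] by (simp only: inv)
    have "(\<integral>x. u x * laplacian ?\<psi> x \<partial>lborel) = (\<integral>x. L x * ?\<psi> x \<partial>lborel)"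
      using w \<psi> by (simp add: weak_pair_def)
    then have "(\<integral>x. u (b + c *\<^sub>R x) * laplacian ?\<psi> (b + c *\<^sub>R x) \<partial>lborel) = (\<integral>x. L (b + c *\<^sub>R x) * ?\<psi> (b + c *\<^sub>R x) \<partial>lborel)"
      using lborel_integral_affine[OF c, of "\<lambda>x. u x * laplacian ?\<psi> x" b] lborel_integral_affine[OF c, of "\<lambda>x. L x * ?\<psi> x" b]
      by (simp only:)
    then have "of_real ((inverse c)\<^sup>2) * (\<integral>x. u (b + c *\<^sub>R x) * laplacian \<phi> x \<partial>lborel) = (\<integral>x. L (b + c *\<^sub>R x) * \<phi> x \<partial>lborel)"
      unfolding lap inv by (simp only: mult.left_commute[of "u _"] integral_mult_right_zero)
    then have "of_real (c\<^sup>2) * (of_real ((inverse c)\<^sup>2) * (\<integral>x. u (b + c *\<^sub>R x) * laplacian \<phi> x \<partial>lborel)) = of_real (c\<^sup>2) * (\<integral>x. L (b + c *\<^sub>R x) * \<phi> x \<partial>lborel)"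
      by simp
    moreover note of_real_square_inverse[OF c]
    ultimately show ?thesis by (simp only: mult.assoc integral_mult_right_zero)
  qed
  with w c show ?thesis by (simp add: weak_pair_def L2_affine L2_cmult)
qed

lemma nsq_affine:
  fixes f :: "real^'n::finite \<Rightarrow> complex"
  assumes "c \<noteq> 0" shows "nsq (\<lambda>x. f (b + c *\<^sub>R x)) = nsq f / \<bar>c\<bar> ^ CARD('n)"
  unfolding nsq_def using lborel_integral_affine[OF assms, of "\<lambda>x. (norm (f x))\<^sup>2" b]
  by (simp add: divide_inverse mult.commute)

section \<open>The mollification error is of second order\<close>

text \<open>The norm in \<open>L\<^sup>1\<close> of the primitive whose Laplacian drives the scale of the normalized mollifier.\<close>

definition mollifier_const :: "'n::finite itself \<Rightarrow> real" where
  "mollifier_const _ = (\<integral>x. \<bar>bump_primitive (x :: real^'n)\<bar> \<partial>lborel) / (\<integral>x. bump (x :: real^'n) \<partial>lborel)"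

lemma mollifier_const_nonneg: "0 \<le> mollifier_const TYPE('n::finite)"
  unfolding mollifier_const_def using bump_integral_pos[where 'n='n]
  by (intro divide_nonneg_nonneg) auto

text \<open>The factor \<open>t\<^sup>-\<^sup>N\<close> contributes \<open>N bump\<close> and the argument contributes the radial derivative, the two terms of
  the Laplacian of \<open>bump_primitive\<close>.\<close>

lemma mollifier_scale_deriv:
  fixes z :: "real^'n::finite"
  assumes t: "0 < t"
  shows "((\<lambda>t. mollifier t z) has_real_derivative
     - (inverse t ^ (CARD('n) + 1) / (\<integral>x. bump (x :: real^'n) \<partial>lborel)) *
       Re (laplacian (\<lambda>x. complex_of_real (bump_primitive x)) (z /\<^sub>R t))) (at t)"
proof -
  obtain d where d: "((bump :: real^'n \<Rightarrow> real) has_derivative d) (at (z /\<^sub>R t))"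
    using bump_differentiable by blast
  have "((\<lambda>t. z /\<^sub>R t) has_derivative (\<lambda>h. (- h * inverse t ^ 2) *\<^sub>R z)) (at t)"
    using t by (auto intro!: derivative_eq_intros simp: power2_eq_square)
  from has_derivative_compose[OF this d] have
    "((\<lambda>t. bump (z /\<^sub>R t)) has_derivative (\<lambda>h. d ((- h * inverse t ^ 2) *\<^sub>R z))) (at t)" .
  moreover have "(\<lambda>h. d ((- h * inverse t ^ 2) *\<^sub>R z)) = (*) (- inverse t * d (z /\<^sub>R t))"
    using has_derivative_linear[OF d] by (simp add: fun_eq_iff linear_cmul linear_neg power2_eq_square)
  ultimately have b: "((\<lambda>t. bump (z /\<^sub>R t)) has_real_derivative - inverse t * d (z /\<^sub>R t)) (at t)"
    unfolding has_field_derivative_def by (simp only:)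
  have p: "((\<lambda>t. inverse t ^ CARD('n)) has_real_derivative - real CARD('n) * inverse t ^ (CARD('n) + 1)) (at t)"
  proof -
    have "0 < CARD('n)" by simp
    then obtain m where m: "CARD('n) = Suc m" using gr0_implies_Suc by blast
    have "((\<lambda>t. inverse t ^ Suc m) has_real_derivative (1 + of_nat m) * (- (inverse t ^ Suc (Suc 0)) * inverse t ^ m)) (at t)"
      using t by (intro DERIV_power_Suc DERIV_inverse) simp
    then show ?thesis unfolding m by (rule DERIV_cong) (simp add: algebra_simps)
  qed
  have "((\<lambda>t. inverse t ^ CARD('n) * bump (z /\<^sub>R t) / (\<integral>x. bump (x :: real^'n) \<partial>lborel)) has_real_derivative
     (- real CARD('n) * inverse t ^ (CARD('n) + 1) * bump (z /\<^sub>R t) + - inverse t * d (z /\<^sub>R t) * inverse t ^ CARD('n))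
       / (\<integral>x. bump (x :: real^'n) \<partial>lborel)) (at t)"
    by (intro DERIV_cdivide DERIV_mult p b)
  moreover have "inverse t ^ CARD('n) * bump (z /\<^sub>R t) / (\<integral>x. bump (x :: real^'n) \<partial>lborel) = mollifier t z" for t
    by (simp add: mollifier_def field_simps)
  ultimately show ?thesis
    unfolding laplacian_bump_primitive[OF d] by (simp add: algebra_simps add_divide_distrib diff_divide_distrib)
qed

text \<open>The scale derivative of the mollifier is a Laplacian, so along the scale the mollified pairing
  of \<open>v\<close> with \<open>g\<close> moves only by a pairing of \<open>L\<close> with \<open>g\<close>.\<close>

lemma mollification_error:
  fixes v L g :: "real^'n::finite \<Rightarrow> complex"
  assumes v: "lap_pair v L" and g: "L2 g" and r: "0 < r"
  shows "norm ((\<integral>x. v x * g x \<partial>lborel) - (\<integral>x. \<integral>y. v x * g y * of_real (mollifier r (x - y)) \<partial>lborel \<partial>lborel))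
    \<le> mollifier_const TYPE('n) * r\<^sup>2 * (sqrt (nsq L) * sqrt (nsq g))"
proof -
  note vL = weak_pair_L2[OF v]
  let ?c = "\<integral>x. bump (x :: real^'n) \<partial>lborel"
  let ?\<Phi> = "\<lambda>x :: real^'n. complex_of_real (bump_primitive x)"
  let ?B = "\<lambda>k. \<integral>x. \<integral>y. v x * g y * k (x - y) \<partial>lborel \<partial>lborel"
  let ?m = "\<lambda>t z :: real^'n. complex_of_real (mollifier t z)"
  define S where "S = sqrt (nsq v) * sqrt (nsq g)"
  define I where "I z = (\<integral>y. v (y + z) * g y \<partial>lborel)" for z
  define A where "A = mollifier_const TYPE('n) * (sqrt (nsq L) * sqrt (nsq g))"
  have A0: "0 \<le> A" unfolding A_def
    by (intro mult_nonneg_nonneg mollifier_const_nonneg real_sqrt_ge_zero nsq_nonneg)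
  have c: "0 < ?c" by (rule bump_integral_pos)
  have IS: "norm (I z) \<le> S" for z
    unfolding I_def S_def using L2_Cauchy_Schwarz_norm[OF L2_shift[OF vL(1), of z] g] by (simp add: nsq_shift)
  note sh = pairing_shift[OF L2_measurable[OF vL(1)] L2_measurable[OF g] L2_majorant[OF vL(1) g], folded I_def]
  have \<Phi>: "?\<Phi> \<in> test_functions" by (rule test_function_bump_primitive)
  obtain M where M: "0 < M" "\<And>x. norm (laplacian ?\<Phi> x) \<le> M"
    using ccs_bounded[OF test_function_ccs[OF test_function_laplacian[OF \<Phi>]]] by metis
  have pullB: "?B (\<lambda>z. c * k z) = c * ?B k" for c :: complex and k
    by (simp only: mult.left_commute[of "v _ * g _" c] integral_mult_right_zero)
  define D where "D t = - (inverse t ^ (CARD('n) + 1) / ?c)" for t :: real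
  \<comment> \<open>Moving the Laplacian from the rescaled primitive to \<open>v\<close> costs a factor \<open>t\<^sup>2\<close>, and the norm of this primitive in
    \<open>L\<^sup>1\<close> has order \<open>t\<^sup>N\<close>; since \<open>D t\<close> has order \<open>t\<^sup>-\<^sup>N\<^sup>-\<^sup>1\<close>, a factor \<open>t\<close> is left.\<close>
  have deriv: "((\<lambda>t. ?B (?m t)) has_vector_derivative of_real (D t0) * ?B (\<lambda>z. laplacian ?\<Phi> (inverse t0 *\<^sub>R z + 0))) (at t0)"
    and bound: "norm (of_real (D t0) * ?B (\<lambda>z. laplacian ?\<Phi> (inverse t0 *\<^sub>R z + 0))) \<le> t0 * A"
    if t0: "0 < t0" for t0
  proof -
    let ?l = "\<lambda>z. laplacian ?\<Phi> (inverse t0 *\<^sub>R z + 0)"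
    let ?p = "\<lambda>z. ?\<Phi> (inverse t0 *\<^sub>R z + 0)"
    have p: "?p \<in> test_functions" using t0 \<Phi> by (intro test_function_affine) auto
    have l: "ccs ?l"
      using t0 \<Phi> by (intro test_function_ccs test_function_affine test_function_laplacian) auto
    have Mr: "\<bar>Re (laplacian ?\<Phi> x)\<bar> \<le> M" for x using abs_Re_le_cmod[of "laplacian ?\<Phi> x"] M(2)[of x] by linarith
    define K where "K = inverse (t0 / 2) ^ (CARD('n) + 1) / ?c * M"
    have int: "integrable lborel (\<lambda>z. ?m t z * I z)" if "0 < t" for t
      by (rule sh(2)[OF test_function_ccs[OF test_function_mollifier[OF that]]])
    have real_lap: "laplacian ?\<Phi> x = of_real (Re (laplacian ?\<Phi> x))" for x
    proof -
      obtain d where "((bump :: real^'n \<Rightarrow> real) has_derivative d) (at x)" using bump_differentiable by blast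
      from laplacian_bump_primitive[OF this] show ?thesis by simp
    qed
    have "((\<lambda>t. \<integral>z. ?m t z * I z \<partial>lborel) has_vector_derivative (\<integral>z. of_real (D t0) * (?l z * I z) \<partial>lborel)) (at t0)"
    proof (rule has_vector_derivative_integral[where d = "t0 / 2" and w = "\<lambda>z. K * S * indicator (cball 0 (2 * t0)) z"])
      show "0 < t0 / 2" using t0 by simp
      show "integrable lborel (\<lambda>z. ?m t z * I z)" if "\<bar>t - t0\<bar> < t0 / 2" for t
        using that t0 by (intro int) linarith
      show "(\<lambda>z. of_real (D t0) * (?l z * I z)) \<in> borel_measurable lborel"
        by (intro borel_measurable_integrable integrable_mult_right sh(2) l)
      show "((\<lambda>t. ?m t z * I z) has_vector_derivative of_real (D t0) * (?l z * I z)) (at t0)" for z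
      proof -
        have "((\<lambda>t. ?m t z) has_vector_derivative of_real (D t0 * Re (?l z))) (at t0)"
          using mollifier_scale_deriv[OF t0, of z] unfolding D_def
          by (intro has_vector_derivative_of_real) simp
        from has_vector_derivative_mult_left[OF this, of "I z"] show ?thesis
          using real_lap[of "inverse t0 *\<^sub>R z + 0"] by (simp add: mult.assoc)
      qed
      show "integrable lborel (\<lambda>z :: real^'n. K * S * indicator (cball 0 (2 * t0)) z)"
        by (intro integrable_mult_right integrable_indicator_cball)
      fix t and z :: "real^'n" assume t: "\<bar>t - t0\<bar> < t0 / 2"
      have tt: "t0 / 2 \<le> t" "t \<le> 2 * t0" "0 < t" using t t0 by linarith+
      show "norm (?m t z * I z - ?m t0 z * I z) \<le> \<bar>t - t0\<bar> * (K * S * indicator (cball 0 (2 * t0)) z)"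
      proof (cases "z \<in> cball 0 (2 * t0)")
        case True
        have "norm (mollifier t z - mollifier t0 z) \<le> K * \<bar>t - t0\<bar>"
        proof (rule norm_diff_le_of_vector_derivative[of "t0 / 2" "2 * t0"])
          fix s assume s: "s \<in> {t0 / 2..2 * t0}"
          then have s0: "0 < s" using t0 by auto
          show "((\<lambda>t. mollifier t z) has_vector_derivative D s * Re (laplacian ?\<Phi> (z /\<^sub>R s))) (at s)"
            unfolding D_def using mollifier_scale_deriv[OF s0, of z]
            by (simp add: has_real_derivative_iff_has_vector_derivative)
          have "inverse s \<le> inverse (t0 / 2)" using s t0 by (intro le_imp_inverse_le) auto
          then have "inverse s ^ (CARD('n) + 1) \<le> inverse (t0 / 2) ^ (CARD('n) + 1)"
            using s0 by (intro power_mono) auto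
          then have "inverse s ^ (CARD('n) + 1) / ?c \<le> inverse (t0 / 2) ^ (CARD('n) + 1) / ?c"
            using c by (intro divide_right_mono) auto
          moreover have "\<bar>D s\<bar> = inverse s ^ (CARD('n) + 1) / ?c"
            unfolding D_def using c s0 by simp
          ultimately have "\<bar>D s\<bar> \<le> inverse (t0 / 2) ^ (CARD('n) + 1) / ?c" by (simp only:)
          then have "\<bar>D s\<bar> * \<bar>Re (laplacian ?\<Phi> (z /\<^sub>R s))\<bar> \<le> K"
            unfolding K_def by (intro mult_mono Mr) (use c t0 in auto)
          then show "norm (D s * Re (laplacian ?\<Phi> (z /\<^sub>R s))) \<le> K" by (simp add: abs_mult)
        qed (use tt t0 in auto)
        then have "norm (?m t z - ?m t0 z) \<le> K * \<bar>t - t0\<bar>"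
          by (simp only: of_real_diff[symmetric] norm_of_real real_norm_def)
        then have "norm (?m t z - ?m t0 z) * norm (I z) \<le> K * \<bar>t - t0\<bar> * S"
          by (intro mult_mono IS) (auto intro: order_trans[OF norm_ge_zero])
        moreover have "norm (?m t z * I z - ?m t0 z * I z) = norm (?m t z - ?m t0 z) * norm (I z)"
          by (simp only: left_diff_distrib[symmetric] norm_mult)
        ultimately show ?thesis using True by (simp add: mult_ac)
      next
        case False
        then have "t \<le> norm z" "t0 \<le> norm z" using tt t0 by auto
        then show ?thesis using tt t0 False by (simp add: mollifier_eq_0 indicator_def)
      qed
    qed
    moreover have "(\<integral>z. of_real (D t0) * (?l z * I z) \<partial>lborel) = of_real (D t0) * ?B ?l"
      by (simp only: sh(1)[OF l] integral_mult_right_zero)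
    ultimately have "((\<lambda>t. \<integral>z. ?m t z * I z \<partial>lborel) has_vector_derivative of_real (D t0) * ?B ?l) (at t0)"
      by (simp only:)
    then show "((\<lambda>t. ?B (?m t)) has_vector_derivative of_real (D t0) * ?B ?l) (at t0)"
      by (rule has_vector_derivative_transform_within_open[of _ _ _ "{0<..}"])
         (use t0 in \<open>auto simp: sh(1)[OF test_function_ccs[OF test_function_mollifier]]\<close>)
    have lap_p: "laplacian ?p = (\<lambda>z. of_real ((inverse t0)\<^sup>2) * ?l z)"
      by (rule ext, rule laplacian_affine[OF test_function_smooth[OF \<Phi>]])
    have "(\<integral>x. \<integral>y. L x * g y * ?p (x - y) \<partial>lborel \<partial>lborel) = of_real ((inverse t0)\<^sup>2) * ?B ?l"
      using weak_pair_move_fst[OF translation_op_laplacian v g p] unfolding lap_p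
      by (simp only: pullB[of _ ?l] of_real_1 mult_1_left)
    then have "of_real (t0\<^sup>2) * (\<integral>x. \<integral>y. L x * g y * ?p (x - y) \<partial>lborel \<partial>lborel) = of_real (t0\<^sup>2) * (of_real ((inverse t0)\<^sup>2) * ?B ?l)"
      by (simp only:)
    also have "\<dots> = ?B ?l" using t0 by (intro of_real_square_inverse) simp
    finally have eqB: "of_real (t0\<^sup>2) * (\<integral>x. \<integral>y. L x * g y * ?p (x - y) \<partial>lborel \<partial>lborel) = ?B ?l" .
    have "norm (?B ?l) = t0\<^sup>2 * norm (\<integral>x. \<integral>y. L x * g y * ?p (x - y) \<partial>lborel \<partial>lborel)"
      by (simp only: eqB[symmetric] norm_mult norm_of_real abs_power2)
    also have "\<dots> \<le> t0\<^sup>2 * (sqrt (nsq L) * sqrt (nsq g) * (\<integral>z. norm (?p z) \<partial>lborel))"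
      by (intro mult_left_mono L2_pairing_norm_le vL g test_function_ccs p) simp
    also have "(\<integral>z. norm (?p z) \<partial>lborel) = t0 ^ CARD('n) * (\<integral>z. \<bar>bump_primitive (z :: real^'n)\<bar> \<partial>lborel)"
      using t0 lborel_integral_affine[of "inverse t0" "\<lambda>z :: real^'n. \<bar>bump_primitive z\<bar>" 0] by (simp add: power_inverse)
    finally have "norm (?B ?l) \<le> t0\<^sup>2 * (sqrt (nsq L) * sqrt (nsq g) * (t0 ^ CARD('n) * (\<integral>z. \<bar>bump_primitive (z :: real^'n)\<bar> \<partial>lborel)))" .
    then have "\<bar>D t0\<bar> * norm (?B ?l) \<le> \<bar>D t0\<bar> * (t0\<^sup>2 * (sqrt (nsq L) * sqrt (nsq g) * (t0 ^ CARD('n) * (\<integral>z. \<bar>bump_primitive (z :: real^'n)\<bar> \<partial>lborel))))"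
      by (rule mult_left_mono) simp
    also have "\<dots> = t0 * A"
    proof -
      have "\<bar>D t0\<bar> * (t0\<^sup>2 * t0 ^ CARD('n)) = t0 / ?c"
        unfolding D_def using t0 c by (simp add: power_inverse power2_eq_square abs_mult field_simps)
      moreover have "\<bar>D t0\<bar> * (t0\<^sup>2 * (X * (t0 ^ CARD('n) * Y))) = \<bar>D t0\<bar> * (t0\<^sup>2 * t0 ^ CARD('n)) * (X * Y)" for X Y
        by (simp only: mult_ac)
      ultimately show ?thesis unfolding A_def mollifier_const_def by (simp only:) simp
    qed
    finally show "norm (of_real (D t0) * ?B ?l) \<le> t0 * A" by (simp add: norm_mult)
  qed
  \<comment> \<open>On the whole interval the scale derivative is at most \<open>r A\<close>; afterwards \<open>s\<close> tends to \<open>0\<close>.\<close>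
  have diff: "norm (?B (?m s) - ?B (?m r)) \<le> A * r\<^sup>2" if s: "0 < s" "s < r" for s
  proof -
    have "norm (?B (?m s) - ?B (?m r)) \<le> (r * A) * \<bar>s - r\<bar>"
    proof (rule norm_diff_le_of_vector_derivative[of s r "\<lambda>t. ?B (?m t)"])
      fix t assume t: "t \<in> {s..r}"
      then have "0 < t" using s by simp
      from deriv[OF this] show "((\<lambda>t. ?B (?m t)) has_vector_derivative of_real (D t) * ?B (\<lambda>z. laplacian ?\<Phi> (inverse t *\<^sub>R z + 0))) (at t)" .
      have "t * A \<le> r * A" using t A0 by (intro mult_right_mono) auto
      with bound[OF \<open>0 < t\<close>] show "norm (of_real (D t) * ?B (\<lambda>z. laplacian ?\<Phi> (inverse t *\<^sub>R z + 0))) \<le> r * A" by linarith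
    qed (use s in auto)
    also have "\<dots> \<le> (r * A) * r" using s A0 r by (intro mult_left_mono) auto
    finally show ?thesis by (simp add: power2_eq_square mult_ac)
  qed
  have "((\<lambda>s. norm (?B (?m s) - ?B (?m r))) \<longlongrightarrow> norm ((\<integral>x. v x * g x \<partial>lborel) - ?B (?m r))) (at_right 0)"
    by (intro tendsto_norm tendsto_diff tendsto_const mollified_pairing[OF L2_measurable[OF vL(1)] L2_measurable[OF g] L2_majorant[OF vL(1) g]])
  then have "norm ((\<integral>x. v x * g x \<partial>lborel) - ?B (?m r)) \<le> A * r\<^sup>2"
    by (rule tendsto_upperbound)
       (use diff r in \<open>auto simp: eventually_at_right_field intro!: exI[of _ r]\<close>)
  then show ?thesis by (simp add: A_def mult_ac)
qed

section \<open>Sobolev and Gagliardo-Nirenberg bounds\<close>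

definition average :: "real \<Rightarrow> (real^'n::finite \<Rightarrow> complex) \<Rightarrow> real^'n \<Rightarrow> complex" where
  "average r v y = (\<integral>x. v x * of_real (mollifier r (x - y)) \<partial>lborel)"

lemma level_set_finite:
  fixes v :: "'a::euclidean_space \<Rightarrow> complex"
  assumes v: "L2 v" and a: "0 < a"
  shows "{x. a < norm (v x)} \<in> sets lborel" "emeasure lborel {x. a < norm (v x)} < \<infinity>"
proof -
  have [measurable]: "v \<in> borel_measurable borel" using v by (rule L2_measurable)
  show S: "{x. a < norm (v x)} \<in> sets lborel" by measurable
  have "integrable lborel (indicator {x. a < norm (v x)} :: 'a \<Rightarrow> real)"
  proof (rule Bochner_Integration.integrable_bound)
    show "integrable lborel (\<lambda>x. (norm (v x))\<^sup>2 / a\<^sup>2)" using v by (simp add: L2_def)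
    have "1 \<le> (norm (v x))\<^sup>2 / a\<^sup>2" if "a < norm (v x)" for x
      using power_mono[of a "norm (v x)" 2] that a by simp
    then show "AE x in lborel. norm (indicator {x. a < norm (v x)} x :: real) \<le> norm ((norm (v x))\<^sup>2 / a\<^sup>2)"
      by (auto simp: indicator_def)
  qed (use S in auto)
  then show "emeasure lborel {x. a < norm (v x)} < \<infinity>"
    using S by (simp add: integrable_indicator_iff)
qed

text \<open>Where \<open>v\<close> exceeds twice the size of its averages it is dominated by the mollification error, so
  the level set is small.\<close>

lemma level_set_bound:
  fixes v L :: "real^'n::finite \<Rightarrow> complex"
  assumes v: "lap_pair v L" and r: "0 < r" and l: "0 < l" and avg: "\<And>y. norm (average r v y) \<le> l"
  shows "measure lborel {x. 2 * l < norm (v x)} \<le> (mollifier_const TYPE('n) * r\<^sup>2)\<^sup>2 * nsq L / l\<^sup>2"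
proof -
  define S where "S = {x. 2 * l < norm (v x)}"
  define m where "m = measure lborel S"
  let ?C = "mollifier_const TYPE('n) * r\<^sup>2"
  have vL: "L2 v" "L2 L" using weak_pair_L2[OF v] by auto
  have [measurable]: "v \<in> borel_measurable borel" using vL(1) by (rule L2_measurable)
  have S: "S \<in> sets lborel" "emeasure lborel S < \<infinity>"
    using level_set_finite[OF vL(1), of "2 * l"] l by (auto simp: S_def)
  have iS: "integrable lborel (indicator S :: real^'n \<Rightarrow> real)"
    using S by (intro integrable_real_indicator)
  have m: "(\<integral>x. indicator S x \<partial>lborel) = m" "0 \<le> m" using S by (simp_all add: m_def)
  \<comment> \<open>Pairing with the conjugate phase of \<open>v\<close> on the level set integrates the modulus of \<open>v\<close> there.\<close>
  define g where "g = (\<lambda>x. indicator S x *\<^sub>R cnj (sgn (v x)))"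
  have [measurable]: "(\<lambda>x. sgn (v x)) \<in> borel_measurable borel"
    unfolding sgn_div_norm by measurable
  have gm: "g \<in> borel_measurable borel"
    unfolding g_def using S(1) by (auto intro!: borel_measurable_scaleR borel_measurable_indicator borel_measurable_cnj)
  have ng: "norm (g x) = indicator S x" for x
    using l by (auto simp: g_def S_def indicator_def norm_sgn)
  then have g2: "(norm (g x))\<^sup>2 = indicator S x" for x by (simp add: indicator_def)
  have g: "L2 g" "nsq g = m"
    using iS m gm by (simp_all add: L2_def nsq_def g2)
  have vg: "v x * g x = of_real (indicator S x * norm (v x))" for x
    by (cases "v x = 0") (auto simp: g_def indicator_def sgn_div_norm complex_norm_square[symmetric]
        power2_eq_square scaleR_conv_of_real field_simps)
  have ivS: "integrable lborel (\<lambda>x. indicator S x * norm (v x))"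
    using L2_mult_integrable(1)[OF vL(1) g(1)] by (simp add: ng mult.commute)
  have "2 * l * m = (\<integral>x. indicator S x * (2 * l) \<partial>lborel)" using m by simp
  also have "\<dots> \<le> (\<integral>x. indicator S x * norm (v x) \<partial>lborel)"
    by (rule integral_mono[OF integrable_mult_left[OF iS] ivS]) (auto simp: S_def indicator_def)
  also have "\<dots> = norm (\<integral>x. v x * g x \<partial>lborel)"
    unfolding vg integral_complex_of_real norm_of_real by (simp add: integral_nonneg_AE)
  finally have low: "2 * l * m \<le> norm (\<integral>x. v x * g x \<partial>lborel)" .
  have k: "ccs (\<lambda>z :: real^'n. complex_of_real (mollifier r z))"
    by (rule test_function_ccs[OF test_function_mollifier[OF r]])
  let ?B = "\<integral>x. \<integral>y. v x * g y * of_real (mollifier r (x - y)) \<partial>lborel \<partial>lborel"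
  have pull: "(\<integral>x. v x * g y * of_real (mollifier r (x - y)) \<partial>lborel) = g y * average r v y" for y
    unfolding average_def by (subst integral_mult_right_zero[symmetric]) (simp add: mult_ac)
  have "?B = (\<integral>y. \<integral>x. v x * g y * of_real (mollifier r (x - y)) \<partial>lborel \<partial>lborel)"
    by (rule pairing_swap[OF L2_measurable[OF vL(1)] gm L2_majorant[OF vL(1) g(1)] k, symmetric])
  then have B: "?B = (\<integral>y. g y * average r v y \<partial>lborel)" by (simp only: pull)
  have "norm ?B \<le> (\<integral>y. indicator S y * l \<partial>lborel)"
  proof (cases "integrable lborel (\<lambda>y. g y * average r v y)")
    case True
    then show ?thesis unfolding B
      by (rule Bochner_Integration.integral_norm_bound_integral[OF _ integrable_mult_left[OF iS]])
         (auto simp: norm_mult ng intro!: mult_left_mono avg)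
  next
    case False
    then show ?thesis unfolding B using m l by (simp add: not_integrable_integral_eq)
  qed
  then have "norm ?B \<le> l * m" using m by (simp add: mult.commute)
  then have "l * m \<le> norm (\<integral>x. v x * g x \<partial>lborel) - norm ?B" using low by simp
  also have "\<dots> \<le> norm ((\<integral>x. v x * g x \<partial>lborel) - ?B)" by (rule norm_triangle_ineq2)
  also have "\<dots> \<le> ?C * (sqrt (nsq L) * sqrt m)"
    using mollification_error[OF v g(1) r] g(2) by simp
  finally have "l * m \<le> ?C * sqrt (nsq L) * sqrt m" by (simp add: mult.assoc)
  then have le: "(l * sqrt m) * sqrt m \<le> (?C * sqrt (nsq L)) * sqrt m"
    using m(2) by (simp add: mult.assoc real_sqrt_mult_self)
  have C0: "0 \<le> ?C * sqrt (nsq L)"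
    by (intro mult_nonneg_nonneg mollifier_const_nonneg real_sqrt_ge_zero nsq_nonneg) simp
  have "l * sqrt m \<le> ?C * sqrt (nsq L)"
  proof (cases "m = 0")
    case False
    then have "0 < sqrt m" using m(2) by simp
    with le show ?thesis using mult_right_le_imp_le by blast
  qed (use C0 in simp)
  then have "(l * sqrt m)\<^sup>2 \<le> (?C * sqrt (nsq L))\<^sup>2"
    using l m(2) by (intro power_mono) auto
  then have "m * l\<^sup>2 \<le> ?C\<^sup>2 * nsq L"
    using m(2) nsq_nonneg[of L] by (simp add: power_mult_distrib mult.commute)
  then show ?thesis using l unfolding m_def[symmetric] S_def[symmetric] by (simp add: pos_le_divide_eq)
qed

text \<open>Values of modulus at most \<open>a\<close> contribute at most \<open>a\<close> to the average; a larger value \<open>t\<close> is at most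
  \<open>a\<^sup>1\<^sup>-\<^sup>q t\<^sup>q\<close>, and the kernel is bounded by a multiple of \<open>r\<^sup>-\<^sup>N\<close>.\<close>

lemma average_bound:
  fixes v :: "real^'n::finite \<Rightarrow> complex" and q :: real
  assumes v[measurable]: "v \<in> borel_measurable borel" and q: "1 \<le> q"
    and int: "integrable lborel (\<lambda>x. norm (v x) powr q)" and M: "(\<integral>x. norm (v x) powr q \<partial>lborel) \<le> M"
    and b: "\<And>x :: real^'n. bump x \<le> b * (\<integral>x. bump (x :: real^'n) \<partial>lborel)"
    and r: "0 < r" and a: "0 < a"
  shows "norm (average r v y) \<le> a + a powr (1 - q) * (b / r ^ CARD('n)) * M"
proof -
  let ?c = "\<integral>x. bump (x :: real^'n) \<partial>lborel"
  have c: "0 < ?c" by (rule bump_integral_pos)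
  have b0: "0 \<le> b" using order_trans[OF bump_nonneg b] c by (simp add: zero_le_mult_iff)
  have mb: "mollifier r z \<le> b / r ^ CARD('n)" for z :: "real^'n"
    unfolding mollifier_def using b[of "z /\<^sub>R r"] c r by (simp add: field_simps)
  have pw: "t \<le> a + a powr (1 - q) * t powr q" if "0 \<le> t" for t
  proof (cases "t \<le> a")
    case True then show ?thesis by (simp add: add_increasing2)
  next
    case False
    then have t: "a < t" "0 < t" using a by auto
    have "t = t powr (1 - q) * t powr q" using t by (simp add: powr_add[symmetric])
    also have "t powr (1 - q) \<le> a powr (1 - q)" using t a q by (intro powr_mono2') auto
    finally have "t \<le> a powr (1 - q) * t powr q" by (simp add: mult_right_mono)
    then show ?thesis using a by simp
  qed
  have mi: "integrable lborel (\<lambda>x. mollifier r (x - y))"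
    using mollifier_integrable[OF r] lborel_integrable_shift[of "mollifier r" "-y"] by simp
  have i1: "(\<integral>x. mollifier r (x - y) \<partial>lborel) = 1"
    using mollifier_integral[OF r, where 'n='n] lborel_integral_shift[of "mollifier r" "-y"] by simp
  have [measurable]: "mollifier r \<in> borel_measurable borel"
    using borel_measurable_integrable[OF mollifier_integrable[OF r]] by simp
  have bd: "norm (v x * of_real (mollifier r (x - y))) \<le> a * mollifier r (x - y) + a powr (1 - q) * (b / r ^ CARD('n)) * norm (v x) powr q" for x
  proof -
    have m0: "0 \<le> mollifier r (x - y)" by (rule mollifier_nonneg[OF r])
    have "norm (v x) * mollifier r (x - y) \<le> (a + a powr (1 - q) * norm (v x) powr q) * mollifier r (x - y)"
      using mult_right_mono[OF pw[OF norm_ge_zero] m0] .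
    also have "\<dots> = a * mollifier r (x - y) + (a powr (1 - q) * norm (v x) powr q) * mollifier r (x - y)"
      by (simp add: distrib_right)
    also have "\<dots> \<le> a * mollifier r (x - y) + (a powr (1 - q) * norm (v x) powr q) * (b / r ^ CARD('n))"
      by (intro add_left_mono mult_left_mono mb) simp
    finally show ?thesis using m0 by (simp add: norm_mult mult_ac)
  qed
  have ib: "integrable lborel (\<lambda>x. a * mollifier r (x - y) + a powr (1 - q) * (b / r ^ CARD('n)) * norm (v x) powr q)"
    using mi int by simp
  have "integrable lborel (\<lambda>x. v x * of_real (mollifier r (x - y)))"
  proof (rule Bochner_Integration.integrable_bound[OF ib])
    show "AE x in lborel. norm (v x * of_real (mollifier r (x - y)))
        \<le> norm (a * mollifier r (x - y) + a powr (1 - q) * (b / r ^ CARD('n)) * norm (v x) powr q)"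
      using order_trans[OF bd abs_ge_self] by (intro AE_I2) (simp only: real_norm_def)
  qed measurable
  then have "norm (average r v y) \<le> (\<integral>x. a * mollifier r (x - y) + a powr (1 - q) * (b / r ^ CARD('n)) * norm (v x) powr q \<partial>lborel)"
    unfolding average_def using ib bd by (rule Bochner_Integration.integral_norm_bound_integral)
  also have "\<dots> = a + a powr (1 - q) * (b / r ^ CARD('n)) * (\<integral>x. norm (v x) powr q \<partial>lborel)"
    using mi int i1 by simp
  also have "\<dots> \<le> a + a powr (1 - q) * (b / r ^ CARD('n)) * M"
    using M b0 r by (intro add_left_mono mult_left_mono) auto
  finally show ?thesis .
qed

lemma bump_bound_exists:
  "\<exists>b>0. \<forall>x :: real^'n::finite. bump x \<le> b * (\<integral>x. bump (x :: real^'n) \<partial>lborel)"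
proof -
  obtain M where M: "0 < M" "\<And>x :: real^'n. norm (complex_of_real (bump x)) \<le> M"
    using ccs_bounded[OF test_function_ccs[OF test_function_bump]] by metis
  have "bump x \<le> M" for x :: "real^'n" using M(2)[of x] by simp
  then show ?thesis
    using M(1) bump_integral_pos[where 'n='n]
    by (intro exI[of _ "M / (\<integral>x. bump (x :: real^'n) \<partial>lborel)"]) simp
qed

text \<open>Weak-type estimate: averaging at the scale at which \<open>L\<^sup>q\<close> bounds the averages by the level.\<close>

lemma weak_type_bound:
  fixes q M :: real
  assumes q: "1 \<le> q" and M: "0 \<le> M"
  shows "\<exists>K\<ge>0. \<forall>v L :: real^'n::finite \<Rightarrow> complex. lap_pair v L \<and> nsq L \<le> 1 \<and>
      integrable lborel (\<lambda>x. norm (v x) powr q) \<and> (\<integral>x. norm (v x) powr q \<partial>lborel) \<le> M \<longrightarrow>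
      (\<forall>l>0. measure lborel {x. 2 * l < norm (v x)} \<le> K * l powr (- 2 - 4 * q / CARD('n)))"
proof -
  obtain b where b: "0 < b" "\<And>x :: real^'n. bump x \<le> b * (\<integral>x. bump (x :: real^'n) \<partial>lborel)"
    using bump_bound_exists[where 'n='n] by blast
  define N where "N = real CARD('n)"
  have N: "0 < N" by (simp add: N_def)
  define A where "A = b * (M + 1)"
  have A: "0 < A" using b(1) M by (simp add: A_def)
  define K where "K = (mollifier_const TYPE('n))\<^sup>2 * (A powr (4 / N) * 2 powr (4 * q / N))"
  have "measure lborel {x. 2 * l < norm (v x)} \<le> K * l powr (- 2 - 4 * q / N)"
    if vL: "lap_pair v L" "nsq L \<le> 1" and int: "integrable lborel (\<lambda>x. norm (v x) powr q)"
      "(\<integral>x. norm (v x) powr q \<partial>lborel) \<le> M" and l: "0 < l" for v L :: "real^'n \<Rightarrow> complex" and l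
  proof -
    define a where "a = l / 2"
    \<comment> \<open>At this scale the second term of the bound for the averages is at most \<open>a\<close>, so the averages stay below \<open>l\<close>.\<close>
    define r where "r = (A * a powr (- q)) powr (1 / N)"
    have a: "0 < a" using l by (simp add: a_def)
    have pos: "0 < A * a powr (- q)" using A a by simp
    have r: "0 < r" using A a unfolding r_def by simp
    have rN: "r ^ CARD('n) = A * a powr (- q)"
      using r pos N A a unfolding r_def by (simp add: powr_realpow[symmetric] powr_powr N_def[symmetric])
    have avg: "norm (average r v y) \<le> l" for y
    proof -
      have "norm (average r v y) \<le> a + a powr (1 - q) * (b / r ^ CARD('n)) * M"
        by (rule average_bound[OF L2_measurable[OF weak_pair_L2(1)[OF vL(1)]] q int b(2) r a])
      also have "a powr (1 - q) * (b / r ^ CARD('n)) * M = (a powr (1 - q) / a powr (- q)) * (M / (M + 1))"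
      proof -
        have "P * (b / (b * m * Q)) * M = (P / Q) * (M / m)" if "m \<noteq> 0" "Q \<noteq> 0" for P Q m
          using that b(1) by (simp add: field_simps)
        from this[of "M + 1" "a powr (- q)" "a powr (1 - q)"] show ?thesis
          unfolding rN A_def using M a by simp
      qed
      also have "a powr (1 - q) / a powr (- q) = a" using a by (simp add: powr_diff[symmetric])
      also have "a + a * (M / (M + 1)) \<le> a + a * 1"
        using a M by (intro add_left_mono mult_left_mono) auto
      finally show ?thesis by (simp add: a_def)
    qed
    have r4: "(r\<^sup>2)\<^sup>2 = A powr (4 / N) * a powr (- (4 * q / N))"
    proof -
      have "(r\<^sup>2)\<^sup>2 = r powr 4" using r by (simp add: powr_numeral)
      also have "\<dots> = (A * a powr (- q)) powr (4 / N)" unfolding r_def by (simp add: powr_powr)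
      also have "\<dots> = A powr (4 / N) * a powr (- (4 * q / N))"
        using A a by (simp add: powr_mult powr_powr mult.commute)
      finally show ?thesis .
    qed
    have al: "a powr (- (4 * q / N)) = 2 powr (4 * q / N) * l powr (- (4 * q / N))"
      unfolding a_def using l by (simp add: powr_divide powr_minus field_simps)
    have "measure lborel {x. 2 * l < norm (v x)} \<le> (mollifier_const TYPE('n) * r\<^sup>2)\<^sup>2 * nsq L / l\<^sup>2"
      by (rule level_set_bound[OF vL(1) r l avg])
    also have "\<dots> \<le> (mollifier_const TYPE('n) * r\<^sup>2)\<^sup>2 * 1 / l\<^sup>2"
      using vL(2) by (intro divide_right_mono mult_left_mono) auto
    also have "\<dots> = (mollifier_const TYPE('n))\<^sup>2 * (r\<^sup>2)\<^sup>2 * l powr (- 2)"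
      using l by (simp add: power_mult_distrib powr_minus powr_numeral divide_inverse)
    also have "\<dots> = K * (l powr (- (4 * q / N)) * l powr (- 2))"
      unfolding r4 al K_def by (simp only: mult_ac)
    also have "l powr (- (4 * q / N)) * l powr (- 2) = l powr (- 2 - 4 * q / N)"
      by (simp add: powr_add[symmetric] algebra_simps)
    finally show ?thesis .
  qed
  moreover have "0 \<le> K" unfolding K_def by simp
  ultimately show ?thesis unfolding N_def by blast
qed

text \<open>Dyadic levels: small values are controlled by the square integral because \<open>2 \<le> s\<close>, and the levels above \<open>1\<close>
  sum up to a geometric series because \<open>s < \<beta>\<close>.\<close>

lemma strong_from_weak_type:
  fixes K \<beta> s :: real
  assumes K: "0 \<le> K" and s: "2 \<le> s" "s < \<beta>"
  shows "\<exists>C\<ge>0. \<forall>v :: 'a::euclidean_space \<Rightarrow> complex. L2 v \<and> nsq v \<le> 1 \<and>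
     (\<forall>l>0. measure lborel {x. 2 * l < norm (v x)} \<le> K * l powr (- \<beta>)) \<longrightarrow>
     integrable lborel (\<lambda>x. norm (v x) powr s) \<and> (\<integral>x. norm (v x) powr s \<partial>lborel) \<le> C"
proof -
  define c where "c k = K * 2 powr (s + \<beta>) * (2 powr (s - \<beta>)) ^ k" for k :: nat
  have c0: "0 \<le> c k" for k using K by (simp add: c_def)
  have "2 powr (s - \<beta>) < 2 powr 0" using s by (intro powr_less_mono) auto
  then have sc: "summable c" unfolding c_def by (intro summable_mult summable_geometric) simp
  have "integrable lborel (\<lambda>x. norm (v x) powr s) \<and> (\<integral>x. norm (v x) powr s \<partial>lborel) \<le> 1 + suminf c"
    if v: "L2 v" "nsq v \<le> 1" and w: "\<And>l. 0 < l \<Longrightarrow> measure lborel {x. 2 * l < norm (v x)} \<le> K * l powr (- \<beta>)"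
    for v :: "'a \<Rightarrow> complex"
  proof -
    have vm[measurable]: "v \<in> borel_measurable borel" using v(1) by (rule L2_measurable)
    let ?S = "\<lambda>k::nat. {x. 2 ^ k < norm (v x)}"
    let ?h = "\<lambda>k x. ennreal ((2 ^ (k + 1)) powr s) * indicator (?S k) x"
    have S[measurable]: "?S k \<in> sets lborel" for k by measurable
    have term_le: "f k \<le> (\<Sum>i. f i)" for f :: "nat \<Rightarrow> ennreal" and k
      using sum_le_suminf[of f "{k}"] by simp
    have pw: "ennreal (norm (v x) powr s) \<le> ennreal ((norm (v x))\<^sup>2) + (\<Sum>k. ?h k x)" for x
    proof (cases "norm (v x) \<le> 1")
      case True
      have "norm (v x) powr s \<le> norm (v x) powr 2"
        using True by (intro powr_mono'[OF s(1)]) auto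
      then have "norm (v x) powr s \<le> (norm (v x))\<^sup>2" by (simp add: powr_numeral)
      then show ?thesis by (simp add: add_increasing2 ennreal_leI)
    next
      case False
      define t where "t = norm (v x)"
      have t: "1 < t" using False by (simp add: t_def)
      obtain n :: nat where n: "t \<le> 2 ^ n"
        using real_arch_pow[of 2 t] by (auto intro: less_imp_le)
      define j where "j = (LEAST j. t \<le> 2 ^ j)"
      have j: "t \<le> 2 ^ j" unfolding j_def using n by (rule LeastI)
      have "j \<noteq> 0" using j t by (intro notI) simp
      then obtain k where k: "j = Suc k" using not0_implies_Suc by blast
      have "\<not> t \<le> 2 ^ k" using not_less_Least[of k "\<lambda>j. t \<le> 2 ^ j"] k unfolding j_def by simp
      then have ks: "x \<in> ?S k" by (simp add: t_def)
      have "t powr s \<le> (2 ^ (k + 1)) powr s" using j k t s by (intro powr_mono2) auto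
      then have "ennreal (norm (v x) powr s) \<le> ?h k x" using ks by (simp add: t_def ennreal_leI)
      also have "?h k x \<le> (\<Sum>i. ?h i x)" by (rule term_le)
      finally show ?thesis by (simp add: add_increasing)
    qed
    have hk: "(\<integral>\<^sup>+x. ?h k x \<partial>lborel) \<le> ennreal (c k)" for k
    proof -
      have fin: "emeasure lborel (?S k) < \<infinity>" using level_set_finite(2)[OF v(1), of "2 ^ k"] by simp
      have "measure lborel (?S k) \<le> K * (2 ^ k / 2) powr (- \<beta>)"
        using w[of "2 ^ k / 2"] by simp
      then have "(2 ^ (k + 1)) powr s * measure lborel (?S k) \<le> (2 ^ (k + 1)) powr s * (K * (2 ^ k / 2) powr (- \<beta>))"
        by (rule mult_left_mono) simp
      also have "\<dots> = c k"
      proof -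
        have e: "(2::real) ^ (k + 1) = 2 powr (real k + 1)" "(2::real) ^ k / 2 = 2 powr (real k - 1)"
          by (simp_all add: powr_add powr_diff powr_realpow)
        have "(2 ^ (k + 1)) powr s * (2 ^ k / 2) powr (- \<beta>) = 2 powr ((real k + 1) * s + (real k - 1) * (- \<beta>))"
          unfolding e powr_powr by (simp only: powr_add)
        also have "(real k + 1) * s + (real k - 1) * (- \<beta>) = (s + \<beta>) + (s - \<beta>) * real k"
          by (simp add: algebra_simps)
        also have "2 powr \<dots> = 2 powr (s + \<beta>) * (2 powr (s - \<beta>)) ^ k"
          unfolding powr_add by (simp add: powr_powr[symmetric] powr_realpow)
        finally show ?thesis by (simp add: c_def mult_ac)
      qed
      finally have "(2 ^ (k + 1)) powr s * measure lborel (?S k) \<le> c k" .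
      moreover have "(\<integral>\<^sup>+x. ?h k x \<partial>lborel) = ennreal ((2 ^ (k + 1)) powr s * measure lborel (?S k))"
        using fin by (subst nn_integral_cmult_indicator[OF S]) (simp add: emeasure_eq_ennreal_measure ennreal_mult)
      ultimately show ?thesis by (simp add: ennreal_leI)
    qed
    have "(\<integral>\<^sup>+x. ennreal (norm (v x) powr s) \<partial>lborel) \<le> (\<integral>\<^sup>+x. ennreal ((norm (v x))\<^sup>2) + (\<Sum>k. ?h k x) \<partial>lborel)"
      by (intro nn_integral_mono pw)
    also have "\<dots> = (\<integral>\<^sup>+x. ennreal ((norm (v x))\<^sup>2) \<partial>lborel) + (\<Sum>k. \<integral>\<^sup>+x. ?h k x \<partial>lborel)"
      by (subst nn_integral_add) (auto simp: nn_integral_suminf)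
    also have "\<dots> \<le> ennreal 1 + (\<Sum>k. ennreal (c k))"
    proof (intro add_mono suminf_le hk)
      show "(\<integral>\<^sup>+x. ennreal ((norm (v x))\<^sup>2) \<partial>lborel) \<le> ennreal 1"
        using v nn_integral_eq_integral[of lborel "\<lambda>x. (norm (v x))\<^sup>2"] by (simp add: L2_def nsq_def)
    qed auto
    also have "\<dots> = ennreal (1 + suminf c)"
      using suminf_nonneg[OF sc c0] by (simp add: suminf_ennreal2[OF c0 sc])
    finally have le: "(\<integral>\<^sup>+x. ennreal (norm (v x) powr s) \<partial>lborel) \<le> ennreal (1 + suminf c)" .
    then have "(\<integral>\<^sup>+x. ennreal (norm (v x) powr s) \<partial>lborel) < \<infinity>"
      by (rule order_le_less_trans) simp
    then have int: "integrable lborel (\<lambda>x. norm (v x) powr s)"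
      by (intro integrableI_bounded) auto
    then have "ennreal (\<integral>x. norm (v x) powr s \<partial>lborel) \<le> ennreal (1 + suminf c)"
      using le nn_integral_eq_integral[OF int] by simp
    then show ?thesis using int suminf_nonneg[OF sc c0] by (subst (asm) ennreal_le_iff) auto
  qed
  moreover have "0 \<le> 1 + suminf c" using suminf_nonneg[OF sc c0] by simp
  ultimately show ?thesis by blast
qed

definition Lp_bounded :: "'n::finite itself \<Rightarrow> real \<Rightarrow> bool" where
  "Lp_bounded _ q \<longleftrightarrow> (\<exists>C\<ge>0. \<forall>v L :: real^'n \<Rightarrow> complex. lap_pair v L \<and> nsq v \<le> 1 \<and> nsq L \<le> 1 \<longrightarrow>
     integrable lborel (\<lambda>x. norm (v x) powr q) \<and> (\<integral>x. norm (v x) powr q \<partial>lborel) \<le> C)"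

lemma Lp_bounded_2: "Lp_bounded TYPE('n::finite) 2"
  unfolding Lp_bounded_def
  by (intro exI[of _ 1] conjI allI impI) (auto simp: powr_numeral nsq_def L2_def weak_pair_def)

lemma Lp_bounded_step:
  assumes q: "Lp_bounded TYPE('n::finite) q" "1 \<le> q" and s: "2 \<le> s" "s < 2 + 4 * q / CARD('n)"
  shows "Lp_bounded TYPE('n) s"
proof -
  obtain C where C: "0 \<le> C" "\<And>v L :: real^'n \<Rightarrow> complex. lap_pair v L \<Longrightarrow> nsq v \<le> 1 \<Longrightarrow> nsq L \<le> 1 \<Longrightarrow>
     integrable lborel (\<lambda>x. norm (v x) powr q) \<and> (\<integral>x. norm (v x) powr q \<partial>lborel) \<le> C"
    using q(1) unfolding Lp_bounded_def by blast
  obtain K where K: "0 \<le> K" "\<And>v L :: real^'n \<Rightarrow> complex. lap_pair v L \<and> nsq L \<le> 1 \<and>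
      integrable lborel (\<lambda>x. norm (v x) powr q) \<and> (\<integral>x. norm (v x) powr q \<partial>lborel) \<le> C \<Longrightarrow>
      (\<forall>l>0. measure lborel {x. 2 * l < norm (v x)} \<le> K * l powr (- 2 - 4 * q / CARD('n)))"
    using weak_type_bound[OF q(2) C(1), where 'n='n] by blast
  obtain D where D: "0 \<le> D" "\<And>v :: real^'n \<Rightarrow> complex. L2 v \<and> nsq v \<le> 1 \<and>
     (\<forall>l>0. measure lborel {x. 2 * l < norm (v x)} \<le> K * l powr (- (2 + 4 * q / CARD('n)))) \<Longrightarrow>
     integrable lborel (\<lambda>x. norm (v x) powr s) \<and> (\<integral>x. norm (v x) powr s \<partial>lborel) \<le> D"
    using strong_from_weak_type[OF K(1) s, where 'a="real^'n"] by blast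
  have "integrable lborel (\<lambda>x. norm (v x) powr s) \<and> (\<integral>x. norm (v x) powr s \<partial>lborel) \<le> D"
    if "lap_pair v L" "nsq v \<le> 1" "nsq L \<le> 1" for v L :: "real^'n \<Rightarrow> complex"
    using D(2)[of v] K(2)[of v L] C(2)[of v L] weak_pair_L2(1)[of 1 laplacian v L] that by simp
  with D(1) show ?thesis unfolding Lp_bounded_def by blast
qed

lemma powr_le_add_powr:
  fixes t :: real
  assumes "0 \<le> t" "2 \<le> p" "p \<le> q" shows "t powr p \<le> t\<^sup>2 + t powr q"
proof (cases "t \<le> 1")
  case True
  have "t powr p \<le> t powr 2" using assms True by (intro powr_mono') auto
  then show ?thesis using assms by (simp add: powr_numeral add_increasing2)
next
  case False
  then have "t powr p \<le> t powr q" using assms by (intro powr_mono) auto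
  then show ?thesis by (simp add: add_increasing)
qed

lemma Lp_between:
  fixes v :: "'a::euclidean_space \<Rightarrow> complex"
  assumes v: "L2 v" and pq: "2 \<le> p" "p \<le> q" and int: "integrable lborel (\<lambda>x. norm (v x) powr q)"
  shows "integrable lborel (\<lambda>x. norm (v x) powr p)"
    and "(\<integral>x. norm (v x) powr p \<partial>lborel) \<le> nsq v + (\<integral>x. norm (v x) powr q \<partial>lborel)"
proof -
  have [measurable]: "v \<in> borel_measurable borel" using v by (rule L2_measurable)
  have s: "integrable lborel (\<lambda>x. (norm (v x))\<^sup>2 + norm (v x) powr q)" using v int by (simp add: L2_def)
  show 1: "integrable lborel (\<lambda>x. norm (v x) powr p)"
    by (rule Bochner_Integration.integrable_bound[OF s])
       (auto intro!: AE_I2 powr_le_add_powr pq)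
  have "(\<integral>x. norm (v x) powr p \<partial>lborel) \<le> (\<integral>x. (norm (v x))\<^sup>2 + norm (v x) powr q \<partial>lborel)"
    by (intro integral_mono 1 s powr_le_add_powr pq) auto
  then show "(\<integral>x. norm (v x) powr p \<partial>lborel) \<le> nsq v + (\<integral>x. norm (v x) powr q \<partial>lborel)"
    using v int by (simp add: L2_def nsq_def)
qed

lemma Lp_bounded_mono:
  assumes q: "Lp_bounded TYPE('n::finite) q" and pq: "2 \<le> p" "p \<le> q"
  shows "Lp_bounded TYPE('n) p"
proof -
  obtain C where C: "0 \<le> C" "\<And>v L :: real^'n \<Rightarrow> complex. lap_pair v L \<Longrightarrow> nsq v \<le> 1 \<Longrightarrow> nsq L \<le> 1 \<Longrightarrow>
     integrable lborel (\<lambda>x. norm (v x) powr q) \<and> (\<integral>x. norm (v x) powr q \<partial>lborel) \<le> C"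
    using q unfolding Lp_bounded_def by blast
  have "integrable lborel (\<lambda>x. norm (v x) powr p) \<and> (\<integral>x. norm (v x) powr p \<partial>lborel) \<le> 1 + C"
    if "lap_pair v L" "nsq v \<le> 1" "nsq L \<le> 1" for v L :: "real^'n \<Rightarrow> complex"
    using C(2)[OF that] Lp_between[OF weak_pair_L2(1)[OF that(1)] pq] that(2) by force
  with C(1) show ?thesis unfolding Lp_bounded_def by (intro exI[of _ "1 + C"]) auto
qed

text \<open>The step \<open>q \<mapsto> 2 + 4 q / N\<close> moves every exponent below its fixed point \<open>2 N / (N - 4)\<close> upwards, and
  every exponent at all if \<open>N \<le> 4\<close>; so the exponents reached from \<open>2\<close> have no smaller supremum.\<close>

lemma Lp_bounded_subcritical:
  assumes p: "2 \<le> p" and crit: "5 \<le> CARD('n::finite) \<longrightarrow> p < 2 * real CARD('n) / (real CARD('n) - 4)"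
  shows "Lp_bounded TYPE('n) p"
proof (rule ccontr)
  assume np: "\<not> Lp_bounded TYPE('n) p"
  define N where "N = real CARD('n)"
  have N: "0 < N" by (simp add: N_def)
  define A where "A = {q. 2 \<le> q \<and> Lp_bounded TYPE('n) q}"
  have "q \<le> p" if "q \<in> A" for q
    using that np Lp_bounded_mono[of q p] p unfolding A_def by force
  then have bdd: "bdd_above A" by (rule bdd_aboveI)
  have A2: "2 \<in> A" using Lp_bounded_2 by (simp add: A_def)
  define a where "a = Sup A"
  have a2: "2 \<le> a" unfolding a_def by (rule cSup_upper[OF A2 bdd])
  have ap: "a \<le> p" unfolding a_def using A2 \<open>\<And>q. q \<in> A \<Longrightarrow> q \<le> p\<close> by (intro cSup_least) auto
  have "N * (a - 2) / 4 < a"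
  proof (cases "5 \<le> CARD('n)")
    case True
    then have N5: "5 \<le> N" by (simp add: N_def)
    have "a < 2 * N / (N - 4)" using ap crit True unfolding N_def by simp
    then have "a * (N - 4) < 2 * N" using N5 by (simp add: pos_less_divide_eq)
    then show ?thesis by (simp add: algebra_simps)
  next
    case False
    then have "N \<le> 4" by (simp add: N_def)
    then have "N * (a - 2) \<le> 4 * (a - 2)" using a2 by (intro mult_right_mono) auto
    then show ?thesis by simp
  qed
  then obtain q where q: "q \<in> A" "N * (a - 2) / 4 < q"
    using less_cSup_iff[OF _ bdd, of "N * (a - 2) / 4"] A2 unfolding a_def by blast
  then have "a < 2 + 4 * q / N" using N by (simp add: field_simps)
  then obtain s where s: "a < s" "s < 2 + 4 * q / N" using dense by blast
  have "Lp_bounded TYPE('n) s"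
    using q(1) a2 s by (intro Lp_bounded_step[of q s]) (auto simp: A_def N_def)
  then have "s \<in> A" using s a2 by (simp add: A_def)
  then have "s \<le> a" unfolding a_def by (intro cSup_upper bdd)
  with s show False by simp
qed

lemma Lp_integrable:
  fixes v L :: "real^'n::finite \<Rightarrow> complex"
  assumes p: "Lp_bounded TYPE('n) p" and v: "lap_pair v L"
  shows "integrable lborel (\<lambda>x. norm (v x) powr p)"
proof -
  define c where "c = 1 / (1 + nsq v + nsq L)"
  have c: "0 < c" "c \<le> 1" unfolding c_def using nsq_nonneg[of v] nsq_nonneg[of L] by auto
  have c2: "c\<^sup>2 \<le> c" using c by (simp add: power2_eq_square mult_left_le)
  have "c * nsq v \<le> 1" "c * nsq L \<le> 1"
    unfolding c_def using nsq_nonneg[of v] nsq_nonneg[of L] by auto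
  then have "nsq (\<lambda>x. of_real c * v x) \<le> 1" "nsq (\<lambda>x. of_real c * L x) \<le> 1"
    using mult_right_mono[OF c2 nsq_nonneg[of v]] mult_right_mono[OF c2 nsq_nonneg[of L]] c
    by (simp_all add: nsq_cmult)
  with p weak_pair_cmult[OF v, of "of_real c"]
  have "integrable lborel (\<lambda>x. norm (of_real c * v x) powr p)" unfolding Lp_bounded_def by blast
  then show ?thesis using c by (simp add: norm_mult powr_mult)
qed

text \<open>Rescaling \<open>v\<close> so that its Laplacian has norm \<open>1\<close> gives the Gagliardo-Nirenberg power of the Laplacian.
  The power at the exponent \<open>2 + 8 / N\<close> is exactly \<open>2\<close>; this is what makes \<open>\<sigma> = 4 / N\<close> admissible.  Smaller exponents
  are reached by interpolation with the square integral.\<close>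

lemma Gagliardo_Nirenberg:
  assumes p: "2 \<le> p" "p \<le> 2 + 8 / CARD('n::finite)"
  shows "\<exists>C\<ge>0. \<forall>v L :: real^'n \<Rightarrow> complex. lap_pair v L \<and> nsq v \<le> 1 \<longrightarrow>
     (\<integral>x. norm (v x) powr p \<partial>lborel) \<le> C * (1 + nsq L)"
proof -
  define N where "N = real CARD('n)"
  have N: "0 < N" by (simp add: N_def)
  define q where "q = 2 + 8 / N"
  have q: "2 \<le> q" using N by (simp add: q_def)
  have "5 \<le> CARD('n) \<longrightarrow> q < 2 * real CARD('n) / (real CARD('n) - 4)"
    unfolding q_def N_def by (auto simp: field_simps)
  then have "Lp_bounded TYPE('n) q" by (rule Lp_bounded_subcritical[OF q])
  then obtain C where C: "0 \<le> C" "\<And>v L :: real^'n \<Rightarrow> complex. lap_pair v L \<Longrightarrow> nsq v \<le> 1 \<Longrightarrow> nsq L \<le> 1 \<Longrightarrow>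
     integrable lborel (\<lambda>x. norm (v x) powr q) \<and> (\<integral>x. norm (v x) powr q \<partial>lborel) \<le> C"
    unfolding Lp_bounded_def by blast
  have "(\<integral>x. norm (v x) powr p \<partial>lborel) \<le> (1 + C) * (1 + nsq L)"
    if v: "lap_pair v L" "nsq v \<le> 1" for v L :: "real^'n \<Rightarrow> complex"
  proof -
    define \<Lambda> where "\<Lambda> = 1 + nsq L"
    have \<Lambda>: "1 \<le> \<Lambda>" "nsq L \<le> \<Lambda>" using nsq_nonneg[of L] by (auto simp: \<Lambda>_def)
    define \<mu> where "\<mu> = \<Lambda> powr (- 1 / 4)"
    have \<mu>: "0 < \<mu>" using \<Lambda> by (simp add: \<mu>_def)
    have \<mu>4: "\<mu> ^ 4 = 1 / \<Lambda>"
    proof -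
      have "\<mu> ^ 4 = \<mu> powr 4" using \<mu> by (simp add: powr_numeral)
      also have "\<dots> = \<Lambda> powr (- 1)" unfolding \<mu>_def by (simp add: powr_powr)
      also have "\<dots> = 1 / \<Lambda>" using \<Lambda> by (simp add: powr_minus_divide)
      finally show ?thesis .
    qed
    let ?v = "\<lambda>x. of_real (\<mu> powr (N / 2)) * v (0 + \<mu> *\<^sub>R x)"
    let ?L = "\<lambda>x. of_real (\<mu> powr (N / 2)) * (of_real (\<mu>\<^sup>2) * L (0 + \<mu> *\<^sub>R x))"
    have mN: "(\<mu> powr (N / 2))\<^sup>2 = \<mu> ^ CARD('n)"
      using \<mu> powr_realpow[OF \<mu>, of "CARD('n)"] by (simp add: power2_eq_square powr_add[symmetric] N_def)
    have w: "lap_pair ?v ?L" using \<mu> v(1) by (intro weak_pair_cmult lap_pair_affine) auto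
    have "nsq ?v = nsq v"
      using \<mu> mN by (simp only: nsq_cmult nsq_affine[OF less_imp_neq[OF \<mu>, symmetric]]) simp
    moreover have "nsq ?L = \<mu> ^ 4 * nsq L"
      using \<mu> mN by (simp only: nsq_cmult nsq_affine[OF less_imp_neq[OF \<mu>, symmetric]])
        (simp add: norm_power flip: power_mult)
    then have "nsq ?L \<le> 1" using \<Lambda> \<mu>4 by simp
    ultimately have 1: "(\<integral>x. norm (?v x) powr q \<partial>lborel) \<le> C" using C(2)[OF w] v(2) by simp
    have "norm (?v x) powr q = \<mu> powr (N / 2 * q) * (norm (v (0 + \<mu> *\<^sub>R x)) powr q)" for x
      using \<mu> by (simp add: norm_mult powr_mult powr_powr)
    then have "(\<integral>x. norm (?v x) powr q \<partial>lborel) = \<mu> powr (N / 2 * q) * (\<integral>x. norm (v (0 + \<mu> *\<^sub>R x)) powr q \<partial>lborel)"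
      by (simp only: integral_mult_right_zero)
    also have "(\<integral>x. norm (v (0 + \<mu> *\<^sub>R x)) powr q \<partial>lborel) = (\<integral>x. norm (v x) powr q \<partial>lborel) / \<mu> ^ CARD('n)"
      using lborel_integral_affine[of \<mu> "\<lambda>x. norm (v x) powr q" 0] \<mu> by (simp add: divide_inverse mult.commute)
    also have "\<mu> powr (N / 2 * q) * ((\<integral>x. norm (v x) powr q \<partial>lborel) / \<mu> ^ CARD('n)) =
        (\<mu> powr (N / 2 * q) / \<mu> powr N) * (\<integral>x. norm (v x) powr q \<partial>lborel)"
      using powr_realpow[OF \<mu>, of "CARD('n)"] by (simp add: N_def)
    also have "\<mu> powr (N / 2 * q) / \<mu> powr N = \<mu> ^ 4"
    proof -
      have "N / 2 * q - N = 4" using N by (simp add: q_def field_simps)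
      then show ?thesis using \<mu> by (simp add: powr_diff[symmetric] powr_numeral)
    qed
    finally have "(\<integral>x. norm (v x) powr q \<partial>lborel) / \<Lambda> \<le> C" using 1 by (simp add: \<mu>4)
    then have 2: "(\<integral>x. norm (v x) powr q \<partial>lborel) \<le> C * \<Lambda>" using \<Lambda> by (simp add: pos_divide_le_eq)
    have "(\<integral>x. norm (v x) powr p \<partial>lborel) \<le> nsq v + (\<integral>x. norm (v x) powr q \<partial>lborel)"
      by (rule Lp_between(2)[OF weak_pair_L2(1)[OF v(1)] p(1)])
         (use p(2) Lp_integrable[OF \<open>Lp_bounded TYPE('n) q\<close> v(1)] in \<open>auto simp: q_def N_def\<close>)
    also have "\<dots> \<le> (1 + C) * \<Lambda>" using v(2) 2 \<Lambda>(1) by (simp add: distrib_right)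
    finally show ?thesis by (simp add: \<Lambda>_def)
  qed
  with C(1) show ?thesis by (intro exI[of _ "1 + C"]) auto
qed

section \<open>Vanishing\<close>

text \<open>Expanding the square, the diagonal contributes at most \<open>K\<close> and the almost orthogonal rest at most \<open>K\<^sup>2 e\<close>.\<close>

lemma nsq_sum_le:
  fixes V :: "nat \<Rightarrow> 'a::euclidean_space \<Rightarrow> complex"
  assumes V: "\<And>i. i < K \<Longrightarrow> L2 (V i)" and B: "\<And>i. i < K \<Longrightarrow> nsq (V i) \<le> 1"
    and off: "\<And>i j. i < K \<Longrightarrow> j < K \<Longrightarrow> i \<noteq> j \<Longrightarrow> norm (\<integral>x. V i x * cnj (V j x) \<partial>lborel) \<le> e" and e: "0 \<le> e"
  shows "nsq (\<lambda>x. \<Sum>i<K. V i x) \<le> real K + (real K)\<^sup>2 * e"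
proof -
  have int: "integrable lborel (\<lambda>x. V i x * cnj (V j x))" if "i < K" "j < K" for i j
    by (intro L2_mult_integrable V that L2_cnj)
  have "complex_of_real (nsq (\<lambda>x. \<Sum>i<K. V i x)) = (\<integral>x. (\<Sum>i<K. V i x) * cnj (\<Sum>i<K. V i x) \<partial>lborel)"
    unfolding nsq_def integral_complex_of_real[symmetric] by (simp only: complex_norm_square)
  also have "\<dots> = (\<integral>x. (\<Sum>i<K. \<Sum>j<K. V i x * cnj (V j x)) \<partial>lborel)"
    by (simp add: sum_product cnj_sum)
  also have "\<dots> = (\<Sum>i<K. \<Sum>j<K. \<integral>x. V i x * cnj (V j x) \<partial>lborel)"
    using int by (subst Bochner_Integration.integral_sum; (intro Bochner_Integration.integrable_sum)?; simp)+
  finally have "nsq (\<lambda>x. \<Sum>i<K. V i x) = norm (\<Sum>i<K. \<Sum>j<K. \<integral>x. V i x * cnj (V j x) \<partial>lborel)"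
    by (metis norm_of_real abs_of_nonneg nsq_nonneg)
  also have "\<dots> \<le> (\<Sum>i<K. \<Sum>j<K. norm (\<integral>x. V i x * cnj (V j x) \<partial>lborel))"
    by (intro order_trans[OF norm_sum] sum_mono) (rule order_refl)
  also have "\<dots> \<le> (\<Sum>i<K. \<Sum>j<K. (if i = j then 1 else 0) + e)"
  proof (intro sum_mono)
    fix i j assume ij: "i \<in> {..<K}" "j \<in> {..<K}"
    have "norm (\<integral>x. V i x * cnj (V i x) \<partial>lborel) \<le> sqrt (nsq (V i)) * sqrt (nsq (V i))"
      using L2_Cauchy_Schwarz_norm[OF V[of i] L2_cnj[OF V[of i]]] ij by (simp add: nsq_cnj)
    also have "\<dots> \<le> 1" using B[of i] nsq_nonneg[of "V i"] ij by simp
    finally show "norm (\<integral>x. V i x * cnj (V j x) \<partial>lborel) \<le> (if i = j then 1 else 0) + e"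
      using off[of i j] ij e by auto
  qed
  also have "\<dots> = real K + (real K)\<^sup>2 * e"
    by (simp add: sum.distrib power2_eq_square sum.delta algebra_simps)
  finally show ?thesis .
qed

text \<open>The dilation of \<open>\<psi>\<close> is the adjoint of the norm-preserving dilation by \<open>l\<close> that is applied to the other factor of
  a pairing.\<close>

lemma test_dilation_continuous:
  fixes \<psi> :: "real^'n::finite \<Rightarrow> complex"
  assumes \<psi>: "ccs \<psi>" and s: "0 < s"
  shows "\<exists>\<rho>>0. \<rho> \<le> 1 \<and> (\<forall>l. 1 < l \<and> l \<le> 1 + \<rho> \<longrightarrow>
    nsq (\<lambda>x. \<psi> x - of_real (l powr (- CARD('n) / 2)) * \<psi> (x /\<^sub>R l)) \<le> s)"
proof -
  have [measurable]: "\<psi> \<in> borel_measurable borel" using \<psi> by (rule ccs_measurable)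
  obtain R where R: "\<And>x. R \<le> norm x \<Longrightarrow> \<psi> x = 0" and cont: "continuous_on UNIV \<psi>"
    using \<psi> unfolding ccs_def by blast
  obtain M where M: "0 < M" "\<And>x. norm (\<psi> x) \<le> M" using ccs_bounded[OF \<psi>] by metis
  let ?F = "\<lambda>l x. \<psi> x - of_real (l powr (- CARD('n) / 2)) * \<psi> (x /\<^sub>R l)"
  have "((\<lambda>l. nsq (?F l)) \<longlongrightarrow> 0) (at 1 within {1<..2})"
    unfolding tendsto_at_iff_sequentially o_def
  proof (intro allI impI)
    fix X :: "nat \<Rightarrow> real" assume X: "\<forall>i. X i \<in> {1<..2} - {1}" "X \<longlonglongrightarrow> 1"
    have "(\<lambda>n. \<integral>x. (norm (?F (X n) x))\<^sup>2 \<partial>lborel) \<longlonglongrightarrow> (\<integral>x. 0 \<partial>(lborel :: (real^'n) measure))"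
    proof (rule integral_dominated_convergence[where w = "\<lambda>x. (2 * M)\<^sup>2 * indicator (cball 0 (2 * \<bar>R\<bar>)) x"])
      show "(\<lambda>x. (norm (?F (X n) x))\<^sup>2) \<in> borel_measurable lborel" for n by measurable
      show "integrable lborel (\<lambda>x :: real^'n. (2 * M)\<^sup>2 * indicator (cball 0 (2 * \<bar>R\<bar>)) x)"
        by (intro integrable_mult_right integrable_indicator_cball)
      show "AE x in lborel. (\<lambda>n. (norm (?F (X n) x))\<^sup>2) \<longlonglongrightarrow> 0"
      proof (rule AE_I2)
        fix x :: "real^'n"
        have "(\<lambda>n. x /\<^sub>R X n) \<longlonglongrightarrow> x /\<^sub>R 1" by (intro tendsto_intros X) auto
        then have "(\<lambda>n. \<psi> (x /\<^sub>R X n)) \<longlonglongrightarrow> \<psi> (x /\<^sub>R 1)"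
          by (rule continuous_on_tendsto_compose[OF cont]) auto
        then have "(\<lambda>n. (norm (?F (X n) x))\<^sup>2) \<longlonglongrightarrow> (norm (\<psi> x - of_real (1 powr (- CARD('n) / 2)) * \<psi> (x /\<^sub>R 1)))\<^sup>2"
          by (intro tendsto_intros X) auto
        then show "(\<lambda>n. (norm (?F (X n) x))\<^sup>2) \<longlonglongrightarrow> 0" by simp
      qed
      show "AE x in lborel. norm ((norm (?F (X n) x))\<^sup>2) \<le> (2 * M)\<^sup>2 * indicator (cball 0 (2 * \<bar>R\<bar>)) x" for n
      proof (rule AE_I2)
        fix x :: "real^'n"
        have Xn: "1 < X n" "X n \<le> 2" using X(1) by auto
        show "norm ((norm (?F (X n) x))\<^sup>2) \<le> (2 * M)\<^sup>2 * indicator (cball 0 (2 * \<bar>R\<bar>)) x"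
        proof (cases "norm x \<le> 2 * \<bar>R\<bar>")
          case True
          have "X n powr (- CARD('n) / 2) \<le> 1" using Xn powr_mono[of "- CARD('n) / 2" 0 "X n"] by simp
          then have "norm (of_real (X n powr (- CARD('n) / 2)) * \<psi> (x /\<^sub>R X n)) \<le> 1 * M"
            unfolding norm_mult by (intro mult_mono M) auto
          then have "norm (?F (X n) x) \<le> 2 * M"
            using norm_triangle_ineq4[of "\<psi> x" "of_real (X n powr (- CARD('n) / 2)) * \<psi> (x /\<^sub>R X n)"] M(2)[of x] by linarith
          then have "(norm (?F (X n) x))\<^sup>2 \<le> (2 * M)\<^sup>2" by (rule power_mono) simp
          then show ?thesis using True by simp
        next
          case False
          have "R \<le> norm x" using False by linarith
          moreover have "R \<le> norm (x /\<^sub>R X n)"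
          proof -
            have "\<bar>R\<bar> * X n \<le> \<bar>R\<bar> * 2" using Xn by (intro mult_left_mono) auto
            then have "\<bar>R\<bar> \<le> norm x / X n" using False Xn by (simp add: pos_le_divide_eq mult.commute)
            then show ?thesis using Xn by (simp add: divide_inverse mult.commute)
          qed
          ultimately show ?thesis using R by simp
        qed
      qed
    qed auto
    then show "(\<lambda>n. nsq (?F (X n))) \<longlonglongrightarrow> 0" by (simp add: nsq_def)
  qed
  then have "\<forall>\<^sub>F l in at 1 within {1<..2}. nsq (?F l) < s"
    using s by (rule order_tendstoD)
  then obtain d where d: "0 < d" "\<And>l. l \<in> {1<..2} \<Longrightarrow> l \<noteq> 1 \<Longrightarrow> dist l 1 < d \<Longrightarrow> nsq (?F l) < s"
    unfolding eventually_at by blast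
  have "nsq (?F l) \<le> s" if "1 < l" "l \<le> 1 + min 1 (d / 2)" for l
  proof -
    have "l \<le> 2" "l - 1 < d" using that d(1) by linarith+
    then show ?thesis using d(2)[of l] that(1) by (simp add: dist_real_def)
  qed
  then show ?thesis using d(1) by (intro exI[of _ "min 1 (d / 2)"]) auto
qed

text \<open>If \<open>L + v\<close> is small, the dilates of \<open>v\<close> are almost eigenfunctions of the Laplacian for different
  eigenvalues, hence almost orthogonal, while a fixed test function cannot tell them apart as long as
  the dilations are close to the identity.  Many almost orthogonal functions cannot all have the same
  sizeable pairing with one function.\<close>

lemma weak_vanishing:
  fixes \<psi> :: "real^'n::finite \<Rightarrow> complex"
  assumes \<psi>: "ccs \<psi>" and \<epsilon>: "0 < \<epsilon>"
  shows "\<exists>\<delta>>0. \<forall>v L :: real^'n \<Rightarrow> complex. lap_pair v L \<and> nsq v \<le> 1 \<and> nsq (\<lambda>x. L x + v x) \<le> \<delta>\<^sup>2 \<longrightarrow>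
     norm (\<integral>x. v x * \<psi> x \<partial>lborel) \<le> \<epsilon>"
proof -
  have \<psi>2: "L2 \<psi>" using \<psi> by (rule L2_ccs)
  have "0 < (\<epsilon> / 2)\<^sup>2" using \<epsilon> by simp
  from test_dilation_continuous[OF \<psi> this] obtain \<rho> where \<rho>: "0 < \<rho>" "\<rho> \<le> 1"
    and close: "\<And>l. 1 < l \<Longrightarrow> l \<le> 1 + \<rho> \<Longrightarrow>
      nsq (\<lambda>x. \<psi> x - of_real (l powr (- CARD('n) / 2)) * \<psi> (x /\<^sub>R l)) \<le> (\<epsilon> / 2)\<^sup>2"
    by auto
  \<comment> \<open>The sum of \<open>K\<close> dilates will have squared norm at most \<open>2 K\<close>, hence pairing with \<open>\<psi>\<close> of order \<open>\<surd>K\<close>, while it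
    would be about \<open>K\<close> times the pairing with \<open>v\<close>.\<close>
  obtain K :: nat where K0: "8 * nsq \<psi> / \<epsilon>\<^sup>2 + 1 \<le> real K" using real_arch_simple by blast
  have "0 \<le> 8 * nsq \<psi> / \<epsilon>\<^sup>2" by (simp add: nsq_nonneg)
  then have K: "0 < real K" using K0 by linarith
  have K8: "8 * nsq \<psi> \<le> real K * \<epsilon>\<^sup>2" using K0 \<epsilon> by (simp add: pos_divide_le_eq[symmetric])
  \<comment> \<open>Equally spaced dilation factors in the interval from \<open>1\<close> to \<open>1 + \<rho>\<close>; \<open>\<delta>\<close> below makes all mutual inner products at
    most \<open>1 / K\<close>.\<close>
  define h where "h = \<rho> / real K"
  have h: "0 < h" using \<rho> K by (simp add: h_def)
  define l where "l j = 1 + h * (real j + 1)" for j :: nat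
  have l1: "1 < l j" for j using h by (simp add: l_def)
  have l2: "l j \<le> 1 + \<rho>" if "j < K" for j
  proof -
    have "h * (real j + 1) \<le> h * real K" using that h by (intro mult_left_mono) auto
    then show ?thesis using K by (simp add: l_def h_def)
  qed
  have gap: "h \<le> \<bar>l i - l j\<bar>" if "i \<noteq> j" for i j
  proof -
    have "1 \<le> \<bar>real i - real j\<bar>" using that by linarith
    then have "h * 1 \<le> h * \<bar>real i - real j\<bar>" using h by (intro mult_left_mono) auto
    also have "\<dots> = \<bar>l i - l j\<bar>" using h by (simp add: l_def abs_mult[symmetric] right_diff_distrib[symmetric]) (simp add: abs_mult)
    finally show ?thesis by simp
  qed
  define \<delta> where "\<delta> = h / (4 * real K)"
  have \<delta>: "0 < \<delta>" using h K by (simp add: \<delta>_def)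
  have "norm (\<integral>x. v x * \<psi> x \<partial>lborel) \<le> \<epsilon>"
    if v: "lap_pair v L" "nsq v \<le> 1" and f\<delta>: "nsq (\<lambda>x. L x + v x) \<le> \<delta>\<^sup>2" for v L :: "real^'n \<Rightarrow> complex"
  proof -
    let ?f = "\<lambda>x. L x + v x"
    have vL: "L2 v" "L2 L" using weak_pair_L2[OF v(1)] by auto
    have f: "L2 ?f" by (intro L2_add vL)
    define D where "D m u = (\<lambda>x. complex_of_real (m powr (CARD('n) / 2)) * u (0 + m *\<^sub>R x))" for m :: real and u :: "real^'n \<Rightarrow> complex"
    have D2: "L2 (D m u)" if "L2 u" "0 < m" for m u
      unfolding D_def using that by (intro L2_cmult L2_affine) auto
    have nD: "nsq (D m u) = nsq u" if m: "0 < m" for m u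
    proof -
      have "(m powr (CARD('n) / 2))\<^sup>2 = m ^ CARD('n)"
        using powr_realpow[OF m, of "CARD('n)"] by (simp add: power2_eq_square powr_add[symmetric])
      then show ?thesis unfolding D_def using m
        by (simp only: nsq_cmult nsq_affine[OF less_imp_neq[OF m, symmetric]]) simp
    qed
    have Dlap: "lap_pair (D m v) (\<lambda>x. of_real (m\<^sup>2) * (D m ?f x - D m v x))" if m: "0 < m" for m
    proof -
      have "lap_pair (D m v) (\<lambda>x. of_real (m powr (CARD('n) / 2)) * (of_real (m\<^sup>2) * L (0 + m *\<^sub>R x)))"
        unfolding D_def using m v(1) by (intro weak_pair_cmult lap_pair_affine) auto
      moreover have "(\<lambda>x. of_real (m powr (CARD('n) / 2)) * (of_real (m\<^sup>2) * L (0 + m *\<^sub>R x))) = (\<lambda>x. of_real (m\<^sup>2) * (D m ?f x - D m v x))"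
        by (simp add: D_def fun_eq_iff algebra_simps)
      ultimately show ?thesis by simp
    qed
    have off: "norm (\<integral>x. D (l i) v x * cnj (D (l j) v x) \<partial>lborel) \<le> 4 * \<delta> / h"
      if ij: "i < K" "j < K" "i \<noteq> j" for i j
    proof -
      let ?a = "l i" and ?b = "l j"
      have a: "0 < ?a" "1 < ?a" "?a \<le> 2" and b: "0 < ?b" "1 < ?b" "?b \<le> 2"
        using l1[of i] l1[of j] l2[OF ij(1)] l2[OF ij(2)] \<rho> by auto
      let ?X = "D ?a v" and ?Y = "\<lambda>x. cnj (D ?b v x)" and ?fX = "D ?a ?f" and ?fY = "\<lambda>x. cnj (D ?b ?f x)"
      have L: "L2 ?X" "L2 ?Y" "L2 ?fX" "L2 ?fY" using a b vL f by (auto intro!: D2 L2_cnj)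
      note i1 = L2_mult_integrable(2)[OF L(1,2)] and i2 = L2_mult_integrable(2)[OF L(3,2)] and i3 = L2_mult_integrable(2)[OF L(1,4)]
      \<comment> \<open>The dilate by \<open>a\<close> satisfies \<open>\<Delta> X = a\<^sup>2 (f - X)\<close>; moving the Laplacian to the other dilate gives
        \<open>(b\<^sup>2 - a\<^sup>2)\<close> times the inner product in terms of the small functions \<open>f\<close>.\<close>
      have e1: "(\<integral>x. of_real (?a\<^sup>2) * (?fX x - ?X x) * ?Y x \<partial>lborel) = of_real 1 * (\<integral>x. ?X x * cnj (of_real (?b\<^sup>2) * (D ?b ?f x - D ?b v x)) \<partial>lborel)"
        by (rule weak_pair_integration_by_parts[OF translation_op_laplacian Dlap[OF a(1)]
              weak_pair_cnj[OF translation_op_laplacian Dlap[OF b(1)]]])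
      have e2: "(\<integral>x. of_real (?a\<^sup>2) * (?fX x - ?X x) * ?Y x \<partial>lborel) = of_real (?a\<^sup>2) * ((\<integral>x. ?fX x * ?Y x \<partial>lborel) - (\<integral>x. ?X x * ?Y x \<partial>lborel))"
        unfolding Bochner_Integration.integral_diff[OF i2 i1, symmetric] integral_mult_right_zero[symmetric]
        by (intro Bochner_Integration.integral_cong) (auto simp: algebra_simps)
      have e3: "(\<integral>x. ?X x * cnj (of_real (?b\<^sup>2) * (D ?b ?f x - D ?b v x)) \<partial>lborel) = of_real (?b\<^sup>2) * ((\<integral>x. ?X x * ?fY x \<partial>lborel) - (\<integral>x. ?X x * ?Y x \<partial>lborel))"
        unfolding Bochner_Integration.integral_diff[OF i3 i1, symmetric] integral_mult_right_zero[symmetric]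
        by (intro Bochner_Integration.integral_cong) (auto simp: algebra_simps)
      have alg: "(B - A) * Q = B * R - A * P" if "A * (P - Q) = B * (R - Q)" for A B P Q R :: complex
        using that by (simp add: algebra_simps)
      have eq: "of_real (?b\<^sup>2 - ?a\<^sup>2) * (\<integral>x. ?X x * ?Y x \<partial>lborel) = of_real (?b\<^sup>2) * (\<integral>x. ?X x * ?fY x \<partial>lborel) - of_real (?a\<^sup>2) * (\<integral>x. ?fX x * ?Y x \<partial>lborel)"
        unfolding of_real_diff by (rule alg) (use e1 in \<open>simp only: e2 e3 of_real_1 mult_1_left\<close>)
      have sv: "sqrt (nsq v) \<le> 1" "0 \<le> sqrt (nsq v)" using v(2) nsq_nonneg[of v] by auto
      have sf: "sqrt (nsq ?f) \<le> \<delta>" "0 \<le> sqrt (nsq ?f)" using f\<delta> \<delta> nsq_nonneg[of ?f] by (auto intro: real_le_lsqrt)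
      have n1: "norm (\<integral>x. ?X x * ?fY x \<partial>lborel) \<le> 1 * \<delta>"
        by (rule order_trans[OF L2_Cauchy_Schwarz_norm[OF L(1,4), unfolded nsq_cnj nD[OF a(1)] nD[OF b(1)]]
              mult_mono[OF sv(1) sf(1)]]) (use sf in auto)
      have n2: "norm (\<integral>x. ?fX x * ?Y x \<partial>lborel) \<le> \<delta> * 1"
        by (rule order_trans[OF L2_Cauchy_Schwarz_norm[OF L(3,2), unfolded nsq_cnj nD[OF a(1)] nD[OF b(1)]]
              mult_mono[OF sf(1) sv(1)]]) (use sv \<delta> in auto)
      have ab4: "?a\<^sup>2 \<le> 4" "?b\<^sup>2 \<le> 4" using power_mono[OF a(3), of 2] power_mono[OF b(3), of 2] a b by auto
      have "\<bar>?b\<^sup>2 - ?a\<^sup>2\<bar> * norm (\<integral>x. ?X x * ?Y x \<partial>lborel) = norm (of_real (?b\<^sup>2 - ?a\<^sup>2) * (\<integral>x. ?X x * ?Y x \<partial>lborel))"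
        by (simp only: norm_mult norm_of_real)
      also have "\<dots> \<le> norm (of_real (?b\<^sup>2) * (\<integral>x. ?X x * ?fY x \<partial>lborel)) + norm (of_real (?a\<^sup>2) * (\<integral>x. ?fX x * ?Y x \<partial>lborel))"
        unfolding eq by (rule norm_triangle_ineq4)
      also have "\<dots> \<le> 4 * (1 * \<delta>) + 4 * (\<delta> * 1)"
        unfolding norm_mult norm_of_real using ab4 n1 n2 by (intro add_mono mult_mono) auto
      finally have up: "\<bar>?b\<^sup>2 - ?a\<^sup>2\<bar> * norm (\<integral>x. ?X x * ?Y x \<partial>lborel) \<le> 8 * \<delta>" by simp
      have "2 * h \<le> \<bar>?b - ?a\<bar> * (?b + ?a)"
        using mult_mono[OF gap[of j i] _ , of 2 "?b + ?a"] ij(3) a b h by (simp add: mult.commute)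
      also have "\<dots> = \<bar>?b\<^sup>2 - ?a\<^sup>2\<bar>"
        using a b by (simp add: power2_eq_square square_diff_square_factored abs_mult mult.commute)
      finally have "2 * h * norm (\<integral>x. ?X x * ?Y x \<partial>lborel) \<le> \<bar>?b\<^sup>2 - ?a\<^sup>2\<bar> * norm (\<integral>x. ?X x * ?Y x \<partial>lborel)"
        by (rule mult_right_mono) simp
      with up have "2 * h * norm (\<integral>x. ?X x * ?Y x \<partial>lborel) \<le> 8 * \<delta>" by linarith
      then show ?thesis using h by (simp add: field_simps)
    qed
    let ?W = "\<lambda>x. \<Sum>i<K. D (l i) v x"
    have DL: "L2 (D (l i) v)" for i using l1[of i] by (intro D2 vL) simp
    have "nsq ?W \<le> real K + (real K)\<^sup>2 * (4 * \<delta> / h)"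
    proof (rule nsq_sum_le[OF DL _ off])
      show "nsq (D (l i) v) \<le> 1" for i using nD[of "l i" v] l1[of i] v(2) by simp
      show "0 \<le> 4 * \<delta> / h" using \<delta> h by simp
    qed
    also have "(real K)\<^sup>2 * (4 * \<delta> / h) = real K" using h K by (simp add: \<delta>_def power2_eq_square)
    finally have W: "nsq ?W \<le> 2 * real K" by simp
    have W2: "L2 ?W" by (intro L2_sum DL)
    have "norm (\<integral>x. ?W x * \<psi> x \<partial>lborel) \<le> sqrt (nsq ?W) * sqrt (nsq \<psi>)"
      by (rule L2_Cauchy_Schwarz_norm[OF W2 \<psi>2])
    also have "\<dots> \<le> sqrt (2 * real K) * sqrt (real K * \<epsilon>\<^sup>2 / 8)"
      using W K8 by (intro mult_mono) (auto simp: nsq_nonneg)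
    also have "\<dots> = real K * \<epsilon> / 2"
    proof -
      have "2 * real K * (real K * \<epsilon>\<^sup>2 / 8) = (real K * \<epsilon> / 2)\<^sup>2" by (simp add: power2_eq_square)
      then show ?thesis using K \<epsilon> by (simp only: real_sqrt_mult[symmetric] real_sqrt_abs) simp
    qed
    finally have up: "norm (\<integral>x. ?W x * \<psi> x \<partial>lborel) \<le> real K * \<epsilon> / 2" .
    have each: "norm ((\<integral>x. D (l i) v x * \<psi> x \<partial>lborel) - (\<integral>x. v x * \<psi> x \<partial>lborel)) \<le> \<epsilon> / 2" if "i < K" for i
    proof -
      let ?a = "l i"
      have a: "0 < ?a" using l1[of i] by simp
      let ?\<psi>' = "\<lambda>x. of_real (?a powr (- CARD('n) / 2)) * \<psi> (x /\<^sub>R ?a)"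
      have \<psi>': "L2 ?\<psi>'" using L2_cmult[OF L2_affine[of "inverse ?a" \<psi> 0]] \<psi>2 a by simp
      have "(\<integral>x. D ?a v x * \<psi> x \<partial>lborel) = (\<integral>x. v x * ?\<psi>' x \<partial>lborel)"
      proof -
        let ?g = "\<lambda>x. complex_of_real (?a powr (CARD('n) / 2)) * (v x * \<psi> (x /\<^sub>R ?a))"
        have "(\<integral>x. D ?a v x * \<psi> x \<partial>lborel) = (\<integral>x. ?g (0 + ?a *\<^sub>R x) \<partial>lborel)"
          using a by (simp add: D_def mult.assoc)
        also have "\<dots> = (\<integral>x. ?g x \<partial>lborel) /\<^sub>R \<bar>?a\<bar> ^ DIM(real^'n)"
          using a by (intro lborel_integral_affine) simp
        also have "\<dots> = of_real (?a powr (CARD('n) / 2) / ?a ^ CARD('n)) * (\<integral>x. v x * \<psi> (x /\<^sub>R ?a) \<partial>lborel)"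
        proof -
          have "(of_real c * z) /\<^sub>R \<bar>?a\<bar> ^ m = of_real (c / ?a ^ m) * z" for c m and z :: complex
            using a by (simp add: scaleR_conv_of_real field_simps)
          then show ?thesis by (simp only: integral_mult_right_zero DIM_cart DIM_real mult_1_right)
        qed
        also have "?a powr (CARD('n) / 2) / ?a ^ CARD('n) = ?a powr (- CARD('n) / 2)"
          using a powr_realpow[OF a, of "CARD('n)"] powr_diff[of ?a "CARD('n) / 2" "CARD('n)"] by (simp add: field_simps)
        also have "of_real (?a powr (- CARD('n) / 2)) * (\<integral>x. v x * \<psi> (x /\<^sub>R ?a) \<partial>lborel) = (\<integral>x. v x * ?\<psi>' x \<partial>lborel)"
          by (simp only: mult.left_commute[of "v _"] integral_mult_right_zero)
        finally show ?thesis .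
      qed
      then have "(\<integral>x. v x * \<psi> x \<partial>lborel) - (\<integral>x. D ?a v x * \<psi> x \<partial>lborel) = (\<integral>x. v x * (\<psi> x - ?\<psi>' x) \<partial>lborel)"
        using L2_mult_integrable(2)[OF vL(1) \<psi>2] L2_mult_integrable(2)[OF vL(1) \<psi>']
        by (simp only: right_diff_distrib Bochner_Integration.integral_diff)
      also have "norm \<dots> \<le> sqrt (nsq v) * sqrt (nsq (\<lambda>x. \<psi> x - ?\<psi>' x))"
      proof (rule L2_Cauchy_Schwarz_norm[OF vL(1)])
        show "L2 (\<lambda>x. \<psi> x - ?\<psi>' x)" using L2_add[OF \<psi>2 L2_cmult[OF \<psi>', of "-1"]] by simp
      qed
      also have "\<dots> \<le> 1 * (\<epsilon> / 2)"
        using close[OF l1 l2[OF that]] v(2) \<epsilon> nsq_nonneg by (intro mult_mono real_le_lsqrt) auto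
      finally show ?thesis by (simp add: norm_minus_commute)
    qed
    have "(\<integral>x. ?W x * \<psi> x \<partial>lborel) = (\<Sum>i<K. \<integral>x. D (l i) v x * \<psi> x \<partial>lborel)"
      unfolding sum_distrib_right by (intro Bochner_Integration.integral_sum L2_mult_integrable DL \<psi>2)
    then have "of_nat K * (\<integral>x. v x * \<psi> x \<partial>lborel) = (\<integral>x. ?W x * \<psi> x \<partial>lborel) - (\<Sum>i<K. (\<integral>x. D (l i) v x * \<psi> x \<partial>lborel) - (\<integral>x. v x * \<psi> x \<partial>lborel))"
      by (simp add: sum_subtractf)
    then have "norm (of_nat K * (\<integral>x. v x * \<psi> x \<partial>lborel)) \<le> norm (\<integral>x. ?W x * \<psi> x \<partial>lborel) + norm (\<Sum>i<K. (\<integral>x. D (l i) v x * \<psi> x \<partial>lborel) - (\<integral>x. v x * \<psi> x \<partial>lborel))"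
      by (simp only: norm_triangle_ineq4)
    also have "\<dots> \<le> real K * \<epsilon> / 2 + (\<Sum>i<K. \<epsilon> / 2)"
      using each by (intro add_mono up order_trans[OF norm_sum] sum_mono) auto
    finally have "real K * norm (\<integral>x. v x * \<psi> x \<partial>lborel) \<le> real K * \<epsilon>" by (simp add: norm_mult mult.commute)
    then show ?thesis using K by simp
  qed
  with \<delta> show ?thesis by blast
qed

text \<open>The hypotheses are invariant under translations, so the bound for one kernel holds for all its translates.\<close>

lemma average_vanishing:
  assumes r: "0 < r" and \<epsilon>: "0 < \<epsilon>"
  shows "\<exists>\<delta>>0. \<forall>v L :: real^'n::finite \<Rightarrow> complex. lap_pair v L \<and> nsq v \<le> 1 \<and> nsq (\<lambda>x. L x + v x) \<le> \<delta>\<^sup>2 \<longrightarrow>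
     (\<forall>y. norm (average r v y) \<le> \<epsilon>)"
proof -
  let ?m = "\<lambda>z :: real^'n. complex_of_real (mollifier r z)"
  obtain \<delta> where \<delta>: "0 < \<delta>" "\<And>v L :: real^'n \<Rightarrow> complex. lap_pair v L \<Longrightarrow> nsq v \<le> 1 \<Longrightarrow> nsq (\<lambda>x. L x + v x) \<le> \<delta>\<^sup>2 \<Longrightarrow>
     norm (\<integral>x. v x * ?m x \<partial>lborel) \<le> \<epsilon>"
    using weak_vanishing[OF test_function_ccs[OF test_function_mollifier[OF r]] \<epsilon>, where 'n='n] by blast
  have "norm (average r v y) \<le> \<epsilon>"
    if v: "lap_pair v L" "nsq v \<le> 1" "nsq (\<lambda>x. L x + v x) \<le> \<delta>\<^sup>2" for v L :: "real^'n \<Rightarrow> complex" and y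
  proof -
    have "lap_pair (\<lambda>x. v (x + y)) (\<lambda>x. L (x + y))"
      using lap_pair_affine[OF v(1), of 1 y] by (simp add: add.commute)
    moreover have "average r v y = (\<integral>x. v (x + y) * ?m x \<partial>lborel)"
      unfolding average_def using lborel_integral_shift[of "\<lambda>x. v x * ?m (x - y)" y] by simp
    ultimately show ?thesis
      using \<delta>(2)[of "\<lambda>x. v (x + y)" "\<lambda>x. L (x + y)"] v(2,3) nsq_shift[of v y] nsq_shift[of "\<lambda>x. L x + v x" y] by simp
  qed
  with \<delta>(1) show ?thesis by blast
qed

text \<open>Small averages make the level sets small, while a bound in a higher Lebesgue space controls
  what happens on them.\<close>

lemma Lp_vanishing:
  fixes p :: real
  assumes p: "2 < p" and crit: "5 \<le> CARD('n::finite) \<longrightarrow> p < 2 * real CARD('n) / (real CARD('n) - 4)"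
    and \<epsilon>: "0 < \<epsilon>"
  shows "\<exists>\<delta>>0. \<forall>v L :: real^'n \<Rightarrow> complex. lap_pair v L \<and> nsq v \<le> 1 \<and> nsq (\<lambda>x. L x + v x) \<le> \<delta>\<^sup>2 \<longrightarrow>
     (\<integral>x. norm (v x) powr p \<partial>lborel) \<le> \<epsilon>"
proof -
  obtain q where q: "p < q" "5 \<le> CARD('n) \<longrightarrow> q < 2 * real CARD('n) / (real CARD('n) - 4)"
  proof (cases "5 \<le> CARD('n)")
    case True
    with crit dense[of p "2 * real CARD('n) / (real CARD('n) - 4)"] that show ?thesis by blast
  next
    case False
    with that[of "p + 1"] show ?thesis by simp
  qed
  have bdd: "Lp_bounded TYPE('n) q" using p q by (intro Lp_bounded_subcritical) auto
  then obtain C0 where C0: "0 \<le> C0" "\<And>v L :: real^'n \<Rightarrow> complex. lap_pair v L \<Longrightarrow> nsq v \<le> 1 \<Longrightarrow> nsq L \<le> 1 \<Longrightarrow>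
     integrable lborel (\<lambda>x. norm (v x) powr q) \<and> (\<integral>x. norm (v x) powr q \<partial>lborel) \<le> C0"
    unfolding Lp_bounded_def by blast
  define C where "C = 2 powr q * C0 + 1"
  have C: "0 < C" using C0(1) by (simp add: C_def add_nonneg_pos)
  \<comment> \<open>Three parts of size \<open>\<epsilon> / 3\<close>: values below \<open>2 \<nu>\<close> are controlled by the square integral, values above by
    \<open>\<theta>\<close> times the \<open>q\<close>-th power plus the constant \<open>T\<close>, and the latter only matters on the level set, which is
    small for the chosen scale \<open>r\<close>.\<close>
  define \<theta> where "\<theta> = \<epsilon> / (3 * C)"
  have \<theta>: "0 < \<theta>" using \<epsilon> C by (simp add: \<theta>_def)
  define T where "T = \<theta> powr (- p / (q - p))"
  have T: "0 < T" using \<theta> by (simp add: T_def)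
  define \<nu> where "\<nu> = (\<epsilon> / 3) powr (1 / (p - 2)) / 2"
  have \<nu>: "0 < \<nu>" using \<epsilon> by (simp add: \<nu>_def)
  have \<nu>p: "(2 * \<nu>) powr (p - 2) = \<epsilon> / 3" using \<epsilon> p by (simp add: \<nu>_def powr_powr)
  let ?c = "mollifier_const TYPE('n)"
  have c0: "0 \<le> ?c" by (rule mollifier_const_nonneg)
  define B where "B = 4 * ?c\<^sup>2 * T / \<nu>\<^sup>2 + 1"
  have B: "0 < B" unfolding B_def using T by (intro add_nonneg_pos divide_nonneg_nonneg mult_nonneg_nonneg) auto
  define r where "r = min 1 (\<epsilon> / (3 * B))"
  have r: "0 < r" "r \<le> 1" "r \<le> \<epsilon> / (3 * B)" using \<epsilon> B by (auto simp: r_def)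
  obtain \<delta>0 where \<delta>0: "0 < \<delta>0" "\<And>v L :: real^'n \<Rightarrow> complex. lap_pair v L \<Longrightarrow> nsq v \<le> 1 \<Longrightarrow> nsq (\<lambda>x. L x + v x) \<le> \<delta>0\<^sup>2 \<Longrightarrow>
     (\<forall>y. norm (average r v y) \<le> \<nu>)"
    using average_vanishing[OF r(1) \<nu>, where 'n='n] by blast
  define \<delta> where "\<delta> = min 1 \<delta>0"
  have \<delta>: "0 < \<delta>" "\<delta> \<le> 1" "\<delta> \<le> \<delta>0" using \<delta>0(1) by (auto simp: \<delta>_def)
  have "(\<integral>x. norm (v x) powr p \<partial>lborel) \<le> \<epsilon>"
    if v: "lap_pair v L" "nsq v \<le> 1" and f: "nsq (\<lambda>x. L x + v x) \<le> \<delta>\<^sup>2" for v L :: "real^'n \<Rightarrow> complex"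
  proof -
    have vL: "L2 v" "L2 L" using weak_pair_L2[OF v(1)] by auto
    have [measurable]: "v \<in> borel_measurable borel" using vL(1) by (rule L2_measurable)
    have d2: "\<delta>\<^sup>2 \<le> 1" "\<delta>\<^sup>2 \<le> \<delta>0\<^sup>2" using \<delta> power_mono[of \<delta> 1 2] power_mono[of \<delta> \<delta>0 2] by auto
    have "nsq L \<le> (\<integral>x. 2 * (norm (L x + v x))\<^sup>2 + 2 * (norm (v x))\<^sup>2 \<partial>lborel)"
      unfolding nsq_def
    proof (rule integral_mono)
      show "integrable lborel (\<lambda>x. (norm (L x))\<^sup>2)" using vL(2) by (simp add: L2_def)
      show "integrable lborel (\<lambda>x. 2 * (norm (L x + v x))\<^sup>2 + 2 * (norm (v x))\<^sup>2)"
        using vL(1) L2_add[OF vL(2,1)] by (simp add: L2_def)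
      show "(norm (L x))\<^sup>2 \<le> 2 * (norm (L x + v x))\<^sup>2 + 2 * (norm (v x))\<^sup>2" for x
        using norm_add_square_le[of "L x + v x" "- v x"] by simp
    qed
    also have "\<dots> = 2 * nsq (\<lambda>x. L x + v x) + 2 * nsq v"
      using vL(1) L2_add[OF vL(2,1)] by (simp add: L2_def nsq_def)
    finally have L4: "nsq L \<le> 4" using f d2(1) v(2) by linarith
    have half: "norm (of_real (1/2) * v x) powr q = (1/2) powr q * norm (v x) powr q" for x
      by (simp add: norm_mult powr_divide)
    have "nsq (\<lambda>x. of_real (1/2) * v x) \<le> 1" "nsq (\<lambda>x. of_real (1/2) * L x) \<le> 1"
      unfolding nsq_cmult using v(2) L4 by (simp_all add: power2_eq_square)
    then have qb: "integrable lborel (\<lambda>x. norm (of_real (1/2) * v x) powr q)" "(\<integral>x. norm (of_real (1/2) * v x) powr q \<partial>lborel) \<le> C0"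
      using C0(2)[OF weak_pair_cmult[OF v(1), of "of_real (1/2)"]] by auto
    have qi: "integrable lborel (\<lambda>x. norm (v x) powr q)" by (rule Lp_integrable[OF bdd v(1)])
    have "(1/2) powr q * (\<integral>x. norm (v x) powr q \<partial>lborel) \<le> C0"
      using qb(2) unfolding half by simp
    then have "2 powr q * ((1/2) powr q * (\<integral>x. norm (v x) powr q \<partial>lborel)) \<le> 2 powr q * C0"
      by (rule mult_left_mono) simp
    moreover have "2 powr q * ((1/2) powr q * X) = X" for X :: real
      by (simp add: powr_divide)
    ultimately have qC: "(\<integral>x. norm (v x) powr q \<partial>lborel) \<le> C" by (simp add: C_def)
    define S where "S = {x. 2 * \<nu> < norm (v x)}"
    have S: "S \<in> sets lborel" "emeasure lborel S < \<infinity>"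
      using level_set_finite[OF vL(1), of "2 * \<nu>"] \<nu> by (auto simp: S_def)
    have iS: "integrable lborel (indicator S :: real^'n \<Rightarrow> real)" using S by (intro integrable_real_indicator)
    have "measure lborel S \<le> (?c * r\<^sup>2)\<^sup>2 * nsq L / \<nu>\<^sup>2"
      unfolding S_def using \<delta>0(2)[OF v order_trans[OF f d2(2)]] by (intro level_set_bound[OF v(1) r(1) \<nu>]) blast
    also have "\<dots> \<le> (?c * r\<^sup>2)\<^sup>2 * 4 / \<nu>\<^sup>2" using L4 by (intro divide_right_mono mult_left_mono) auto
    finally have "T * measure lborel S \<le> T * ((?c * r\<^sup>2)\<^sup>2 * 4 / \<nu>\<^sup>2)" using T by (intro mult_left_mono) auto
    also have "\<dots> = (4 * ?c\<^sup>2 * T / \<nu>\<^sup>2) * r ^ 4"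
      by (simp add: power_mult_distrib flip: power_mult)
    also have "\<dots> \<le> B * r"
    proof (rule mult_mono)
      show "r ^ 4 \<le> r" using r power_decreasing[of 1 4 r] by simp
    qed (use B r in \<open>auto simp: B_def\<close>)
    also have "\<dots> \<le> \<epsilon> / 3" using r(3) B by (simp add: field_simps)
    finally have TS: "T * measure lborel S \<le> \<epsilon> / 3" .
    have pw: "t powr p \<le> (2 * \<nu>) powr (p - 2) * t\<^sup>2 + (\<theta> * t powr q + T * (if 2 * \<nu> < t then 1 else 0))" if t: "0 \<le> t" for t
    proof (cases "2 * \<nu> < t")
      case False
      have "t powr p = t powr (p - 2) * t\<^sup>2"
        using t by (cases "t = 0") (simp_all add: powr_numeral[symmetric] powr_add[symmetric] del: powr_numeral)
      also have "\<dots> \<le> (2 * \<nu>) powr (p - 2) * t\<^sup>2" using False t p by (intro mult_right_mono powr_mono2) auto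
      finally show ?thesis using False \<theta> by (simp add: add_increasing2)
    next
      case True
      then have t0: "0 < t" using \<nu> by linarith
      have "t powr p \<le> \<theta> * t powr q + T"
      proof (cases "1 \<le> \<theta> * t powr (q - p)")
        case True
        have "t powr p * 1 \<le> t powr p * (\<theta> * t powr (q - p))" using True by (intro mult_left_mono) auto
        also have "\<dots> = \<theta> * t powr q" using t0 by (simp add: mult.left_commute powr_add[symmetric])
        finally show ?thesis using T by simp
      next
        case False
        then have "t powr (q - p) \<le> 1 / \<theta>" using \<theta> by (simp add: field_simps)
        then have "(t powr (q - p)) powr (p / (q - p)) \<le> (1 / \<theta>) powr (p / (q - p))"
          using p q by (intro powr_mono2) auto
        moreover have "(t powr (q - p)) powr (p / (q - p)) = t powr p" using q by (simp add: powr_powr)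
        moreover have "(1 / \<theta>) powr (p / (q - p)) = T" using \<theta> unfolding T_def
          by (simp add: powr_divide powr_minus_divide)
        ultimately have "t powr p \<le> T" by simp
        then show ?thesis using \<theta> by (simp add: add_increasing)
      qed
      then show ?thesis using True by (simp add: add_increasing)
    qed
    let ?h = "\<lambda>x. (2 * \<nu>) powr (p - 2) * (norm (v x))\<^sup>2 + (\<theta> * norm (v x) powr q + T * indicator S x)"
    have hi: "integrable lborel ?h" using vL(1) qi iS by (simp add: L2_def)
    have "(\<integral>x. norm (v x) powr p \<partial>lborel) \<le> (\<integral>x. ?h x \<partial>lborel)"
    proof (rule integral_mono[OF _ hi])
      show "integrable lborel (\<lambda>x. norm (v x) powr p)"
        using p q by (intro Lp_between(1)[OF vL(1) _ _ qi]) auto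
      show "norm (v x) powr p \<le> ?h x" for x using pw[of "norm (v x)"]
        by (cases "2 * \<nu> < norm (v x)") (simp_all add: S_def indicator_def)
    qed
    also have "\<dots> = (2 * \<nu>) powr (p - 2) * nsq v + (\<theta> * (\<integral>x. norm (v x) powr q \<partial>lborel) + T * measure lborel S)"
      using vL(1) qi iS S by (simp add: L2_def nsq_def)
    also have "\<dots> \<le> \<epsilon> / 3 * 1 + (\<theta> * C + \<epsilon> / 3)"
      using v(2) qC TS \<theta> \<epsilon> unfolding \<nu>p by (intro add_mono mult_left_mono) auto
    also have "\<dots> = \<epsilon>" using C by (simp add: \<theta>_def field_simps)
    finally show ?thesis .
  qed
  with \<delta>(1) show ?thesis by blast
qed

section \<open>Sobolev functions as weak pairs\<close>

text \<open>Iterated integrals involve \<open>v (x - y)\<close> as a function on the product, which is measurable for Borel \<open>v\<close>;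
  Sobolev functions are only Lebesgue measurable and are therefore replaced by Borel representatives.\<close>

abbreviation represents :: "('a::euclidean_space \<Rightarrow> 'b::euclidean_space) \<Rightarrow> ('a \<Rightarrow> 'b) \<Rightarrow> bool" where
  "represents g f \<equiv> g \<in> borel_measurable borel \<and> (AE x in lebesgue. f x = g x)"

lemma represents_measurable:
  assumes "represents g f" shows "f \<in> borel_measurable lebesgue"
proof -
  have "g \<in> borel_measurable lebesgue" using assms by (intro measurable_completion) simp
  then show ?thesis using assms by (intro borel_measurable_AE[of g f]) (auto elim: eventually_mono)
qed

lemma represents_integral:
  assumes "represents g f"
  shows "(\<integral>x. f x \<partial>lebesgue) = (\<integral>x. g x \<partial>lborel)" "integrable lebesgue f \<longleftrightarrow> integrable lborel g"
proof -
  have g: "g \<in> borel_measurable lebesgue" "g \<in> borel_measurable lborel"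
    using assms by (auto intro: measurable_completion)
  have ae: "AE x in lebesgue. f x = g x" using assms by simp
  note f = represents_measurable[OF assms]
  show "(\<integral>x. f x \<partial>lebesgue) = (\<integral>x. g x \<partial>lborel)"
    using integral_cong_AE[OF f g(1) ae] integral_completion[OF g(2)] by simp
  show "integrable lebesgue f \<longleftrightarrow> integrable lborel g"
    using integrable_cong_AE[OF f g(1) ae] integrable_completion[OF g(2)] by simp
qed

lemma represents_comp:
  assumes "represents g f" and "(\<lambda>x. F x (g x)) \<in> borel_measurable borel"
  shows "represents (\<lambda>x. F x (g x)) (\<lambda>x. F x (f x))"
  using assms by (auto elim: eventually_mono)

lemma ex_represents:
  fixes f :: "'a::euclidean_space \<Rightarrow> complex"
  assumes "f \<in> borel_measurable lebesgue"
  shows "\<exists>g. represents g f"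
proof -
  have "(\<lambda>x. Re (f x)) \<in> borel_measurable lebesgue" "(\<lambda>x. Im (f x)) \<in> borel_measurable lebesgue"
    using assms by measurable
  then obtain a b where ab: "a \<in> borel_measurable lborel" "AE x in lborel. Re (f x) = a x"
      "b \<in> borel_measurable lborel" "AE x in lborel. Im (f x) = b x"
    using completion_ex_borel_measurable_real[of "\<lambda>x. Re (f x)" lborel]
      completion_ex_borel_measurable_real[of "\<lambda>x. Im (f x)" lborel] by blast
  have "AE x in lborel. f x = Complex (a x) (b x)"
    using ab(2,4) by eventually_elim (simp add: complex_eq_iff)
  moreover have "(\<lambda>x. Complex (a x) (b x)) \<in> borel_measurable borel"
    using ab(1,3) by (simp add: Complex_eq)
  ultimately show ?thesis by (intro exI[of _ "\<lambda>x. Complex (a x) (b x)"]) (auto intro: AE_completion)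
qed

lemma norm_powr_2: "norm x powr 2 = (norm x)\<^sup>2"
  by (simp add: powr_numeral)

lemma represents_L2:
  assumes "represents v u"
  shows "u \<in> Lp_space 2 \<longleftrightarrow> L2 v" "(Lp_norm 2 u)\<^sup>2 = nsq v" "Lp_norm 2 u = sqrt (nsq v)"
proof -
  have [measurable]: "v \<in> borel_measurable borel" using assms by simp
  have r: "represents (\<lambda>x. norm (v x) powr 2) (\<lambda>x. norm (u x) powr 2)"
    by (rule represents_comp[OF assms]) measurable
  show "u \<in> Lp_space 2 \<longleftrightarrow> L2 v"
    using represents_measurable[OF assms] represents_integral(2)[OF r]
    by (simp add: Lp_space_def L2_def norm_powr_2)
  have "(\<integral>x. norm (u x) powr 2 \<partial>lebesgue) = nsq v"
    using represents_integral(1)[OF r] by (simp add: nsq_def norm_powr_2)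
  then show "(Lp_norm 2 u)\<^sup>2 = nsq v" "Lp_norm 2 u = sqrt (nsq v)"
    using nsq_nonneg[of v] by (simp_all add: Lp_norm_def powr_half_sqrt)
qed

lemma Lp_space_2_representative:
  fixes u :: "real^'n::finite \<Rightarrow> complex"
  assumes "u \<in> Lp_space 2" obtains v where "represents v u" "L2 v"
proof -
  obtain v where "represents v u" using ex_represents[of u] assms by (auto simp: Lp_space_def)
  with represents_L2(1)[OF this] assms that show ?thesis by blast
qed

lemma locally_integrable_L2:
  assumes "u \<in> Lp_space 2" shows "locally_integrable u"
  unfolding locally_integrable_def set_integrable_def
proof (intro allI impI)
  fix K :: "(real^'a) set" assume K: "compact K"
  obtain v where v: "represents v u" "L2 v" using Lp_space_2_representative[OF assms] .
  have [measurable]: "v \<in> borel_measurable borel" "K \<in> sets borel" using v borel_compact[OF K] by auto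
  have r: "represents (\<lambda>x. indicator K x *\<^sub>R v x) (\<lambda>x. indicator K x *\<^sub>R u x)"
    by (rule represents_comp[OF v(1)]) measurable
  have "integrable lborel (indicator K :: real^'a \<Rightarrow> real)"
    using emeasure_bounded_finite[OF compact_imp_bounded[OF K]] by (intro integrable_real_indicator) auto
  then have "integrable lborel (\<lambda>x. indicator K x + (norm (v x))\<^sup>2)" using v(2) by (simp add: L2_def)
  then have "integrable lborel (\<lambda>x. indicator K x *\<^sub>R v x)"
  proof (rule Bochner_Integration.integrable_bound)
    show "AE x in lborel. norm (indicator K x *\<^sub>R v x) \<le> norm (indicator K x + (norm (v x))\<^sup>2)"
      using mult_le_add_squares[of 1 "norm (v _)"] by (intro AE_I2) (auto simp: indicator_def)
  qed measurable
  then show "integrable lebesgue (\<lambda>x. indicator K x *\<^sub>R u x)"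
    using represents_integral(2)[OF r] by simp
qed

lemma locally_integrable_measurable:
  assumes "locally_integrable u" shows "u \<in> borel_measurable lebesgue"
proof (rule borel_measurable_LIMSEQ_metric)
  show "(\<lambda>x. indicator (cball 0 (real n)) x *\<^sub>R u x) \<in> borel_measurable lebesgue" for n
    using assms unfolding locally_integrable_def set_integrable_def
    by (intro borel_measurable_integrable) simp
  fix x :: "real^'a"
  obtain N :: nat where "norm x \<le> real N" using real_arch_simple by blast
  then have "\<forall>\<^sub>F n in sequentially. u x = indicator (cball 0 (real n)) x *\<^sub>R u x"
    by (intro eventually_sequentiallyI[of N]) auto
  then show "(\<lambda>n. indicator (cball 0 (real n)) x *\<^sub>R u x) \<longlonglongrightarrow> u x"
    by (rule Lim_transform_eventually[OF tendsto_const])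
qed

lemma has_weak_partial_deriv_iff:
  assumes u: "represents v u" "L2 v" and g: "represents h g" "L2 h"
  shows "has_weak_partial_deriv i u g \<longleftrightarrow> weak_pair (-1) (partial_deriv i) v h"
proof -
  have [measurable]: "v \<in> borel_measurable borel" "h \<in> borel_measurable borel" using u g by auto
  have "locally_integrable u" "locally_integrable g"
    using represents_L2(1)[OF u(1)] represents_L2(1)[OF g(1)] u(2) g(2) by (auto intro: locally_integrable_L2)
  moreover have "(\<integral>x. u x * partial_deriv i \<phi> x \<partial>lebesgue) = (\<integral>x. v x * partial_deriv i \<phi> x \<partial>lborel)"
    "(\<integral>x. g x * \<phi> x \<partial>lebesgue) = (\<integral>x. h x * \<phi> x \<partial>lborel)" if "\<phi> \<in> test_functions" for \<phi>
  proof -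
    have [measurable]: "\<phi> \<in> borel_measurable borel" "partial_deriv i \<phi> \<in> borel_measurable borel"
      using that by (auto intro: ccs_measurable test_function_ccs test_function_partial_deriv)
    have r1: "represents (\<lambda>x. v x * partial_deriv i \<phi> x) (\<lambda>x. u x * partial_deriv i \<phi> x)"
      by (rule represents_comp[OF u(1)]) measurable
    have r2: "represents (\<lambda>x. h x * \<phi> x) (\<lambda>x. g x * \<phi> x)"
      by (rule represents_comp[OF g(1)]) measurable
    show "(\<integral>x. u x * partial_deriv i \<phi> x \<partial>lebesgue) = (\<integral>x. v x * partial_deriv i \<phi> x \<partial>lborel)"
      by (rule represents_integral(1)[OF r1])
    show "(\<integral>x. g x * \<phi> x \<partial>lebesgue) = (\<integral>x. h x * \<phi> x \<partial>lborel)"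
      by (rule represents_integral(1)[OF r2])
  qed
  ultimately show ?thesis
    using u(2) g(2) by (simp add: has_weak_partial_deriv_def weak_pair_def)
qed

lemma weak_partial_deriv_unique:
  fixes u g h :: "real^'n::finite \<Rightarrow> complex"
  assumes g: "has_weak_partial_deriv i u g" and h: "has_weak_partial_deriv i u h"
  shows "AE x in lebesgue. g x = h x"
proof -
  have li: "locally_integrable g" "locally_integrable h" using g h by (auto simp: has_weak_partial_deriv_def)
  obtain g' where g': "represents g' g"
    using ex_represents[OF locally_integrable_measurable[OF li(1)]] by blast
  obtain h' where h': "represents h' h"
    using ex_represents[OF locally_integrable_measurable[OF li(2)]] by blast
  have [measurable]: "g' \<in> borel_measurable borel" "h' \<in> borel_measurable borel" using g' h' by auto
  have loc: "integrable lborel (\<lambda>x. indicator (cball 0 R) x *\<^sub>R f' x)" if "represents f' f" "locally_integrable f"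
    for R and f f' :: "real^'n \<Rightarrow> complex"
  proof -
    have [measurable]: "f' \<in> borel_measurable borel" using that by simp
    have "represents (\<lambda>x. indicator (cball 0 R) x *\<^sub>R f' x) (\<lambda>x. indicator (cball 0 R) x *\<^sub>R f x)"
      by (rule represents_comp[OF that(1)]) (auto intro!: borel_measurable_scaleR borel_measurable_indicator)
    from represents_integral(2)[OF this] that(2) show ?thesis
      unfolding locally_integrable_def set_integrable_def by simp
  qed
  have "AE x in lborel. g' x - h' x = 0"
  proof (rule AE_zero_of_test_functions)
    show "integrable lborel (\<lambda>x. indicator (cball 0 R) x *\<^sub>R (g' x - h' x))" for R
      using loc[OF g' li(1), of R] loc[OF h' li(2), of R] by (simp add: scaleR_right_diff_distrib)
    fix \<phi> :: "real^'n \<Rightarrow> complex" assume \<phi>: "\<phi> \<in> test_functions"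
    have [measurable]: "\<phi> \<in> borel_measurable borel" using \<phi> by (intro ccs_measurable test_function_ccs)
    obtain R where R: "\<And>x. R \<le> norm x \<Longrightarrow> \<phi> x = 0" using \<phi> by (auto simp: test_functions_iff)
    obtain M where M: "0 < M" "\<And>x. norm (\<phi> x) \<le> M" using ccs_bounded[OF test_function_ccs[OF \<phi>]] by metis
    have int: "integrable lborel (\<lambda>x. f' x * \<phi> x)" if f: "represents f' f" "locally_integrable f"
      for f f' :: "real^'n \<Rightarrow> complex"
    proof (rule Bochner_Integration.integrable_bound)
      show "integrable lborel (\<lambda>x. M * norm (indicator (cball 0 R) x *\<^sub>R f' x))"
        by (intro integrable_mult_right integrable_norm loc[OF f])
      have [measurable]: "f' \<in> borel_measurable borel" using f(1) by simp
      show "(\<lambda>x. f' x * \<phi> x) \<in> borel_measurable lborel" by measurable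
      have "norm (f' x * \<phi> x) \<le> M * norm (indicator (cball 0 R) x *\<^sub>R f' x)" for x
        using R[of x] mult_left_mono[OF M(2)[of x] norm_ge_zero[of "f' x"]]
        by (cases "norm x \<le> R") (auto simp: norm_mult mult.commute)
      then show "AE x in lborel. norm (f' x * \<phi> x) \<le> norm (M * norm (indicator (cball 0 R) x *\<^sub>R f' x))"
        using M(1) by (intro AE_I2) (simp add: abs_mult)
    qed
    have eq: "(\<integral>x. f' x * \<phi> x \<partial>lborel) = (\<integral>x. f x * \<phi> x \<partial>lebesgue)" if "represents f' f" for f f' :: "real^'n \<Rightarrow> complex"
    proof -
      have [measurable]: "f' \<in> borel_measurable borel" using that by simp
      have "represents (\<lambda>x. f' x * \<phi> x) (\<lambda>x. f x * \<phi> x)"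
        by (rule represents_comp[OF that]) measurable
      from represents_integral(1)[OF this] show ?thesis by simp
    qed
    have "(\<integral>x. g x * \<phi> x \<partial>lebesgue) = (\<integral>x. h x * \<phi> x \<partial>lebesgue)"
      using g h \<phi> by (auto simp: has_weak_partial_deriv_def)
    then show "(\<integral>x. (g' x - h' x) * \<phi> x \<partial>lborel) = 0"
      using int[OF g' li(1)] int[OF h' li(2)] by (simp add: left_diff_distrib eq[OF g'] eq[OF h'])
  qed measurable
  then have "AE x in lebesgue. g' x = h' x" by (auto intro: AE_completion elim: eventually_mono)
  with g' h' show ?thesis by auto
qed

lemma Sobolev_H_imp_L2: "u \<in> Sobolev_H k \<Longrightarrow> u \<in> Lp_space 2"
  by (cases k) auto

lemma represents_trans_AE:
  "represents v u \<Longrightarrow> AE x in lebesgue. u x = w x \<Longrightarrow> represents v w"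
  by (auto elim: eventually_elim2)

lemma Sobolev_H_cong_AE:
  assumes u: "u \<in> Sobolev_H k" and ae: "AE x in lebesgue. u x = w x"
  shows "w \<in> Sobolev_H k"
proof -
  obtain v where v: "represents v u" "L2 v" using Lp_space_2_representative[OF Sobolev_H_imp_L2[OF u]] .
  have w: "represents v w" using represents_trans_AE[OF v(1) ae] .
  then have w2: "w \<in> Lp_space 2" using represents_L2(1) v(2) by blast
  show ?thesis
  proof (cases k)
    case 0 then show ?thesis using w2 by simp
  next
    case (Suc j)
    have "\<exists>g\<in>Sobolev_H j. has_weak_partial_deriv i w g" for i
    proof -
      from u Suc obtain g where g: "g \<in> Sobolev_H j" "has_weak_partial_deriv i u g" by auto
      obtain h where h: "represents h g" "L2 h" using Lp_space_2_representative[OF Sobolev_H_imp_L2[OF g(1)]] .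
      have "has_weak_partial_deriv i w g"
        using g(2) has_weak_partial_deriv_iff[OF v h] has_weak_partial_deriv_iff[OF w v(2) h] by simp
      with g(1) show ?thesis by blast
    qed
    with w2 Suc show ?thesis by simp
  qed
qed

lemma Sobolev_H_weak_partial_deriv:
  assumes "u \<in> Sobolev_H (Suc k)"
  shows "weak_partial_deriv i u \<in> Sobolev_H k" "has_weak_partial_deriv i u (weak_partial_deriv i u)"
proof -
  from assms obtain g where g: "g \<in> Sobolev_H k" "has_weak_partial_deriv i u g" by auto
  show w: "has_weak_partial_deriv i u (weak_partial_deriv i u)"
    unfolding weak_partial_deriv_def by (rule someI[of "\<lambda>g. has_weak_partial_deriv i u g", OF g(2)])
  show "weak_partial_deriv i u \<in> Sobolev_H k"
    by (rule Sobolev_H_cong_AE[OF g(1) weak_partial_deriv_unique[OF g(2) w]])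
qed

lemma Sobolev_H_add_cmult:
  "u \<in> Sobolev_H k \<Longrightarrow> w \<in> Sobolev_H k \<Longrightarrow> (\<lambda>x. a * u x + b * w x) \<in> Sobolev_H k"
proof (induction k arbitrary: u w)
  case 0
  obtain v where v1: "represents v u" "L2 v"
    using Lp_space_2_representative[OF Sobolev_H_imp_L2[OF 0(1)]] .
  obtain v' where v2: "represents v' w" "L2 v'"
    using Lp_space_2_representative[OF Sobolev_H_imp_L2[OF 0(2)]] .
  note v = v1 v2
  have r: "represents (\<lambda>x. a * v x + b * v' x) (\<lambda>x. a * u x + b * w x)" using v by (auto elim: eventually_elim2)
  have "L2 (\<lambda>x. a * v x + b * v' x)" by (intro L2_add L2_cmult v)
  with represents_L2(1)[OF r] show ?case by simp
next
  case (Suc k)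
  obtain v where v1: "represents v u" "L2 v"
    using Lp_space_2_representative[OF Sobolev_H_imp_L2[OF Suc.prems(1)]] .
  obtain v' where v2: "represents v' w" "L2 v'"
    using Lp_space_2_representative[OF Sobolev_H_imp_L2[OF Suc.prems(2)]] .
  note v = v1 v2
  have r: "represents (\<lambda>x. a * v x + b * v' x) (\<lambda>x. a * u x + b * w x)" using v by (auto elim: eventually_elim2)
  have l: "L2 (\<lambda>x. a * v x + b * v' x)" by (intro L2_add L2_cmult v)
  have "\<exists>g\<in>Sobolev_H k. has_weak_partial_deriv i (\<lambda>x. a * u x + b * w x) g" for i
  proof -
    obtain g where g1: "g \<in> Sobolev_H k" "has_weak_partial_deriv i u g"
      using Sobolev_H_weak_partial_deriv[OF Suc.prems(1)] by blast
    obtain g' where g2: "g' \<in> Sobolev_H k" "has_weak_partial_deriv i w g'"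
      using Sobolev_H_weak_partial_deriv[OF Suc.prems(2)] by blast
    note g = g1 g2
    obtain h where h1: "represents h g" "L2 h"
      using Lp_space_2_representative[OF Sobolev_H_imp_L2[OF g(1)]] .
    obtain h' where h2: "represents h' g'" "L2 h'"
      using Lp_space_2_representative[OF Sobolev_H_imp_L2[OF g(3)]] .
    note h = h1 h2
    have rg: "represents (\<lambda>x. a * h x + b * h' x) (\<lambda>x. a * g x + b * g' x)" using h by (auto elim: eventually_elim2)
    have lg: "L2 (\<lambda>x. a * h x + b * h' x)" by (intro L2_add L2_cmult h)
    have "weak_pair (-1) (partial_deriv i) v h" "weak_pair (-1) (partial_deriv i) v' h'"
      using g(2,4) has_weak_partial_deriv_iff[OF v(1,2) h(1,2)] has_weak_partial_deriv_iff[OF v(3,4) h(3,4)] by auto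
    then have "weak_pair (-1) (partial_deriv i) (\<lambda>x. a * v x + b * v' x) (\<lambda>x. a * h x + b * h' x)"
      by (intro weak_pair_add translation_op_partial_deriv weak_pair_cmult)
    then have "has_weak_partial_deriv i (\<lambda>x. a * u x + b * w x) (\<lambda>x. a * g x + b * g' x)"
      using has_weak_partial_deriv_iff[OF r l rg lg] by simp
    with Suc.IH[OF g(1,3)] show ?thesis by blast
  qed
  moreover have "(\<lambda>x. a * u x + b * w x) \<in> Lp_space 2" using represents_L2(1)[OF r] l by simp
  ultimately show ?case by simp
qed

lemma Sobolev_H_cmult: "u \<in> Sobolev_H k \<Longrightarrow> (\<lambda>x. a * u x) \<in> Sobolev_H k"
  using Sobolev_H_add_cmult[of u k u a 0] by simp

lemma represents_self: "f \<in> borel_measurable borel \<Longrightarrow> represents f f"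
  by simp

lemma test_function_weak_pair:
  assumes "\<phi> \<in> test_functions" shows "weak_pair (-1) (partial_deriv i) \<phi> (partial_deriv i \<phi>)"
  using assms test_function_integration_by_parts[OF assms]
  by (auto simp: weak_pair_def intro!: L2_ccs test_function_ccs test_function_partial_deriv)

lemma Sobolev_H_test_function: "\<phi> \<in> test_functions \<Longrightarrow> \<phi> \<in> Sobolev_H k"
proof (induction k arbitrary: \<phi>)
  case 0
  then have "L2 \<phi>" by (intro L2_ccs test_function_ccs)
  with represents_L2(1)[of \<phi> \<phi>] show ?case by (simp add: L2_def)
next
  case (Suc k)
  then have l: "L2 \<phi>" "L2 (partial_deriv i \<phi>)" for i
    by (auto intro!: L2_ccs test_function_ccs test_function_partial_deriv)
  have "has_weak_partial_deriv i \<phi> (partial_deriv i \<phi>)" for i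
    using has_weak_partial_deriv_iff[OF represents_self l(1) represents_self l(2), of i i]
      test_function_weak_pair[OF Suc.prems] l L2_measurable by blast
  moreover have "\<phi> \<in> Lp_space 2" using represents_L2(1)[OF represents_self[OF L2_measurable[OF l(1)]]] l(1) by blast
  ultimately show ?case using Suc.IH[OF test_function_partial_deriv[OF Suc.prems]] by auto
qed

text \<open>Green's identity in the second part recovers the norm of the gradient from \<open>v\<close> and its weak Laplacian; this
  makes the pair of these two functions sufficient for the energy.\<close>

lemma lap_pair_of_partial_derivs:
  assumes D: "\<And>i. weak_pair (-1) (partial_deriv i) v (D i)" and E: "\<And>i. weak_pair (-1) (partial_deriv i) (D i) (E i)"
  shows "lap_pair v (\<lambda>x. \<Sum>i\<in>UNIV. E i x)"
    and "of_real (\<Sum>i\<in>UNIV. nsq (D i)) = - (\<integral>x. (\<Sum>i\<in>UNIV. E i x) * cnj (v x) \<partial>lborel)"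
proof -
  have L: "L2 v" "L2 (D i)" "L2 (E i)" for i using weak_pair_L2[OF D] weak_pair_L2[OF E] by auto
  have "(\<integral>x. v x * laplacian \<phi> x \<partial>lborel) = (\<integral>x. (\<Sum>i\<in>UNIV. E i x) * \<phi> x \<partial>lborel)" if \<phi>: "\<phi> \<in> test_functions" for \<phi>
  proof -
    have t: "partial_deriv i \<phi> \<in> test_functions" "partial_deriv i (partial_deriv i \<phi>) \<in> test_functions" for i
      using \<phi> by (auto intro: test_function_partial_deriv)
    have i1: "integrable lborel (\<lambda>x. v x * partial_deriv i (partial_deriv i \<phi>) x)" "integrable lborel (\<lambda>x. E i x * \<phi> x)" for i
      by (rule L2_mult_integrable(2)[OF L(1) L2_ccs[OF test_function_ccs[OF t(2)]]])
         (rule L2_mult_integrable(2)[OF L(3) L2_ccs[OF test_function_ccs[OF \<phi>]]])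
    have "(\<integral>x. v x * laplacian \<phi> x \<partial>lborel) = (\<Sum>i\<in>UNIV. \<integral>x. v x * partial_deriv i (partial_deriv i \<phi>) x \<partial>lborel)"
      unfolding laplacian_def sum_distrib_left by (rule Bochner_Integration.integral_sum) (rule i1)
    also have "\<dots> = (\<Sum>i\<in>UNIV. \<integral>x. E i x * \<phi> x \<partial>lborel)"
      using D E t \<phi> by (intro sum.cong refl) (simp add: weak_pair_def)
    also have "\<dots> = (\<integral>x. (\<Sum>i\<in>UNIV. E i x) * \<phi> x \<partial>lborel)"
      unfolding sum_distrib_right by (rule Bochner_Integration.integral_sum[symmetric]) (rule i1)
    finally show ?thesis .
  qed
  then show "lap_pair v (\<lambda>x. \<Sum>i\<in>UNIV. E i x)" using L by (simp add: weak_pair_def L2_sum)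
  have "complex_of_real (nsq (D i)) = - (\<integral>x. E i x * cnj (v x) \<partial>lborel)" for i
  proof -
    have "(\<integral>x. E i x * cnj (v x) \<partial>lborel) = of_real (-1) * (\<integral>x. D i x * cnj (D i x) \<partial>lborel)"
      by (rule weak_pair_integration_by_parts[OF translation_op_partial_deriv E weak_pair_cnj[OF translation_op_partial_deriv D]])
    also have "(\<integral>x. D i x * cnj (D i x) \<partial>lborel) = of_real (nsq (D i))"
      unfolding nsq_def integral_complex_of_real[symmetric] by (simp only: complex_norm_square)
    finally show ?thesis by simp
  qed
  moreover have "(\<integral>x. (\<Sum>i\<in>UNIV. E i x) * cnj (v x) \<partial>lborel) = (\<Sum>i\<in>UNIV. \<integral>x. E i x * cnj (v x) \<partial>lborel)"
    unfolding sum_distrib_right by (intro Bochner_Integration.integral_sum L2_mult_integrable L L2_cnj)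
  ultimately show "of_real (\<Sum>i\<in>UNIV. nsq (D i)) = - (\<integral>x. (\<Sum>i\<in>UNIV. E i x) * cnj (v x) \<partial>lborel)"
    by (simp add: sum_negf)
qed

lemma lap_pair_test_function:
  assumes "\<phi> \<in> test_functions" shows "lap_pair \<phi> (laplacian \<phi>)"
proof -
  have "lap_pair \<phi> (\<lambda>x. \<Sum>i\<in>UNIV. partial_deriv i (partial_deriv i \<phi>) x)"
    by (rule lap_pair_of_partial_derivs(1)[OF test_function_weak_pair[OF assms]
          test_function_weak_pair[OF test_function_partial_deriv[OF assms]]])
  then show ?thesis by (simp add: laplacian_def[abs_def])
qed

lemma nsq_add:
  assumes f: "L2 f" and g: "L2 g"
  shows "nsq (\<lambda>x. f x + g x) = nsq f + nsq g + 2 * Re (\<integral>x. f x * cnj (g x) \<partial>lborel)"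
proof -
  have i: "integrable lborel (\<lambda>x. f x * cnj (g x))" by (intro L2_mult_integrable f L2_cnj g)
  define R where "R x = Re (f x * cnj (g x))" for x
  have R: "integrable lborel R" unfolding R_def using i by (rule integrable_Re)
  have "Re (\<integral>x. f x * cnj (g x) \<partial>lborel) = (\<integral>x. R x \<partial>lborel)"
    unfolding R_def by (rule integral_Re[OF i, symmetric])
  moreover have "(norm (f x + g x))\<^sup>2 = (norm (f x))\<^sup>2 + (norm (g x))\<^sup>2 + 2 * R x" for x unfolding R_def
    unfolding cmod_power2 by (simp add: power2_eq_square algebra_simps)
  ultimately show ?thesis
    using f g R by (simp add: nsq_def L2_def)
qed

lemma Sobolev_H_2_lap_pair:
  fixes u :: "real^'n::finite \<Rightarrow> complex"
  assumes u: "u \<in> Sobolev_H 2"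
  obtains v L where "represents v u" "represents L (weak_laplacian u)" "lap_pair v L"
    "(\<integral>x. (norm (weak_grad u x))\<^sup>2 \<partial>lebesgue) = - Re (\<integral>x. L x * cnj (v x) \<partial>lborel)"
proof -
  have u2: "u \<in> Sobolev_H (Suc (Suc 0))" using u by (simp add: numeral_2_eq_2)
  let ?d = "\<lambda>i. weak_partial_deriv i u" and ?e = "\<lambda>i. weak_partial_deriv i (weak_partial_deriv i u)"
  note d = Sobolev_H_weak_partial_deriv[OF u2]
  note e = Sobolev_H_weak_partial_deriv[OF d(1)]
  obtain v where v: "represents v u" "L2 v" using Lp_space_2_representative[OF Sobolev_H_imp_L2[OF u]] .
  have "\<forall>i. \<exists>D. represents D (?d i) \<and> L2 D" using Lp_space_2_representative[OF Sobolev_H_imp_L2[OF d(1)]] by metis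
  then obtain D where D: "\<And>i. represents (D i) (?d i)" "\<And>i. L2 (D i)" by metis
  have "\<forall>i. \<exists>E. represents E (?e i) \<and> L2 E" using Lp_space_2_representative[OF Sobolev_H_imp_L2[OF e(1)]] by metis
  then obtain E where E: "\<And>i. represents (E i) (?e i)" "\<And>i. L2 (E i)" by metis
  have wD: "weak_pair (-1) (partial_deriv i) v (D i)" for i
    using d(2)[of i] has_weak_partial_deriv_iff[OF v D(1)[of i] D(2)[of i]] by simp
  have wE: "weak_pair (-1) (partial_deriv i) (D i) (E i)" for i
    using e(2)[of i i] has_weak_partial_deriv_iff[OF D(1)[of i] D(2)[of i] E(1)[of i] E(2)[of i]] by simp
  note pairs = lap_pair_of_partial_derivs[OF wD wE]
  have rL: "represents (\<lambda>x. \<Sum>i\<in>UNIV. E i x) (weak_laplacian u)"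
  proof
    show "(\<lambda>x. \<Sum>i\<in>UNIV. E i x) \<in> borel_measurable borel" using E by (intro borel_measurable_sum) auto
    have "AE x in lebesgue. \<forall>i\<in>UNIV. ?e i x = E i x" using E by (subst AE_finite_all) auto
    then show "AE x in lebesgue. weak_laplacian u x = (\<Sum>i\<in>UNIV. E i x)"
      by eventually_elim (simp add: weak_laplacian_def)
  qed
  have "represents (\<lambda>x. \<Sum>i\<in>UNIV. (norm (D i x))\<^sup>2) (\<lambda>x. (norm (weak_grad u x))\<^sup>2)"
  proof
    show "(\<lambda>x. \<Sum>i\<in>UNIV. (norm (D i x))\<^sup>2) \<in> borel_measurable borel"
      using D by (intro borel_measurable_sum borel_measurable_power borel_measurable_norm) auto
    have "AE x in lebesgue. \<forall>i\<in>UNIV. ?d i x = D i x" using D by (subst AE_finite_all) auto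
    then show "AE x in lebesgue. (norm (weak_grad u x))\<^sup>2 = (\<Sum>i\<in>UNIV. (norm (D i x))\<^sup>2)"
      by eventually_elim (simp add: weak_grad_def norm_vec_def L2_set_def sum_nonneg)
  qed
  from represents_integral(1)[OF this]
  have "(\<integral>x. (norm (weak_grad u x))\<^sup>2 \<partial>lebesgue) = (\<Sum>i\<in>UNIV. nsq (D i))"
    using D(2) by (simp add: nsq_def L2_def)
  also have "\<dots> = Re (of_real (\<Sum>i\<in>UNIV. nsq (D i)))" by simp
  also have "\<dots> = - Re (\<integral>x. (\<Sum>i\<in>UNIV. E i x) * cnj (v x) \<partial>lborel)" unfolding pairs(2) by simp
  finally show ?thesis using that[OF v(1) rL pairs(1)] by blast
qed

lemma lap_pair_unique:
  fixes v L L' :: "real^'n::finite \<Rightarrow> complex"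
  assumes L: "lap_pair v L" and L': "lap_pair v' L'" and ae: "AE x in lebesgue. v x = v' x"
  shows "AE x in lebesgue. L x = L' x"
proof -
  note l = weak_pair_L2[OF L] weak_pair_L2[OF L']
  have ae': "AE x in lborel. v x = v' x" using ae by (simp add: AE_completion_iff)
  have [measurable]: "L \<in> borel_measurable borel" "L' \<in> borel_measurable borel" "v \<in> borel_measurable borel" "v' \<in> borel_measurable borel"
    using l by (auto simp: L2_def)
  have "AE x in lborel. L x + (-1) * L' x = 0"
  proof (rule AE_zero_of_test_functions)
    have d: "L2 (\<lambda>x. L x + (-1) * L' x)" by (intro L2_add L2_cmult l)
    have "represents (\<lambda>x. L x + (-1) * L' x) (\<lambda>x. L x + (-1) * L' x)" by simp
    from represents_L2(1)[OF this] d have "locally_integrable (\<lambda>x. L x + (-1) * L' x)"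
      by (intro locally_integrable_L2) blast
    then have "integrable lebesgue (\<lambda>x. indicator (cball 0 R) x *\<^sub>R (L x + (-1) * L' x))" for R
      unfolding locally_integrable_def set_integrable_def by simp
    moreover have "(\<lambda>x. indicator (cball 0 R) x *\<^sub>R (L x + (-1) * L' x)) \<in> borel_measurable lborel" for R
      by (auto intro!: borel_measurable_scaleR borel_measurable_indicator)
    ultimately show "integrable lborel (\<lambda>x. indicator (cball 0 R) x *\<^sub>R (L x + (-1) * L' x))" for R
      using integrable_completion by blast
    fix \<phi> :: "real^'n \<Rightarrow> complex" assume \<phi>: "\<phi> \<in> test_functions"
    have [measurable]: "laplacian \<phi> \<in> borel_measurable borel"
      using \<phi> by (intro ccs_measurable test_function_ccs test_function_laplacian)
    have "(\<integral>x. v x * laplacian \<phi> x \<partial>lborel) = (\<integral>x. v' x * laplacian \<phi> x \<partial>lborel)"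
      by (rule integral_cong_AE) (use ae' in \<open>auto elim: eventually_mono\<close>)
    then have "(\<integral>x. L x * \<phi> x \<partial>lborel) = (\<integral>x. L' x * \<phi> x \<partial>lborel)"
      using L L' \<phi> by (simp add: weak_pair_def)
    moreover have "integrable lborel (\<lambda>x. L x * \<phi> x)" "integrable lborel (\<lambda>x. L' x * \<phi> x)"
      using l \<phi> by (auto intro!: L2_mult_integrable L2_ccs test_function_ccs)
    ultimately show "(\<integral>x. (L x + (-1) * L' x) * \<phi> x \<partial>lborel) = 0" by (simp add: left_diff_distrib)
  qed measurable
  then show ?thesis by (auto simp: AE_completion_iff elim: eventually_mono)
qed

lemma nsq_cong_AE:
  assumes "L2 f" "L2 g" "AE x in lebesgue. f x = g x" shows "nsq f = nsq g"
  unfolding nsq_def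
proof (rule integral_cong_AE)
  show "AE x in lborel. (norm (f x))\<^sup>2 = (norm (g x))\<^sup>2"
    using assms(3) by (auto simp: AE_completion_iff elim: eventually_mono)
qed (use assms in \<open>auto simp: L2_def\<close>)

text \<open>With \<open>H\<close> the squared norm of \<open>(\<Delta> + 1) u\<close>, the quadratic part of the energy is \<open>H\<close> minus the mass; so
  the energy is compared with minus the mass throughout.\<close>

definition helmholtz_sq :: "(real^'n::finite \<Rightarrow> complex) \<Rightarrow> (real^'n \<Rightarrow> complex) \<Rightarrow> real" where
  "helmholtz_sq v L = nsq (\<lambda>x. L x + v x)"

lemma Sobolev_norms:
  fixes u :: "real^'n::finite \<Rightarrow> complex"
  assumes u: "u \<in> Sobolev_H 2" and v: "represents v u" and vL: "lap_pair v L"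
  shows "represents L (weak_laplacian u)"
    and "(\<integral>x. (norm (weak_laplacian u x))\<^sup>2 \<partial>lebesgue) = nsq L"
    and "2 * (\<integral>x. (norm (weak_grad u x))\<^sup>2 \<partial>lebesgue) = nsq L + nsq v - helmholtz_sq v L"
proof -
  obtain v' L' where *: "represents v' u" "represents L' (weak_laplacian u)" "lap_pair v' L'"
    "(\<integral>x. (norm (weak_grad u x))\<^sup>2 \<partial>lebesgue) = - Re (\<integral>x. L' x * cnj (v' x) \<partial>lborel)"
    using Sobolev_H_2_lap_pair[OF u] .
  note l = weak_pair_L2[OF vL] weak_pair_L2[OF *(3)]
  have vv': "AE x in lebesgue. v x = v' x" using v *(1) by (auto elim: eventually_elim2)
  have LL': "AE x in lebesgue. L x = L' x" by (rule lap_pair_unique[OF vL *(3) vv'])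
  show 1: "represents L (weak_laplacian u)"
    using l(2) *(2) LL' by (auto simp: L2_def elim: eventually_elim2)
  have [measurable]: "L \<in> borel_measurable borel" using l by (auto simp: L2_def)
  have "represents (\<lambda>x. (norm (L x))\<^sup>2) (\<lambda>x. (norm (weak_laplacian u x))\<^sup>2)"
    by (rule represents_comp[OF 1]) measurable
  from represents_integral(1)[OF this]
  show "(\<integral>x. (norm (weak_laplacian u x))\<^sup>2 \<partial>lebesgue) = nsq L" by (simp add: nsq_def)
  have "AE x in lebesgue. L x + v x = L' x + v' x" using vv' LL' by eventually_elim simp
  then have "helmholtz_sq v L = helmholtz_sq v' L'"
    unfolding helmholtz_sq_def by (intro nsq_cong_AE L2_add l)
  then show "2 * (\<integral>x. (norm (weak_grad u x))\<^sup>2 \<partial>lebesgue) = nsq L + nsq v - helmholtz_sq v L"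
    using *(4) nsq_cong_AE[OF l(1,3) vv'] nsq_cong_AE[OF l(2,4) LL'] nsq_add[OF l(4,3)]
    by (simp add: helmholtz_sq_def)
qed

definition power_integral :: "real \<Rightarrow> (real^'n::finite \<Rightarrow> complex) \<Rightarrow> real" where
  "power_integral \<sigma> v = (\<integral>x. norm (v x) powr (2 * \<sigma> + 2) \<partial>lborel)"

lemma energy_eq:
  assumes u: "u \<in> Sobolev_H 2" and v: "represents v u" and vL: "lap_pair v L"
  shows "energy \<sigma> u = helmholtz_sq v L - nsq v - power_integral \<sigma> v / (\<sigma> + 1)"
proof -
  have [measurable]: "v \<in> borel_measurable borel" using v by simp
  have "represents (\<lambda>x. norm (v x) powr (2 * \<sigma> + 2)) (\<lambda>x. norm (u x) powr (2 * \<sigma> + 2))"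
    by (rule represents_comp[OF v]) measurable
  from represents_integral(1)[OF this] Sobolev_norms(2,3)[OF assms] show ?thesis
    unfolding energy_def power_integral_def by (simp add: field_simps)
qed

section \<open>The minimization problem\<close>

lemma Lp_bounded_admissible:
  assumes "0 < \<sigma>" "\<sigma> \<le> 4 / real CARD('n::finite)"
  shows "Lp_bounded TYPE('n) (2 * \<sigma> + 2)"
proof (rule Lp_bounded_subcritical)
  show "2 \<le> 2 * \<sigma> + 2" using assms by simp
  show "5 \<le> CARD('n) \<longrightarrow> 2 * \<sigma> + 2 < 2 * real CARD('n) / (real CARD('n) - 4)"
  proof
    assume "5 \<le> CARD('n)"
    then have N: "5 \<le> real CARD('n)" by simp
    have "2 * \<sigma> + 2 \<le> 2 * (4 / real CARD('n)) + 2" using assms by simp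
    also have "\<dots> < 2 * real CARD('n) / (real CARD('n) - 4)" using N by (simp add: field_simps)
    finally show "2 * \<sigma> + 2 < 2 * real CARD('n) / (real CARD('n) - 4)" .
  qed
qed

lemma power_integrable:
  fixes v L :: "real^'n::finite \<Rightarrow> complex"
  assumes "0 < \<sigma>" "\<sigma> \<le> 4 / real CARD('n)" "lap_pair v L"
  shows "integrable lborel (\<lambda>x. norm (v x) powr (2 * \<sigma> + 2))"
  by (rule Lp_integrable[OF Lp_bounded_admissible[OF assms(1,2)] assms(3)])

lemma power_integral_nonneg: "0 \<le> power_integral \<sigma> v"
  unfolding power_integral_def by simp

lemma nsq_eq_0_iff: "L2 v \<Longrightarrow> nsq v = 0 \<longleftrightarrow> (AE x in lborel. v x = 0)"
  unfolding nsq_def by (subst integral_nonneg_eq_0_iff_AE) (auto simp: L2_def)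

lemma power_integral_pos:
  fixes v L :: "real^'n::finite \<Rightarrow> complex"
  assumes "0 < \<sigma>" "\<sigma> \<le> 4 / real CARD('n)" "lap_pair v L" "0 < nsq v"
  shows "0 < power_integral \<sigma> v"
proof -
  have "\<not> (AE x in lborel. v x = 0)" using assms(4) nsq_eq_0_iff[OF weak_pair_L2(1)[OF assms(3)]] by auto
  then have "power_integral \<sigma> v \<noteq> 0"
    unfolding power_integral_def
    by (subst integral_nonneg_eq_0_iff_AE[OF power_integrable[OF assms(1-3)]]) auto
  with power_integral_nonneg[of \<sigma> v] show ?thesis by simp
qed

lemma power_integral_cmult:
  "0 < a \<Longrightarrow> power_integral \<sigma> (\<lambda>x. of_real (sqrt a) * v x) = a powr (\<sigma> + 1) * power_integral \<sigma> v"
proof -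
  assume a: "0 < a"
  have "sqrt a powr (2 * \<sigma> + 2) = a powr (1/2 * (2 * \<sigma> + 2))"
    using a by (simp add: powr_half_sqrt[symmetric] powr_powr)
  also have "1/2 * (2 * \<sigma> + 2) = \<sigma> + 1" by simp
  finally show ?thesis using a by (simp add: power_integral_def norm_mult powr_mult)
qed

lemma helmholtz_sq_cmult: "helmholtz_sq (\<lambda>x. c * v x) (\<lambda>x. c * L x) = (norm c)\<^sup>2 * helmholtz_sq v L"
  unfolding helmholtz_sq_def using nsq_cmult[of c "\<lambda>x. L x + v x"] by (simp add: distrib_left)

lemma Sobolev_H_2_representative:
  fixes u :: "real^'n::finite \<Rightarrow> complex"
  assumes "u \<in> Sobolev_H 2" obtains v L where "represents v u" "lap_pair v L"
  using Sobolev_H_2_lap_pair[OF assms] by blast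

lemma minimizer_le:
  fixes u w :: "real^'n::finite \<Rightarrow> complex"
  assumes "minimizer \<sigma> m u" "w \<in> mass_constraint m"
  shows "energy \<sigma> u \<le> energy \<sigma> w"
proof -
  have "ereal (energy \<sigma> u) \<le> ereal (energy \<sigma> w)"
    using assms unfolding minimizer_def min_energy_def by (metis INF_lower)
  then show ?thesis by simp
qed

lemma mass_constraint_iff:
  assumes "represents v u" shows "u \<in> mass_constraint m \<longleftrightarrow> u \<in> Sobolev_H 2 \<and> nsq v = m"
  using represents_L2(2)[OF assms] by (simp add: mass_constraint_def)

text \<open>The comparison function, rescaled to mass \<open>m\<close>, is a competitor.\<close>

lemma minimizer_compare:
  fixes u w :: "real^'n::finite \<Rightarrow> complex"
  assumes u: "minimizer \<sigma> m u" "represents v u" "lap_pair v L" and m: "0 < m"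
    and w: "w \<in> Sobolev_H 2" "represents v' w" "lap_pair v' L'" "0 < nsq v'"
  shows "helmholtz_sq v L - power_integral \<sigma> v / (\<sigma> + 1) \<le>
    (m / nsq v') * helmholtz_sq v' L' - (m / nsq v') powr (\<sigma> + 1) * power_integral \<sigma> v' / (\<sigma> + 1)"
proof -
  define a where "a = m / nsq v'"
  have a: "0 < a" using m w(4) by (simp add: a_def)
  let ?w = "\<lambda>x. of_real (sqrt a) * w x" and ?v = "\<lambda>x. of_real (sqrt a) * v' x" and ?L = "\<lambda>x. of_real (sqrt a) * L' x"
  have r: "represents ?v ?w" using w(2) by (auto elim: eventually_mono)
  have s: "?w \<in> Sobolev_H 2" by (rule Sobolev_H_cmult[OF w(1)])
  have p: "lap_pair ?v ?L" by (rule weak_pair_cmult[OF w(3)])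
  have n: "nsq ?v = m" using a w(4) by (simp add: nsq_cmult a_def)
  have um: "u \<in> Sobolev_H 2" "nsq v = m"
    using u(1) mass_constraint_iff[OF u(2)] by (auto simp: minimizer_def)
  have "energy \<sigma> u \<le> energy \<sigma> ?w"
    using n s mass_constraint_iff[OF r] by (intro minimizer_le[OF u(1)]) blast
  then show ?thesis
    unfolding energy_eq[OF um(1) u(2,3)] energy_eq[OF s r p] n um(2) helmholtz_sq_cmult power_integral_cmult[OF a] a_def[symmetric]
    using a by simp
qed

lemma laplacian_mult:
  assumes f: "smooth f" and g: "smooth g"
  shows "laplacian (\<lambda>x. f x * g x) x = f x * laplacian g x + 2 * (\<Sum>i\<in>UNIV. partial_deriv i f x * partial_deriv i g x) + laplacian f x * g x"
proof -
  have d: "f differentiable (at x)" "g differentiable (at x)" "partial_deriv i f differentiable (at x)"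
    "partial_deriv i g differentiable (at x)" for i x
    using f g by (auto intro: smooth_differentiable smooth_partial_deriv)
  have 1: "partial_deriv i (\<lambda>x. f x * g x) = (\<lambda>x. f x * partial_deriv i g x + partial_deriv i f x * g x)" for i
    by (rule ext, rule partial_deriv_mult[OF d(1,2)])
  have 2: "partial_deriv i (\<lambda>x. f x * partial_deriv i g x + partial_deriv i f x * g x) x =
     f x * partial_deriv i (partial_deriv i g) x + 2 * (partial_deriv i f x * partial_deriv i g x) + partial_deriv i (partial_deriv i f) x * g x" for i
  proof -
    have "partial_deriv i (\<lambda>x. f x * partial_deriv i g x + partial_deriv i f x * g x) x =
        partial_deriv i (\<lambda>x. f x * partial_deriv i g x) x + partial_deriv i (\<lambda>x. partial_deriv i f x * g x) x"
      by (rule partial_deriv_add[OF differentiable_mult[OF d(1,4)] differentiable_mult[OF d(3,2)]])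
    then show ?thesis
      by (simp only: partial_deriv_mult[OF d(1) d(4)] partial_deriv_mult[OF d(3) d(2)]) simp
  qed
  show ?thesis unfolding laplacian_def 1 2 by (simp add: sum.distrib sum_distrib_left sum_distrib_right)
qed

lemma nsq_add_le:
  assumes f: "L2 f" and g: "L2 g" shows "nsq (\<lambda>x. f x + g x) \<le> 2 * nsq f + 2 * nsq g"
proof -
  have "nsq (\<lambda>x. f x + g x) \<le> (\<integral>x. 2 * (norm (f x))\<^sup>2 + 2 * (norm (g x))\<^sup>2 \<partial>lborel)"
    unfolding nsq_def using L2_add[OF f g] f g by (intro integral_mono norm_add_square_le) (auto simp: L2_def)
  then show ?thesis using f g by (simp add: nsq_def L2_def)
qed

text \<open>Plane waves of unit frequency are annihilated by \<open>\<Delta> + 1\<close>; spreading their envelope makes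
  \<open>helmholtz_sq\<close> negligible against the mass.\<close>

lemma plane_wave_packets:
  shows "\<exists>C. \<forall>\<epsilon>. 0 < \<epsilon> \<and> \<epsilon> \<le> 1 \<longrightarrow> (\<exists>w \<in> (test_functions :: (real^'n::finite \<Rightarrow> complex) set).
     0 < nsq w \<and> helmholtz_sq w (laplacian w) \<le> C * \<epsilon>\<^sup>2 * nsq w)"
proof -
  let ?\<chi> = "\<lambda>x :: real^'n. complex_of_real (bump x)"
  fix k :: 'n
  define e where "e = (\<lambda>x :: real^'n. exp (\<i> * complex_of_real (x $ k)))"
  have chain: "((\<lambda>t. \<i> ^ j * exp (\<i> * complex_of_real t)) has_vector_derivative \<i> ^ Suc j * exp (\<i> * complex_of_real t)) (at t)" for j t
    by (rule has_vector_derivative_real_field) (auto intro!: derivative_eq_intros)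
  have coord: "(\<lambda>x :: real^'n. complex_of_real (x $ k)) differentiable (at x)" for x
    by (intro smooth_differentiable smooth_coord)
  have se: "smooth e"
    using smooth_chain[where F = "\<lambda>j t. \<i> ^ j * exp (\<i> * complex_of_real t)" and q = "\<lambda>x :: real^'n. x $ k" and j = 0,
        OF chain smooth_coord] by (simp add: e_def)
  have pc: "partial_deriv i (\<lambda>x :: real^'n. complex_of_real (x $ k)) x = (if i = k then 1 else 0)" for i x
  proof -
    have "((\<lambda>x :: real^'n. complex_of_real (x $ k)) has_derivative (\<lambda>h. complex_of_real (h $ k))) (at x)"
      by (intro bounded_linear_imp_has_derivative bounded_linear_compose[OF bounded_linear_of_real]
          bounded_linear_vec_nth)
    from partial_deriv_eq[OF this] show ?thesis by (simp add: axis_def)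
  qed
  have pe: "partial_deriv i e = (\<lambda>x. (if i = k then \<i> else 0) * e x)" for i
    using partial_deriv_chain(2)[where F = "\<lambda>t. \<i> ^ 0 * exp (\<i> * complex_of_real t)" and q = "\<lambda>x :: real^'n. x $ k",
        OF chain[of 0] coord, where i = i] by (auto simp: e_def pc fun_eq_iff)
  have "partial_deriv i (partial_deriv i e) x = (if i = k then - 1 else 0) * e x" for i x
  proof -
    have "partial_deriv i (\<lambda>x. c * e x) x = c * partial_deriv i e x" for c
      by (rule partial_deriv_linear[OF bounded_linear_mult_right smooth_differentiable[OF se]])
    then show ?thesis by (simp add: pe)
  qed
  then have le: "laplacian e x = - e x" for x
    unfolding laplacian_def by (simp add: if_distrib[of "\<lambda>c. c * e x"] cong: if_cong)
  have ne: "norm (e x) = 1" for x by (simp add: e_def norm_exp_eq_Re)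
  have \<chi>: "?\<chi> \<in> test_functions" by (rule test_function_bump)
  have \<chi>2: "L2 ?\<chi>" "L2 (laplacian ?\<chi>)" "L2 (partial_deriv k ?\<chi>)"
    using \<chi> by (auto intro!: L2_ccs test_function_ccs test_function_laplacian test_function_partial_deriv)
  have n\<chi>: "0 < nsq ?\<chi>"
  proof -
    have "nsq ?\<chi> \<noteq> 0"
    proof
      assume "nsq ?\<chi> = 0"
      then have "AE x in lborel. bump (x :: real^'n) = 0" using nsq_eq_0_iff[OF \<chi>2(1)] by simp
      then have "(\<integral>x. bump (x :: real^'n) \<partial>lborel) = 0" by (subst integral_cong_AE[where g = "\<lambda>_. 0"]) auto
      with bump_integral_pos[where 'n='n] show False by simp
    qed
    with nsq_nonneg[of ?\<chi>] show ?thesis by simp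
  qed
  define C where "C = (2 * nsq (laplacian ?\<chi>) + 8 * nsq (partial_deriv k ?\<chi>)) / nsq ?\<chi>"
  have "\<exists>w \<in> (test_functions :: (real^'n \<Rightarrow> complex) set). 0 < nsq w \<and> helmholtz_sq w (laplacian w) \<le> C * \<epsilon>\<^sup>2 * nsq w"
    if \<epsilon>: "0 < \<epsilon>" "\<epsilon> \<le> 1" for \<epsilon>
  proof -
    have \<epsilon>0: "\<epsilon> \<noteq> 0" using \<epsilon> by simp
    define \<psi> where "\<psi> = (\<lambda>x. ?\<chi> (\<epsilon> *\<^sub>R x + 0))"
    have \<psi>: "\<psi> \<in> test_functions" unfolding \<psi>_def using \<chi> \<epsilon>0 by (rule test_function_affine)
    define w where "w = (\<lambda>x. e x * \<psi> x)"
    have w: "w \<in> test_functions" unfolding w_def by (rule test_function_mult[OF se \<psi>])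
    have p\<psi>: "partial_deriv k \<psi> x = of_real \<epsilon> * partial_deriv k ?\<chi> (0 + \<epsilon> *\<^sub>R x)" for x
      unfolding \<psi>_def using partial_deriv_affine[OF smooth_differentiable[OF test_function_smooth[OF \<chi>]], where a = \<epsilon> and x = x and b = 0 and i = k] by simp
    have l\<psi>: "laplacian \<psi> x = of_real (\<epsilon>\<^sup>2) * laplacian ?\<chi> (0 + \<epsilon> *\<^sub>R x)" for x
      unfolding \<psi>_def using laplacian_affine[OF test_function_smooth[OF \<chi>], where a = \<epsilon> and b = 0 and x = x] by simp
    let ?g = "\<lambda>x. of_real (\<epsilon>\<^sup>2) * laplacian ?\<chi> x + (2 * \<i> * of_real \<epsilon>) * partial_deriv k ?\<chi> x"
    have g2: "L2 (\<lambda>x. of_real (\<epsilon>\<^sup>2) * laplacian ?\<chi> x)" "L2 (\<lambda>x. (2 * \<i> * of_real \<epsilon>) * partial_deriv k ?\<chi> x)"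
      using \<chi>2 by (auto intro!: L2_cmult)
    have lw: "laplacian w x + w x = e x * ?g (0 + \<epsilon> *\<^sub>R x)" for x
    proof -
      have "(\<Sum>i\<in>UNIV. partial_deriv i e x * partial_deriv i \<psi> x) = (\<Sum>i\<in>UNIV. if i = k then \<i> * e x * partial_deriv i \<psi> x else 0)"
        by (intro sum.cong) (auto simp: pe)
      also have "\<dots> = \<i> * e x * partial_deriv k \<psi> x" by simp
      finally show ?thesis
        unfolding w_def laplacian_mult[OF se test_function_smooth[OF \<psi>]] le l\<psi> by (simp only: p\<psi>) (simp add: algebra_simps)
    qed
    have "helmholtz_sq w (laplacian w) = nsq (\<lambda>x. ?g (0 + \<epsilon> *\<^sub>R x))"
      unfolding helmholtz_sq_def lw unfolding nsq_def by (simp only: norm_mult ne mult_1_left)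
    also have "\<dots> = nsq ?g / \<bar>\<epsilon>\<bar> ^ CARD('n)" by (rule nsq_affine[OF \<epsilon>0])
    also have "nsq ?g \<le> 2 * nsq (\<lambda>x. of_real (\<epsilon>\<^sup>2) * laplacian ?\<chi> x) + 2 * nsq (\<lambda>x. (2 * \<i> * of_real \<epsilon>) * partial_deriv k ?\<chi> x)"
      by (rule nsq_add_le[OF g2])
    also have "\<dots> = (\<epsilon>\<^sup>2 * \<epsilon>\<^sup>2) * (2 * nsq (laplacian ?\<chi>)) + \<epsilon>\<^sup>2 * (8 * nsq (partial_deriv k ?\<chi>))"
      unfolding nsq_cmult by (simp add: norm_mult norm_power power_mult_distrib power2_eq_square)
    also have "\<dots> \<le> (\<epsilon>\<^sup>2 * 1) * (2 * nsq (laplacian ?\<chi>)) + \<epsilon>\<^sup>2 * (8 * nsq (partial_deriv k ?\<chi>))"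
      using \<epsilon> nsq_nonneg by (intro add_mono mult_right_mono mult_left_mono) (auto intro: power_le_one)
    also have "\<dots> = C * \<epsilon>\<^sup>2 * nsq ?\<chi>" using n\<chi> by (simp add: C_def field_simps)
    finally have h: "helmholtz_sq w (laplacian w) \<le> C * \<epsilon>\<^sup>2 * nsq ?\<chi> / \<bar>\<epsilon>\<bar> ^ CARD('n)"
      by (simp add: divide_right_mono)
    have "nsq w = nsq (\<lambda>x. ?\<chi> (0 + \<epsilon> *\<^sub>R x))"
      unfolding w_def \<psi>_def unfolding nsq_def by (simp only: norm_mult ne mult_1_left add_0_left add_0_right)
    also have "\<dots> = nsq ?\<chi> / \<bar>\<epsilon>\<bar> ^ CARD('n)" by (rule nsq_affine[OF \<epsilon>0])
    finally have n: "nsq w = nsq ?\<chi> / \<bar>\<epsilon>\<bar> ^ CARD('n)" .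
    then have "0 < nsq w" using n\<chi> \<epsilon> by simp
    with h n w show ?thesis by (intro bexI[of _ w]) auto
  qed
  then show ?thesis by blast
qed

text \<open>Wave packets of mass \<open>m\<close> have energy arbitrarily close to \<open>- m\<close> or below it, since the nonlinear term only lowers
  the energy.\<close>

lemma minimizer_energy_le_mass:
  fixes u :: "real^'n::finite \<Rightarrow> complex"
  assumes \<sigma>: "0 < \<sigma>" and u: "minimizer \<sigma> m u" "represents v u" "lap_pair v L" and m: "0 < m"
  shows "helmholtz_sq v L - power_integral \<sigma> v / (\<sigma> + 1) \<le> 0"
proof -
  obtain C where C: "\<And>\<epsilon>. 0 < \<epsilon> \<Longrightarrow> \<epsilon> \<le> 1 \<Longrightarrow> \<exists>w \<in> (test_functions :: (real^'n \<Rightarrow> complex) set).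
     0 < nsq w \<and> helmholtz_sq w (laplacian w) \<le> C * \<epsilon>\<^sup>2 * nsq w"
    using plane_wave_packets[where 'n='n] by blast
  let ?E = "helmholtz_sq v L - power_integral \<sigma> v / (\<sigma> + 1)"
  have le: "?E \<le> m * (C * \<epsilon>\<^sup>2)" if \<epsilon>: "0 < \<epsilon>" "\<epsilon> \<le> 1" for \<epsilon>
  proof -
    obtain w :: "real^'n \<Rightarrow> complex" where w: "w \<in> test_functions" "0 < nsq w" "helmholtz_sq w (laplacian w) \<le> C * \<epsilon>\<^sup>2 * nsq w"
      using C[OF \<epsilon>] by blast
    have "?E \<le> (m / nsq w) * helmholtz_sq w (laplacian w) - (m / nsq w) powr (\<sigma> + 1) * power_integral \<sigma> w / (\<sigma> + 1)"
      by (rule minimizer_compare[OF u m Sobolev_H_test_function[OF w(1)]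
            represents_self[OF ccs_measurable[OF test_function_ccs[OF w(1)]]] lap_pair_test_function[OF w(1)] w(2)])
    also have "\<dots> \<le> (m / nsq w) * helmholtz_sq w (laplacian w)"
      using \<sigma> power_integral_nonneg[of \<sigma> w] by simp
    also have "\<dots> \<le> (m / nsq w) * (C * \<epsilon>\<^sup>2 * nsq w)" using w m by (intro mult_left_mono) auto
    also have "\<dots> = m * (C * \<epsilon>\<^sup>2)" using w(2) by simp
    finally show ?thesis .
  qed
  have "((\<lambda>\<epsilon>. m * (C * \<epsilon>\<^sup>2)) \<longlongrightarrow> m * (C * 0\<^sup>2)) (at_right 0)" by (intro tendsto_intros)
  then have "((\<lambda>\<epsilon>. m * (C * \<epsilon>\<^sup>2)) \<longlongrightarrow> 0) (at_right 0)" by simp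
  then show ?thesis
    by (rule tendsto_lowerbound) (use le in \<open>auto simp: eventually_at_right_field intro!: exI[of _ 1]\<close>)
qed

section \<open>The Euler-Lagrange equation\<close>

text \<open>The norm is not differentiable where it vanishes, but its square is a quadratic polynomial in \<open>t\<close>; at a zero the
  exponent \<open>p > 2\<close> makes the derivative \<open>0\<close>.\<close>

lemma norm_line_powr_derivative:
  fixes z w :: complex
  assumes p: "2 < p"
  shows "((\<lambda>t. norm (z + of_real t * w) powr p) has_real_derivative
     p * norm (z + of_real t * w) powr (p - 2) * Re ((z + of_real t * w) * cnj w)) (at t)"
proof -
  define q where "q t = (norm z)\<^sup>2 + 2 * t * Re (z * cnj w) + t\<^sup>2 * (norm w)\<^sup>2" for t :: real
  have q: "(norm (z + of_real t * w))\<^sup>2 = q t" for t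
    unfolding q_def cmod_power2 by (simp add: power2_eq_square algebra_simps)
  have dq: "(q has_real_derivative 2 * Re ((z + of_real t * w) * cnj w)) (at t)"
  proof -
    have "((\<lambda>t. (norm z)\<^sup>2 + 2 * t * Re (z * cnj w) + t\<^sup>2 * (norm w)\<^sup>2) has_real_derivative 2 * Re (z * cnj w) + 2 * t * (norm w)\<^sup>2) (at t)"
      by (auto intro!: derivative_eq_intros)
    moreover have "2 * Re (z * cnj w) + 2 * t * (norm w)\<^sup>2 = 2 * Re ((z + of_real t * w) * cnj w)"
      unfolding cmod_power2 by (simp add: power2_eq_square algebra_simps)
    ultimately show ?thesis unfolding q_def[abs_def] by simp
  qed
  have f: "norm (z + of_real t * w) powr p = q t powr (p / 2)" for t
    unfolding q[symmetric] by (simp only: norm_powr_2[symmetric] powr_powr) simp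
  show ?thesis
  proof (cases "z + of_real t * w = 0")
    case False
    then have qt: "0 < q t" unfolding q[symmetric] by simp
    have "((\<lambda>t. q t powr (p / 2)) has_real_derivative (p / 2) * q t powr (p / 2 - 1) * (2 * Re ((z + of_real t * w) * cnj w))) (at t)"
      using DERIV_chain2[where f = "\<lambda>z. z powr (p / 2)" and g = q, OF has_real_derivative_powr[OF qt] dq] by simp
    moreover have "q t powr (p / 2 - 1) = norm (z + of_real t * w) powr (p - 2)"
      unfolding q[symmetric] by (simp only: norm_powr_2[symmetric] powr_powr) (simp add: right_diff_distrib)
    moreover define R where "R = Re ((z + of_real t * w) * cnj w)"
    ultimately show ?thesis unfolding f R_def[symmetric] by (simp add: mult_ac)
  next
    case True
    then have z: "z = - of_real t * w" by (simp add: eq_neg_iff_add_eq_0)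
    have n: "norm (z + of_real s * w) = \<bar>s - t\<bar> * norm w" for s
    proof -
      have "z + of_real s * w = of_real (s - t) * w" unfolding z by (simp add: algebra_simps)
      then show ?thesis by (simp only: norm_mult norm_of_real)
    qed
    have "((\<lambda>s. \<bar>s - t\<bar> powr (p - 1) * norm w powr p) \<longlongrightarrow> \<bar>t - t\<bar> powr (p - 1) * norm w powr p) (at t)"
      using p by (intro tendsto_intros) auto
    then have l: "((\<lambda>s. \<bar>s - t\<bar> powr (p - 1) * norm w powr p) \<longlongrightarrow> 0) (at t)" using p by simp
    have "((\<lambda>s. (norm (z + of_real s * w) powr p - norm (z + of_real t * w) powr p) / (s - t)) \<longlongrightarrow> 0) (at t)"
    proof (rule Lim_null_comparison[OF _ l])
      have "norm ((norm (z + of_real s * w) powr p - norm (z + of_real t * w) powr p) / (s - t)) \<le> \<bar>s - t\<bar> powr (p - 1) * norm w powr p" if "s \<noteq> t" for s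
      proof -
        have "\<bar>s - t\<bar> powr p = \<bar>s - t\<bar> powr (p - 1) * \<bar>s - t\<bar>"
          using that powr_add[of "\<bar>s - t\<bar>" "p - 1" 1] by simp
        then show ?thesis using that p by (simp add: n powr_mult abs_mult)
      qed
      then show "\<forall>\<^sub>F s in at t. norm ((norm (z + of_real s * w) powr p - norm (z + of_real t * w) powr p) / (s - t)) \<le> \<bar>s - t\<bar> powr (p - 1) * norm w powr p"
        by (simp add: eventually_at_filter)
    qed
    then show ?thesis using True by (simp add: has_field_derivative_iff)
  qed
qed

lemma power_integral_derivative:
  fixes v w :: "real^'n::finite \<Rightarrow> complex"
  assumes \<sigma>: "0 < \<sigma>" and v: "v \<in> borel_measurable borel" "integrable lborel (\<lambda>x. norm (v x) powr (2 * \<sigma> + 2))"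
    and w: "w \<in> borel_measurable borel" "integrable lborel (\<lambda>x. norm (w x) powr (2 * \<sigma> + 2))"
  shows "((\<lambda>t. power_integral \<sigma> (\<lambda>x. v x + of_real t * w x)) has_real_derivative
    (\<integral>x. (2 * \<sigma> + 2) * norm (v x) powr (2 * \<sigma>) * Re (v x * cnj (w x)) \<partial>lborel)) (at 0)"
proof -
  have [measurable]: "v \<in> borel_measurable borel" "w \<in> borel_measurable borel" using v w by auto
  define p where "p = 2 * \<sigma> + 2"
  have p: "2 < p" "2 * \<sigma> = p - 2" using \<sigma> by (auto simp: p_def)
  \<comment> \<open>A bound for the derivative on the whole segment \<open>- 1 \<le> t \<le> 1\<close>.\<close>
  define W where "W x = p * (2 powr p * (norm (v x) powr p + norm (w x) powr p))" for x
  have Wi: "integrable lborel W" unfolding W_def using v(2) w(2) by (simp add: p_def)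
  have sum_powr: "(a + b) powr p \<le> 2 powr p * (a powr p + b powr p)" if "0 \<le> a" "0 \<le> b" for a b :: real
  proof -
    have "(a + b) powr p \<le> (2 * max a b) powr p" using that p by (intro powr_mono2) auto
    also have "\<dots> = 2 powr p * max a b powr p" using that by (simp add: powr_mult)
    also have "max a b powr p \<le> a powr p + b powr p" by (simp add: max_def)
    finally show ?thesis by (simp add: mult_left_mono)
  qed
  have bd: "norm (v x + of_real t * w x) powr p \<le> 2 powr p * (norm (v x) powr p + norm (w x) powr p)" if "\<bar>t\<bar> \<le> 1" for t x
  proof -
    have "norm (v x + of_real t * w x) \<le> norm (v x) + norm (w x)"
      using norm_triangle_ineq[of "v x" "of_real t * w x"] mult_right_mono[OF that norm_ge_zero[of "w x"]] by (simp add: norm_mult)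
    then have "norm (v x + of_real t * w x) powr p \<le> (norm (v x) + norm (w x)) powr p" using p by (intro powr_mono2) auto
    with sum_powr[of "norm (v x)" "norm (w x)"] show ?thesis by simp
  qed
  have "((\<lambda>t. \<integral>x. norm (v x + of_real t * w x) powr p \<partial>lborel) has_vector_derivative
      (\<integral>x. p * norm (v x) powr (p - 2) * Re (v x * cnj (w x)) \<partial>lborel)) (at 0)"
  proof (rule has_vector_derivative_integral[where d = 1 and w = W])
    show "integrable lborel (\<lambda>x. norm (v x + of_real t * w x) powr p)" if "\<bar>t - 0\<bar> < 1" for t
    proof (rule Bochner_Integration.integrable_bound)
      show "integrable lborel (\<lambda>x. 2 powr p * (norm (v x) powr p + norm (w x) powr p))" using v(2) w(2) by (simp add: p_def)
      show "AE x in lborel. norm (norm (v x + of_real t * w x) powr p) \<le> norm (2 powr p * (norm (v x) powr p + norm (w x) powr p))"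
        using bd[of t] that by (intro AE_I2) simp
    qed measurable
    show "(\<lambda>x. p * norm (v x) powr (p - 2) * Re (v x * cnj (w x))) \<in> borel_measurable lborel" by measurable
    show "((\<lambda>t. norm (v x + of_real t * w x) powr p) has_vector_derivative p * norm (v x) powr (p - 2) * Re (v x * cnj (w x))) (at 0)" for x
      using norm_line_powr_derivative[OF p(1), of "v x" "w x" 0] by (simp add: has_real_derivative_iff_has_vector_derivative)
    show "norm (norm (v x + of_real t * w x) powr p - norm (v x + of_real 0 * w x) powr p) \<le> \<bar>t - 0\<bar> * W x" if t: "\<bar>t - 0\<bar> < 1" for t x
    proof -
      have "norm (norm (v x + of_real t * w x) powr p - norm (v x + of_real 0 * w x) powr p) \<le> W x * \<bar>t - 0\<bar>"
      proof (rule norm_diff_le_of_vector_derivative[of "-1" 1])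
        fix s :: real assume s: "s \<in> {-1..1}"
        let ?z = "v x + of_real s * w x"
        show "((\<lambda>t. norm (v x + of_real t * w x) powr p) has_vector_derivative p * norm ?z powr (p - 2) * Re (?z * cnj (w x))) (at s)"
          using norm_line_powr_derivative[OF p(1), of "v x" "w x" s] by (simp add: has_real_derivative_iff_has_vector_derivative)
        define a where "a = norm (v x) + norm (w x)"
        have "norm ?z \<le> norm (v x) + norm (of_real s * w x)" by (rule norm_triangle_ineq)
        also have "norm (of_real s * w x) \<le> norm (w x)" using s by (simp add: norm_mult mult_left_le_one_le abs_le_iff)
        finally have za: "norm ?z \<le> a" by (simp add: a_def)
        have wa: "norm (w x) \<le> a" "0 \<le> a" by (simp_all add: a_def)
        have "\<bar>Re (?z * cnj (w x))\<bar> \<le> norm (?z * cnj (w x))" by (rule abs_Re_le_cmod)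
        also have "\<dots> \<le> a * a" unfolding norm_mult complex_mod_cnj using za wa by (intro mult_mono) auto
        finally have "norm ?z powr (p - 2) * \<bar>Re (?z * cnj (w x))\<bar> \<le> a powr (p - 2) * (a * a)"
          using za p by (intro mult_mono powr_mono2) auto
        also have "\<dots> = a powr p"
        proof (cases "a = 0")
          case False
          then have "0 < a" by (simp add: a_def add_nonneg_eq_0_iff less_le)
          then show ?thesis using powr_add[of a "p - 2" 2] by (simp add: powr_numeral power2_eq_square)
        qed (use p in simp)
        also have "\<dots> \<le> 2 powr p * (norm (v x) powr p + norm (w x) powr p)" unfolding a_def by (rule sum_powr) auto
        finally show "norm (p * norm ?z powr (p - 2) * Re (?z * cnj (w x))) \<le> W x"
          using p by (simp add: W_def abs_mult mult.assoc)
      qed (use t in auto)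
      then show ?thesis by (simp add: mult.commute)
    qed
  qed (use Wi in auto)
  then show ?thesis
    unfolding power_integral_def p(2) p_def[symmetric] by (simp add: has_real_derivative_iff_has_vector_derivative)
qed

lemma nsq_line:
  assumes f: "L2 f" and g: "L2 g"
  shows "nsq (\<lambda>x. f x + of_real t * g x) = nsq f + 2 * t * Re (\<integral>x. f x * cnj (g x) \<partial>lborel) + t\<^sup>2 * nsq g"
proof -
  have "(\<integral>x. f x * cnj (of_real t * g x) \<partial>lborel) = of_real t * (\<integral>x. f x * cnj (g x) \<partial>lborel)"
    by (simp add: mult.left_commute)
  then show ?thesis
    unfolding nsq_add[OF f L2_cmult[OF g]] nsq_cmult by simp
qed

lemma nsq_line_derivative:
  assumes f: "L2 f" and g: "L2 g"
  shows "((\<lambda>t. nsq (\<lambda>x. f x + of_real t * g x)) has_real_derivative 2 * Re (\<integral>x. f x * cnj (g x) \<partial>lborel)) (at 0)"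
  unfolding nsq_line[OF f g] by (auto intro!: derivative_eq_intros)

lemma nonlinear_integrable:
  fixes v L :: "real^'n::finite \<Rightarrow> complex"
  assumes \<sigma>: "0 < \<sigma>" "\<sigma> \<le> 4 / real CARD('n)" and v: "lap_pair v L" and \<phi>: "ccs \<phi>"
  shows "integrable lborel (\<lambda>x. of_real (norm (v x) powr (2 * \<sigma>)) * v x * \<phi> x)"
proof -
  have [measurable]: "v \<in> borel_measurable borel" "\<phi> \<in> borel_measurable borel"
    using L2_measurable[OF weak_pair_L2(1)[OF v]] ccs_measurable[OF \<phi>] by auto
  obtain M where M: "0 < M" "\<And>x. norm (\<phi> x) \<le> M" using ccs_bounded[OF \<phi>] by metis
  have t: "t powr (2 * \<sigma>) * t * s \<le> s + M * t powr (2 * \<sigma> + 2)" if "0 \<le> t" "0 \<le> s" "s \<le> M" for t s :: real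
  proof (cases "t \<le> 1")
    case True
    then have "t powr (2 * \<sigma>) * t \<le> 1 * 1" using that \<sigma> by (intro mult_mono powr_le1) auto
    then have "t powr (2 * \<sigma>) * t * s \<le> 1 * s" using that by (intro mult_right_mono) auto
    then show ?thesis using M that by (simp add: add_increasing2)
  next
    case False
    then have "t powr (2 * \<sigma>) * t \<le> t powr (2 * \<sigma> + 2)"
      using powr_add[of t "2 * \<sigma>" 1] powr_mono[of "2 * \<sigma> + 1" "2 * \<sigma> + 2" t] by simp
    then have "t powr (2 * \<sigma>) * t * s \<le> t powr (2 * \<sigma> + 2) * M" using that by (intro mult_mono) auto
    then show ?thesis using that by (simp add: mult.commute add_increasing)
  qed
  have "integrable lborel (\<lambda>x. norm (\<phi> x) + M * norm (v x) powr (2 * \<sigma> + 2))"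
    using power_integrable[OF \<sigma> v] ccs_integrable[OF \<phi>] by simp
  then show ?thesis
  proof (rule Bochner_Integration.integrable_bound)
    show "AE x in lborel. norm (of_real (norm (v x) powr (2 * \<sigma>)) * v x * \<phi> x) \<le> norm (norm (\<phi> x) + M * norm (v x) powr (2 * \<sigma> + 2))"
    proof (rule AE_I2)
      fix x
      have "norm (of_real (norm (v x) powr (2 * \<sigma>)) * v x * \<phi> x) = norm (v x) powr (2 * \<sigma>) * norm (v x) * norm (\<phi> x)"
        by (simp add: norm_mult)
      also have "\<dots> \<le> norm (\<phi> x) + M * norm (v x) powr (2 * \<sigma> + 2)" using M(2)[of x] by (intro t) auto
      also have "\<dots> \<le> norm \<dots>" by simp
      finally show "norm (of_real (norm (v x) powr (2 * \<sigma>)) * v x * \<phi> x) \<le> norm (norm (\<phi> x) + M * norm (v x) powr (2 * \<sigma> + 2))" .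
    qed
  qed measurable
qed

text \<open>The perturbed functions are rescaled to mass \<open>m\<close>.  The derivative of the scaling factor is what produces the
  multiplier, and it produces it in explicit form.  The variation \<open>\<psi>\<close> is conjugated so that the pairings
  become bilinear in \<open>\<phi>\<close>.\<close>

lemma first_variation:
  fixes u v L :: "real^'n::finite \<Rightarrow> complex"
  assumes \<sigma>: "0 < \<sigma>" "\<sigma> \<le> 4 / real CARD('n)" and u: "minimizer \<sigma> m u" "represents v u" "lap_pair v L" and m: "0 < m"
    and \<phi>: "\<phi> \<in> test_functions" and c: "c = (power_integral \<sigma> v - helmholtz_sq v L) / m"
  shows "Re ((\<integral>x. (L x + v x) * (laplacian \<phi> x + \<phi> x) \<partial>lborel) + of_real c * (\<integral>x. v x * \<phi> x \<partial>lborel)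
     - (\<integral>x. of_real (norm (v x) powr (2 * \<sigma>)) * v x * \<phi> x \<partial>lborel)) = 0"
proof -
  note vL = weak_pair_L2[OF u(3)]
  have um: "u \<in> Sobolev_H 2" "nsq v = m"
    using u(1) mass_constraint_iff[OF u(2)] by (auto simp: minimizer_def)
  define \<psi> where "\<psi> = (\<lambda>x. cnj (\<phi> x))"
  have \<psi>: "\<psi> \<in> test_functions" unfolding \<psi>_def by (rule test_function_linear[OF bounded_linear_cnj \<phi>])
  have l\<psi>: "laplacian \<psi> = (\<lambda>x. cnj (laplacian \<phi> x))"
    unfolding \<psi>_def by (rule ext, rule laplacian_linear[OF bounded_linear_cnj test_function_smooth[OF \<phi>]])
  have \<psi>2: "L2 \<psi>" "L2 (laplacian \<psi>)" using \<psi> by (auto intro!: L2_ccs test_function_ccs test_function_laplacian)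
  have f2: "L2 (\<lambda>x. L x + v x)" and g2: "L2 (\<lambda>x. laplacian \<psi> x + \<psi> x)" by (intro L2_add vL \<psi>2)+
  define n where "n t = nsq (\<lambda>x. v x + of_real t * \<psi> x)" for t
  define H where "H t = nsq (\<lambda>x. (L x + v x) + of_real t * (laplacian \<psi> x + \<psi> x))" for t
  define P where "P t = power_integral \<sigma> (\<lambda>x. v x + of_real t * \<psi> x)" for t
  define A where "A = Re (\<integral>x. (L x + v x) * (laplacian \<phi> x + \<phi> x) \<partial>lborel)"
  define B where "B = Re (\<integral>x. v x * \<phi> x \<partial>lborel)"
  define D where "D = Re (\<integral>x. of_real (norm (v x) powr (2 * \<sigma>)) * v x * \<phi> x \<partial>lborel)"
  have dn: "(n has_real_derivative 2 * B) (at 0)"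
    using nsq_line_derivative[OF vL(1) \<psi>2(1)] unfolding n_def B_def \<psi>_def by simp
  have dH: "(H has_real_derivative 2 * A) (at 0)"
  proof -
    have "cnj (laplacian \<psi> x + \<psi> x) = laplacian \<phi> x + \<phi> x" for x unfolding l\<psi> by (simp add: \<psi>_def)
    with nsq_line_derivative[OF f2 g2] show ?thesis unfolding H_def A_def by (simp only:)
  qed
  have dP: "(P has_real_derivative (2 * \<sigma> + 2) * D) (at 0)"
  proof -
    have nl: "integrable lborel (\<lambda>x. of_real (norm (v x) powr (2 * \<sigma>)) * v x * \<phi> x)"
      by (rule nonlinear_integrable[OF \<sigma> u(3) test_function_ccs[OF \<phi>]])
    have "(\<integral>x. (2 * \<sigma> + 2) * norm (v x) powr (2 * \<sigma>) * Re (v x * cnj (\<psi> x)) \<partial>lborel)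
        = (\<integral>x. (2 * \<sigma> + 2) * Re (of_real (norm (v x) powr (2 * \<sigma>)) * v x * \<phi> x) \<partial>lborel)"
      by (intro Bochner_Integration.integral_cong) (auto simp: \<psi>_def algebra_simps)
    also have "\<dots> = (2 * \<sigma> + 2) * D"
      unfolding D_def integral_mult_right_zero integral_Re[OF nl] ..
    finally show ?thesis
      using power_integral_derivative[OF \<sigma>(1) L2_measurable[OF vL(1)] power_integrable[OF \<sigma> u(3)]
          L2_measurable[OF \<psi>2(1)] power_integrable[OF \<sigma> lap_pair_test_function[OF \<psi>]]]
      unfolding P_def by simp
  qed
  have n0: "n 0 = m" and H0: "H 0 = helmholtz_sq v L" and P0: "P 0 = power_integral \<sigma> v"
    unfolding n_def H_def P_def helmholtz_sq_def using um(2) by simp_all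
  define j where "j t = (m / n t) * H t - (m / n t) powr (\<sigma> + 1) * P t / (\<sigma> + 1)" for t
  have da: "((\<lambda>t. m / n t) has_real_derivative - (2 * B / m)) (at 0)"
    using dn m n0 by (auto intro!: derivative_eq_intros simp: power2_eq_square)
  have db: "((\<lambda>t. (m / n t) powr (\<sigma> + 1)) has_real_derivative (\<sigma> + 1) * - (2 * B / m)) (at 0)"
  proof -
    have "((\<lambda>z. z powr (\<sigma> + 1)) has_real_derivative (\<sigma> + 1) * (m / n 0) powr (\<sigma> + 1 - 1)) (at (m / n 0))"
      by (rule has_real_derivative_powr) (use m n0 in simp)
    from DERIV_chain2[where f = "\<lambda>z. z powr (\<sigma> + 1)" and g = "\<lambda>t. m / n t", OF this da] show ?thesis
      using m n0 by simp
  qed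
  have dj: "(j has_real_derivative - (2 * B / m) * H 0 + 2 * A * (m / n 0)
      - ((\<sigma> + 1) * - (2 * B / m) * P 0 + (2 * \<sigma> + 2) * D * (m / n 0) powr (\<sigma> + 1)) / (\<sigma> + 1)) (at 0)"
    unfolding j_def by (intro DERIV_diff DERIV_cdivide DERIV_mult da dH db dP)
  have "isCont n 0" using dn by (rule DERIV_isCont)
  then have "(n \<longlongrightarrow> n 0) (at 0)" by (simp add: isCont_def)
  then have "\<forall>\<^sub>F t in at 0. 0 < n t" using n0 m by (intro order_tendstoD(1)[of n "n 0"]) auto
  then obtain d where d: "0 < d" "\<And>t. t \<noteq> 0 \<Longrightarrow> dist t 0 < d \<Longrightarrow> 0 < n t" unfolding eventually_at by auto
  have "j 0 \<le> j t" if t: "\<bar>0 - t\<bar> < d" for t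
  proof -
    have nt: "0 < nsq (\<lambda>x. v x + of_real t * \<psi> x)"
      using d(2)[of t] t n0 m unfolding n_def[symmetric] by (cases "t = 0") (auto simp: dist_real_def)
    let ?w = "\<lambda>x. 1 * u x + of_real t * \<psi> x"
    have s: "?w \<in> Sobolev_H 2" by (rule Sobolev_H_add_cmult[OF um(1) Sobolev_H_test_function[OF \<psi>]])
    have [measurable]: "v \<in> borel_measurable borel" "\<psi> \<in> borel_measurable borel" using vL \<psi>2 by (auto simp: L2_def)
    have r: "represents (\<lambda>x. v x + of_real t * \<psi> x) ?w" using u(2) by (auto elim: eventually_mono)
    have p: "lap_pair (\<lambda>x. v x + of_real t * \<psi> x) (\<lambda>x. L x + of_real t * laplacian \<psi> x)"
      by (intro weak_pair_add translation_op_laplacian u(3) weak_pair_cmult lap_pair_test_function \<psi>)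
    have "helmholtz_sq (\<lambda>x. v x + of_real t * \<psi> x) (\<lambda>x. L x + of_real t * laplacian \<psi> x) = H t"
      unfolding helmholtz_sq_def H_def by (simp add: algebra_simps)
    then have "helmholtz_sq v L - power_integral \<sigma> v / (\<sigma> + 1) \<le> j t"
      using minimizer_compare[OF u m s r p nt] unfolding j_def n_def P_def by simp
    moreover have "j 0 = helmholtz_sq v L - power_integral \<sigma> v / (\<sigma> + 1)"
      unfolding j_def n0 H0 P0 using m by simp
    ultimately show ?thesis by simp
  qed
  then have "\<forall>t. \<bar>0 - t\<bar> < d \<longrightarrow> j 0 \<le> j t" by blast
  from DERIV_local_min[OF dj d(1) this]
  have "- (2 * B / m) * H 0 + 2 * A - ((\<sigma> + 1) * - (2 * B / m) * P 0 + (2 * \<sigma> + 2) * D) / (\<sigma> + 1) = 0"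
    using m n0 by simp
  moreover have "((\<sigma> + 1) * - (2 * B / m) * P 0 + (2 * \<sigma> + 2) * D) / (\<sigma> + 1) = - (2 * B / m) * P 0 + 2 * D"
    using \<sigma>(1) by (simp add: field_simps)
  ultimately have "A + c * B - D = 0"
    unfolding c H0[symmetric] P0[symmetric] using m by (simp add: field_simps)
  then show ?thesis unfolding A_def B_def D_def by simp
qed

text \<open>Two of the four derivatives are moved onto \<open>v\<close>, after which only square integrable functions and the nonlinear
  term are left.\<close>

lemma solution_iff:
  fixes u v L :: "real^'n::finite \<Rightarrow> complex"
  assumes \<sigma>: "0 < \<sigma>" "\<sigma> \<le> 4 / real CARD('n)" and u: "u \<in> Sobolev_H 2" "represents v u" "lap_pair v L"
  shows "solution \<sigma> c u \<longleftrightarrow> (\<forall>\<phi>\<in>test_functions.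
    (\<integral>x. L x * laplacian \<phi> x \<partial>lborel) + 2 * (\<integral>x. L x * \<phi> x \<partial>lborel) + of_real (1 + c) * (\<integral>x. v x * \<phi> x \<partial>lborel)
     - (\<integral>x. of_real (norm (v x) powr (2 * \<sigma>)) * v x * \<phi> x \<partial>lborel) = 0)"
proof -
  note vL = weak_pair_L2[OF u(3)]
  have "(\<integral>x. u x * (laplacian (laplacian \<phi>) x + 2 * laplacian \<phi> x + of_real (1 + c) * \<phi> x)
             - of_real (norm (u x) powr (2 * \<sigma>)) * u x * \<phi> x \<partial>lebesgue) =
    (\<integral>x. L x * laplacian \<phi> x \<partial>lborel) + 2 * (\<integral>x. L x * \<phi> x \<partial>lborel) + of_real (1 + c) * (\<integral>x. v x * \<phi> x \<partial>lborel)
     - (\<integral>x. of_real (norm (v x) powr (2 * \<sigma>)) * v x * \<phi> x \<partial>lborel)" if \<phi>: "\<phi> \<in> test_functions" for \<phi>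
  proof -
    have t: "laplacian \<phi> \<in> test_functions" "laplacian (laplacian \<phi>) \<in> test_functions"
      using \<phi> by (auto intro!: test_function_laplacian)
    have [measurable]: "v \<in> borel_measurable borel" "\<phi> \<in> borel_measurable borel" "laplacian \<phi> \<in> borel_measurable borel"
      "laplacian (laplacian \<phi>) \<in> borel_measurable borel"
      using vL \<phi> t by (auto intro!: L2_measurable ccs_measurable test_function_ccs)
    have r: "represents (\<lambda>x. v x * (laplacian (laplacian \<phi>) x + 2 * laplacian \<phi> x + of_real (1 + c) * \<phi> x) - of_real (norm (v x) powr (2 * \<sigma>)) * v x * \<phi> x)
       (\<lambda>x. u x * (laplacian (laplacian \<phi>) x + 2 * laplacian \<phi> x + of_real (1 + c) * \<phi> x) - of_real (norm (u x) powr (2 * \<sigma>)) * u x * \<phi> x)"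
      by (rule represents_comp[OF u(2)]) measurable
    have i: "integrable lborel (\<lambda>x. v x * laplacian (laplacian \<phi>) x)" "integrable lborel (\<lambda>x. v x * laplacian \<phi> x)" "integrable lborel (\<lambda>x. v x * \<phi> x)"
      using vL \<phi> t by (auto intro!: L2_mult_integrable L2_ccs test_function_ccs)
    have nl: "integrable lborel (\<lambda>x. of_real (norm (v x) powr (2 * \<sigma>)) * v x * \<phi> x)"
      by (rule nonlinear_integrable[OF \<sigma> u(3) test_function_ccs[OF \<phi>]])
    have "(\<integral>x. v x * (laplacian (laplacian \<phi>) x + 2 * laplacian \<phi> x + of_real (1 + c) * \<phi> x) - of_real (norm (v x) powr (2 * \<sigma>)) * v x * \<phi> x \<partial>lborel)
      = (\<integral>x. v x * laplacian (laplacian \<phi>) x + 2 * (v x * laplacian \<phi> x) + of_real (1 + c) * (v x * \<phi> x) - of_real (norm (v x) powr (2 * \<sigma>)) * v x * \<phi> x \<partial>lborel)"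
      by (intro Bochner_Integration.integral_cong) (auto simp: algebra_simps)
    also have "\<dots> = (\<integral>x. v x * laplacian (laplacian \<phi>) x \<partial>lborel) + 2 * (\<integral>x. v x * laplacian \<phi> x \<partial>lborel) + of_real (1 + c) * (\<integral>x. v x * \<phi> x \<partial>lborel)
       - (\<integral>x. of_real (norm (v x) powr (2 * \<sigma>)) * v x * \<phi> x \<partial>lborel)"
      using i nl by simp
    also have "(\<integral>x. v x * laplacian (laplacian \<phi>) x \<partial>lborel) = (\<integral>x. L x * laplacian \<phi> x \<partial>lborel)"
      using u(3) t by (simp add: weak_pair_def)
    also have "(\<integral>x. v x * laplacian \<phi> x \<partial>lborel) = (\<integral>x. L x * \<phi> x \<partial>lborel)"
      using u(3) \<phi> by (simp add: weak_pair_def)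
    finally show ?thesis using represents_integral(1)[OF r] by simp
  qed
  then show ?thesis using u(1) by (simp add: solution_def)
qed

lemma minimizer_solution:
  fixes u v L :: "real^'n::finite \<Rightarrow> complex"
  assumes \<sigma>: "0 < \<sigma>" "\<sigma> \<le> 4 / real CARD('n)" and u: "minimizer \<sigma> m u" "represents v u" "lap_pair v L" and m: "0 < m"
  shows "solution \<sigma> ((power_integral \<sigma> v - helmholtz_sq v L) / m) u"
proof -
  define c where "c = (power_integral \<sigma> v - helmholtz_sq v L) / m"
  note vL = weak_pair_L2[OF u(3)]
  have um: "u \<in> Sobolev_H 2" using u(1) mass_constraint_iff[OF u(2)] by (auto simp: minimizer_def)
  define X where "X \<phi> = (\<integral>x. (L x + v x) * (laplacian \<phi> x + \<phi> x) \<partial>lborel) + of_real c * (\<integral>x. v x * \<phi> x \<partial>lborel)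
     - (\<integral>x. of_real (norm (v x) powr (2 * \<sigma>)) * v x * \<phi> x \<partial>lborel)" for \<phi>
  have Re0: "Re (X \<phi>) = 0" if "\<phi> \<in> test_functions" for \<phi>
    unfolding X_def by (rule first_variation[OF \<sigma> u m that c_def])
  have X0: "X \<phi> = 0" if \<phi>: "\<phi> \<in> test_functions" for \<phi>
  proof -
    \<comment> \<open>Only real parts are stationary; replacing the test function by \<open>\<i>\<close> times it yields the imaginary part.\<close>
    have i\<phi>: "(\<lambda>x. \<i> * \<phi> x) \<in> test_functions" by (rule test_function_linear[OF bounded_linear_mult_right \<phi>])
    have l: "laplacian (\<lambda>x. \<i> * \<phi> x) = (\<lambda>x. \<i> * laplacian \<phi> x)"
      by (rule ext, rule laplacian_linear[OF bounded_linear_mult_right test_function_smooth[OF \<phi>]])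
    have "X (\<lambda>x. \<i> * \<phi> x) = \<i> * X \<phi>"
      unfolding X_def l distrib_left[symmetric] mult.left_commute[of _ \<i>] integral_mult_right_zero
      by (simp add: right_diff_distrib distrib_left)
    with Re0[OF i\<phi>] have "Im (X \<phi>) = 0" by simp
    with Re0[OF \<phi>] show ?thesis by (simp add: complex_eq_iff)
  qed
  have "(\<integral>x. L x * laplacian \<phi> x \<partial>lborel) + 2 * (\<integral>x. L x * \<phi> x \<partial>lborel) + of_real (1 + c) * (\<integral>x. v x * \<phi> x \<partial>lborel)
     - (\<integral>x. of_real (norm (v x) powr (2 * \<sigma>)) * v x * \<phi> x \<partial>lborel) = X \<phi>" if \<phi>: "\<phi> \<in> test_functions" for \<phi>
  proof -
    have \<phi>2: "L2 \<phi>" "L2 (laplacian \<phi>)" using \<phi> by (auto intro!: L2_ccs test_function_ccs test_function_laplacian)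
    have i: "integrable lborel (\<lambda>x. L x * laplacian \<phi> x)" "integrable lborel (\<lambda>x. L x * \<phi> x)"
      "integrable lborel (\<lambda>x. v x * laplacian \<phi> x)" "integrable lborel (\<lambda>x. v x * \<phi> x)"
      using vL \<phi>2 by (auto intro!: L2_mult_integrable)
    have e: "(\<integral>x. v x * laplacian \<phi> x \<partial>lborel) = (\<integral>x. L x * \<phi> x \<partial>lborel)" using u(3) \<phi> by (simp add: weak_pair_def)
    have "(\<integral>x. (L x + v x) * (laplacian \<phi> x + \<phi> x) \<partial>lborel) = (\<integral>x. L x * laplacian \<phi> x + L x * \<phi> x + v x * laplacian \<phi> x + v x * \<phi> x \<partial>lborel)"
      by (intro Bochner_Integration.integral_cong) (auto simp: algebra_simps)
    also have "\<dots> = (\<integral>x. L x * laplacian \<phi> x \<partial>lborel) + (\<integral>x. L x * \<phi> x \<partial>lborel) + (\<integral>x. L x * \<phi> x \<partial>lborel) + (\<integral>x. v x * \<phi> x \<partial>lborel)"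
      using i e by simp
    finally show ?thesis unfolding X_def by (simp add: algebra_simps)
  qed
  with X0 have "solution \<sigma> c u" by (subst solution_iff[OF \<sigma> um u(2,3)]) simp
  then show ?thesis by (simp add: c_def)
qed

text \<open>Testing the equation with the solution itself.  The solution is no test function, so the equation is
  tested with mollifiers centred at \<open>x\<close>, multiplied by \<open>cnj (v x)\<close> and integrated in \<open>x\<close>.\<close>

lemma solution_Nehari:
  fixes u v L :: "real^'n::finite \<Rightarrow> complex"
  assumes \<sigma>: "0 < \<sigma>" "\<sigma> \<le> 4 / real CARD('n)" and u: "solution \<sigma> c u" "represents v u" "lap_pair v L"
  shows "helmholtz_sq v L + c * nsq v = power_integral \<sigma> v"
proof -
  note vL = weak_pair_L2[OF u(3)]
  have us: "u \<in> Sobolev_H 2" using u(1) by (simp add: solution_def)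
  let ?f = "\<lambda>x. of_real (norm (v x) powr (2 * \<sigma>)) * v x"
  have vm[measurable]: "v \<in> borel_measurable borel" using vL by (simp add: L2_def)
  have fm: "?f \<in> borel_measurable borel" by measurable
  have vc: "L2 (\<lambda>x. cnj (v x))" "L2 (\<lambda>x. cnj (L x))" by (intro L2_cnj vL)+
  have wc: "lap_pair (\<lambda>x. cnj (v x)) (\<lambda>x. cnj (L x))"
    by (rule weak_pair_cnj[OF translation_op_laplacian u(3)])
  let ?m = "\<lambda>t z :: real^'n. complex_of_real (mollifier t z)"
  let ?B = "\<lambda>f g k. \<integral>x. \<integral>y. f x * g y * k (x - y) \<partial>lborel \<partial>lborel"
  have Hp: "integrable lborel (\<lambda>x. norm (v x) powr (2 * \<sigma> + 2))" by (rule power_integrable[OF \<sigma> u(3)])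
  have maj: "norm (cnj (v x)) * norm (?f y) \<le> norm (v x) powr (2 * \<sigma> + 2) + norm (v y) powr (2 * \<sigma> + 2)" for x y
  proof -
    define a b where "a = norm (v x)" and "b = norm (v y)"
    have ab: "0 \<le> a" "0 \<le> b" by (auto simp: a_def b_def)
    define s where "s = max a b"
    have s: "0 \<le> s" "a \<le> s" "b \<le> s" using ab by (auto simp: s_def)
    have "a * (b powr (2 * \<sigma>) * b) \<le> s * (s powr (2 * \<sigma>) * s)"
      using ab s \<sigma> by (intro mult_mono powr_mono2) auto
    also have "\<dots> = s powr (2 * \<sigma> + 2)"
      using s \<sigma> by (cases "s = 0") (auto simp: powr_add powr_numeral power2_eq_square)
    also have "\<dots> \<le> a powr (2 * \<sigma> + 2) + b powr (2 * \<sigma> + 2)" by (simp add: s_def max_def)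
    finally show ?thesis by (simp add: a_def b_def norm_mult)
  qed
  have eq: "?B (\<lambda>x. cnj (L x)) L (?m t) + 2 * ?B (\<lambda>x. cnj (v x)) L (?m t) + of_real (1 + c) * ?B (\<lambda>x. cnj (v x)) v (?m t)
      - ?B (\<lambda>x. cnj (v x)) ?f (?m t) = 0" if t: "0 < t" for t
  proof -
    have \<kappa>: "?m t \<in> test_functions" by (rule test_function_mollifier[OF t])
    have lk: "laplacian (\<lambda>y. ?m t (x - y)) = (\<lambda>y. laplacian (?m t) (x - y))" for x
      using translation_op_laplacian \<kappa> by (auto simp: translation_op_def)
    have pt: "(\<integral>y. L y * laplacian (?m t) (x - y) \<partial>lborel) + 2 * (\<integral>y. L y * ?m t (x - y) \<partial>lborel) + of_real (1 + c) * (\<integral>y. v y * ?m t (x - y) \<partial>lborel)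
       - (\<integral>y. ?f y * ?m t (x - y) \<partial>lborel) = 0" for x
      using bspec[OF iffD1[OF solution_iff[OF \<sigma> us u(2,3)] u(1)] test_function_reflect[OF \<kappa>, of x]] by (simp only: lk)
    have i1: "integrable lborel (\<lambda>x. \<integral>y. cnj (v x) * L y * laplacian (?m t) (x - y) \<partial>lborel)"
      using lborel_pair.integrable_fst[OF pairing_integrable[OF L2_measurable[OF vc(1)] L2_measurable[OF vL(2)] L2_majorant[OF vc(1) vL(2)]
          test_function_ccs[OF test_function_laplacian[OF \<kappa>]]]] by simp
    have i2: "integrable lborel (\<lambda>x. \<integral>y. cnj (v x) * L y * ?m t (x - y) \<partial>lborel)"
      using lborel_pair.integrable_fst[OF pairing_integrable[OF L2_measurable[OF vc(1)] L2_measurable[OF vL(2)] L2_majorant[OF vc(1) vL(2)]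
          test_function_ccs[OF \<kappa>]]] by simp
    have i3: "integrable lborel (\<lambda>x. \<integral>y. cnj (v x) * v y * ?m t (x - y) \<partial>lborel)"
      using lborel_pair.integrable_fst[OF pairing_integrable[OF L2_measurable[OF vc(1)] L2_measurable[OF vL(1)] L2_majorant[OF vc(1) vL(1)]
          test_function_ccs[OF \<kappa>]]] by simp
    have i4: "integrable lborel (\<lambda>x. \<integral>y. cnj (v x) * ?f y * ?m t (x - y) \<partial>lborel)"
      using lborel_pair.integrable_fst[OF pairing_integrable[OF L2_measurable[OF vc(1)] fm Hp maj test_function_ccs[OF \<kappa>]]] by simp
    have pull: "(\<integral>y. cnj (v x) * g y * k (x - y) \<partial>lborel) = cnj (v x) * (\<integral>y. g y * k (x - y) \<partial>lborel)" for g k x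
      by (simp add: mult.assoc)
    have alg: "a * (p + 2 * q + k * r - s) = a * p + 2 * (a * q) + k * (a * r) - a * s" for a p q k r s :: complex
      by (simp add: algebra_simps)
    have "0 = (\<integral>x. cnj (v x) * ((\<integral>y. L y * laplacian (?m t) (x - y) \<partial>lborel) + 2 * (\<integral>y. L y * ?m t (x - y) \<partial>lborel) + of_real (1 + c) * (\<integral>y. v y * ?m t (x - y) \<partial>lborel)
       - (\<integral>y. ?f y * ?m t (x - y) \<partial>lborel)) \<partial>lborel)" unfolding pt by simp
    also have "\<dots> = (\<integral>x. (\<integral>y. cnj (v x) * L y * laplacian (?m t) (x - y) \<partial>lborel) + 2 * (\<integral>y. cnj (v x) * L y * ?m t (x - y) \<partial>lborel)
        + of_real (1 + c) * (\<integral>y. cnj (v x) * v y * ?m t (x - y) \<partial>lborel) - (\<integral>y. cnj (v x) * ?f y * ?m t (x - y) \<partial>lborel) \<partial>lborel)"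
      by (simp only: alg pull[of _ L "laplacian (?m t)"] pull[of _ L "?m t"] pull[of _ v "?m t"] pull[of _ ?f "?m t"])
    also have "\<dots> = ?B (\<lambda>x. cnj (v x)) L (laplacian (?m t)) + 2 * ?B (\<lambda>x. cnj (v x)) L (?m t) + of_real (1 + c) * ?B (\<lambda>x. cnj (v x)) v (?m t)
        - ?B (\<lambda>x. cnj (v x)) ?f (?m t)"
      by (simp only: Bochner_Integration.integral_diff[OF Bochner_Integration.integrable_add[OF Bochner_Integration.integrable_add[OF i1 integrable_mult_right[OF i2]] integrable_mult_right[OF i3]] i4]
          Bochner_Integration.integral_add[OF Bochner_Integration.integrable_add[OF i1 integrable_mult_right[OF i2]] integrable_mult_right[OF i3]]
          Bochner_Integration.integral_add[OF i1 integrable_mult_right[OF i2]] integral_mult_right_zero)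
    also have "?B (\<lambda>x. cnj (v x)) L (laplacian (?m t)) = ?B (\<lambda>x. cnj (L x)) L (?m t)"
      using weak_pair_move_fst[OF translation_op_laplacian wc vL(2) \<kappa>] by simp
    finally show ?thesis by simp
  qed
  have "((\<lambda>t. ?B (\<lambda>x. cnj (L x)) L (?m t) + 2 * ?B (\<lambda>x. cnj (v x)) L (?m t) + of_real (1 + c) * ?B (\<lambda>x. cnj (v x)) v (?m t)
      - ?B (\<lambda>x. cnj (v x)) ?f (?m t)) \<longlongrightarrow>
     (\<integral>x. cnj (L x) * L x \<partial>lborel) + 2 * (\<integral>x. cnj (v x) * L x \<partial>lborel) + of_real (1 + c) * (\<integral>x. cnj (v x) * v x \<partial>lborel)
      - (\<integral>x. cnj (v x) * ?f x \<partial>lborel)) (at_right 0)"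
    by (intro tendsto_diff tendsto_add tendsto_mult_left mollified_pairing[OF L2_measurable[OF vc(2)] L2_measurable[OF vL(2)] L2_majorant[OF vc(2) vL(2)]]
        mollified_pairing[OF L2_measurable[OF vc(1)] L2_measurable[OF vL(2)] L2_majorant[OF vc(1) vL(2)]]
        mollified_pairing[OF L2_measurable[OF vc(1)] L2_measurable[OF vL(1)] L2_majorant[OF vc(1) vL(1)]]
        mollified_pairing[OF L2_measurable[OF vc(1)] fm Hp maj])
  moreover have "\<forall>\<^sub>F t in at_right 0. 0 = ?B (\<lambda>x. cnj (L x)) L (?m t) + 2 * ?B (\<lambda>x. cnj (v x)) L (?m t) + of_real (1 + c) * ?B (\<lambda>x. cnj (v x)) v (?m t)
      - ?B (\<lambda>x. cnj (v x)) ?f (?m t)"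
    using eventually_at_right_less[of 0] by eventually_elim (simp only: eq)
  ultimately have z: "(\<integral>x. cnj (L x) * L x \<partial>lborel) + 2 * (\<integral>x. cnj (v x) * L x \<partial>lborel) + of_real (1 + c) * (\<integral>x. cnj (v x) * v x \<partial>lborel)
      - (\<integral>x. cnj (v x) * ?f x \<partial>lborel) = 0"
    by (rule tendsto_unique[OF trivial_limit_at_right_real _ Lim_transform_eventually[OF tendsto_const]])
  have sq: "(\<integral>x. cnj (g x) * g x \<partial>lborel) = of_real (nsq g)" for g :: "real^'n \<Rightarrow> complex"
    unfolding nsq_def integral_complex_of_real[symmetric] by (simp only: complex_norm_square mult.commute)
  have pf: "(\<integral>x. cnj (v x) * ?f x \<partial>lborel) = of_real (power_integral \<sigma> v)"
    unfolding power_integral_def integral_complex_of_real[symmetric]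
  proof (intro Bochner_Integration.integral_cong refl)
    fix x
    have "cnj (v x) * ?f x = of_real (norm (v x) powr (2 * \<sigma>)) * (v x * cnj (v x))" by (simp add: mult_ac)
    also have "v x * cnj (v x) = of_real ((norm (v x))\<^sup>2)" by (simp only: complex_norm_square)
    also have "of_real (norm (v x) powr (2 * \<sigma>)) * complex_of_real ((norm (v x))\<^sup>2) = of_real (norm (v x) powr (2 * \<sigma>) * norm (v x) powr 2)"
      by (simp only: of_real_mult norm_powr_2)
    also have "norm (v x) powr (2 * \<sigma>) * norm (v x) powr 2 = norm (v x) powr (2 * \<sigma> + 2)" by (rule powr_add[symmetric])
    finally show "cnj (v x) * ?f x = of_real (norm (v x) powr (2 * \<sigma> + 2))" .
  qed
  have "helmholtz_sq v L = nsq L + nsq v + 2 * Re (\<integral>x. cnj (v x) * L x \<partial>lborel)"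
    unfolding helmholtz_sq_def nsq_add[OF vL(2,1)] by (simp only: mult.commute[of "cnj _"])
  moreover have "nsq L + 2 * Re (\<integral>x. cnj (v x) * L x \<partial>lborel) + (1 + c) * nsq v - power_integral \<sigma> v = 0"
    using arg_cong[OF z[unfolded sq pf], of Re] by simp
  ultimately show ?thesis by (simp add: distrib_right)
qed

section \<open>Action and frequency\<close>

lemma nontrivial_solution_iff:
  assumes "represents v u" "L2 v"
  shows "nontrivial_solution \<sigma> c u \<longleftrightarrow> solution \<sigma> c u \<and> 0 < nsq v"
proof -
  have "(AE x in lebesgue. u x = 0) \<longleftrightarrow> (AE x in lebesgue. v x = 0)"
    using assms(1) by (auto elim: eventually_elim2)
  also have "\<dots> \<longleftrightarrow> nsq v = 0" using nsq_eq_0_iff[OF assms(2)] by (simp add: AE_completion_iff)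
  finally show ?thesis using nsq_nonneg[of v] by (auto simp: nontrivial_solution_def)
qed

lemma frequency_eq:
  fixes u :: "real^'n::finite \<Rightarrow> complex"
  assumes \<sigma>: "0 < \<sigma>" "\<sigma> \<le> 4 / real CARD('n)" and u: "nontrivial_solution \<sigma> c u"
  shows "frequency \<sigma> u = c"
  unfolding frequency_def
proof (rule the_equality)
  show "nontrivial_solution \<sigma> c u" by (rule u)
  fix c' assume u': "nontrivial_solution \<sigma> c' u"
  have "u \<in> Sobolev_H 2" using u by (simp add: nontrivial_solution_def solution_def)
  then obtain v L where v: "represents v u" "lap_pair v L" by (rule Sobolev_H_2_representative)
  note it = nontrivial_solution_iff[OF v(1) weak_pair_L2(1)[OF v(2)]]
  have s: "solution \<sigma> c u" "solution \<sigma> c' u" "0 < nsq v" using iffD1[OF it u] iffD1[OF it u'] by auto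
  have "c' * nsq v = c * nsq v"
    using solution_Nehari[OF \<sigma> s(1) v] solution_Nehari[OF \<sigma> s(2) v] by linarith
  then show "c' = c" using s(3) by simp
qed

lemma action_eq:
  assumes "u \<in> Sobolev_H 2" "represents v u" "lap_pair v L"
  shows "action \<sigma> c u = helmholtz_sq v L - power_integral \<sigma> v / (\<sigma> + 1) + c * nsq v"
  unfolding action_def energy_eq[OF assms] represents_L2(2)[OF assms(2)] by (simp add: distrib_right)

lemma minimizer_imp:
  assumes "minimizer \<sigma> m u" "represents v u"
  shows "u \<in> Sobolev_H 2" "nsq v = m"
  using assms mass_constraint_iff[OF assms(2)] by (auto simp: minimizer_def)

lemma minimizer_nontrivial_solution:
  fixes u v L :: "real^'n::finite \<Rightarrow> complex"
  assumes \<sigma>: "0 < \<sigma>" "\<sigma> \<le> 4 / real CARD('n)" and u: "minimizer \<sigma> m u" "represents v u" "lap_pair v L" and m: "0 < m"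
  shows "nontrivial_solution \<sigma> ((power_integral \<sigma> v - helmholtz_sq v L) / m) u"
    and "frequency \<sigma> u = (power_integral \<sigma> v - helmholtz_sq v L) / m"
proof -
  show 1: "nontrivial_solution \<sigma> ((power_integral \<sigma> v - helmholtz_sq v L) / m) u"
    using minimizer_solution[OF \<sigma> u m] minimizer_imp(2)[OF u(1,2)] m
      nontrivial_solution_iff[OF u(2) weak_pair_L2(1)[OF u(3)]] by simp
  show "frequency \<sigma> u = (power_integral \<sigma> v - helmholtz_sq v L) / m" by (rule frequency_eq[OF \<sigma> 1])
qed

text \<open>The energy bound gives \<open>Q \<le> P / (\<sigma> + 1)\<close>, which is less than \<open>P\<close>.\<close>

lemma minimizer_frequency_pos:
  fixes u :: "real^'n::finite \<Rightarrow> complex"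
  assumes \<sigma>: "0 < \<sigma>" "\<sigma> \<le> 4 / real CARD('n)" and u: "minimizer \<sigma> m u" "represents v u" "lap_pair v L" and m: "0 < m"
  shows "0 < (power_integral \<sigma> v - helmholtz_sq v L) / m"
proof -
  have P: "0 < power_integral \<sigma> v"
    using power_integral_pos[OF \<sigma> u(3)] minimizer_imp(2)[OF u(1,2)] m by simp
  have "helmholtz_sq v L \<le> power_integral \<sigma> v / (\<sigma> + 1)"
    using minimizer_energy_le_mass[OF \<sigma>(1) u m] by simp
  also have "\<dots> < power_integral \<sigma> v" using P \<sigma> by (simp add: pos_divide_less_eq)
  finally show ?thesis using m by simp
qed

lemma powr_Bernoulli_strict:
  fixes a s :: real
  assumes a: "0 < a" "a \<noteq> 1" and s: "1 < s"
  shows "1 + s * (a - 1) < a powr s"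
proof -
  have d: "((\<lambda>z. z powr s) has_real_derivative s * x powr (s - 1)) (at x)" if "0 < x" for x
    using has_real_derivative_powr[OF that] by simp
  show ?thesis
  proof (cases "a < 1")
    case True
    have "\<exists>z. a < z \<and> z < 1 \<and> 1 powr s - a powr s = (1 - a) * (s * z powr (s - 1))"
      by (rule MVT2[OF True]) (use d a in auto)
    then obtain z where z: "a < z" "z < 1" "1 powr s - a powr s = (1 - a) * (s * z powr (s - 1))" by blast
    have "z powr (s - 1) < 1 powr (s - 1)" using z a s by (intro powr_less_mono2) auto
    then have "s * z powr (s - 1) < s * 1" using s by (intro mult_strict_left_mono) auto
    from mult_strict_left_mono[OF this, of "1 - a"] have "(1 - a) * (s * z powr (s - 1)) < (1 - a) * (s * 1)" using True by simp
    then show ?thesis using z(3) by (simp add: algebra_simps)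
  next
    case False
    then have a1: "1 < a" using a by simp
    have "\<exists>z. 1 < z \<and> z < a \<and> a powr s - 1 powr s = (a - 1) * (s * z powr (s - 1))"
      by (rule MVT2[OF a1]) (use d in auto)
    then obtain z where z: "1 < z" "z < a" "a powr s - 1 powr s = (a - 1) * (s * z powr (s - 1))" by blast
    have "1 powr (s - 1) < z powr (s - 1)" using z s by (intro powr_less_mono2) auto
    then have "s * 1 < s * z powr (s - 1)" using s by (intro mult_strict_left_mono) auto
    from mult_strict_left_mono[OF this, of "a - 1"] have "(a - 1) * (s * 1) < (a - 1) * (s * z powr (s - 1))" using a1 by simp
    then show ?thesis using z(3) by (simp add: algebra_simps)
  qed
qed

text \<open>By the Nehari identity the action along the ray through a solution \<open>w\<close> is, up to a positive factor, \<open>a \<mapsto> a - a\<^sup>\<sigma>\<^sup>+\<^sup>1 / (\<sigma> + 1)\<close> in the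
  squared amplitude \<open>a\<close>; it has its strict maximum at \<open>w\<close> itself.  The point of mass \<open>m\<close> on this ray is a
  competitor for the minimizer.\<close>

lemma minimizer_action_le:
  fixes u w :: "real^'n::finite \<Rightarrow> complex"
  assumes \<sigma>: "0 < \<sigma>" "\<sigma> \<le> 4 / real CARD('n)" and u: "minimizer \<sigma> m u" and m: "0 < m"
    and w: "nontrivial_solution \<sigma> c w" "represents v' w" "lap_pair v' L'"
  shows "action \<sigma> c u \<le> action \<sigma> c w" and "nsq v' \<noteq> m \<Longrightarrow> action \<sigma> c u < action \<sigma> c w"
proof -
  obtain v L where v: "represents v u" "lap_pair v L"
    using u Sobolev_H_2_representative unfolding minimizer_def mass_constraint_def by blast
  note um = minimizer_imp[OF u v(1)]
  have ws: "solution \<sigma> c w" "0 < nsq v'" "w \<in> Sobolev_H 2"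
    using w(1) nontrivial_solution_iff[OF w(2) weak_pair_L2(1)[OF w(3)]] by (auto simp: solution_def)
  define a where "a = m / nsq v'"
  have a: "0 < a" using m ws(2) by (simp add: a_def)
  define P where "P = power_integral \<sigma> v'"
  have P: "0 < P" unfolding P_def by (rule power_integral_pos[OF \<sigma> w(3) ws(2)])
  have N: "helmholtz_sq v' L' + c * nsq v' = P" unfolding P_def by (rule solution_Nehari[OF \<sigma> ws(1) w(2,3)])
  have "helmholtz_sq v L - power_integral \<sigma> v / (\<sigma> + 1) \<le> a * helmholtz_sq v' L' - a powr (\<sigma> + 1) * P / (\<sigma> + 1)"
    unfolding a_def P_def by (rule minimizer_compare[OF u v m ws(3) w(2,3) ws(2)])
  moreover have "c * m = a * (c * nsq v')" using ws(2) by (simp add: a_def)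
  moreover have "a * P = a * helmholtz_sq v' L' + a * (c * nsq v')" unfolding N[symmetric] by (rule distrib_left)
  ultimately have le: "action \<sigma> c u \<le> a * P - a powr (\<sigma> + 1) * P / (\<sigma> + 1)"
    unfolding action_eq[OF um(1) v] um(2) by linarith
  have aw: "action \<sigma> c w = P - P / (\<sigma> + 1)"
    unfolding action_eq[OF ws(3) w(2,3)] using N by (simp add: P_def)
  have "a * P - a powr (\<sigma> + 1) * P / (\<sigma> + 1) < P - P / (\<sigma> + 1)" if "a \<noteq> 1"
  proof -
    have "1 + (\<sigma> + 1) * (a - 1) < a powr (\<sigma> + 1)" using a that \<sigma> by (intro powr_Bernoulli_strict) auto
    then have "(1 + (\<sigma> + 1) * (a - 1)) * (P / (\<sigma> + 1)) < a powr (\<sigma> + 1) * (P / (\<sigma> + 1))"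
      using P \<sigma> by (intro mult_strict_right_mono) auto
    moreover have "(1 + (\<sigma> + 1) * (a - 1)) * (P / (\<sigma> + 1)) = P / (\<sigma> + 1) + (a - 1) * P"
      using \<sigma> by (simp add: field_simps)
    ultimately show ?thesis by (simp add: algebra_simps)
  qed
  then show "action \<sigma> c u \<le> action \<sigma> c w" using le aw by (cases "a = 1") auto
  show "action \<sigma> c u < action \<sigma> c w" if "nsq v' \<noteq> m"
  proof -
    have "a \<noteq> 1" using that ws(2) by (auto simp: a_def)
    with \<open>a \<noteq> 1 \<Longrightarrow> _\<close> le aw show ?thesis by simp
  qed
qed

text \<open>For the converse, a solution of the same action must have mass \<open>m\<close> by the strict inequality, and at fixed mass
  action and energy differ by a constant.\<close>

lemma minimizer_min_action:
  fixes u v :: "real^'n::finite \<Rightarrow> complex"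
  assumes \<sigma>: "0 < \<sigma>" "\<sigma> \<le> 4 / real CARD('n)" and u: "minimizer \<sigma> m u" and m: "0 < m"
  shows "0 < frequency \<sigma> u" and "min_action_solution \<sigma> (frequency \<sigma> u) u"
    and "min_action_solution \<sigma> (frequency \<sigma> u) v \<Longrightarrow> minimizer \<sigma> m v"
proof -
  obtain v0 L0 where v0: "represents v0 u" "lap_pair v0 L0"
    using u Sobolev_H_2_representative unfolding minimizer_def mass_constraint_def by blast
  note freq = minimizer_nontrivial_solution[OF \<sigma> u v0 m]
  show "0 < frequency \<sigma> u" using minimizer_frequency_pos[OF \<sigma> u v0 m] freq(2) by simp
  define c where "c = frequency \<sigma> u"
  have nt: "nontrivial_solution \<sigma> c u" using freq by (simp add: c_def)
  have rep: "\<exists>v' L'. represents v' w \<and> lap_pair v' L'" if "nontrivial_solution \<sigma> c w" for w :: "real^'n \<Rightarrow> complex"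
  proof -
    have "w \<in> Sobolev_H 2" using that by (simp add: nontrivial_solution_def solution_def)
    then show ?thesis using Sobolev_H_2_representative by blast
  qed
  show ma: "min_action_solution \<sigma> (frequency \<sigma> u) u"
    unfolding min_action_solution_def c_def[symmetric]
  proof (intro conjI nt allI impI)
    fix w :: "real^'n \<Rightarrow> complex" assume w: "nontrivial_solution \<sigma> c w"
    with rep obtain v' L' where "represents v' w" "lap_pair v' L'" by blast
    then show "action \<sigma> c u \<le> action \<sigma> c w" by (rule minimizer_action_le(1)[OF \<sigma> u m w])
  qed
  assume v: "min_action_solution \<sigma> (frequency \<sigma> u) v"
  then have vn: "nontrivial_solution \<sigma> c v"
    and "\<forall>w :: real^'n \<Rightarrow> complex. nontrivial_solution \<sigma> c w \<longrightarrow> action \<sigma> c v \<le> action \<sigma> c w"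
    by (simp_all add: min_action_solution_def c_def)
  then have vu: "action \<sigma> c v \<le> action \<sigma> c u" using nt by simp
  from rep[OF vn] obtain v' L' where v': "represents v' v" "lap_pair v' L'" by blast
  have mass: "nsq v' = m" using minimizer_action_le(2)[OF \<sigma> u m vn v'] vu by argo
  have vs: "v \<in> Sobolev_H 2" using vn by (simp add: nontrivial_solution_def solution_def)
  then have vm: "v \<in> mass_constraint m" using mass mass_constraint_iff[OF v'(1)] by blast
  have um: "u \<in> mass_constraint m" using u by (simp add: minimizer_def)
  have "energy \<sigma> v \<le> energy \<sigma> u" using vu vm um by (simp add: action_def mass_constraint_def)
  with minimizer_le[OF u vm] have "energy \<sigma> v = energy \<sigma> u" by simp
  then show "minimizer \<sigma> m v" using u vm by (simp add: minimizer_def)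
qed

text \<open>Comparing each of two minimizers with the rescaled other one gives two inequalities; their combination
  bounds the nonlinear term of the heavier minimizer from below.\<close>

lemma minimizer_frequency_strict_mono:
  fixes u1 u2 :: "real^'n::finite \<Rightarrow> complex"
  assumes \<sigma>: "0 < \<sigma>" "\<sigma> \<le> 4 / real CARD('n)" and m: "0 < m1" "m1 < m2"
    and u: "minimizer \<sigma> m1 u1" "minimizer \<sigma> m2 u2"
  shows "frequency \<sigma> u1 < frequency \<sigma> u2"
proof -
  have m2: "0 < m2" using m by simp
  obtain v1 L1 where v1: "represents v1 u1" "lap_pair v1 L1"
    using u(1) Sobolev_H_2_representative unfolding minimizer_def mass_constraint_def by blast
  obtain v2 L2 where v2: "represents v2 u2" "lap_pair v2 L2"
    using u(2) Sobolev_H_2_representative unfolding minimizer_def mass_constraint_def by blast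
  note um1 = minimizer_imp[OF u(1) v1(1)] and um2 = minimizer_imp[OF u(2) v2(1)]
  define A B C D where "A = helmholtz_sq v1 L1" and "B = power_integral \<sigma> v1" and "C = helmholtz_sq v2 L2" and "D = power_integral \<sigma> v2"
  define s where "s = \<sigma> + 1"
  have s: "1 < s" using \<sigma> by (simp add: s_def)
  define \<theta> where "\<theta> = m2 / m1"
  have \<theta>: "1 < \<theta>" "0 < \<theta>" using m by (simp_all add: \<theta>_def)
  have B: "0 < B" unfolding B_def by (rule power_integral_pos[OF \<sigma> v1(2)]) (use um1 m in simp)
  have "C - D / s \<le> \<theta> * A - \<theta> powr s * B / s"
    using minimizer_compare[OF u(2) v2 m2 um1(1) v1] m unfolding um1(2) A_def B_def C_def D_def s_def \<theta>_def by simp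
  from mult_left_mono[OF this, of s] s have 1: "s * C - D \<le> s * \<theta> * A - \<theta> powr s * B"
    by (simp add: right_diff_distrib mult.assoc)
  have inv: "m1 / m2 = 1 / \<theta>" using m by (simp add: \<theta>_def)
  have "A - B / s \<le> (m1 / m2) * C - (m1 / m2) powr s * D / s"
    using minimizer_compare[OF u(1) v1 m(1) um2(1) v2] m2 unfolding um2(2) A_def B_def C_def D_def s_def by simp
  then have "A - B / s \<le> C / \<theta> - D / \<theta> powr s / s"
    unfolding inv using \<theta> by (simp add: powr_divide)
  from mult_left_mono[OF this, of "s * \<theta>"] s \<theta> have "s * \<theta> * A - \<theta> * B \<le> s * C - \<theta> * (D / \<theta> powr s)"
    by (simp add: right_diff_distrib)
  with 1 have "(\<theta> powr s - \<theta>) * B \<le> D - \<theta> * (D / \<theta> powr s)" by (simp add: left_diff_distrib)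
  also have "D - \<theta> * (D / \<theta> powr s) = (\<theta> powr s - \<theta>) * (D / \<theta> powr s)"
  proof -
    have "\<theta> powr s * (D / \<theta> powr s) = D" using \<theta> by simp
    then show ?thesis by (simp only: left_diff_distrib)
  qed
  finally have le: "(\<theta> powr s - \<theta>) * B \<le> (\<theta> powr s - \<theta>) * (D / \<theta> powr s)" .
  have ts: "\<theta> < \<theta> powr s" using powr_less_mono[of 1 s \<theta>] \<theta> s by simp
  then have "0 < \<theta> powr s - \<theta>" by simp
  from le this have "B \<le> D / \<theta> powr s" by (rule mult_left_le_imp_le)
  then have DB: "\<theta> powr s * B \<le> D" using \<theta> by (simp add: pos_le_divide_eq mult.commute)
  have "s * (\<theta> * (B - A)) < s * (D - C)"
  proof -
    have "s * C \<le> s * \<theta> * A - \<theta> powr s * B + D" using 1 by simp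
    moreover have "(s - 1) * (\<theta> powr s * B) \<le> (s - 1) * D" using DB s by (intro mult_left_mono) auto
    moreover have "s * (\<theta> * B) < s * (\<theta> powr s * B)" using ts B s by simp
    ultimately show ?thesis by (simp add: algebra_simps)
  qed
  then have "\<theta> * (B - A) < D - C" using s by simp
  then have "\<theta> * (B - A) / m2 < (D - C) / m2" using m2 by (simp add: divide_strict_right_mono)
  moreover have "\<theta> * (B - A) / m2 = (B - A) / m1" using m m2 by (simp add: \<theta>_def)
  ultimately show ?thesis
    unfolding minimizer_nontrivial_solution(2)[OF \<sigma> u(1) v1 m(1)] minimizer_nontrivial_solution(2)[OF \<sigma> u(2) v2 m2]
    by (simp add: A_def B_def C_def D_def)
qed

section \<open>Large and small mass\<close>

text \<open>Competitors are the multiples of one fixed test function \<open>w\<close>.  Their energy per mass plus one is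
  \<open>h / n - k m\<^sup>\<sigma>\<close> with \<open>k > 0\<close>, and minus this is a lower bound for the frequency.\<close>

lemma frequency_large_mass:
  fixes Z :: real
  assumes \<sigma>: "0 < \<sigma>" "\<sigma> \<le> 4 / real CARD('n::finite)"
  shows "\<forall>\<^sub>F m in at_top. \<forall>u :: real^'n \<Rightarrow> complex. 0 < m \<and> minimizer \<sigma> m u \<longrightarrow> Z \<le> frequency \<sigma> u"
proof -
  obtain w :: "real^'n \<Rightarrow> complex" where w: "w \<in> test_functions" "0 < nsq w"
    using plane_wave_packets[where 'n='n] by (metis zero_less_one order_refl)
  have rw: "represents w w" by (rule represents_self[OF ccs_measurable[OF test_function_ccs[OF w(1)]]])
  note pw = lap_pair_test_function[OF w(1)]
  define n h p where "n = nsq w" and "h = helmholtz_sq w (laplacian w)" and "p = power_integral \<sigma> w"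
  have n: "0 < n" using w by (simp add: n_def)
  have p: "0 < p" unfolding p_def by (rule power_integral_pos[OF \<sigma> pw w(2)])
  define k where "k = p / (n powr (\<sigma> + 1) * (\<sigma> + 1))"
  have k: "0 < k" using p n \<sigma> by (simp add: k_def)
  define X where "X = max 1 ((Z + h / n) / k)"
  have X: "1 \<le> X" "Z + h / n \<le> k * X" using k by (auto simp: X_def field_simps max_def)
  have "Z \<le> frequency \<sigma> u" if m: "X powr (1 / \<sigma>) \<le> m" "0 < m" and u: "minimizer \<sigma> m u" for m and u :: "real^'n \<Rightarrow> complex"
  proof -
    obtain v L where v: "represents v u" "lap_pair v L"
      using u Sobolev_H_2_representative unfolding minimizer_def mass_constraint_def by blast
    have "X = (X powr (1 / \<sigma>)) powr \<sigma>" using X \<sigma> by (simp add: powr_powr)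
    also have "\<dots> \<le> m powr \<sigma>" using m \<sigma> by (intro powr_mono2) auto
    finally have Xm: "k * X \<le> k * m powr \<sigma>" using k by simp
    have "helmholtz_sq v L - power_integral \<sigma> v / (\<sigma> + 1) \<le> (m / n) * h - (m / n) powr (\<sigma> + 1) * p / (\<sigma> + 1)"
      unfolding n_def h_def p_def by (rule minimizer_compare[OF u v m(2) Sobolev_H_test_function[OF w(1)] rw pw w(2)])
    also have "(m / n) powr (\<sigma> + 1) * p / (\<sigma> + 1) = m * (k * m powr \<sigma>)"
      using m n by (simp add: k_def powr_divide powr_add)
    finally have "m * (k * m powr \<sigma>) - m * (h / n) \<le> power_integral \<sigma> v / (\<sigma> + 1) - helmholtz_sq v L" by simp
    also have "power_integral \<sigma> v / (\<sigma> + 1) \<le> power_integral \<sigma> v"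
      using \<sigma> power_integral_nonneg[of \<sigma> v] by (simp add: pos_divide_le_eq mult_le_cancel_left1)
    finally have "m * (k * m powr \<sigma> - h / n) \<le> power_integral \<sigma> v - helmholtz_sq v L" by (simp add: right_diff_distrib)
    then have "k * m powr \<sigma> - h / n \<le> frequency \<sigma> u"
      unfolding minimizer_nontrivial_solution(2)[OF \<sigma> u v m(2)] using m(2) by (simp add: pos_le_divide_eq mult.commute)
    with Xm X(2) show ?thesis by simp
  qed
  then show ?thesis
    by (intro eventually_mono[OF eventually_ge_at_top[of "X powr (1 / \<sigma>)"]]) blast
qed

lemma normalized_data:
  fixes u v L :: "real^'n::finite \<Rightarrow> complex"
  assumes u: "minimizer \<sigma> m u" "represents v u" "lap_pair v L" and m: "0 < m"
  defines "a \<equiv> complex_of_real (sqrt (1 / m))"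
  shows "represents (\<lambda>x. a * v x) (normalized (m, u))" "lap_pair (\<lambda>x. a * v x) (\<lambda>x. a * L x)"
    "normalized (m, u) \<in> Sobolev_H 2" "nsq (\<lambda>x. a * v x) = 1"
    "helmholtz_sq (\<lambda>x. a * v x) (\<lambda>x. a * L x) = helmholtz_sq v L / m"
    "power_integral \<sigma> v = m powr (\<sigma> + 1) * power_integral \<sigma> (\<lambda>x. a * v x)"
proof -
  note um = minimizer_imp[OF u(1,2)]
  have "sqrt (1 / m) = 1 / sqrt m" by (simp add: real_sqrt_divide)
  then have n: "normalized (m, u) = (\<lambda>x. a * u x)"
    unfolding a_def by (simp only: normalized_def) simp
  have an: "(norm a)\<^sup>2 = 1 / m" using m by (simp add: a_def)
  show "represents (\<lambda>x. a * v x) (normalized (m, u))" unfolding n using u(2) by (auto elim: eventually_mono)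
  show "lap_pair (\<lambda>x. a * v x) (\<lambda>x. a * L x)" by (rule weak_pair_cmult[OF u(3)])
  show "normalized (m, u) \<in> Sobolev_H 2" unfolding n by (rule Sobolev_H_cmult[OF um(1)])
  show "nsq (\<lambda>x. a * v x) = 1" unfolding nsq_cmult an um(2) using m by simp
  show "helmholtz_sq (\<lambda>x. a * v x) (\<lambda>x. a * L x) = helmholtz_sq v L / m" unfolding helmholtz_sq_cmult an by simp
  have "power_integral \<sigma> (\<lambda>x. a * v x) = (1 / m) powr (\<sigma> + 1) * power_integral \<sigma> v"
    unfolding a_def using m by (intro power_integral_cmult) simp
  then show "power_integral \<sigma> v = m powr (\<sigma> + 1) * power_integral \<sigma> (\<lambda>x. a * v x)"
    using m by (simp add: powr_divide)
qed

lemma nsq_laplacian_le: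
  assumes "L2 L" "L2 v" shows "nsq L \<le> 2 * helmholtz_sq v L + 2 * nsq v"
  using nsq_add_le[OF L2_add[OF assms] L2_cmult[OF assms(2), of "-1"]] nsq_cmult[of "-1" v]
  by (simp add: helmholtz_sq_def)

text \<open>The energy is at most minus the mass, so the Helmholtz term is at most a multiple of the nonlinear one,
  which by the Gagliardo-Nirenberg inequality grows at most linearly in the Helmholtz term, with a factor of order \<open>m\<^sup>\<sigma>\<close>.  For small mass it is absorbed.\<close>

lemma small_mass_estimate:
  assumes \<sigma>: "0 < \<sigma>" "\<sigma> \<le> 4 / real CARD('n::finite)"
  shows "\<exists>K>0. \<exists>m0>0. \<forall>m u v L. 0 < m \<and> m \<le> m0 \<and> minimizer \<sigma> m (u :: real^'n \<Rightarrow> complex) \<and> represents v u \<and> lap_pair v L \<longrightarrow>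
     frequency \<sigma> u \<le> K * m powr \<sigma> \<and> helmholtz_sq v L / m \<le> K * m powr \<sigma>"
proof -
  have p: "2 \<le> 2 * \<sigma> + 2" "2 * \<sigma> + 2 \<le> 2 + 8 / CARD('n)" using \<sigma> by auto
  from Gagliardo_Nirenberg[OF p] obtain C where C: "0 \<le> C" "\<And>v L :: real^'n \<Rightarrow> complex. lap_pair v L \<Longrightarrow> nsq v \<le> 1 \<Longrightarrow>
     power_integral \<sigma> v \<le> C * (1 + nsq L)"
    unfolding power_integral_def by blast
  define D where "D = C + 1"
  have D: "1 \<le> D" "C \<le> D" using C(1) by (simp_all add: D_def)
  \<comment> \<open>Below this mass \<open>b = m\<^sup>\<sigma> D\<close> is at most \<open>1 / 4\<close>, which absorbs the term \<open>2 b q\<close>.\<close>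
  define m0 where "m0 = (1 / (4 * D)) powr (1 / \<sigma>)"
  have m0: "0 < m0" using D by (simp add: m0_def)
  have "frequency \<sigma> u \<le> (6 * D) * m powr \<sigma> \<and> helmholtz_sq v L / m \<le> (6 * D) * m powr \<sigma>"
    if m: "0 < m" "m \<le> m0" and u: "minimizer \<sigma> m u" "represents v u" "lap_pair v L" for m and u v L :: "real^'n \<Rightarrow> complex"
  proof -
    let ?a = "complex_of_real (sqrt (1 / m))"
    let ?v = "\<lambda>x. ?a * v x" and ?L = "\<lambda>x. ?a * L x"
    note nd = normalized_data[OF u m(1)]
    define q where "q = helmholtz_sq v L / m"
    define P where "P = power_integral \<sigma> ?v"
    define b where "b = m powr \<sigma> * D"
    have q0: "0 \<le> q" unfolding q_def helmholtz_sq_def using m by (intro divide_nonneg_nonneg nsq_nonneg) simp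
    have H: "helmholtz_sq v L = m * q" using m by (simp add: q_def)
    have PP: "power_integral \<sigma> v = m * (m powr \<sigma> * P)" using nd(6) m by (simp add: P_def powr_add)
    have "m powr \<sigma> \<le> m0 powr \<sigma>" using m \<sigma> by (intro powr_mono2) auto
    also have "\<dots> = 1 / (4 * D)" using D \<sigma> by (simp add: m0_def powr_powr)
    finally have "m powr \<sigma> * D \<le> 1 / (4 * D) * D" using D by (intro mult_right_mono) auto
    then have b: "b \<le> 1 / 4" "0 \<le> b" using D by (simp_all add: b_def)
    have "P \<le> C * (1 + nsq ?L)" unfolding P_def by (rule C(2)[OF nd(2)]) (simp add: nd(4))
    also have "\<dots> \<le> D * (3 + 2 * q)"
      using nsq_laplacian_le[OF weak_pair_L2(2)[OF nd(2)] weak_pair_L2(1)[OF nd(2)]] nd(4,5) D q0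
      by (intro mult_mono) (auto simp: q_def nsq_nonneg)
    finally have "m powr \<sigma> * P \<le> m powr \<sigma> * (D * (3 + 2 * q))" by (intro mult_left_mono) auto
    then have Pb: "m powr \<sigma> * P \<le> b * (3 + 2 * q)" by (simp add: b_def mult.assoc)
    have P0: "0 \<le> m powr \<sigma> * P" unfolding P_def by (intro mult_nonneg_nonneg power_integral_nonneg) simp
    have "m * q \<le> power_integral \<sigma> v / (\<sigma> + 1)" using minimizer_energy_le_mass[OF \<sigma>(1) u m(1)] H by simp
    also have "\<dots> \<le> power_integral \<sigma> v"
      using \<sigma> power_integral_nonneg[of \<sigma> v] by (simp add: pos_divide_le_eq mult_le_cancel_left1)
    finally have "q \<le> m powr \<sigma> * P" using m unfolding PP by simp
    with Pb have "q \<le> 3 * b + 2 * (b * q)" by (simp add: distrib_left)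
    moreover have "b * q \<le> 1 / 4 * q" using b q0 by (intro mult_right_mono) auto
    ultimately have q6: "q \<le> 6 * b" by linarith
    have "b * q \<le> b * (6 * (1 / 4))" using q6 b by (intro mult_left_mono) auto
    with Pb have "m powr \<sigma> * P \<le> 6 * b" by (simp add: distrib_left)
    moreover have "frequency \<sigma> u = m powr \<sigma> * P - q"
      unfolding minimizer_nontrivial_solution(2)[OF \<sigma> u m(1)] PP H using m by (simp add: field_simps)
    ultimately have "frequency \<sigma> u \<le> 6 * b" using q0 by simp
    with q6 show ?thesis by (simp add: b_def q_def mult_ac)
  qed
  with m0 D show ?thesis by (intro exI[of _ "6 * D"] conjI exI[of _ m0]) auto
qed

lemma Sobolev_Lp_norms:
  fixes u :: "real^'n::finite \<Rightarrow> complex"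
  assumes u: "u \<in> Sobolev_H 2" and v: "represents v u" and vL: "lap_pair v L"
  shows "Lp_norm 2 (weak_laplacian u) = sqrt (nsq L)"
    and "Lp_norm 2 (weak_grad u) = sqrt ((nsq L + nsq v - helmholtz_sq v L) / 2)"
    and "Lp_norm 2 (\<lambda>x. weak_laplacian u x + u x) = sqrt (helmholtz_sq v L)"
proof -
  note s = Sobolev_norms[OF assms]
  show "Lp_norm 2 (weak_laplacian u) = sqrt (nsq L)" by (rule represents_L2(3)[OF s(1)])
  have "(\<integral>x. norm (weak_grad u x) powr 2 \<partial>lebesgue) = (nsq L + nsq v - helmholtz_sq v L) / 2"
    using s(3) by (simp add: norm_powr_2)
  moreover have "0 \<le> (\<integral>x. norm (weak_grad u x) powr 2 \<partial>lebesgue)" by simp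
  ultimately show "Lp_norm 2 (weak_grad u) = sqrt ((nsq L + nsq v - helmholtz_sq v L) / 2)"
    unfolding Lp_norm_def by (simp only: powr_half_sqrt)
  have "represents (\<lambda>x. L x + v x) (\<lambda>x. weak_laplacian u x + u x)"
    using s(1) v by (auto elim: eventually_elim2)
  from represents_L2(3)[OF this] show "Lp_norm 2 (\<lambda>x. weak_laplacian u x + u x) = sqrt (helmholtz_sq v L)"
    by (simp add: helmholtz_sq_def)
qed

text \<open>The reverse triangle inequality for \<open>f\<close> and \<open>- g\<close>; it will be used for a Laplacian that is close to minus the
  function.\<close>

lemma L2_norm_diff_le:
  assumes f: "L2 f" and g: "L2 g"
  shows "\<bar>sqrt (nsq f) - sqrt (nsq g)\<bar> \<le> sqrt (nsq (\<lambda>x. f x + g x))"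
proof -
  have "\<bar>Re (\<integral>x. f x * cnj (g x) \<partial>lborel)\<bar> \<le> sqrt (nsq f) * sqrt (nsq g)"
    using abs_Re_le_cmod L2_Cauchy_Schwarz_norm[OF f L2_cnj[OF g]] order_trans by (fastforce simp: nsq_cnj)
  then have "nsq f + nsq g - 2 * (sqrt (nsq f) * sqrt (nsq g)) \<le> nsq (\<lambda>x. f x + g x)"
    unfolding nsq_add[OF f g] by linarith
  moreover have "(sqrt (nsq f) - sqrt (nsq g))\<^sup>2 = nsq f + nsq g - 2 * (sqrt (nsq f) * sqrt (nsq g))"
    by (simp add: power2_diff nsq_nonneg)
  ultimately show ?thesis by (intro real_le_rsqrt) simp
qed

lemma eventually_minimizers_along_small:
  fixes P :: "real \<times> (real^'n::finite \<Rightarrow> complex) \<Rightarrow> bool"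
  assumes "0 < m0" "\<And>m u. 0 < m \<Longrightarrow> m \<le> m0 \<Longrightarrow> minimizer \<sigma> m u \<Longrightarrow> P (m, u)"
  shows "eventually P (minimizers_along \<sigma> (at_right 0))"
  unfolding eventually_minimizers_along eventually_at_right_field
  using assms by (intro exI[of _ m0]) auto

lemma eventually_minimizers_along_bound:
  fixes P :: "real \<times> (real^'n::finite \<Rightarrow> complex) \<Rightarrow> bool"
  assumes K: "0 < K" "0 < \<sigma>" "0 < \<epsilon>"
    and b: "0 < m0" "\<And>m u. 0 < m \<Longrightarrow> m \<le> m0 \<Longrightarrow> K * m powr \<sigma> \<le> \<epsilon> \<Longrightarrow> minimizer \<sigma> m u \<Longrightarrow> P (m, u)"
  shows "eventually P (minimizers_along \<sigma> (at_right 0))"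
proof (rule eventually_minimizers_along_small[of "min m0 ((\<epsilon> / K) powr (1 / \<sigma>))"])
  show "0 < min m0 ((\<epsilon> / K) powr (1 / \<sigma>))" using K b(1) by simp
  fix m and u :: "real^'n \<Rightarrow> complex" assume m: "0 < m" "m \<le> min m0 ((\<epsilon> / K) powr (1 / \<sigma>))" and u: "minimizer \<sigma> m u"
  have "m powr \<sigma> \<le> ((\<epsilon> / K) powr (1 / \<sigma>)) powr \<sigma>" using m K by (intro powr_mono2) auto
  then have "K * m powr \<sigma> \<le> \<epsilon>" using K by (simp add: powr_powr field_simps)
  then show "P (m, u)" using m u by (intro b) auto
qed

section \<open>Properties of the minimizers\<close>

theorem theorem1p3:
  fixes \<sigma> :: real
  assumes "0 < \<sigma>" and "\<sigma> \<le> 4 / real CARD('n::finite)"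
  shows
    "(\<forall>m>0. \<forall>u :: real^'n \<Rightarrow> complex. minimizer \<sigma> m u \<longrightarrow>
       (\<exists>c>0. c = frequency \<sigma> u \<and> min_action_solution \<sigma> c u \<and>
              (\<forall>v :: real^'n \<Rightarrow> complex. min_action_solution \<sigma> c v \<longrightarrow> minimizer \<sigma> m v))) \<and>
     (\<forall>m1>0. \<forall>m2>m1. \<forall>(u1 :: real^'n \<Rightarrow> complex) (u2 :: real^'n \<Rightarrow> complex).
       minimizer \<sigma> m1 u1 \<and> minimizer \<sigma> m2 u2 \<longrightarrow> frequency \<sigma> u1 < frequency \<sigma> u2) \<and>
     (\<sigma> < 4 / real CARD('n) \<longrightarrow>
       filterlim (\<lambda>(m, u :: real^'n \<Rightarrow> complex). frequency \<sigma> u) at_top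
         (minimizers_along \<sigma> at_top)) \<and>
     (\<sigma> < max 1 (4 / (real CARD('n) + 1)) \<longrightarrow>
       ((\<lambda>(m, u :: real^'n \<Rightarrow> complex). frequency \<sigma> u) \<longlongrightarrow> 0) (minimizers_along \<sigma> (at_right 0)) \<and>
       (\<forall>m>0. \<forall>u :: real^'n \<Rightarrow> complex. minimizer \<sigma> m u \<longrightarrow>
          normalized (m, u) = (\<lambda>x. u x / of_real (Lp_norm 2 u)) \<and>
          Lp_norm 2 (normalized (m, u)) = 1) \<and>
       ((\<lambda>z :: real \<times> (real^'n \<Rightarrow> complex). Lp_norm 2 (weak_laplacian (normalized z))) \<longlongrightarrow> 1)
         (minimizers_along \<sigma> (at_right 0)) \<and>
       ((\<lambda>z :: real \<times> (real^'n \<Rightarrow> complex). Lp_norm 2 (weak_grad (normalized z))) \<longlongrightarrow> 1)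
         (minimizers_along \<sigma> (at_right 0)) \<and>
       ((\<lambda>z :: real \<times> (real^'n \<Rightarrow> complex).
           Lp_norm 2 (\<lambda>x. weak_laplacian (normalized z) x + normalized z x)) \<longlongrightarrow> 0)
         (minimizers_along \<sigma> (at_right 0)) \<and>
       (\<forall>p>2. (5 \<le> CARD('n) \<longrightarrow> p < 2 * real CARD('n) / (real CARD('n) - 4)) \<longrightarrow>
          (\<forall>m>0. \<forall>u :: real^'n \<Rightarrow> complex. minimizer \<sigma> m u \<longrightarrow> normalized (m, u) \<in> Lp_space p) \<and>
          ((\<lambda>z :: real \<times> (real^'n \<Rightarrow> complex). Lp_norm p (normalized z)) \<longlongrightarrow> 0)
            (minimizers_along \<sigma> (at_right 0))))"
proof -
  note \<sigma> = assms
  let ?F = "minimizers_along \<sigma> (at_right 0) :: (real \<times> (real^'n \<Rightarrow> complex)) filter"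
  have rep: "\<exists>v L. represents v u \<and> lap_pair v L" if "minimizer \<sigma> m u" for m and u :: "real^'n \<Rightarrow> complex"
    using that Sobolev_H_2_representative unfolding minimizer_def mass_constraint_def by blast
  obtain K m0 where K: "0 < K" "0 < m0" and est: "\<And>m u v L. 0 < m \<Longrightarrow> m \<le> m0 \<Longrightarrow> minimizer \<sigma> m (u :: real^'n \<Rightarrow> complex) \<Longrightarrow>
      represents v u \<Longrightarrow> lap_pair v L \<Longrightarrow> frequency \<sigma> u \<le> K * m powr \<sigma> \<and> helmholtz_sq v L / m \<le> K * m powr \<sigma>"
    using small_mass_estimate[OF \<sigma>] by blast
  have freq0: "((\<lambda>(m, u :: real^'n \<Rightarrow> complex). frequency \<sigma> u) \<longlongrightarrow> 0) ?F"
  proof (rule tendstoI)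
    fix \<epsilon> :: real assume \<epsilon>: "0 < \<epsilon>"
    show "eventually (\<lambda>z. dist (case z of (m, u :: real^'n \<Rightarrow> complex) \<Rightarrow> frequency \<sigma> u) 0 < \<epsilon>) ?F"
    proof (rule eventually_minimizers_along_bound[OF K(1) \<sigma>(1) half_gt_zero[OF \<epsilon>] K(2)])
      fix m and u :: "real^'n \<Rightarrow> complex" assume m: "0 < m" "m \<le> m0" "K * m powr \<sigma> \<le> \<epsilon> / 2" and u: "minimizer \<sigma> m u"
      obtain v L where v: "represents v u" "lap_pair v L" using rep[OF u] by blast
      show "dist (case (m, u) of (m, u) \<Rightarrow> frequency \<sigma> u) 0 < \<epsilon>"
        using est[OF m(1,2) u v] m(3) minimizer_min_action(1)[OF \<sigma> u m(1)] \<epsilon> by simp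
    qed
  qed
  have helm0: "((\<lambda>z :: real \<times> (real^'n \<Rightarrow> complex). Lp_norm 2 (\<lambda>x. weak_laplacian (normalized z) x + normalized z x)) \<longlongrightarrow> 0) ?F"
  proof (rule tendstoI)
    fix \<epsilon> :: real assume \<epsilon>: "0 < \<epsilon>"
    have e2: "0 < (\<epsilon> / 2)\<^sup>2" using \<epsilon> by simp
    show "eventually (\<lambda>z. dist (Lp_norm 2 (\<lambda>x. weak_laplacian (normalized z) x + normalized z x)) 0 < \<epsilon>) ?F"
    proof (rule eventually_minimizers_along_bound[OF K(1) \<sigma>(1) e2 K(2)])
      fix m and u :: "real^'n \<Rightarrow> complex" assume m: "0 < m" "m \<le> m0" "K * m powr \<sigma> \<le> (\<epsilon> / 2)\<^sup>2" and u: "minimizer \<sigma> m u"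
      obtain v L where v: "represents v u" "lap_pair v L" using rep[OF u] by blast
      note nd = normalized_data[OF u v m(1)]
      have "helmholtz_sq v L / m \<le> (\<epsilon> / 2)\<^sup>2" using est[OF m(1,2) u v] m(3) by simp
      then have "sqrt (helmholtz_sq v L / m) \<le> \<epsilon> / 2" using \<epsilon> by (intro real_le_lsqrt) auto
      moreover have "0 \<le> helmholtz_sq v L / m"
        unfolding helmholtz_sq_def using m by (intro divide_nonneg_nonneg nsq_nonneg) simp
      ultimately show "dist (Lp_norm 2 (\<lambda>x. weak_laplacian (normalized (m, u)) x + normalized (m, u) x)) 0 < \<epsilon>"
        using \<epsilon> unfolding Sobolev_Lp_norms(3)[OF nd(3,1,2)] nd(5) by simp
    qed
  qed
  have lap1: "((\<lambda>z :: real \<times> (real^'n \<Rightarrow> complex). Lp_norm 2 (weak_laplacian (normalized z))) \<longlongrightarrow> 1) ?F"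
  proof -
    have "eventually (\<lambda>z. norm (Lp_norm 2 (weak_laplacian (normalized z)) - 1) \<le> Lp_norm 2 (\<lambda>x. weak_laplacian (normalized z) x + normalized z x)) ?F"
    proof (rule eventually_minimizers_along_small[of 1])
      fix m and u :: "real^'n \<Rightarrow> complex" assume m: "0 < m" and u: "minimizer \<sigma> m u"
      obtain v L where v: "represents v u" "lap_pair v L" using rep[OF u] by blast
      note nd = normalized_data[OF u v m]
      show "norm (Lp_norm 2 (weak_laplacian (normalized (m, u))) - 1) \<le> Lp_norm 2 (\<lambda>x. weak_laplacian (normalized (m, u)) x + normalized (m, u) x)"
        using L2_norm_diff_le[OF weak_pair_L2(2)[OF nd(2)] weak_pair_L2(1)[OF nd(2)]]
        unfolding Sobolev_Lp_norms[OF nd(3,1,2)] nd(4) helmholtz_sq_def by simp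
    qed simp
    then have "((\<lambda>z. Lp_norm 2 (weak_laplacian (normalized z)) - 1) \<longlongrightarrow> 0) ?F" using helm0 by (rule Lim_null_comparison)
    then show ?thesis by (simp add: LIM_zero_iff)
  qed
  \<comment> \<open>The gradient is controlled by the identity \<open>2 \<parallel>\<nabla>v\<parallel>\<^sup>2 = \<parallel>\<Delta>v\<parallel>\<^sup>2 + \<parallel>v\<parallel>\<^sup>2 - \<parallel>(\<Delta> + 1)v\<parallel>\<^sup>2\<close>.\<close>
  have grad1: "((\<lambda>z :: real \<times> (real^'n \<Rightarrow> complex). Lp_norm 2 (weak_grad (normalized z))) \<longlongrightarrow> 1) ?F"
  proof (rule Lim_transform_eventually)
    let ?g = "\<lambda>z :: real \<times> (real^'n \<Rightarrow> complex). sqrt (((Lp_norm 2 (weak_laplacian (normalized z)))\<^sup>2 + 1 - (Lp_norm 2 (\<lambda>x. weak_laplacian (normalized z) x + normalized z x))\<^sup>2) / 2)"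
    have "(?g \<longlongrightarrow> sqrt ((1\<^sup>2 + 1 - 0\<^sup>2) / 2)) ?F" by (intro tendsto_intros lap1 helm0) simp
    then show "(?g \<longlongrightarrow> 1) ?F" by simp
    show "eventually (\<lambda>z. ?g z = Lp_norm 2 (weak_grad (normalized z))) ?F"
    proof (rule eventually_minimizers_along_small[of 1])
      fix m and u :: "real^'n \<Rightarrow> complex" assume m: "0 < m" and u: "minimizer \<sigma> m u"
      obtain v L where v: "represents v u" "lap_pair v L" using rep[OF u] by blast
      note nd = normalized_data[OF u v m]
      show "?g (m, u) = Lp_norm 2 (weak_grad (normalized (m, u)))"
        unfolding Sobolev_Lp_norms[OF nd(3,1,2)] nd(4) by (simp add: helmholtz_sq_def nsq_nonneg)
    qed simp
  qed
  have normal: "normalized (m, u) = (\<lambda>x. u x / of_real (Lp_norm 2 u)) \<and> Lp_norm 2 (normalized (m, u)) = 1"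
    if m: "0 < m" and u: "minimizer \<sigma> m u" for m and u :: "real^'n \<Rightarrow> complex"
  proof -
    obtain v L where v: "represents v u" "lap_pair v L" using rep[OF u] by blast
    note nd = normalized_data[OF u v m]
    show ?thesis
      using represents_L2(3)[OF v(1)] represents_L2(3)[OF nd(1)] nd(4) minimizer_imp(2)[OF u v(1)]
      by (simp add: normalized_def)
  qed
  have Lp: "(\<forall>m>0. \<forall>u :: real^'n \<Rightarrow> complex. minimizer \<sigma> m u \<longrightarrow> normalized (m, u) \<in> Lp_space p) \<and>
      ((\<lambda>z :: real \<times> (real^'n \<Rightarrow> complex). Lp_norm p (normalized z)) \<longlongrightarrow> 0) ?F"
    if p: "2 < p" "5 \<le> CARD('n) \<longrightarrow> p < 2 * real CARD('n) / (real CARD('n) - 4)" for p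
  proof
    have bdd: "Lp_bounded TYPE('n) p" using p by (intro Lp_bounded_subcritical) auto
    have powr_rep: "represents (\<lambda>x. norm (w x) powr p) (\<lambda>x. norm (f x) powr p)" if "represents w f" for f w :: "real^'n \<Rightarrow> complex"
    proof -
      have [measurable]: "w \<in> borel_measurable borel" using that by simp
      show ?thesis by (rule represents_comp[OF that]) measurable
    qed
    show "\<forall>m>0. \<forall>u :: real^'n \<Rightarrow> complex. minimizer \<sigma> m u \<longrightarrow> normalized (m, u) \<in> Lp_space p"
    proof (intro allI impI)
      fix m :: real and u :: "real^'n \<Rightarrow> complex" assume m: "0 < m" and u: "minimizer \<sigma> m u"
      obtain v L where v: "represents v u" "lap_pair v L" using rep[OF u] by blast
      note nd = normalized_data[OF u v m]
      show "normalized (m, u) \<in> Lp_space p"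
        using represents_measurable[OF nd(1)] represents_integral(2)[OF powr_rep[OF nd(1)]] Lp_integrable[OF bdd nd(2)]
        by (simp add: Lp_space_def)
    qed
    show "((\<lambda>z :: real \<times> (real^'n \<Rightarrow> complex). Lp_norm p (normalized z)) \<longlongrightarrow> 0) ?F"
    proof (rule tendstoI)
      fix \<epsilon> :: real assume \<epsilon>: "0 < \<epsilon>"
      then have "0 < (\<epsilon> / 2) powr p" by simp
      from Lp_vanishing[OF p this] obtain \<delta> where \<delta>: "0 < \<delta>" "\<And>v L :: real^'n \<Rightarrow> complex. lap_pair v L \<Longrightarrow> nsq v \<le> 1 \<Longrightarrow>
          helmholtz_sq v L \<le> \<delta>\<^sup>2 \<Longrightarrow> (\<integral>x. norm (v x) powr p \<partial>lborel) \<le> (\<epsilon> / 2) powr p"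
        unfolding helmholtz_sq_def by blast
      have d2: "0 < \<delta>\<^sup>2" using \<delta>(1) by simp
      show "eventually (\<lambda>z. dist (Lp_norm p (normalized z)) 0 < \<epsilon>) ?F"
      proof (rule eventually_minimizers_along_bound[OF K(1) \<sigma>(1) d2 K(2)])
        fix m and u :: "real^'n \<Rightarrow> complex" assume m: "0 < m" "m \<le> m0" "K * m powr \<sigma> \<le> \<delta>\<^sup>2" and u: "minimizer \<sigma> m u"
        obtain v L where v: "represents v u" "lap_pair v L" using rep[OF u] by blast
        note nd = normalized_data[OF u v m(1)]
        let ?v = "\<lambda>x. complex_of_real (sqrt (1 / m)) * v x"
        have "(\<integral>x. norm (?v x) powr p \<partial>lborel) \<le> (\<epsilon> / 2) powr p"
          by (rule \<delta>(2)[OF nd(2)]) (use nd(4,5) est[OF m(1,2) u v] m(3) in simp_all)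
        then have "(\<integral>x. norm (?v x) powr p \<partial>lborel) powr (1 / p) \<le> ((\<epsilon> / 2) powr p) powr (1 / p)"
          using p by (intro powr_mono2) auto
        also have "\<dots> = \<epsilon> / 2" using p \<epsilon> by (simp add: powr_powr)
        also have "(\<integral>x. norm (?v x) powr p \<partial>lborel) powr (1 / p) = Lp_norm p (normalized (m, u))"
          unfolding Lp_norm_def represents_integral(1)[OF powr_rep[OF nd(1)]] ..
        finally have "Lp_norm p (normalized (m, u)) \<le> \<epsilon> / 2" .
        moreover have "0 \<le> Lp_norm p (normalized (m, u))" by (simp add: Lp_norm_def)
        ultimately show "dist (Lp_norm p (normalized (m, u))) 0 < \<epsilon>" using \<epsilon> by simp
      qed
    qed
  qed
  have large: "filterlim (\<lambda>(m, u :: real^'n \<Rightarrow> complex). frequency \<sigma> u) at_top (minimizers_along \<sigma> at_top)"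
    unfolding filterlim_at_top eventually_minimizers_along using frequency_large_mass[OF \<sigma>] by simp
  have ground_state: "\<forall>m>0. \<forall>u :: real^'n \<Rightarrow> complex. minimizer \<sigma> m u \<longrightarrow>
       (\<exists>c>0. c = frequency \<sigma> u \<and> min_action_solution \<sigma> c u \<and>
              (\<forall>v :: real^'n \<Rightarrow> complex. min_action_solution \<sigma> c v \<longrightarrow> minimizer \<sigma> m v))"
  proof (intro allI impI)
    fix m :: real and u :: "real^'n \<Rightarrow> complex" assume m: "0 < m" and u: "minimizer \<sigma> m u"
    note * = minimizer_min_action[OF \<sigma> u m]
    show "\<exists>c>0. c = frequency \<sigma> u \<and> min_action_solution \<sigma> c u \<and>
              (\<forall>v :: real^'n \<Rightarrow> complex. min_action_solution \<sigma> c v \<longrightarrow> minimizer \<sigma> m v)"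
      by (intro exI[of _ "frequency \<sigma> u"] conjI allI impI refl *)
  qed
  have mono: "\<forall>m1>0. \<forall>m2>m1. \<forall>(u1 :: real^'n \<Rightarrow> complex) (u2 :: real^'n \<Rightarrow> complex).
       minimizer \<sigma> m1 u1 \<and> minimizer \<sigma> m2 u2 \<longrightarrow> frequency \<sigma> u1 < frequency \<sigma> u2"
    using minimizer_frequency_strict_mono[OF \<sigma>] by simp
  have normal': "\<forall>m>0. \<forall>u :: real^'n \<Rightarrow> complex. minimizer \<sigma> m u \<longrightarrow>
          normalized (m, u) = (\<lambda>x. u x / of_real (Lp_norm 2 u)) \<and> Lp_norm 2 (normalized (m, u)) = 1"
    by (intro allI impI normal)
  have Lp': "\<forall>p>2. (5 \<le> CARD('n) \<longrightarrow> p < 2 * real CARD('n) / (real CARD('n) - 4)) \<longrightarrow>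
          (\<forall>m>0. \<forall>u :: real^'n \<Rightarrow> complex. minimizer \<sigma> m u \<longrightarrow> normalized (m, u) \<in> Lp_space p) \<and>
          ((\<lambda>z :: real \<times> (real^'n \<Rightarrow> complex). Lp_norm p (normalized z)) \<longlongrightarrow> 0) ?F"
    by (intro allI impI) (rule Lp)
  show ?thesis
    by (intro conjI impI ground_state mono large freq0 normal' lap1 grad1 helm0 Lp')
qed

end
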